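(* Let $T=(T(t))_{t>0}$ be a $\mathcal{C}_b$-semigroup of kernel operators on $\mathcal{B}_b(\mathds{R}^d)$ of type $(M,\omega)$ consisting of strong Feller operators, with full generator $\hat A$, and let $\rho>0$ be such that $T(t)f\in\mathcal{C}_b^\rho(\mathds{R}^d)$ for all $t>0$, $f\in\mathcal{B}_b(\mathds{R}^d)$, and there is $\varphi\in L^1(0,1)$ with $\|T(t)f\|_{\mathcal{C}_b^\rho}\le\varphi(t)\|f\|_\infty$ for $t\in(0,1)$, $f\in\mathcal{B}_b(\mathds{R}^d)$. Fix a Borel function $\chi$ with $\mathds{1}_{B(0,1)}\le\chi\le\mathds{1}_{B(0,2)}$. Let $b:\mathds{R}^d\to\mathds{R}^d$ be bounded and Borel measurable and let $\mu(x,dy)$, $x\in\mathds{R}^d$, be positive measures on $\mathds{R}^d\setminus\{0\}$ such that $x\mapsto\int f(y)\mu(x,dy)$ is Borel for all $f\in\mathcal{C}_c(\mathds{R}^d\setminus\{0\})$, and there is $\beta\in(0,2)$ with $\beta<\rho$ and $\sup_x\int\min\{|y|^\beta,1\}\mu(x,dy)<\infty$; if $\rho\le1$ assume that $b(x)-\int y\chi(y)\mu(x,dy)=0$ for all $x$. Let \[\hat Bf(x)=b(x)\cdot\nabla f(x)+\int_{\mathds{R}^d\setminus\{0\}}\big(f(x+y)-f(x)-y\cdot\nabla f(x)\chi(y)\big)\mu(x,dy)\] (for $\rho\le1$ this reads $\hat Bf(x)=\int(f(x+y)-f(x))\mu(x,dy)$), and $\hat A+\hat B=\{(u,f+\hat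 Bu):(u,f)\in\hat A\}$. Then: (a) $\hat A+\hat B$ is the full generator of a $\mathcal{C}_b$-semigroup $S$ consisting of strong Feller operators. (b) If $T$ consists of sub Markovian operators, then so does $S$. (c) If additionally $\sup_{x\in\mathds{R}^d}\mu(x,\{|y|>R\})\to0$ as $R\to\infty$, $T$ is a positive $\mathcal{C}_\infty$-semigroup and $\mathcal{C}_c^\infty(\mathds{R}^d)$ is a core for the generator $A$ of $T|_{\mathcal{C}_\infty(\mathds{R}^d)}$, then $S$ is a $\mathcal{C}_\infty$-semigroup.
   Context: Kernel operator on $\mathcal{B}_b(\mathds{R}^d)$: $Tf(x)=\int f(y)k(x,dy)$ with a bounded kernel. Semigroup of kernel operators of type $(M,\omega)$: kernel operators $T(t)$, $t>0$, with $T(t+s)=T(t)T(s)$, $\|T(t)\|\le Me^{\omega t}$, $(t,x)\mapsto T(t)f(x)$ measurable. Full generator: $\hat A=\{(f,g):T(t)f-f=\int_0^tT(s)g\,ds\ \forall t>0\}$. $\mathcal{C}_b$-semigroup: $T(t)\mathcal{C}_b\subset\mathcal{C}_b$ and $T(t)f\to f$ boundedly and pointwise as $t\to0$ for $f\in\mathcal{C}_b$. $\mathcal{C}_\infty$-semigroup: $T(t)\mathcal{C}_\infty\subset\mathcal{C}_\infty$ and $\|T(t)f-f\|_\infty\to0$ for $f\in\mathcal{C}_\infty$. Strong Feller: maps $\mathcal{B}_b$ into $\mathcal{C}_b$. Sub Markovian operator: positive with norm $\le1$. $\mathcal{C}_b^\rho$ is the standard Hölder space of order $\rho$ (bounded functions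 with bounded derivatives up to order $\lceil\rho\rceil-1$ whose highest derivatives are $(\rho-\lceil\rho\rceil+1)$-Hölder). Under the hypotheses one has $D(\hat A)\subset\mathcal{C}_b^\rho(\mathds{R}^d)$, so $\hat B$ is defined on $D(\hat A)$. *)

theory Defs
  imports "HOL-Analysis.Analysis"
begin

definition Bb :: "('a::euclidean_space \<Rightarrow> real) set" where
  "Bb = {f. f \<in> borel_measurable borel \<and> bounded (range f)}"

definition Cb :: "('a::euclidean_space \<Rightarrow> real) set" where
  "Cb = {f. continuous_on UNIV f \<and> bounded (range f)}"

definition Cinf :: "('a::euclidean_space \<Rightarrow> real) set" where
  "Cinf = {f. continuous_on UNIV f \<and> (f \<longlongrightarrow> 0) at_infinity}"

definition supnorm :: "('a \<Rightarrow> real) \<Rightarrow> real" where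
  "supnorm f = (SUP x. \<bar>f x\<bar>)"

definition pd :: "('a::euclidean_space \<Rightarrow> real) \<Rightarrow> 'a \<Rightarrow> 'a \<Rightarrow> real" where
  "pd f e x = deriv (\<lambda>h. f (x + h *\<^sub>R e)) 0"

fun Dlist :: "'a::euclidean_space list \<Rightarrow> ('a \<Rightarrow> real) \<Rightarrow> 'a \<Rightarrow> real" where
  "Dlist [] f = f"
| "Dlist (e # es) f = pd (Dlist es f) e"

definition grad :: "('a::euclidean_space \<Rightarrow> real) \<Rightarrow> 'a \<Rightarrow> 'a" where
  "grad f x = (\<Sum>e\<in>Basis. pd f e x *\<^sub>R e)"

definition hord :: "real \<Rightarrow> nat" where
  "hord \<rho> = nat (\<lceil>\<rho>\<rceil> - 1)"

definition Cb_rho :: "real \<Rightarrow> ('a::euclidean_space \<Rightarrow> real) set" where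
  "Cb_rho \<rho> = {f.
     (\<forall>es. set es \<subseteq> Basis \<and> length es < hord \<rho> \<longrightarrow> (\<forall>x. Dlist es f differentiable at x)) \<and>
     (\<forall>es. set es \<subseteq> Basis \<and> length es \<le> hord \<rho> \<longrightarrow>
          continuous_on UNIV (Dlist es f) \<and> bounded (range (Dlist es f))) \<and>
     (\<forall>es. set es \<subseteq> Basis \<and> length es = hord \<rho> \<longrightarrow>
          (\<exists>C. \<forall>x y. \<bar>Dlist es f x - Dlist es f y\<bar> \<le> C * dist x y powr (\<rho> - real (hord \<rho>))))}"

definition Cb_rho_norm :: "real \<Rightarrow> ('a::euclidean_space \<Rightarrow> real) \<Rightarrow> real" where
  "Cb_rho_norm \<rho> f =
     (\<Sum>es\<in>{es. set es \<subseteq> Basis \<and> length es \<le> hord \<rho>}. supnorm (Dlist es f)) +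
     (\<Sum>es\<in>{es. set es \<subseteq> Basis \<and> length es = hord \<rho>}.
        (SUP p\<in>{(x,y). x \<noteq> y}. \<bar>Dlist es f (fst p) - Dlist es f (snd p)\<bar>
                                  / dist (fst p) (snd p) powr (\<rho> - real (hord \<rho>))))"

definition Cc_inf :: "('a::euclidean_space \<Rightarrow> real) set" where
  "Cc_inf = {f. (\<forall>es. set es \<subseteq> Basis \<longrightarrow> (\<forall>x. Dlist es f differentiable at x))
               \<and> compact (closure {x. f x \<noteq> 0})}"

definition pos_kernel :: "('a::euclidean_space \<Rightarrow> 'a measure) \<Rightarrow> bool" where
  "pos_kernel k \<longleftrightarrow> (\<forall>x. sets (k x) = sets borel) \<and>
     (\<forall>A\<in>sets borel. (\<lambda>x. emeasure (k x) A) \<in> borel_measurable borel) \<and>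
     (\<exists>C::real. \<forall>x. emeasure (k x) UNIV \<le> ennreal C)"

text \<open>A kernel operator with a bounded (signed) kernel, the signed kernel being written as
  the difference of two bounded positive kernels (Jordan decomposition).\<close>
definition kernel_op :: "(('a::euclidean_space \<Rightarrow> real) \<Rightarrow> 'a \<Rightarrow> real) \<Rightarrow> bool" where
  "kernel_op K \<longleftrightarrow> (\<exists>k1 k2. pos_kernel k1 \<and> pos_kernel k2 \<and>
     (\<forall>f\<in>Bb. \<forall>x. K f x = (\<integral>y. f y \<partial>k1 x) - (\<integral>y. f y \<partial>k2 x)))"

definition kernel_semigroup ::
  "(real \<Rightarrow> ('a::euclidean_space \<Rightarrow> real) \<Rightarrow> 'a \<Rightarrow> real) \<Rightarrow> real \<Rightarrow> real \<Rightarrow> bool" where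
  "kernel_semigroup T M \<omega> \<longleftrightarrow>
     (\<forall>t>0. kernel_op (T t)) \<and>
     (\<forall>t>0. \<forall>s>0. \<forall>f\<in>Bb. T (t + s) f = T t (T s f)) \<and>
     (\<forall>t>0. \<forall>f\<in>Bb. supnorm (T t f) \<le> M * exp (\<omega> * t) * supnorm f) \<and>
     (\<forall>f\<in>Bb. (\<lambda>(t,x). T t f x) \<in> borel_measurable (restrict_space borel ({0<..} \<times> UNIV)))"

definition full_generator ::
  "(real \<Rightarrow> ('a::euclidean_space \<Rightarrow> real) \<Rightarrow> 'a \<Rightarrow> real) \<Rightarrow> (('a \<Rightarrow> real) \<times> ('a \<Rightarrow> real)) set" where
  "full_generator T = {(f,g). f \<in> Bb \<and> g \<in> Bb \<and>
     (\<forall>t>0. \<forall>x. T t f x - f x = (LINT s:{0..t}|lborel. T s g x))}"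

definition Cb_semigroup :: "(real \<Rightarrow> ('a::euclidean_space \<Rightarrow> real) \<Rightarrow> 'a \<Rightarrow> real) \<Rightarrow> bool" where
  "Cb_semigroup T \<longleftrightarrow> (\<exists>M \<omega>. kernel_semigroup T M \<omega>) \<and>
     (\<forall>t>0. \<forall>f\<in>Cb. T t f \<in> Cb) \<and>
     (\<forall>f\<in>Cb. (\<forall>x. ((\<lambda>t. T t f x) \<longlongrightarrow> f x) (at_right 0)) \<and>
              (\<exists>C. \<forall>t\<in>{0<..1}. supnorm (T t f) \<le> C))"

definition Cinf_semigroup :: "(real \<Rightarrow> ('a::euclidean_space \<Rightarrow> real) \<Rightarrow> 'a \<Rightarrow> real) \<Rightarrow> bool" where
  "Cinf_semigroup T \<longleftrightarrow> (\<exists>M \<omega>. kernel_semigroup T M \<omega>) \<and>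
     (\<forall>t>0. \<forall>f\<in>Cinf. T t f \<in> Cinf) \<and>
     (\<forall>f\<in>Cinf. ((\<lambda>t. supnorm (\<lambda>x. T t f x - f x)) \<longlongrightarrow> 0) (at_right 0))"

definition Cinf_generator ::
  "(real \<Rightarrow> ('a::euclidean_space \<Rightarrow> real) \<Rightarrow> 'a \<Rightarrow> real) \<Rightarrow> (('a \<Rightarrow> real) \<times> ('a \<Rightarrow> real)) set" where
  "Cinf_generator T = {(f,g). f \<in> Cinf \<and> g \<in> Cinf \<and>
     ((\<lambda>t. supnorm (\<lambda>x. (T t f x - f x) / t - g x)) \<longlongrightarrow> 0) (at_right 0)}"

definition is_core :: "('a \<Rightarrow> real) set \<Rightarrow> (('a \<Rightarrow> real) \<times> ('a \<Rightarrow> real)) set \<Rightarrow> bool" where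
  "is_core D A \<longleftrightarrow> D \<subseteq> fst ` A \<and>
     (\<forall>(f,g)\<in>A. \<exists>fs gs. (\<forall>n. fs n \<in> D \<and> (fs n, gs n) \<in> A) \<and>
        (\<lambda>n. supnorm (\<lambda>x. fs n x - f x)) \<longlonglongrightarrow> 0 \<and>
        (\<lambda>n. supnorm (\<lambda>x. gs n x - g x)) \<longlonglongrightarrow> 0)"

definition strong_Feller :: "(('a::euclidean_space \<Rightarrow> real) \<Rightarrow> 'a \<Rightarrow> real) \<Rightarrow> bool" where
  "strong_Feller K \<longleftrightarrow> (\<forall>f\<in>Bb. K f \<in> Cb)"

definition positive_op :: "(('a::euclidean_space \<Rightarrow> real) \<Rightarrow> 'a \<Rightarrow> real) \<Rightarrow> bool" where
  "positive_op K \<longleftrightarrow> (\<forall>f\<in>Bb. (\<forall>x. f x \<ge> 0) \<longrightarrow> (\<forall>x. K f x \<ge> 0))"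

definition sub_Markovian :: "(('a::euclidean_space \<Rightarrow> real) \<Rightarrow> 'a \<Rightarrow> real) \<Rightarrow> bool" where
  "sub_Markovian K \<longleftrightarrow> positive_op K \<and> (\<forall>f\<in>Bb. supnorm (K f) \<le> supnorm f)"

definition Bhat :: "real \<Rightarrow> ('a::euclidean_space \<Rightarrow> 'a) \<Rightarrow> ('a \<Rightarrow> 'a measure) \<Rightarrow> ('a \<Rightarrow> real)
    \<Rightarrow> ('a \<Rightarrow> real) \<Rightarrow> 'a \<Rightarrow> real" where
  "Bhat \<rho> b \<mu> chi f x =
     (if \<rho> \<le> 1 then (\<integral>y. (f (x + y) - f x) \<partial>\<mu> x)
      else b x \<bullet> grad f x + (\<integral>y. (f (x + y) - f x - (y \<bullet> grad f x) * chi y) \<partial>\<mu> x))"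

definition gen_sum :: "(('a \<Rightarrow> real) \<times> ('a \<Rightarrow> real)) set \<Rightarrow> (('a \<Rightarrow> real) \<Rightarrow> 'a \<Rightarrow> real)
    \<Rightarrow> (('a \<Rightarrow> real) \<times> ('a \<Rightarrow> real)) set" where
  "gen_sum A B = {(u, \<lambda>x. f x + B u x) | u f. (u, f) \<in> A}"

end

theory Submission
  imports Defs
begin

text \<open>
  Put \<open>G(t) = B T(t)\<close>. The smoothing estimate gives \<open>\<parallel>G(t)\<parallel> \<le> C \<phi>(t)\<close>, which is integrable at \<open>0\<close>, so the Volterra
  equation \<open>S = T + S * G\<close> is solved by a norm convergent Dyson series, and its solution is unique among
  exponentially bounded families; uniqueness yields the semigroup law, and dominated convergence the strong
  Feller property. Taking Laplace transforms, \<open>R\<^sub>S (1 - B R\<^sub>T) = R\<^sub>T\<close>, which identifies the full generator.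

  For the sub Markov property, \<open>B\<close> is approximated by operators \<open>P\<^sub>n - c\<^sub>n\<close> with \<open>P\<^sub>n\<close> positive and bounded. Their
  perturbed semigroups are \<open>exp (- c\<^sub>n t)\<close> times a Dyson series with positive terms, and they converge to \<open>S\<close>.

  For the last part, bounded Borel functions vanishing at infinity are mapped to functions vanishing at infinity
  by \<open>T(t)\<close> (positivity), by \<open>B T(t)\<close> (interpolation and the uniform tail condition), and hence by \<open>S(t)\<close>.
\<close>

section \<open>Functionals given by finite signed measures\<close>

text \<open>Two obstacles shape the setting. On \<open>Bb\<close> the semigroup need not be norm
  continuous, so limits are taken along bounded pointwise convergence and integrals are pointwise.
  And \<open>Bhat\<close> is unbounded: it only acts on functions already smoothed by
  \<open>T\<close>, which is why \<open>G\<close> is convolved on the right; its closedness is used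
  as the rule that it commutes with the Laplace integral of \<open>T\<close>. Smallness comes from
  the weight \<open>exp (l * t)\<close>: raising \<open>l\<close> brings the integral of the
  weighted bound for \<open>G\<close> down to 1/2, the ratio of the geometric series below. For
  positivity no closeness in operator norm is used. The operators
  \<open>P\<^sub>n - c\<^sub>n\<close> are bounded uniformly in \<open>n\<close> on functions with a
  Taylor expansion of order \<open>min \<rho> 2\<close>, and they converge pointwise there; this is
  enough for the Dyson series. In the last part \<open>G(s) f\<close> need not be continuous, since
  \<open>b\<close> and \<open>\<mu>\<close> are only measurable. Hence the class of Borel functions
  vanishing at infinity replaces \<open>Cinf\<close>, and the strong Feller property restores
  continuity at the end.\<close>

lemma BbI: "f \<in> borel_measurable borel \<Longrightarrow> (\<And>x. \<bar>f x\<bar> \<le> B) \<Longrightarrow> f \<in> Bb"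
  unfolding Bb_def bounded_iff by auto

lemma Bb_measurable: "f \<in> Bb \<Longrightarrow> f \<in> borel_measurable borel"
  unfolding Bb_def by auto

lemma Bb_bdd_above: "f \<in> Bb \<Longrightarrow> bdd_above (range (\<lambda>x. \<bar>f x\<bar>))"
  unfolding Bb_def bounded_iff bdd_above_def by auto

lemma supnorm_ge: "f \<in> Bb \<Longrightarrow> \<bar>f x\<bar> \<le> supnorm f"
  unfolding supnorm_def by (rule cSUP_upper) (auto dest: Bb_bdd_above)

lemma supnorm_le: "(\<And>x. \<bar>f x\<bar> \<le> B) \<Longrightarrow> supnorm f \<le> B"
  unfolding supnorm_def by (rule cSUP_least) auto

lemma supnorm_nonneg: "f \<in> Bb \<Longrightarrow> 0 \<le> supnorm f"
  using supnorm_ge[of f undefined] abs_ge_zero order_trans by blast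

lemma Bb_add: "f \<in> Bb \<Longrightarrow> g \<in> Bb \<Longrightarrow> (\<lambda>x. f x + g x) \<in> Bb"
  apply (rule BbI[where B="supnorm f + supnorm g"])
  subgoal by (intro borel_measurable_add Bb_measurable)
  subgoal for x using supnorm_ge[of f x] supnorm_ge[of g x] by linarith
  done

lemma Bb_cmult: "f \<in> Bb \<Longrightarrow> (\<lambda>x. c * f x) \<in> Bb"
  apply (rule BbI[where B="\<bar>c\<bar> * supnorm f"])
  subgoal by (intro borel_measurable_times Bb_measurable borel_measurable_const)
  subgoal for x using supnorm_ge[of f x] by (simp add: abs_mult mult_left_mono)
  done

lemma Bb_diff: "f \<in> Bb \<Longrightarrow> g \<in> Bb \<Longrightarrow> (\<lambda>x. f x - g x) \<in> Bb"
  using Bb_add[of f "\<lambda>x. -1 * g x"] Bb_cmult[of g "-1"] by simp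

lemma Bb_const: "(\<lambda>x. c) \<in> Bb"
  by (rule BbI[where B="\<bar>c\<bar>"]) auto

lemma Bb_indicator: "A \<in> sets borel \<Longrightarrow> (indicator A :: 'a::euclidean_space \<Rightarrow> real) \<in> Bb"
  by (rule BbI[where B=1]) (auto simp: indicator_def)

lemma Bb_limit:
  assumes "\<And>n. F n \<in> Bb" "\<And>n x. \<bar>F n x\<bar> \<le> B" "\<And>x. (\<lambda>n. F n x) \<longlonglongrightarrow> f x"
  shows "f \<in> Bb"
proof (rule BbI[where B=B])
  show "f \<in> borel_measurable borel"
    by (rule borel_measurable_LIMSEQ_real[where u=F]) (use assms in \<open>auto intro: Bb_measurable\<close>)
  show "\<bar>f x\<bar> \<le> B" for x
    by (rule LIMSEQ_le_const2[OF tendsto_rabs[OF assms(3)]]) (use assms in auto)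
qed

text \<open>Approximating simple functions can be taken with modulus at most
  \<open>2 * \<bar>f x\<bar>\<close>. Keeping this bound in the limit step makes the approximating
  sequence of a bounded \<open>f\<close> uniformly bounded, which continuity along bounded pointwise
  convergence asks for.\<close>

lemma real_measurable_induct:
  fixes f :: "'b \<Rightarrow> real"
  assumes f: "f \<in> borel_measurable N" and N: "space N = UNIV"
    and ind: "\<And>A. A \<in> sets N \<Longrightarrow> P (indicator A)"
    and add: "\<And>f g. P f \<Longrightarrow> P g \<Longrightarrow> P (\<lambda>x. f x + g x)"
    and scale: "\<And>c f. P f \<Longrightarrow> P (\<lambda>x. c * f x)"
    and lim: "\<And>F. (\<And>n. P (F n)) \<Longrightarrow> (\<And>x. (\<lambda>n. F n x) \<longlonglongrightarrow> f x) \<Longrightarrow> (\<And>n x. \<bar>F n x\<bar> \<le> 2 * \<bar>f x\<bar>) \<Longrightarrow> P f"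
  shows "P f"
proof -
  obtain F where F: "\<And>i. simple_function N (F i)" "\<And>x. (\<lambda>i. F i x) \<longlonglongrightarrow> f x"
      "\<And>i x. dist (F i x) 0 \<le> 2 * dist (f x) 0"
    using borel_measurable_implies_sequence_metric[OF f, of 0] N by (auto; metis)
  have zero: "P (\<lambda>x. 0)" using scale[OF ind[of "{}"], of 0] by simp
  have sums: "finite Y \<Longrightarrow> (\<And>y. y \<in> Y \<Longrightarrow> P (g y)) \<Longrightarrow> P (\<lambda>x. \<Sum>y\<in>Y. g y x)"
    for Y :: "real set" and g :: "real \<Rightarrow> 'b \<Rightarrow> real"
    by (induction Y rule: finite_induct) (auto simp: zero add)
  have "P (F i)" for i
  proof -
    have fin: "finite (range (F i))" using simple_functionD(1)[OF F(1)[of i]] N by simp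
    have m: "F i -` {y} \<in> sets N" for y using simple_functionD(2)[OF F(1)[of i], of "{y}"] N by simp
    have "F i = (\<lambda>x. \<Sum>y\<in>range (F i). y * indicator (F i -` {y}) x)"
      using fin by (auto simp: indicator_def if_distrib fun_eq_iff cong: if_cong)
    moreover have "P (\<lambda>x. \<Sum>y\<in>range (F i). y * indicator (F i -` {y}) x)"
      by (rule sums[OF fin]) (intro scale ind m)
    ultimately show ?thesis by simp
  qed
  then show ?thesis by (rule lim) (use F in auto)
qed

text \<open>\<open>sfun L\<close>: the functional \<open>L\<close> is integration against a finite signed measure, phrased
  without measures as linearity, boundedness and continuity along bounded pointwise convergence.\<close>

definition sfun :: "(('a::euclidean_space \<Rightarrow> real) \<Rightarrow> real) \<Rightarrow> bool" where
  "sfun L \<longleftrightarrow> (\<forall>f\<in>Bb. \<forall>g\<in>Bb. L (\<lambda>x. f x + g x) = L f + L g) \<and>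
     (\<forall>c. \<forall>f\<in>Bb. L (\<lambda>x. c * f x) = c * L f) \<and>
     (\<exists>C. \<forall>f\<in>Bb. \<bar>L f\<bar> \<le> C * supnorm f) \<and>
     (\<forall>F f B. (\<forall>n. F n \<in> Bb) \<longrightarrow> (\<forall>n x. \<bar>F n x\<bar> \<le> B) \<longrightarrow> (\<forall>x. (\<lambda>n. F n x) \<longlonglongrightarrow> f x)
        \<longrightarrow> (\<lambda>n. L (F n)) \<longlonglongrightarrow> L f)"

lemma sfunI:
  fixes L :: "('a::euclidean_space \<Rightarrow> real) \<Rightarrow> real"
  assumes "\<And>f g. f \<in> Bb \<Longrightarrow> g \<in> Bb \<Longrightarrow> L (\<lambda>x. f x + g x) = L f + L g"
    and "\<And>c f. f \<in> Bb \<Longrightarrow> L (\<lambda>x. c * f x) = c * L f"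
    and "\<And>f. f \<in> Bb \<Longrightarrow> \<bar>L f\<bar> \<le> C * supnorm f"
    and "\<And>F f B. (\<And>n. F n \<in> Bb) \<Longrightarrow> (\<And>n x. \<bar>F n x\<bar> \<le> B) \<Longrightarrow> (\<And>x. (\<lambda>n. F n x) \<longlonglongrightarrow> f x) \<Longrightarrow> f \<in> Bb
        \<Longrightarrow> (\<lambda>n. L (F n)) \<longlonglongrightarrow> L f"
  shows "sfun L"
  unfolding sfun_def
proof (intro conjI ballI allI impI)
  show "\<exists>C. \<forall>f\<in>Bb. \<bar>L f\<bar> \<le> C * supnorm f" using assms(3) by blast
  fix F :: "nat \<Rightarrow> 'a \<Rightarrow> real" and f B assume *: "\<forall>n. F n \<in> Bb" "\<forall>n x. \<bar>F n x\<bar> \<le> B" "\<forall>x. (\<lambda>n. F n x) \<longlonglongrightarrow> f x"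
  show "(\<lambda>n. L (F n)) \<longlonglongrightarrow> L f"
    using Bb_limit[of F B f] * by (intro assms(4)) auto
qed (use assms in auto)

lemma sfun_add: "sfun L \<Longrightarrow> f \<in> Bb \<Longrightarrow> g \<in> Bb \<Longrightarrow> L (\<lambda>x. f x + g x) = L f + L g"
  unfolding sfun_def by blast
lemma sfun_cmult: "sfun L \<Longrightarrow> f \<in> Bb \<Longrightarrow> L (\<lambda>x. c * f x) = c * L f"
  unfolding sfun_def by blast
lemma sfun_bound: "sfun L \<Longrightarrow> \<exists>C\<ge>0. \<forall>f\<in>Bb. \<bar>L f\<bar> \<le> C * supnorm f"
proof -
  assume "sfun L"
  then obtain C where C: "\<forall>f\<in>Bb. \<bar>L f\<bar> \<le> C * supnorm f" unfolding sfun_def by blast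
  have "\<forall>f\<in>Bb. \<bar>L f\<bar> \<le> \<bar>C\<bar> * supnorm f"
    using C by (meson abs_ge_self mult_right_mono order_trans supnorm_nonneg)
  then show ?thesis by (intro exI[of _ "\<bar>C\<bar>"]) auto
qed
lemma sfun_lim: "sfun L \<Longrightarrow> (\<And>n. F n \<in> Bb) \<Longrightarrow> (\<And>n x. \<bar>F n x\<bar> \<le> B) \<Longrightarrow>
    (\<And>x. (\<lambda>n. F n x) \<longlonglongrightarrow> f x) \<Longrightarrow> (\<lambda>n. L (F n)) \<longlonglongrightarrow> L f"
  unfolding sfun_def by blast
lemma sfun_diff: "sfun L \<Longrightarrow> f \<in> Bb \<Longrightarrow> g \<in> Bb \<Longrightarrow> L (\<lambda>x. f x - g x) = L f - L g"
  using sfun_add[of L f "\<lambda>x. -1 * g x"] sfun_cmult[of L g "-1"] Bb_cmult[of g "-1"] by simp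
lemma sfun_zero: "sfun L \<Longrightarrow> L (\<lambda>x. 0) = 0"
  using sfun_cmult[of L "\<lambda>x. 0" 0] Bb_const[of 0] by simp

lemma sfun_zero_functional: "sfun (\<lambda>f. 0)"
  by (rule sfunI[where C=0]) auto

lemma sfun_uminus: "sfun L \<Longrightarrow> sfun (\<lambda>f. - L f)"
proof -
  assume L: "sfun L"
  obtain C where "\<forall>f\<in>Bb. \<bar>L f\<bar> \<le> C * supnorm f" using sfun_bound[OF L] by blast
  then show ?thesis
    by (intro sfunI[where C=C]) (auto simp: sfun_add[OF L] sfun_cmult[OF L] intro!: tendsto_minus sfun_lim[OF L])
qed

lemma integrable_Bb:
  assumes "finite_measure m" "sets m = sets borel" "f \<in> Bb"
  shows "integrable m f"
proof -
  interpret finite_measure m by fact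
  show ?thesis
    by (rule integrable_const_bound[where B="supnorm f"])
       (use assms Bb_measurable[OF assms(3)] supnorm_ge[OF assms(3)] measurable_cong_sets[OF assms(2) refl] in auto)
qed

lemma sfun_integral:
  fixes m :: "'a::euclidean_space measure"
  assumes m: "finite_measure m" and s: "sets m = sets borel"
  shows "sfun (\<lambda>f. \<integral>y. f y \<partial>m)"
proof (rule sfunI[where C="measure m (space m)"])
  interpret finite_measure m by fact
  fix f :: "'a \<Rightarrow> real" assume f: "f \<in> Bb"
  have "\<bar>\<integral>y. f y \<partial>m\<bar> \<le> (\<integral>y. supnorm f \<partial>m)"
    using integrable_Bb[OF m s f] supnorm_ge[OF f] by (intro order_trans[OF integral_abs_bound] integral_mono) auto
  then show "\<bar>\<integral>y. f y \<partial>m\<bar> \<le> measure m (space m) * supnorm f" by (simp add: mult.commute)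
next
  interpret finite_measure m by fact
  fix F :: "nat \<Rightarrow> 'a \<Rightarrow> real" and f B
  assume F: "\<And>n. F n \<in> Bb" "\<And>n x. \<bar>F n x\<bar> \<le> B" "\<And>x. (\<lambda>n. F n x) \<longlonglongrightarrow> f x" "f \<in> Bb"
  show "(\<lambda>n. \<integral>y. F n y \<partial>m) \<longlonglongrightarrow> (\<integral>y. f y \<partial>m)"
    by (rule integral_dominated_convergence[where w="\<lambda>_. B"])
       (use F in \<open>auto simp: measurable_cong_sets[OF s refl] intro!: Bb_measurable\<close>)
qed (auto simp: integrable_Bb[OF m s])

lemma sfun_minus:
  assumes L: "sfun L" and K: "sfun K" shows "sfun (\<lambda>f. L f - K f)"
proof -
  obtain C where C: "\<forall>f\<in>Bb. \<bar>L f\<bar> \<le> C * supnorm f" using sfun_bound[OF L] by blast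
  obtain D where D: "\<forall>f\<in>Bb. \<bar>K f\<bar> \<le> D * supnorm f" using sfun_bound[OF K] by blast
  show ?thesis
  proof (rule sfunI[where C="C + D"])
    fix f :: "'a \<Rightarrow> real" assume "f \<in> Bb"
    then show "\<bar>L f - K f\<bar> \<le> (C + D) * supnorm f"
      using C[rule_format, of f] D[rule_format, of f] by (auto simp: algebra_simps)
  qed (auto simp: sfun_add[OF L] sfun_cmult[OF L] sfun_add[OF K] sfun_cmult[OF K] algebra_simps
      intro!: tendsto_diff sfun_lim[OF L] sfun_lim[OF K])
qed

lemma sfun_plus: "sfun L \<Longrightarrow> sfun K \<Longrightarrow> sfun (\<lambda>f. L f + K f)"
  using sfun_minus[of L "\<lambda>f. - K f"] sfun_uminus[of K] by simp

text \<open>Measure-theoretic induction: both sides respect sums, multiples and bounded pointwise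
  limits. It reduces the Jordan representation below to indicators.\<close>

lemma sfun_eqI:
  assumes L: "sfun L" and K: "sfun K" and eq: "\<And>A. A \<in> sets borel \<Longrightarrow> L (indicator A) = K (indicator A)"
    and f: "f \<in> Bb"
  shows "L f = K f"
proof -
  have "f \<in> Bb \<and> L f = K f"
  proof (rule real_measurable_induct[where P="\<lambda>f. f \<in> Bb \<and> L f = K f" and N=borel and f=f])
    fix F assume F: "\<And>n. F n \<in> Bb \<and> L (F n) = K (F n)" "\<And>x. (\<lambda>n. F n x) \<longlonglongrightarrow> f x" "\<And>n x. \<bar>F n x\<bar> \<le> 2 * \<bar>f x\<bar>"
    have b: "\<And>n x. \<bar>F n x\<bar> \<le> 2 * supnorm f" using order_trans[OF F(3) mult_left_mono[OF supnorm_ge[OF f]]] by auto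
    have "(\<lambda>n. L (F n)) \<longlonglongrightarrow> L f" using F b by (intro sfun_lim[OF L]) auto
    moreover have "(\<lambda>n. L (F n)) \<longlonglongrightarrow> K f" using F b by (auto intro!: sfun_lim[OF K])
    ultimately show "f \<in> Bb \<and> L f = K f" using f LIMSEQ_unique by auto
  qed (use f Bb_measurable in \<open>auto simp: Bb_indicator eq Bb_add Bb_cmult sfun_add[OF L] sfun_cmult[OF L] sfun_add[OF K] sfun_cmult[OF K]\<close>)
  then show ?thesis by simp
qed

section \<open>Jordan decomposition of a functional\<close>

definition jpos :: "(('a::euclidean_space \<Rightarrow> real) \<Rightarrow> real) \<Rightarrow> 'a set \<Rightarrow> real" where
  "jpos L A = (SUP B\<in>sets borel. L (indicator (A \<inter> B)))"

text \<open>The positive part of the signed measure \<open>A \<mapsto> L (indicator A)\<close>. The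
  negative part is \<open>jmeas (\<lambda>f. - L f)\<close>, so no Hahn set has to be found.\<close>

definition jmeas :: "(('a::euclidean_space \<Rightarrow> real) \<Rightarrow> real) \<Rightarrow> 'a measure" where
  "jmeas L = measure_of UNIV (sets borel) (\<lambda>A. ennreal (jpos L A))"

context
  fixes L :: "('a::euclidean_space \<Rightarrow> real) \<Rightarrow> real" and C :: real
  assumes L: "sfun L" and C: "\<And>f. f \<in> Bb \<Longrightarrow> \<bar>L f\<bar> \<le> C * supnorm f"
begin

lemma sfun_bound_nonneg: "0 \<le> C"
proof -
  have "0 \<le> C * supnorm (\<lambda>x::'a. 1::real)" using C[OF Bb_const[of 1]] by (smt (verit))
  moreover have "supnorm (\<lambda>x::'a. 1::real) = 1" unfolding supnorm_def by simp
  ultimately show ?thesis by simp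
qed

lemma sfun_indicator_le: "A \<in> sets borel \<Longrightarrow> L (indicator A) \<le> C"
proof -
  assume A: "A \<in> sets borel"
  have "supnorm (indicator A :: 'a \<Rightarrow> real) \<le> 1" by (rule supnorm_le) (auto simp: indicator_def)
  then have "C * supnorm (indicator A :: 'a \<Rightarrow> real) \<le> C"
    using mult_left_mono[OF _ sfun_bound_nonneg, of _ 1] by simp
  with C[OF Bb_indicator[OF A]] show ?thesis by simp
qed

lemma jpos_bdd: "A \<in> sets borel \<Longrightarrow> bdd_above ((\<lambda>B. L (indicator (A \<inter> B))) ` sets borel)"
  unfolding bdd_above_def using sfun_indicator_le by (auto intro!: exI[of _ C])

lemma jpos_ge: "A \<in> sets borel \<Longrightarrow> B \<in> sets borel \<Longrightarrow> L (indicator (A \<inter> B)) \<le> jpos L A"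
  unfolding jpos_def by (rule cSUP_upper[OF _ jpos_bdd])

lemma jpos_leI: "(\<And>B. B \<in> sets borel \<Longrightarrow> L (indicator (A \<inter> B)) \<le> c) \<Longrightarrow> jpos L A \<le> c"
  unfolding jpos_def by (rule cSUP_least) (auto intro: exI[of _ "{}"])

lemma jpos_le: "A \<in> sets borel \<Longrightarrow> jpos L A \<le> C"
  by (rule jpos_leI) (simp add: sfun_indicator_le)

lemma sfun_indicator_empty: "L (indicator {}) = 0"
proof -
  have "(indicator {} :: 'a \<Rightarrow> real) = (\<lambda>x. 0)" by auto
  then show ?thesis using sfun_zero[OF L] by simp
qed

lemma jpos_empty: "jpos L {} = 0"
proof -
  have "sets (borel :: 'a measure) \<noteq> {}" by auto
  then show ?thesis by (simp add: jpos_def sfun_indicator_empty)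
qed

lemma jpos_nonneg: "A \<in> sets borel \<Longrightarrow> 0 \<le> jpos L A"
  using jpos_ge[of A "{}"] by (simp add: sfun_indicator_empty)

lemma sfun_indicator_Un:
  assumes "A \<in> sets borel" "B \<in> sets borel" "A \<inter> B = {}"
  shows "L (indicator (A \<union> B)) = L (indicator A) + L (indicator B)"
proof -
  have "(indicator (A \<union> B) :: 'a \<Rightarrow> real) = (\<lambda>x. indicator A x + indicator B x)"
    using assms(3) by (auto simp: fun_eq_iff indicator_def)
  then show ?thesis using sfun_add[OF L Bb_indicator[OF assms(1)] Bb_indicator[OF assms(2)]] by simp
qed

lemma jpos_mono:
  assumes "A \<in> sets borel" "B \<in> sets borel" "A \<subseteq> B"
  shows "jpos L A \<le> jpos L B"
proof (rule jpos_leI)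
  fix D assume D: "D \<in> sets (borel :: 'a measure)"
  have "A \<inter> D = B \<inter> (A \<inter> D)" using assms(3) by auto
  then show "L (indicator (A \<inter> D)) \<le> jpos L B"
    using jpos_ge[OF assms(2), of "A \<inter> D"] assms D by (metis sets.Int)
qed

lemma jpos_Un:
  assumes A: "A \<in> sets borel" and B: "B \<in> sets borel" and AB: "A \<inter> B = {}"
  shows "jpos L (A \<union> B) = jpos L A + jpos L B"
proof (rule antisym)
  show "jpos L (A \<union> B) \<le> jpos L A + jpos L B"
  proof (rule jpos_leI)
    fix D assume D: "D \<in> sets (borel :: 'a measure)"
    have "L (indicator ((A \<union> B) \<inter> D)) = L (indicator (A \<inter> D)) + L (indicator (B \<inter> D))"
      using sfun_indicator_Un[of "A \<inter> D" "B \<inter> D"] A B D AB by (auto simp: Int_Un_distrib2)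
    then show "L (indicator ((A \<union> B) \<inter> D)) \<le> jpos L A + jpos L B"
      using jpos_ge[OF A D] jpos_ge[OF B D] by simp
  qed
  \<comment> \<open>The test sets for \<open>A\<close> and \<open>B\<close> are chosen
    independently, so the two suprema can be taken one after the other.\<close>
  have *: "L (indicator (A \<inter> D)) + L (indicator (B \<inter> E)) \<le> jpos L (A \<union> B)"
    if D: "D \<in> sets borel" and E: "E \<in> sets borel" for D E
  proof -
    have "(A \<union> B) \<inter> ((A \<inter> D) \<union> (B \<inter> E)) = (A \<inter> D) \<union> (B \<inter> E)" by auto
    then have "L (indicator ((A \<inter> D) \<union> (B \<inter> E))) \<le> jpos L (A \<union> B)"
      using jpos_ge[of "A \<union> B" "(A \<inter> D) \<union> (B \<inter> E)"] A B D E by auto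
    moreover have "L (indicator ((A \<inter> D) \<union> (B \<inter> E))) = L (indicator (A \<inter> D)) + L (indicator (B \<inter> E))"
      by (rule sfun_indicator_Un) (use A B D E AB in auto)
    ultimately show ?thesis by simp
  qed
  have "jpos L A \<le> jpos L (A \<union> B) - L (indicator (B \<inter> E))" if E: "E \<in> sets borel" for E
    by (rule jpos_leI) (use *[OF _ E] in \<open>auto simp: le_diff_eq\<close>)
  then have "jpos L B \<le> jpos L (A \<union> B) - jpos L A"
    by (intro jpos_leI) (auto simp: algebra_simps)
  then show "jpos L A + jpos L B \<le> jpos L (A \<union> B)" by simp
qed

lemma sfun_indicator_sums:
  assumes A: "range A \<subseteq> sets borel" "disjoint_family A"
  shows "(\<lambda>i. L (indicator (A i))) sums L (indicator (\<Union>i. A i))"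
proof -
  have fin: "(\<Sum>i<n. L (indicator (A i))) = L (indicator (\<Union>i<n. A i))" for n
  proof (induction n)
    case (Suc n)
    have "\<forall>i<n. A i \<inter> A n = {}" using A(2) by (simp add: disjoint_family_on_def)
    then have "(\<Union>i<n. A i) \<inter> A n = {}" by blast
    then have "L (indicator ((\<Union>i<n. A i) \<union> A n)) = L (indicator (\<Union>i<n. A i)) + L (indicator (A n))"
      using A by (intro sfun_indicator_Un) auto
    then show ?case using Suc by (simp add: lessThan_Suc Un_commute add.commute)
  qed (simp add: sfun_zero[OF L])
  have "(\<lambda>n. L (indicator (\<Union>i<n. A i))) \<longlonglongrightarrow> L (indicator (\<Union>i. A i))"
  proof (rule sfun_lim[OF L, where B=1])
    show "(\<lambda>n. indicator (\<Union>i<n. A i) x :: real) \<longlonglongrightarrow> indicator (\<Union>i. A i) x" for x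
      by (rule LIMSEQ_indicator_UN)
    show "\<And>n. (indicator (\<Union>i<n. A i) :: 'a \<Rightarrow> real) \<in> Bb" using A by (intro Bb_indicator) auto
  qed (auto simp: indicator_def)
  then show ?thesis unfolding sums_def fin .
qed

text \<open>Finite additivity and monotonicity bound the series by the value at the union. For the
  converse, each single \<open>L (indicator ((\<Union>i. A i) \<inter> D))\<close> is itself a
  convergent series, with terms at most \<open>jpos L (A i)\<close>.\<close>

lemma jpos_sums:
  assumes A: "range A \<subseteq> sets borel" "disjoint_family A"
  shows "(\<lambda>i. jpos L (A i)) sums jpos L (\<Union>i. A i)"
proof -
  have m: "\<And>i. A i \<in> sets borel" "(\<Union>i. A i) \<in> sets borel" using A by auto
  have fin: "(\<Sum>i<n. jpos L (A i)) = jpos L (\<Union>i<n. A i)" for n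
  proof (induction n)
    case 0 then show ?case by (auto simp: jpos_empty)
  next
    case (Suc n)
    have "\<forall>i<n. A i \<inter> A n = {}" using A(2) by (simp add: disjoint_family_on_def)
    then have "(\<Union>i<n. A i) \<inter> A n = {}" by blast
    then have "jpos L ((\<Union>i<n. A i) \<union> A n) = jpos L (\<Union>i<n. A i) + jpos L (A n)"
      using A by (intro jpos_Un) auto
    then show ?case using Suc by (simp add: lessThan_Suc Un_commute add.commute)
  qed
  have fle: "(\<Sum>i<n. jpos L (A i)) \<le> jpos L (\<Union>i. A i)" for n
    unfolding fin using m by (intro jpos_mono) auto
  have s: "summable (\<lambda>i. jpos L (A i))"
    by (rule bounded_imp_summable[where B="jpos L (\<Union>i. A i)"])
       (use jpos_nonneg[OF m(1)] fle[of "Suc _"] in \<open>auto simp: lessThan_Suc_atMost\<close>)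
  have "suminf (\<lambda>i. jpos L (A i)) = jpos L (\<Union>i. A i)"
  proof (rule antisym)
    show "suminf (\<lambda>i. jpos L (A i)) \<le> jpos L (\<Union>i. A i)" by (rule suminf_le_const[OF s fle])
    show "jpos L (\<Union>i. A i) \<le> suminf (\<lambda>i. jpos L (A i))"
    proof (rule jpos_leI)
      fix D assume D: "D \<in> sets (borel :: 'a measure)"
      have "(\<lambda>i. L (indicator (A i \<inter> D))) sums L (indicator (\<Union>i. A i \<inter> D))"
        using A D by (intro sfun_indicator_sums) (auto simp: disjoint_family_on_def)
      then have "L (indicator ((\<Union>i. A i) \<inter> D)) = suminf (\<lambda>i. L (indicator (A i \<inter> D)))"
         and "summable (\<lambda>i. L (indicator (A i \<inter> D)))"
        by (auto simp: sums_iff)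
      then show "L (indicator ((\<Union>i. A i) \<inter> D)) \<le> suminf (\<lambda>i. jpos L (A i))"
        using suminf_le[OF jpos_ge[OF m(1) D] _ s] by simp
    qed
  qed
  with s show ?thesis by (simp add: sums_iff)
qed

lemma sets_jmeas: "sets (jmeas L) = sets borel"
  unfolding jmeas_def by (metis sets.sets_measure_of_eq space_borel)

lemma emeasure_jmeas:
  assumes "A \<in> sets borel" shows "emeasure (jmeas L) A = ennreal (jpos L A)"
  unfolding jmeas_def
proof (rule emeasure_measure_of_sigma)
  show "sigma_algebra UNIV (sets (borel :: 'a measure))" by (metis sets.sigma_algebra_axioms space_borel)
  show "positive (sets borel) (\<lambda>A. ennreal (jpos L A))"
    by (auto simp: positive_def jpos_empty)
  show "countably_additive (sets borel) (\<lambda>A. ennreal (jpos L A))"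
  proof (rule countably_additiveI)
    fix A :: "nat \<Rightarrow> 'a set" assume A: "range A \<subseteq> sets borel" "disjoint_family A"
    have "(\<lambda>i. ennreal (jpos L (A i))) sums ennreal (jpos L (\<Union>i. A i))"
      by (rule sums_ennreal[THEN iffD2]) (use A jpos_nonneg jpos_sums in auto)
    then show "(\<Sum>i. ennreal (jpos L (A i))) = ennreal (jpos L (\<Union>i. A i))" by (simp add: sums_iff)
  qed
qed fact

lemma finite_jmeas: "finite_measure (jmeas L)"
  by (rule finite_measureI) (simp add: emeasure_jmeas sets_eq_imp_space_eq[OF sets_jmeas])

lemma measure_jmeas: "A \<in> sets borel \<Longrightarrow> measure (jmeas L) A = jpos L A"
  by (simp add: measure_def emeasure_jmeas jpos_nonneg)

end

text \<open>Testing \<open>- L\<close> with \<open>B\<close> amounts to testing \<open>L\<close>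
  with the complement of \<open>B\<close>, up to the constant \<open>L (indicator A)\<close>. The
  resulting inequality, applied to \<open>L\<close> and to \<open>- L\<close>, gives both
  directions.\<close>

lemma jpos_uminus:
  assumes L: "sfun L" and A: "A \<in> sets borel"
  shows "jpos (\<lambda>f. - L f) A = jpos L A - L (indicator A)"
proof -
  have 1: "jpos (\<lambda>f. - K f) A \<le> jpos K A - K (indicator A)" if K: "sfun K" for K
  proof -
    obtain C where C: "\<And>f. f \<in> Bb \<Longrightarrow> \<bar>K f\<bar> \<le> C * supnorm f" using sfun_bound[OF K] by blast
    obtain C' where C': "\<And>f. f \<in> Bb \<Longrightarrow> \<bar>- K f\<bar> \<le> C' * supnorm f" using sfun_bound[OF sfun_uminus[OF K]] by blast
    show ?thesis
    proof (rule jpos_leI[OF sfun_uminus[OF K] C'])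
      fix B assume B: "B \<in> sets (borel :: 'a measure)"
      have "K (indicator ((A \<inter> B) \<union> (A \<inter> -B))) = K (indicator (A \<inter> B)) + K (indicator (A \<inter> -B))"
        by (rule sfun_indicator_Un[OF K C]) (use A B in auto)
      moreover have "(A \<inter> B) \<union> (A \<inter> -B) = A" by auto
      ultimately show "- K (indicator (A \<inter> B)) \<le> jpos K A - K (indicator A)"
        using jpos_ge[OF K C A, of "-B"] B by auto
    qed auto
  qed
  from 1[OF L] 1[OF sfun_uminus[OF L]] show ?thesis by simp
qed

lemma sfun_repr:
  assumes L: "sfun L" and f: "f \<in> Bb"
  shows "L f = (\<integral>y. f y \<partial>jmeas L) - (\<integral>y. f y \<partial>jmeas (\<lambda>f. - L f))"
proof -
  note L' = sfun_uminus[OF L]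
  obtain C where C: "\<And>f. f \<in> Bb \<Longrightarrow> \<bar>L f\<bar> \<le> C * supnorm f" using sfun_bound[OF L] by blast
  then have C': "\<And>f. f \<in> Bb \<Longrightarrow> \<bar>- L f\<bar> \<le> C * supnorm f" by simp
  show ?thesis
  proof (rule sfun_eqI[OF L _ _ f])
    show "sfun (\<lambda>f. (\<integral>y. f y \<partial>jmeas L) - (\<integral>y. f y \<partial>jmeas (\<lambda>f. - L f)))"
      by (intro sfun_minus sfun_integral finite_jmeas[OF L C] finite_jmeas[OF L' C'] sets_jmeas[OF L C] sets_jmeas[OF L' C'])
    fix A assume A: "A \<in> sets (borel :: 'a measure)"
    then show "L (indicator A) = (\<integral>y. indicator A y \<partial>jmeas L) - (\<integral>y. indicator A y \<partial>jmeas (\<lambda>f. - L f))"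
      using sets_jmeas[OF L C] sets_jmeas[OF L' C']
      by (simp add: measure_jmeas[OF L C] measure_jmeas[OF L' C'] jpos_uminus[OF L A]
          sets_eq_imp_space_eq[OF sets_jmeas[OF L C]] sets_eq_imp_space_eq[OF sets_jmeas[OF L' C']])
  qed
qed

lemma sfunE:
  fixes L :: "('a::euclidean_space \<Rightarrow> real) \<Rightarrow> real"
  assumes L: "sfun L"
  obtains m1 m2 :: "'a measure" where "finite_measure m1" "sets m1 = sets borel" "finite_measure m2" "sets m2 = sets borel"
    "\<And>f. f \<in> Bb \<Longrightarrow> L f = (\<integral>y. f y \<partial>m1) - (\<integral>y. f y \<partial>m2)"
proof -
  note L' = sfun_uminus[OF L]
  obtain C where C: "\<And>f. f \<in> Bb \<Longrightarrow> \<bar>L f\<bar> \<le> C * supnorm f" using sfun_bound[OF L] by blast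
  then have C': "\<And>f. f \<in> Bb \<Longrightarrow> \<bar>- L f\<bar> \<le> C * supnorm f" by simp
  show ?thesis
  proof (rule that)
    show "finite_measure (jmeas L)" "sets (jmeas L) = sets borel"
      by (rule finite_jmeas[OF L C], assumption) (rule sets_jmeas[OF L C])
    show "finite_measure (jmeas (\<lambda>f. - L f))" "sets (jmeas (\<lambda>f. - L f)) = sets borel"
      by (rule finite_jmeas[OF L' C'], assumption) (rule sets_jmeas[OF L' C'])
    show "L f = (\<integral>y. f y \<partial>jmeas L) - (\<integral>y. f y \<partial>jmeas (\<lambda>f. - L f))" if "f \<in> Bb" for f
      by (rule sfun_repr[OF L that])
  qed
qed

section \<open>Kernel operators\<close>

text \<open>The supremum in \<open>jpos\<close> runs over uncountably many sets, so its
  measurability in a parameter is not clear. Finite unions of sets from a countable basis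
  approximate every Borel set: outer regularity gives an open set, which is exhausted by such
  unions. The point is that one family serves all finite measures.\<close>

lemma countable_approx_family:
  "\<exists>\<C> :: 'a::euclidean_space set set. countable \<C> \<and> \<C> \<subseteq> sets borel \<and> {} \<in> \<C> \<and>
    (\<forall>m B e. finite_measure m \<longrightarrow> sets m = sets borel \<longrightarrow> B \<in> sets borel \<longrightarrow> 0 < e \<longrightarrow>
       (\<exists>D\<in>\<C>. measure m (B - D) < e \<and> measure m (D - B) < e))"
proof -
  obtain \<B> :: "'a set set" where \<B>: "countable \<B>" "topological_basis \<B>"
    using ex_countable_basis by blast
  define \<C> where "\<C> = Union ` {F. F \<subseteq> \<B> \<and> finite F}"
  have op: "open U" if "U \<in> \<C>" for U
    using that topological_basis_open[OF \<B>(2)] unfolding \<C>_def by blast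
  have "countable {F. F \<subseteq> \<B> \<and> finite F}"
    using countable_Collect_finite_subset[OF \<B>(1)] by (simp add: conj_commute)
  then have cC: "countable \<C>" unfolding \<C>_def by (rule countable_image)
  moreover have "\<C> \<subseteq> sets borel" using op by auto
  moreover have "{} \<in> \<C>" unfolding \<C>_def by (auto intro!: image_eqI[of _ _ "{}"])
  moreover have "\<exists>D\<in>\<C>. measure m (B - D) < e \<and> measure m (D - B) < e"
    if m: "finite_measure m" and s: "sets m = sets borel" and B: "B \<in> sets borel" and e: "0 < e" for m B e
  proof -
    interpret finite_measure m by fact
    have [simp]: "space m = UNIV" using sets_eq_imp_space_eq[OF s] by simp
    have "emeasure m B < emeasure m B + ennreal e"
      using e by (simp add: emeasure_eq_measure ennreal_less_iff flip: ennreal_plus)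
    then have "(INF U \<in> {U. B \<subseteq> U \<and> open U}. emeasure m U) < emeasure m B + ennreal e"
      using outer_regular[OF s _ B] by simp
    then obtain U where U: "B \<subseteq> U" "open U" "emeasure m U < emeasure m B + ennreal e"
      unfolding INF_less_iff by blast
    have sU: "U \<in> sets m" and sB: "B \<in> sets m" using U(2) B s by auto
    have UB: "measure m (U - B) < e"
    proof -
      have "ennreal (measure m U) < ennreal (measure m B + e)"
        using U(3) e by (simp add: emeasure_eq_measure)
      then have "measure m U < measure m B + e" by (simp add: ennreal_less_iff del: ennreal_plus)
      then show ?thesis using finite_measure_Diff[OF sU sB U(1)] by simp
    qed
    obtain \<B>' where \<B>': "\<B>' \<subseteq> \<B>" "U = \<Union>\<B>'" using \<B>(2) U(2) unfolding topological_basis_def by blast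
    \<comment> \<open>The empty set is added so that the enumeration exists even if
      \<open>\<B>'\<close> is empty.\<close>
    have cB: "countable (insert {} \<B>')" using \<B>' \<B>(1) countable_subset by auto
    define b where "b = from_nat_into (insert {} \<B>')"
    have b: "range b = insert {} \<B>'" unfolding b_def by (rule range_from_nat_into[OF _ cB]) simp
    define D where "D n = (\<Union>i<n. b i)" for n :: nat
    have bm: "b i \<in> sets m" for i
    proof -
      have "b i \<in> insert {} \<B>'" using b by auto
      then show ?thesis using \<B>' topological_basis_open[OF \<B>(2)] s by auto
    qed
    have DC: "D n \<in> \<C>" for n
    proof -
      have "D n = \<Union>(b ` {..<n} - {{}})" unfolding D_def by auto
      moreover have "b ` {..<n} - {{}} \<subseteq> \<B>" using b \<B>' by auto
      ultimately show ?thesis unfolding \<C>_def by auto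
    qed
    have UD: "(\<Union>n. D n) = U"
    proof -
      have "(\<Union>n. D n) = (\<Union>i. b i)" unfolding D_def by (auto intro: lessI)
      also have "\<dots> = U" using b \<B>'(2) by auto
      finally show ?thesis .
    qed
    have "(\<lambda>n. measure m (D n)) \<longlonglongrightarrow> measure m (\<Union>n. D n)"
    proof (rule finite_Lim_measure_incseq)
      show "range D \<subseteq> sets m" using bm by (auto simp: D_def)
      show "incseq D" unfolding D_def by (intro monoI UN_mono) auto
    qed
    then have "eventually (\<lambda>n. measure m U - e < measure m (D n)) sequentially"
      using e unfolding UD by (auto dest!: order_tendstoD(1)[where a="measure m U - e"])
    then obtain n where n: "measure m U - e < measure m (D n)" by (auto simp: eventually_sequentially)
    have sD: "D n \<in> sets m" using bm by (auto simp: D_def)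
    have DU: "D n \<subseteq> U" using UD by auto
    have "measure m (U - D n) < e" using n finite_measure_Diff[OF sU sD DU] by simp
    moreover have "measure m (B - D n) \<le> measure m (U - D n)"
      using U(1) sU sD by (intro finite_measure_mono) auto
    moreover have "measure m (D n - B) \<le> measure m (U - B)"
      using DU sU sB by (intro finite_measure_mono) auto
    ultimately show ?thesis using UB DC[of n] by (auto intro!: bexI[of _ "D n"])
  qed
  ultimately show ?thesis by (intro exI[of _ \<C>]) simp
qed

text \<open>Replacing a test set by an approximating one changes \<open>L\<close> by at most the
  total variation of the symmetric difference, so the countable family yields the same
  supremum.\<close>

lemma jpos_countable_SUP:
  fixes L :: "('a::euclidean_space \<Rightarrow> real) \<Rightarrow> real"
  assumes L: "sfun L" and A: "A \<in> sets borel" and ne: "\<C> \<noteq> {}" and \<C>: "\<C> \<subseteq> sets borel"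
    and approx: "\<forall>m B e. finite_measure m \<longrightarrow> sets m = sets borel \<longrightarrow> B \<in> sets borel \<longrightarrow> 0 < e \<longrightarrow>
       (\<exists>D\<in>\<C>. measure m (B - D) < e \<and> measure m (D - B) < e)"
  shows "jpos L A = (SUP B\<in>\<C>. L (indicator (A \<inter> B)))"
proof -
  obtain C where C: "\<And>f. f \<in> Bb \<Longrightarrow> \<bar>L f\<bar> \<le> C * supnorm f" using sfun_bound[OF L] by blast
  have C': "\<And>f. f \<in> Bb \<Longrightarrow> \<bar>- L f\<bar> \<le> C * supnorm f" using C by simp
  note L' = sfun_uminus[OF L]
  let ?P = "jmeas L" and ?Q = "jmeas (\<lambda>f. - L f)"
  have bdd: "bdd_above ((\<lambda>B. L (indicator (A \<inter> B))) ` \<C>)"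
    by (rule bdd_above_mono[OF jpos_bdd[OF L C A]]) (use \<C> in auto)
  have "jpos L A \<le> (SUP B\<in>\<C>. L (indicator (A \<inter> B)))"
  proof (rule jpos_leI[OF L C])
    fix B assume B: "B \<in> sets (borel :: 'a measure)"
    show "L (indicator (A \<inter> B)) \<le> (SUP B\<in>\<C>. L (indicator (A \<inter> B)))"
    proof (rule field_le_epsilon)
      fix e :: real assume e: "0 < e"
      interpret P: finite_measure ?P by (rule finite_jmeas[OF L C])
      interpret Q: finite_measure ?Q by (rule finite_jmeas[OF L' C'])
      have sP: "sets ?P = sets borel" and sQ: "sets ?Q = sets borel"
        by (rule sets_jmeas[OF L C], assumption) (rule sets_jmeas[OF L' C'])
      \<comment> \<open>The total variation of \<open>L\<close>: the approximation has to hold for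
        the positive and the negative part by one and the same set \<open>D\<close>.\<close>
      define m where "m = measure_of UNIV (sets borel) (\<lambda>A. emeasure ?P A + emeasure ?Q A)"
      have sm: "sets m = sets borel" unfolding m_def by (metis sets.sets_measure_of_eq space_borel)
      have em: "emeasure m X = emeasure ?P X + emeasure ?Q X" if "X \<in> sets borel" for X
        unfolding m_def
      proof (rule emeasure_measure_of_sigma)
        show "sigma_algebra UNIV (sets (borel :: 'a measure))" by (metis sets.sigma_algebra_axioms space_borel)
        show "countably_additive (sets borel) (\<lambda>A. emeasure ?P A + emeasure ?Q A)"
          by (rule countably_additiveI) (auto simp: sP sQ suminf_add[symmetric] suminf_emeasure)
      qed (use that in \<open>auto simp: positive_def\<close>)
      have fm: "finite_measure m"
        by (rule finite_measureI) (simp add: em sets_eq_imp_space_eq[OF sm] P.emeasure_eq_measure Q.emeasure_eq_measure)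
      interpret m: finite_measure m by fact
      have mm: "measure m X = measure ?P X + measure ?Q X" if "X \<in> sets borel" for X
        using em[OF that] by (simp add: P.emeasure_eq_measure Q.emeasure_eq_measure m.emeasure_eq_measure flip: ennreal_plus)
      obtain D where D: "D \<in> \<C>" "measure m (B - D) < e/2" "measure m (D - B) < e/2"
        using approx[rule_format, OF fm sm B, of "e/2"] e by auto
      have Db: "D \<in> sets borel" using D \<C> by auto
      have Lm: "L (indicator X) = measure ?P X - measure ?Q X" if X: "X \<in> sets borel" for X
        by (simp add: measure_jmeas[OF L C X] measure_jmeas[OF L' C' X] jpos_uminus[OF L X])
      have bnd: "\<bar>L (indicator X)\<bar> \<le> measure m Y" if X: "X \<in> sets borel" "Y \<in> sets borel" "X \<subseteq> Y" for X Y
      proof -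
        have "measure m X \<le> measure m Y" using that sm by (intro m.finite_measure_mono) auto
        then show ?thesis using Lm[OF X(1)] mm[OF X(1)] measure_nonneg[of ?P X] measure_nonneg[of ?Q X] by linarith
      qed
      have e1: "A \<inter> B = (A \<inter> B \<inter> D) \<union> (A \<inter> (B - D))" and e2: "A \<inter> D = (A \<inter> B \<inter> D) \<union> (A \<inter> (D - B))" by auto
      have 1: "L (indicator (A \<inter> B)) = L (indicator (A \<inter> B \<inter> D)) + L (indicator (A \<inter> (B - D)))"
        by (subst e1, rule sfun_indicator_Un[OF L C]) (use A B Db in auto)
      have 2: "L (indicator (A \<inter> D)) = L (indicator (A \<inter> B \<inter> D)) + L (indicator (A \<inter> (D - B)))"
        by (subst e2, rule sfun_indicator_Un[OF L C]) (use A B Db in auto)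
      have "\<bar>L (indicator (A \<inter> (B - D)))\<bar> \<le> measure m (B - D)" "\<bar>L (indicator (A \<inter> (D - B)))\<bar> \<le> measure m (D - B)"
        using A B Db by (auto intro!: bnd)
      then have "L (indicator (A \<inter> B)) \<le> L (indicator (A \<inter> D)) + e" using 1 2 D by linarith
      also have "L (indicator (A \<inter> D)) \<le> (SUP B\<in>\<C>. L (indicator (A \<inter> B)))"
        by (rule cSUP_upper[OF D(1) bdd])
      finally show "L (indicator (A \<inter> B)) \<le> (SUP B\<in>\<C>. L (indicator (A \<inter> B))) + e" by simp
    qed
  qed auto
  moreover have "(SUP B\<in>\<C>. L (indicator (A \<inter> B))) \<le> jpos L A"
    by (rule cSUP_least[OF ne]) (use \<C> in \<open>auto intro!: jpos_ge[OF L C A]\<close>)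
  ultimately show ?thesis by simp
qed

text \<open>With the supremum over a countable family, measurability in \<open>x\<close> passes from
  the functions \<open>K (indicator (A \<inter> B))\<close> to the masses of the positive
  part.\<close>

lemma pos_kernel_jmeas:
  assumes sf: "\<And>x. sfun (\<lambda>f. K f x)" and m: "\<And>f. f \<in> Bb \<Longrightarrow> K f \<in> borel_measurable borel"
    and C: "\<And>f x. f \<in> Bb \<Longrightarrow> \<bar>K f x\<bar> \<le> C * supnorm f"
  shows "pos_kernel (\<lambda>x. jmeas (\<lambda>f. K f x))"
  unfolding pos_kernel_def
proof (intro conjI allI ballI)
  show "sets (jmeas (\<lambda>f. K f x)) = sets borel" for x by (rule sets_jmeas[OF sf C])
  obtain \<C> :: "'a set set" where \<C>: "countable \<C>" "\<C> \<subseteq> sets borel" "{} \<in> \<C>"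
    "\<forall>m B e. finite_measure m \<longrightarrow> sets m = sets borel \<longrightarrow> B \<in> sets borel \<longrightarrow> 0 < e \<longrightarrow>
       (\<exists>D\<in>\<C>. measure m (B - D) < e \<and> measure m (D - B) < e)"
    using countable_approx_family by (elim exE conjE)
  fix A assume A: "A \<in> sets (borel :: 'a measure)"
  have "(\<lambda>x. jpos (\<lambda>f. K f x) A) = (\<lambda>x. SUP B\<in>\<C>. K (indicator (A \<inter> B)) x)"
    using jpos_countable_SUP[OF sf A _ \<C>(2) \<C>(4)] \<C>(3) by auto
  moreover have "\<dots> \<in> borel_measurable borel"
  proof (rule borel_measurable_cSUP[OF \<C>(1)])
    show "(\<lambda>x. K (indicator (A \<inter> B)) x) \<in> borel_measurable borel" if "B \<in> \<C>" for B
      using m[OF Bb_indicator[of "A \<inter> B"]] A \<C>(2) that by auto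
    show "bdd_above ((\<lambda>i. K (indicator (A \<inter> i)) x) ` \<C>)" for x
      by (rule bdd_above_mono[OF jpos_bdd[OF sf C A]]) (use \<C> in auto)
  qed
  ultimately have "(\<lambda>x. jpos (\<lambda>f. K f x) A) \<in> borel_measurable borel" by simp
  then show "(\<lambda>x. emeasure (jmeas (\<lambda>f. K f x)) A) \<in> borel_measurable borel"
    using measurable_compose[OF _ measurable_ennreal] by (simp add: emeasure_jmeas[OF sf C] A)
next
  show "\<exists>C. \<forall>x. emeasure (jmeas (\<lambda>f. K f x)) UNIV \<le> ennreal C"
    by (rule exI[of _ C]) (simp add: emeasure_jmeas[OF sf C] ennreal_leI jpos_le[OF sf C])
qed

text \<open>The way back from functionals to kernels: positive and negative parts, taken separately
  at each \<open>x\<close>, form bounded kernels. This is how the perturbed semigroup is seen to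
  consist of kernel operators.\<close>

lemma kernel_opI:
  assumes sf: "\<And>x. sfun (\<lambda>f. K f x)" and m: "\<And>f. f \<in> Bb \<Longrightarrow> K f \<in> borel_measurable borel"
    and C: "\<And>f x. f \<in> Bb \<Longrightarrow> \<bar>K f x\<bar> \<le> C * supnorm f"
  shows "kernel_op K"
  unfolding kernel_op_def
proof (intro exI conjI ballI allI)
  show "pos_kernel (\<lambda>x. jmeas (\<lambda>f. K f x))" using assms by (rule pos_kernel_jmeas)
  show "pos_kernel (\<lambda>x. jmeas (\<lambda>f. - K f x))"
    using pos_kernel_jmeas[of "\<lambda>f x. - K f x" C] sfun_uminus[OF sf] m C by auto
qed (rule sfun_repr[OF sf])

lemma pos_kernel_finite: "pos_kernel k \<Longrightarrow> finite_measure (k x)"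
proof (rule finite_measureI)
  assume k: "pos_kernel k"
  have "space (k x) = UNIV" using k sets_eq_imp_space_eq[of "k x" borel] unfolding pos_kernel_def by auto
  moreover have "emeasure (k x) UNIV < \<infinity>"
    using k unfolding pos_kernel_def by (metis ennreal_less_top infinity_ennreal_def le_less_trans)
  ultimately show "emeasure (k x) (space (k x)) \<noteq> \<infinity>" by auto
qed

lemma sfun_cong:
  assumes L: "sfun L" and eq: "\<And>f. f \<in> Bb \<Longrightarrow> L' f = L f" shows "sfun L'"
proof -
  obtain C where "\<forall>f\<in>Bb. \<bar>L f\<bar> \<le> C * supnorm f" using sfun_bound[OF L] by blast
  then show ?thesis
    by (intro sfunI[where C=C]) (auto simp: eq sfun_add[OF L] sfun_cmult[OF L] Bb_add Bb_cmult intro!: sfun_lim[OF L])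
qed

lemma kernel_op_sfun:
  assumes "kernel_op K" shows "sfun (\<lambda>f. K f x)"
proof -
  obtain k1 k2 where k: "pos_kernel k1" "pos_kernel k2" "\<And>f x. f \<in> Bb \<Longrightarrow> K f x = (\<integral>y. f y \<partial>k1 x) - (\<integral>y. f y \<partial>k2 x)"
    using assms unfolding kernel_op_def by blast
  have "sfun (\<lambda>f. (\<integral>y. f y \<partial>k1 x) - (\<integral>y. f y \<partial>k2 x))"
    using k by (intro sfun_minus sfun_integral pos_kernel_finite) (auto simp: pos_kernel_def)
  then show ?thesis using k(3) by (rule sfun_cong)
qed

text \<open>Both the functional and its argument depend on the parameter. For indicators of
  rectangles the two dependences separate; a Dynkin class argument and induction over measurable
  functions do the rest.\<close>

lemma sfun_param_measurable:
  fixes L :: "'p \<Rightarrow> ('a::euclidean_space \<Rightarrow> real) \<Rightarrow> real"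
  assumes N: "space N = UNIV" and L: "\<And>p. sfun (L p)"
    and m: "\<And>f. f \<in> Bb \<Longrightarrow> (\<lambda>p. L p f) \<in> borel_measurable N"
    and F: "(\<lambda>(p,y). F p y) \<in> borel_measurable (N \<Otimes>\<^sub>M borel)" and FB: "\<And>p. F p \<in> Bb"
  shows "(\<lambda>p. L p (F p)) \<in> borel_measurable N"
proof -
  let ?M = "N \<Otimes>\<^sub>M (borel :: 'a measure)"
  let ?G = "{A \<times> B | A B. A \<in> sets N \<and> B \<in> sets (borel :: 'a measure)}"
  let ?Q = "\<lambda>F :: 'p \<times> 'a \<Rightarrow> real. (\<forall>p. (\<lambda>y. F (p,y)) \<in> Bb) \<and> (\<lambda>p. L p (\<lambda>y. F (p,y))) \<in> borel_measurable N"
  have ind: "?Q (indicator A)" if "A \<in> sets ?M" for A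
  proof -
    have A: "A \<in> sigma_sets (space N \<times> space borel) ?G" using that by (simp add: sets_pair_measure)
    have B: "(\<lambda>y. indicator X (p,y) :: real) \<in> Bb" if "X \<in> sigma_sets (space N \<times> space borel) ?G" for X p
    proof -
      have "X \<in> sets ?M" using that by (simp add: sets_pair_measure)
      then have "Pair p -` X \<in> sets borel" by (rule sets_Pair1)
      then have "indicator (Pair p -` X) \<in> Bb" by (rule Bb_indicator)
      moreover have "indicator (Pair p -` X) = (\<lambda>y. indicator X (p,y) :: real)" by (auto simp: indicator_def)
      ultimately show ?thesis by simp
    qed
    have "(\<lambda>p. L p (\<lambda>y. indicator A (p,y))) \<in> borel_measurable N"
      using Int_stable_pair_measure_generator pair_measure_closed A
    proof (induction A rule: sigma_sets_induct_disjoint)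
      case (basic X)
      then obtain A B where X: "X = A \<times> B" "A \<in> sets N" "B \<in> sets borel" by auto
      have "L p (\<lambda>y. indicator X (p,y)) = indicator A p * L p (indicator B)" for p
        using sfun_cmult[OF L Bb_indicator[OF X(3)], of p "indicator A p"] X by (simp add: indicator_times)
      then show ?case using X m[OF Bb_indicator[OF X(3)]] by simp
    next
      case empty then show ?case by (simp add: sfun_zero[OF L])
    next
      case (compl X)
      have "(\<lambda>y. indicator (space N \<times> space borel - X) (p,y) :: real) = (\<lambda>y. 1 - indicator X (p,y))" for p
        using N by (auto simp: indicator_def)
      then have "L p (\<lambda>y. indicator (space N \<times> space borel - X) (p,y)) = L p (\<lambda>y. 1) - L p (\<lambda>y. indicator X (p,y))" for p
        using sfun_diff[OF L Bb_const[of 1] B[OF compl(1)]] by simp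
      then show ?case using compl m[OF Bb_const[of 1]] by simp
    next
      case (union X)
      have mem: "\<And>i. X i \<in> sigma_sets (space N \<times> space borel) ?G" using union by auto
      have fin: "L p (\<lambda>y. \<Sum>i<n. indicator (X i) (p,y)) = (\<Sum>i<n. L p (\<lambda>y. indicator (X i) (p,y)))
          \<and> (\<lambda>y. \<Sum>i<n. indicator (X i) (p,y) :: real) \<in> Bb" for p n
        by (induction n) (auto simp: sfun_zero[OF L] Bb_const sfun_add[OF L] B[OF mem] Bb_add)
      \<comment> \<open>By disjointness the partial sums are indicators, hence bounded by 1, which
        provides the uniform bound for \<open>sfun_lim\<close>.\<close>
      have ii: "(\<Sum>i<n. indicator (X i) z :: real) = indicator (\<Union>i<n. X i) z" for n z
        using union(1) by (subst indicator_UN_disjoint) (auto simp: disjoint_family_on_def)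
      have "(\<lambda>n. L p (\<lambda>y. \<Sum>i<n. indicator (X i) (p,y))) \<longlonglongrightarrow> L p (\<lambda>y. indicator (\<Union>i. X i) (p,y))" for p
      proof (rule sfun_lim[OF L, where B=1])
        show "(\<lambda>y. \<Sum>i<n. indicator (X i) (p,y) :: real) \<in> Bb" for n using fin by blast
        show "\<bar>\<Sum>i<n. indicator (X i) (p,y)\<bar> \<le> (1::real)" for n y unfolding ii by (auto simp: indicator_def)
        show "(\<lambda>n. \<Sum>i<n. indicator (X i) (p,y) :: real) \<longlonglongrightarrow> indicator (\<Union>i. X i) (p,y)" for y
          unfolding ii by (rule LIMSEQ_indicator_UN)
      qed
      then have "(\<lambda>n. (\<Sum>i<n. L p (\<lambda>y. indicator (X i) (p,y)))) \<longlonglongrightarrow> L p (\<lambda>y. indicator (\<Union>i. X i) (p,y))" for p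
        using fin by simp
      then show ?case by (rule borel_measurable_LIMSEQ_real) (use union in auto)
    qed
    then show ?thesis using B[OF A] by simp
  qed
  have "?Q (\<lambda>(p,y). F p y)"
  proof (rule real_measurable_induct[where P="?Q", OF F])
    show "space ?M = UNIV" using N by (simp add: space_pair_measure)
    show "?Q (indicator A)" if "A \<in> sets ?M" for A by (rule ind[OF that])
    fix H assume H: "\<And>n. ?Q (H n)" "\<And>x. (\<lambda>n. H n x) \<longlonglongrightarrow> (case x of (p,y) \<Rightarrow> F p y)"
      "\<And>n x. \<bar>H n x\<bar> \<le> 2 * \<bar>case x of (p,y) \<Rightarrow> F p y\<bar>"
    have "(\<lambda>n. L p (\<lambda>y. H n (p,y))) \<longlonglongrightarrow> L p (F p)" for p
    proof (rule sfun_lim[OF L, where B="2 * supnorm (F p)"])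
      show "\<bar>H n (p,y)\<bar> \<le> 2 * supnorm (F p)" for n y
        using H(3)[of n "(p,y)"] supnorm_ge[OF FB, of p y] by simp
      show "(\<lambda>n. H n (p,y)) \<longlonglongrightarrow> F p y" for y using H(2)[of "(p,y)"] by simp
    qed (use H in auto)
    then have "(\<lambda>p. L p (F p)) \<in> borel_measurable N"
      by (rule borel_measurable_LIMSEQ_real) (use H in auto)
    then show "?Q (\<lambda>(p,y). F p y)" using FB by simp
  qed (auto simp: sfun_add[OF L] sfun_cmult[OF L] Bb_add Bb_cmult)
  then show ?thesis by simp
qed

text \<open>The functional is split into two finite measures, for each of which the ordinary Fubini
  theorem applies; the majorant \<open>k\<close> is uniform in the space variable.\<close>

lemma sfun_Fubini:
  fixes L :: "('a::euclidean_space \<Rightarrow> real) \<Rightarrow> real" and F :: "real \<Rightarrow> 'a \<Rightarrow> real"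
  assumes L: "sfun L" and F: "(\<lambda>(s,y). F s y) \<in> borel_measurable (borel \<Otimes>\<^sub>M borel)"
    and k: "integrable lborel k" and Fk: "\<And>s y. \<bar>F s y\<bar> \<le> k s"
  shows "(\<lambda>y. \<integral>s. F s y \<partial>lborel) \<in> Bb" "integrable lborel (\<lambda>s. L (F s))"
    "L (\<lambda>y. \<integral>s. F s y \<partial>lborel) = (\<integral>s. L (F s) \<partial>lborel)"
proof -
  obtain m1 m2 :: "'a measure" where m: "finite_measure m1" "sets m1 = sets borel" "finite_measure m2" "sets m2 = sets borel"
    "\<And>f. f \<in> Bb \<Longrightarrow> L f = (\<integral>y. f y \<partial>m1) - (\<integral>y. f y \<partial>m2)" using sfunE[OF L] by blast
  have FB: "F s \<in> Bb" for s
    by (rule BbI[where B="k s"]) (use Fk measurable_Pair2[OF F, of s] in \<open>auto simp: split_beta'\<close>)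
  have Fi: "integrable lborel (\<lambda>s. F s y)" for y
  proof (rule Bochner_Integration.integrable_bound[OF k])
    show "(\<lambda>s. F s y) \<in> borel_measurable lborel" using measurable_Pair1[OF F, of y] by (simp add: split_beta')
    show "AE s in lborel. norm (F s y) \<le> norm (k s)" using order_trans[OF Fk abs_ge_self] by auto
  qed
  show IB: "(\<lambda>y. \<integral>s. F s y \<partial>lborel) \<in> Bb"
  proof (rule BbI[where B="\<integral>s. k s \<partial>lborel"])
    have "(\<lambda>(y,s). F s y) \<in> borel_measurable (borel \<Otimes>\<^sub>M lborel)"
      unfolding measurable_cong_sets[OF sets_pair_measure_cong[OF refl sets_lborel] refl]
      using measurable_compose[OF measurable_pair_swap' F] by (simp add: split_beta')
    then show "(\<lambda>y. \<integral>s. F s y \<partial>lborel) \<in> borel_measurable borel"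
      by (rule sigma_finite_measure.borel_measurable_lebesgue_integral[OF sigma_finite_lborel])
    show "\<bar>\<integral>s. F s y \<partial>lborel\<bar> \<le> (\<integral>s. k s \<partial>lborel)" for y
      by (rule order_trans[OF integral_abs_bound]) (use Fi k Fk in \<open>auto intro!: integral_mono\<close>)
  qed
  have key: "integrable lborel (\<lambda>s. \<integral>y. F s y \<partial>m) \<and> (\<integral>y. (\<integral>s. F s y \<partial>lborel) \<partial>m) = (\<integral>s. (\<integral>y. F s y \<partial>m) \<partial>lborel)"
    if fm: "finite_measure m" and s: "sets m = sets borel" for m :: "'a measure"
  proof -
    interpret m: finite_measure m by fact
    interpret pair_sigma_finite lborel m
      by (simp add: pair_sigma_finite_def sigma_finite_lborel m.sigma_finite_measure_axioms)
    have Fm: "case_prod F \<in> borel_measurable (lborel \<Otimes>\<^sub>M m)"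
      unfolding measurable_cong_sets[OF sets_pair_measure_cong[OF sets_lborel s] refl] by (rule F)
    have "integrable (lborel \<Otimes>\<^sub>M m) (case_prod F)"
    proof (rule Fubini_integrable[OF Fm])
      show "integrable lborel (\<lambda>x. \<integral>y. norm (case (x, y) of (a,b) \<Rightarrow> F a b) \<partial>m)"
      proof (rule Bochner_Integration.integrable_bound)
        show "integrable lborel (\<lambda>x. measure m (space m) * k x)" using k by simp
        have "(\<lambda>x. \<integral>y. norm ((case_prod F) (x, y)) \<partial>m) \<in> borel_measurable lborel"
          by (rule m.borel_measurable_lebesgue_integral) (use Fm in \<open>simp add: split_beta'\<close>)
        then show "(\<lambda>x. \<integral>y. norm (case (x, y) of (a,b) \<Rightarrow> F a b) \<partial>m) \<in> borel_measurable lborel" by simp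
        show "AE x in lborel. norm (\<integral>y. norm (case (x, y) of (a,b) \<Rightarrow> F a b) \<partial>m) \<le> norm (measure m (space m) * k x)"
        proof (rule AE_I2)
          fix x
          have "(\<integral>y. \<bar>F x y\<bar> \<partial>m) \<le> (\<integral>y. k x \<partial>m)"
            using integrable_Bb[OF fm s FB[of x]] Fk by (intro integral_mono) auto
          moreover have "0 \<le> k x" using Fk[of x undefined] by simp
          moreover have "0 \<le> (\<integral>y. \<bar>F x y\<bar> \<partial>m)" by simp
          ultimately show "norm (\<integral>y. norm (case (x, y) of (a,b) \<Rightarrow> F a b) \<partial>m) \<le> norm (measure m (space m) * k x)"
            by (simp add: abs_mult)
        qed
      qed
      show "AE x in lborel. integrable m (\<lambda>y. case (x, y) of (a,b) \<Rightarrow> F a b)"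
        using integrable_Bb[OF fm s FB] by simp
    qed
    then show ?thesis using Fubini_integral[of F] integrable_fst'[of "case_prod F"] by simp
  qed
  have LF: "(\<lambda>s. L (F s)) = (\<lambda>s. (\<integral>y. F s y \<partial>m1) - (\<integral>y. F s y \<partial>m2))" using m(5)[OF FB] by auto
  show "integrable lborel (\<lambda>s. L (F s))" unfolding LF using key[OF m(1,2)] key[OF m(3,4)] by auto
  show "L (\<lambda>y. \<integral>s. F s y \<partial>lborel) = (\<integral>s. L (F s) \<partial>lborel)"
    unfolding LF m(5)[OF IB] using key[OF m(1,2)] key[OF m(3,4)] by simp
qed

section \<open>Operator families and the Dyson series\<close>

text \<open>Families of operators are extended by \<open>0\<close> to times \<open>t \<le> 0\<close>, so that convolutions and Laplace
  transforms are integrals over the whole real line.\<close>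

definition op_family :: "(real \<Rightarrow> ('a::euclidean_space \<Rightarrow> real) \<Rightarrow> 'a \<Rightarrow> real) \<Rightarrow> bool" where
  "op_family V \<longleftrightarrow> (\<forall>t x. sfun (\<lambda>f. V t f x)) \<and>
     (\<forall>f\<in>Bb. (\<lambda>(t,x). V t f x) \<in> borel_measurable (borel \<Otimes>\<^sub>M borel)) \<and>
     (\<forall>t\<le>0. \<forall>f\<in>Bb. \<forall>x. V t f x = 0)"

text \<open>The profile \<open>v\<close> is a constant for semigroups and an integrable function,
  possibly singular at 0, for \<open>G\<close>. The exponential factor is kept apart because it is
  multiplicative under convolution.\<close>

definition exp_bounded :: "(real \<Rightarrow> ('a::euclidean_space \<Rightarrow> real) \<Rightarrow> 'a \<Rightarrow> real) \<Rightarrow> (real \<Rightarrow> real) \<Rightarrow> real \<Rightarrow> bool" where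
  "exp_bounded V v l \<longleftrightarrow> (\<forall>t. \<forall>f\<in>Bb. \<forall>x. \<bar>V t f x\<bar> \<le> v t * exp (l * t) * supnorm f)"

text \<open>The order matters: \<open>G s\<close>, which contains the perturbation, acts first.
  Since the families vanish at nonpositive times, only \<open>0 < s < t\<close> contributes.\<close>

definition op_conv :: "(real \<Rightarrow> ('a::euclidean_space \<Rightarrow> real) \<Rightarrow> 'a \<Rightarrow> real) \<Rightarrow> (real \<Rightarrow> ('a \<Rightarrow> real) \<Rightarrow> 'a \<Rightarrow> real)
    \<Rightarrow> real \<Rightarrow> ('a \<Rightarrow> real) \<Rightarrow> 'a \<Rightarrow> real" where
  "op_conv V G t f x = (\<integral>s. V (t - s) (G s f) x \<partial>lborel)"

lemma op_family_sfun: "op_family V \<Longrightarrow> sfun (\<lambda>f. V t f x)"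
  unfolding op_family_def by blast

lemma op_family_measurable: "op_family V \<Longrightarrow> f \<in> Bb \<Longrightarrow> (\<lambda>(t,x). V t f x) \<in> borel_measurable (borel \<Otimes>\<^sub>M borel)"
  unfolding op_family_def by blast

lemma op_family_nonpos: "op_family V \<Longrightarrow> t \<le> 0 \<Longrightarrow> f \<in> Bb \<Longrightarrow> V t f x = 0"
  unfolding op_family_def by blast

lemma op_family_nonpos_ext: "op_family V \<Longrightarrow> t \<le> 0 \<Longrightarrow> f \<in> Bb \<Longrightarrow> V t f = (\<lambda>x. 0)"
  using op_family_nonpos by blast

lemma op_family_zero: "op_family V \<Longrightarrow> V t (\<lambda>x. 0) x = 0"
  using sfun_zero[OF op_family_sfun] .

lemma exp_boundedD: "exp_bounded V v l \<Longrightarrow> f \<in> Bb \<Longrightarrow> \<bar>V t f x\<bar> \<le> v t * exp (l * t) * supnorm f"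
  unfolding exp_bounded_def by blast

lemma exp_bounded_supnorm: "exp_bounded V v l \<Longrightarrow> f \<in> Bb \<Longrightarrow> supnorm (V t f) \<le> v t * exp (l * t) * supnorm f"
  by (rule supnorm_le) (rule exp_boundedD)

lemma exp_bounded_nonneg:
  fixes V :: "real \<Rightarrow> ('a::euclidean_space \<Rightarrow> real) \<Rightarrow> 'a \<Rightarrow> real"
  assumes "exp_bounded V v l" shows "0 \<le> v t"
proof -
  have "supnorm (\<lambda>x::'a. 1::real) = 1" unfolding supnorm_def by simp
  then have "0 \<le> v t * exp (l * t)" using exp_boundedD[OF assms Bb_const[of 1], of t undefined] by (smt (verit) mult_cancel_left2)
  then show ?thesis by (simp add: zero_le_mult_iff)
qed

lemma exp_bounded_mono:
  assumes V: "op_family V" and b: "exp_bounded V v l" and l: "l \<le> l'" and v: "\<And>t. v t \<le> v' t"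
  shows "exp_bounded V v' l'"
  unfolding exp_bounded_def
proof (intro allI ballI)
  fix t x and f :: "'a \<Rightarrow> real" assume f: "f \<in> Bb"
  note n = supnorm_nonneg[OF f] exp_bounded_nonneg[OF b, of t]
  show "\<bar>V t f x\<bar> \<le> v' t * exp (l' * t) * supnorm f"
  proof (cases "t \<le> 0")
    case True then show ?thesis using op_family_nonpos[OF V True f] n order_trans[OF n(2) v[of t]] by simp
  next
    case False
    have "v t * exp (l * t) * supnorm f \<le> v' t * exp (l' * t) * supnorm f"
      using n v[of t] l False by (intro mult_right_mono mult_mono) auto
    then show ?thesis using exp_boundedD[OF b f, of t x] by simp
  qed
qed

lemma op_family_Bb:
  assumes V: "op_family V" and b: "exp_bounded V v l" and f: "f \<in> Bb" shows "V t f \<in> Bb"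
proof (rule BbI[where B="v t * exp (l * t) * supnorm f"])
  show "V t f \<in> borel_measurable borel"
    using measurable_Pair2[OF op_family_measurable[OF V f], of t] by (simp add: split_beta')
qed (rule exp_boundedD[OF b f])

lemma op_family_comp_measurable:
  fixes F :: "'p \<Rightarrow> 'a::euclidean_space \<Rightarrow> real"
  assumes V: "op_family V" and N: "space N = UNIV"
    and r: "r \<in> borel_measurable N" and x: "x \<in> borel_measurable N"
    and F: "(\<lambda>(p,y). F p y) \<in> borel_measurable (N \<Otimes>\<^sub>M borel)" and FB: "\<And>p. F p \<in> Bb"
  shows "(\<lambda>p. V (r p) (F p) (x p)) \<in> borel_measurable N"
proof (rule sfun_param_measurable[OF N _ _ F FB])
  show "sfun (\<lambda>f. V (r p) f (x p))" for p by (rule op_family_sfun[OF V])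
  fix f :: "'a \<Rightarrow> real" assume f: "f \<in> Bb"
  have "(\<lambda>p. (r p, x p)) \<in> measurable N (borel \<Otimes>\<^sub>M borel)" using r x by simp
  from measurable_compose[OF this op_family_measurable[OF V f]]
  show "(\<lambda>p. V (r p) f (x p)) \<in> borel_measurable N" by simp
qed

text \<open>The factors \<open>exp (l * (t - s))\<close> and \<open>exp (l * s)\<close> multiply to
  \<open>exp (l * t)\<close>, so the bound depends on \<open>s\<close> only through
  \<open>\<kappa>\<close>.\<close>

lemma op_conv_integrand_bound:
  assumes Vb: "exp_bounded V (\<lambda>_. A) l" and G: "op_family G" and Gb: "exp_bounded G \<kappa> l" and f: "f \<in> Bb"
  shows "\<bar>V (t - s) (G s f) x\<bar> \<le> A * exp (l * t) * supnorm f * \<kappa> s"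
proof -
  have "\<bar>V (t - s) (G s f) x\<bar> \<le> A * exp (l * (t - s)) * supnorm (G s f)"
    by (rule exp_boundedD[OF Vb op_family_Bb[OF G Gb f]])
  also have "\<dots> \<le> A * exp (l * (t - s)) * (\<kappa> s * exp (l * s) * supnorm f)"
    by (intro mult_left_mono exp_bounded_supnorm[OF Gb f]) (simp add: exp_bounded_nonneg[OF Vb])
  also have "\<dots> = A * (exp (l * (t - s)) * exp (l * s)) * supnorm f * \<kappa> s" by (simp add: mult_ac)
  also have "exp (l * (t - s)) * exp (l * s) = exp (l * t)" by (simp add: exp_add[symmetric] algebra_simps)
  finally show ?thesis .
qed

context
  fixes V G :: "real \<Rightarrow> ('a::euclidean_space \<Rightarrow> real) \<Rightarrow> 'a \<Rightarrow> real" and A l :: real and \<kappa> :: "real \<Rightarrow> real"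
  assumes V: "op_family V" and Vb: "exp_bounded V (\<lambda>_. A) l" and G: "op_family G" and Gb: "exp_bounded G \<kappa> l"
    and \<kappa>: "integrable lborel \<kappa>"
begin

lemma op_conv_integrand_measurable:
  assumes f: "f \<in> Bb"
  shows "(\<lambda>((t,x),s). V (t - s) (G s f) x) \<in> borel_measurable ((borel \<Otimes>\<^sub>M borel) \<Otimes>\<^sub>M borel)"
proof -
  let ?N = "(borel \<Otimes>\<^sub>M borel) \<Otimes>\<^sub>M borel :: ((real \<times> 'a) \<times> real) measure"
  have "(\<lambda>p. V (fst (fst p) - snd p) (G (snd p) f) (snd (fst p))) \<in> borel_measurable ?N"
  proof (rule op_family_comp_measurable[OF V])
    show "space ?N = UNIV" by (simp add: space_pair_measure)
    have "(\<lambda>q. (snd (fst q), snd q)) \<in> measurable (?N \<Otimes>\<^sub>M (borel :: 'a measure)) (borel \<Otimes>\<^sub>M borel)" by simp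
    from measurable_compose[OF this op_family_measurable[OF G f]]
    show "(\<lambda>(p, y). G (snd p) f y) \<in> borel_measurable (?N \<Otimes>\<^sub>M borel)" by (simp add: split_beta')
    show "G (snd p) f \<in> Bb" for p :: "(real \<times> 'a) \<times> real" by (rule op_family_Bb[OF G Gb f])
  qed simp_all
  then show ?thesis by (simp add: split_beta')
qed

lemma op_conv_integrand_measurable1:
  assumes f: "f \<in> Bb" shows "(\<lambda>s. V (t - s) (G s f) x) \<in> borel_measurable lborel"
proof -
  have "(\<lambda>s. ((t,x),s)) \<in> measurable lborel ((borel \<Otimes>\<^sub>M borel) \<Otimes>\<^sub>M borel)" by simp
  from measurable_compose[OF this op_conv_integrand_measurable[OF f]] show ?thesis by simp
qed

lemma op_conv_integrable:
  assumes f: "f \<in> Bb" shows "integrable lborel (\<lambda>s. V (t - s) (G s f) x)"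
proof (rule Bochner_Integration.integrable_bound)
  show "integrable lborel (\<lambda>s. A * exp (l * t) * supnorm f * \<kappa> s)" using \<kappa> by simp
  show "AE s in lborel. norm (V (t - s) (G s f) x) \<le> norm (A * exp (l * t) * supnorm f * \<kappa> s)"
    using order_trans[OF op_conv_integrand_bound[OF Vb G Gb f] abs_ge_self] by auto
qed (rule op_conv_integrand_measurable1[OF f])

lemma exp_bounded_op_conv: "exp_bounded (op_conv V G) (\<lambda>_. A * (\<integral>s. \<kappa> s \<partial>lborel)) l"
  unfolding exp_bounded_def
proof (intro allI ballI)
  fix t x and f :: "'a \<Rightarrow> real" assume f: "f \<in> Bb"
  have "\<bar>op_conv V G t f x\<bar> \<le> (\<integral>s. \<bar>V (t - s) (G s f) x\<bar> \<partial>lborel)" unfolding op_conv_def by (rule integral_abs_bound)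
  also have "\<dots> \<le> (\<integral>s. A * exp (l * t) * supnorm f * \<kappa> s \<partial>lborel)"
    by (intro integral_mono op_conv_integrand_bound[OF Vb G Gb f]) (use \<kappa> op_conv_integrable[OF f] in auto)
  finally show "\<bar>op_conv V G t f x\<bar> \<le> A * (\<integral>s. \<kappa> s \<partial>lborel) * exp (l * t) * supnorm f"
    by (simp add: mult_ac)
qed

text \<open>Two layers of continuity: for fixed \<open>s\<close> the functions
  \<open>G s (F n)\<close> converge boundedly and pointwise, then \<open>V (t - s)\<close> preserves
  the convergence, and \<open>\<kappa>\<close> dominates the integrands in \<open>s\<close>.\<close>

lemma op_conv_lim:
  assumes F: "\<And>n. F n \<in> Bb" "\<And>n x. \<bar>F n x\<bar> \<le> B" "\<And>x. (\<lambda>n. F n x) \<longlonglongrightarrow> f x"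
  shows "(\<lambda>n. op_conv V G t (F n) x) \<longlonglongrightarrow> op_conv V G t f x"
  unfolding op_conv_def
proof (rule integral_dominated_convergence[where w="\<lambda>s. A * exp (l * t) * B * \<kappa> s"])
  have fB: "f \<in> Bb" using F by (rule Bb_limit)
  show "(\<lambda>s. V (t - s) (G s f) x) \<in> borel_measurable lborel" by (rule op_conv_integrand_measurable1[OF fB])
  show "(\<lambda>s. V (t - s) (G s (F n)) x) \<in> borel_measurable lborel" for n by (rule op_conv_integrand_measurable1[OF F(1)])
  show "integrable lborel (\<lambda>s. A * exp (l * t) * B * \<kappa> s)" using \<kappa> by simp
  have snB: "supnorm (F n) \<le> B" for n by (rule supnorm_le) (rule F)
  show "AE s in lborel. norm (V (t - s) (G s (F n)) x) \<le> A * exp (l * t) * B * \<kappa> s" for n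
  proof (rule AE_I2)
    fix s
    have "A * exp (l * t) * supnorm (F n) * \<kappa> s \<le> A * exp (l * t) * B * \<kappa> s"
      by (intro mult_right_mono mult_left_mono snB) (auto simp: exp_bounded_nonneg[OF Vb] exp_bounded_nonneg[OF Gb])
    then show "norm (V (t - s) (G s (F n)) x) \<le> A * exp (l * t) * B * \<kappa> s"
      using op_conv_integrand_bound[OF Vb G Gb F(1), of t s n x] by simp
  qed
  show "AE s in lborel. (\<lambda>n. V (t - s) (G s (F n)) x) \<longlonglongrightarrow> V (t - s) (G s f) x"
  proof (rule AE_I2)
    fix s
    show "(\<lambda>n. V (t - s) (G s (F n)) x) \<longlonglongrightarrow> V (t - s) (G s f) x"
    proof (rule sfun_lim[OF op_family_sfun[OF V], where B="\<kappa> s * exp (l * s) * B"])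
      show "G s (F n) \<in> Bb" for n by (rule op_family_Bb[OF G Gb F(1)])
      show "(\<lambda>n. G s (F n) y) \<longlonglongrightarrow> G s f y" for y by (rule sfun_lim[OF op_family_sfun[OF G] F])
      show "\<bar>G s (F n) y\<bar> \<le> \<kappa> s * exp (l * s) * B" for n y
        by (rule order_trans[OF exp_boundedD[OF Gb F(1)] mult_left_mono[OF snB]]) (simp add: exp_bounded_nonneg[OF Gb])
    qed
  qed
qed

lemma op_family_op_conv: "op_family (op_conv V G)"
  unfolding op_family_def
proof (intro conjI allI ballI impI)
  fix t x
  show "sfun (\<lambda>f. op_conv V G t f x)"
  proof (rule sfunI)
    fix f g :: "'a \<Rightarrow> real" assume f: "f \<in> Bb" and g: "g \<in> Bb"
    have "G s (\<lambda>x. f x + g x) = (\<lambda>y. G s f y + G s g y)" for s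
      using sfun_add[OF op_family_sfun[OF G] f g] by auto
    then show "op_conv V G t (\<lambda>x. f x + g x) x = op_conv V G t f x + op_conv V G t g x"
      unfolding op_conv_def
      by (simp add: sfun_add[OF op_family_sfun[OF V] op_family_Bb[OF G Gb f] op_family_Bb[OF G Gb g]] op_conv_integrable f g)
  next
    fix f :: "'a \<Rightarrow> real" and c assume f: "f \<in> Bb"
    have "G s (\<lambda>x. c * f x) = (\<lambda>y. c * G s f y)" for s using sfun_cmult[OF op_family_sfun[OF G] f] by auto
    then show "op_conv V G t (\<lambda>x. c * f x) x = c * op_conv V G t f x"
      unfolding op_conv_def by (simp add: sfun_cmult[OF op_family_sfun[OF V] op_family_Bb[OF G Gb f]])
  next
    fix f :: "'a \<Rightarrow> real" assume f: "f \<in> Bb"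
    then show "\<bar>op_conv V G t f x\<bar> \<le> (A * (\<integral>s. \<kappa> s \<partial>lborel) * exp (l * t)) * supnorm f" by (rule exp_boundedD[OF exp_bounded_op_conv])
  qed (rule op_conv_lim)
next
  fix f :: "'a \<Rightarrow> real" assume f: "f \<in> Bb"
  have "(\<lambda>((t,x),s). V (t - s) (G s f) x) \<in> borel_measurable ((borel \<Otimes>\<^sub>M borel) \<Otimes>\<^sub>M lborel)"
    unfolding measurable_cong_sets[OF sets_pair_measure_cong[OF refl sets_lborel] refl]
    by (rule op_conv_integrand_measurable[OF f])
  then have "(\<lambda>(p,s). V (fst p - s) (G s f) (snd p)) \<in> borel_measurable ((borel \<Otimes>\<^sub>M borel) \<Otimes>\<^sub>M lborel)"
    by (simp add: split_beta')
  from sigma_finite_measure.borel_measurable_lebesgue_integral[OF sigma_finite_lborel this]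
  show "(\<lambda>(t,x). op_conv V G t f x) \<in> borel_measurable (borel \<Otimes>\<^sub>M borel)" by (simp add: op_conv_def split_beta')
next
  fix t :: real and f :: "'a \<Rightarrow> real" and x assume t: "t \<le> 0" and f: "f \<in> Bb"
  have "V (t - s) (G s f) x = 0" for s
  proof (cases "s \<le> 0")
    case True then show ?thesis using op_family_nonpos_ext[OF G True f] op_family_zero[OF V] by simp
  next
    case False then show ?thesis using t op_family_nonpos[OF V _ op_family_Bb[OF G Gb f]] by simp
  qed
  then show "op_conv V G t f x = 0" by (simp add: op_conv_def)
qed

end

text \<open>Each insertion of the equation into itself halves the constant in the exponential bound.
  Applied to differences, this is uniqueness for the Volterra equation.\<close>

lemma op_conv_fixed_point_zero:
  assumes Db: "exp_bounded D (\<lambda>_. A) l" and G: "op_family G" and Gb: "exp_bounded G \<kappa> l" and \<kappa>: "integrable lborel \<kappa>"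
    and half: "(\<integral>s. \<kappa> s \<partial>lborel) \<le> 1/2"
    and fx: "\<And>t f x. f \<in> Bb \<Longrightarrow> D t f x = op_conv D G t f x" and f: "f \<in> Bb"
  shows "D t f x = 0"
proof -
  have "exp_bounded D (\<lambda>_. A / 2 ^ n) l" for n
  proof (induction n)
    case (Suc n)
    show ?case unfolding exp_bounded_def
    proof (intro allI ballI)
      fix t x and f :: "'a \<Rightarrow> real" assume f: "f \<in> Bb"
      let ?c = "A / 2 ^ n * exp (l * t) * supnorm f"
      have c: "0 \<le> ?c" using exp_bounded_nonneg[OF Suc] supnorm_nonneg[OF f] by (intro mult_nonneg_nonneg) auto
      have "\<bar>D t f x\<bar> = \<bar>\<integral>s. D (t - s) (G s f) x \<partial>lborel\<bar>" using fx[OF f] by (simp add: op_conv_def)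
      also have "\<dots> \<le> (\<integral>s. \<bar>D (t - s) (G s f) x\<bar> \<partial>lborel)" by (rule integral_abs_bound)
      \<comment> \<open>The integrand is not known to be measurable, as \<open>D\<close> is merely
        bounded; integrability of the majorant suffices for this comparison.\<close>
      also have "\<dots> \<le> (\<integral>s. ?c * \<kappa> s \<partial>lborel)"
      proof (rule integral_mono')
        show "integrable lborel (\<lambda>s. ?c * \<kappa> s)" using \<kappa> by simp
        show "\<bar>D (t - s) (G s f) x\<bar> \<le> ?c * \<kappa> s" for s
          by (rule op_conv_integrand_bound[OF Suc G Gb f])
        show "0 \<le> ?c * \<kappa> s" for s by (rule mult_nonneg_nonneg[OF c exp_bounded_nonneg[OF Gb]])
      qed
      also have "\<dots> \<le> ?c * (1/2)" using mult_left_mono[OF half c] by simp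
      finally show "\<bar>D t f x\<bar> \<le> A / 2 ^ Suc n * exp (l * t) * supnorm f" by simp
    qed
  qed (use Db in simp)
  then have "\<bar>D t f x\<bar> \<le> A / 2 ^ n * exp (l * t) * supnorm f" for n using exp_boundedD f by blast
  moreover have "(\<lambda>n. A / 2 ^ n * exp (l * t) * supnorm f) \<longlonglongrightarrow> 0 * exp (l * t) * supnorm f"
    by (intro tendsto_intros LIMSEQ_divide_realpow_zero) auto
  ultimately have "\<bar>D t f x\<bar> \<le> 0" by (intro LIMSEQ_le_const) auto
  then show ?thesis by simp
qed

section \<open>The Dyson series\<close>

lemma geometric_summable: "summable (\<lambda>n. c * (1/2) ^ n :: real)"
  by (intro summable_mult summable_geometric) simp

text \<open>By \<open>half\<close> the \<open>n\<close>-th iterate is smaller by the factor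
  \<open>2 ^ n\<close>, so the series converges in norm and sums to at most \<open>2 * A\<close>.
  Any number below 1 would serve in place of 1/2.\<close>

locale dyson =
  fixes T G :: "real \<Rightarrow> ('a::euclidean_space \<Rightarrow> real) \<Rightarrow> 'a \<Rightarrow> real" and A l :: real and \<kappa> :: "real \<Rightarrow> real"
  assumes T: "op_family T" and Tb: "exp_bounded T (\<lambda>_. A) l" and G: "op_family G" and Gb: "exp_bounded G \<kappa> l"
    and \<kappa>: "integrable lborel \<kappa>" and half: "(\<integral>s. \<kappa> s \<partial>lborel) \<le> 1/2"
begin

text \<open>With \<open>G s = B T(s)\<close> the iterates have the form
  \<open>Sn n (t - s) (B (T s f))\<close>: the perturbation only meets functions smoothed by
  \<open>T\<close>, while the bound of \<open>Sn n\<close> enters as a constant.\<close>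

primrec Sn :: "nat \<Rightarrow> real \<Rightarrow> ('a \<Rightarrow> real) \<Rightarrow> 'a \<Rightarrow> real" where
  "Sn 0 = T"
| "Sn (Suc n) = op_conv (Sn n) G"

definition S :: "real \<Rightarrow> ('a \<Rightarrow> real) \<Rightarrow> 'a \<Rightarrow> real" where
  "S t f x = (\<Sum>n. Sn n t f x)"

lemma A_nonneg: "0 \<le> A" using exp_bounded_nonneg[OF Tb] .

lemma Sn_op_family_exp_bounded: "op_family (Sn n) \<and> exp_bounded (Sn n) (\<lambda>_. A / 2 ^ n) l"
proof (induction n)
  case (Suc n)
  then have o: "op_family (Sn n)" and b: "exp_bounded (Sn n) (\<lambda>_. A / 2 ^ n) l" by auto
  have "A / 2 ^ n * (\<integral>s. \<kappa> s \<partial>lborel) \<le> A / 2 ^ Suc n"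
    using mult_left_mono[OF half, of "A / 2 ^ n"] A_nonneg by simp
  then show ?case
    using op_family_op_conv[OF o b G Gb \<kappa>] exp_bounded_mono[OF _ exp_bounded_op_conv[OF o b G Gb \<kappa>] order_refl] by simp
qed (use T Tb in simp)

lemma Sn_op_family: "op_family (Sn n)" and Sn_exp_bounded: "exp_bounded (Sn n) (\<lambda>_. A / 2 ^ n) l"
  using Sn_op_family_exp_bounded[of n] by auto

lemma Sn_bound: "f \<in> Bb \<Longrightarrow> \<bar>Sn n t f x\<bar> \<le> (A * exp (l * t) * supnorm f) * (1/2) ^ n"
  using exp_boundedD[OF Sn_exp_bounded, of f n t x] by (simp add: power_divide)

lemma Sn_abs_summable: "f \<in> Bb \<Longrightarrow> summable (\<lambda>n. \<bar>Sn n t f x\<bar>)"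
  by (rule summable_comparison_test'[OF geometric_summable, where N=0]) (use Sn_bound in auto)

lemma Sn_summable: "f \<in> Bb \<Longrightarrow> summable (\<lambda>n. Sn n t f x)"
  by (rule summable_rabs_cancel[OF Sn_abs_summable])

lemma S_exp_bounded: "exp_bounded S (\<lambda>_. 2 * A) l"
  unfolding exp_bounded_def
proof (intro allI ballI)
  fix t x and f :: "'a \<Rightarrow> real" assume f: "f \<in> Bb"
  have "\<bar>S t f x\<bar> \<le> (\<Sum>n. \<bar>Sn n t f x\<bar>)" unfolding S_def by (rule summable_rabs[OF Sn_abs_summable[OF f]])
  also have "\<dots> \<le> (\<Sum>n. (A * exp (l * t) * supnorm f) * (1/2) ^ n)"
    by (intro suminf_le Sn_bound[OF f] Sn_abs_summable[OF f] geometric_summable)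
  also have "\<dots> = (A * exp (l * t) * supnorm f) * 2"
    by (subst suminf_mult) (auto simp: suminf_geometric intro: summable_geometric)
  finally show "\<bar>S t f x\<bar> \<le> 2 * A * exp (l * t) * supnorm f" by simp
qed

lemma S_op_family: "op_family S"
  unfolding op_family_def
proof (intro conjI allI ballI impI)
  fix t x
  show "sfun (\<lambda>f. S t f x)"
  proof (rule sfunI)
    fix f g :: "'a \<Rightarrow> real" assume "f \<in> Bb" "g \<in> Bb"
    then show "S t (\<lambda>x. f x + g x) x = S t f x + S t g x"
      by (simp add: S_def sfun_add[OF op_family_sfun[OF Sn_op_family]] suminf_add Sn_summable)
  next
    fix f :: "'a \<Rightarrow> real" and c assume "f \<in> Bb"
    then show "S t (\<lambda>x. c * f x) x = c * S t f x"
      by (simp add: S_def sfun_cmult[OF op_family_sfun[OF Sn_op_family]] suminf_mult Sn_summable)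
  next
    show "f \<in> Bb \<Longrightarrow> \<bar>S t f x\<bar> \<le> (2 * A * exp (l * t)) * supnorm f" for f by (rule exp_boundedD[OF S_exp_bounded])
  next
    fix F :: "nat \<Rightarrow> 'a \<Rightarrow> real" and f B
    assume F: "\<And>n. F n \<in> Bb" "\<And>n x. \<bar>F n x\<bar> \<le> B" "\<And>x. (\<lambda>n. F n x) \<longlonglongrightarrow> f x"
    have snB: "supnorm (F n) \<le> B" for n by (rule supnorm_le) (rule F)
    have b: "\<bar>Sn k t (F n) x\<bar> \<le> (A * exp (l * t) * B) * (1/2) ^ k" for k n
      using A_nonneg by (intro order_trans[OF Sn_bound[OF F(1)]] mult_right_mono mult_left_mono snB) auto
    have "((\<lambda>n. \<Sum>k. Sn k t (F n) x) \<longlonglongrightarrow> (\<Sum>k. Sn k t f x))"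
      by (rule tannerys_theorem[THEN conjunct2, THEN conjunct2, OF _ _ geometric_summable[of "A * exp (l * t) * B"]])
         (use b in \<open>auto intro!: sfun_lim[OF op_family_sfun[OF Sn_op_family] F] always_eventually\<close>)
    then show "(\<lambda>n. S t (F n) x) \<longlonglongrightarrow> S t f x" by (simp add: S_def)
  qed
next
  fix f :: "'a \<Rightarrow> real" assume f: "f \<in> Bb"
  have "(\<lambda>p. \<Sum>n. (\<lambda>(t,x). Sn n t f x) p) \<in> borel_measurable (borel \<Otimes>\<^sub>M borel)"
    by (rule borel_measurable_suminf) (rule op_family_measurable[OF Sn_op_family f])
  then show "(\<lambda>(t,x). S t f x) \<in> borel_measurable (borel \<Otimes>\<^sub>M borel)" by (simp add: S_def split_beta')
next
  fix t :: real and f :: "'a \<Rightarrow> real" and x assume "t \<le> 0" "f \<in> Bb"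
  then show "S t f x = 0" by (simp add: S_def op_family_nonpos[OF Sn_op_family])
qed

lemma S_Bb: "f \<in> Bb \<Longrightarrow> S t f \<in> Bb"
  by (rule op_family_Bb[OF S_op_family S_exp_bounded])

lemma G_Bb: "f \<in> Bb \<Longrightarrow> G t f \<in> Bb"
  by (rule op_family_Bb[OF G Gb])

lemma T_Bb: "f \<in> Bb \<Longrightarrow> T t f \<in> Bb"
  by (rule op_family_Bb[OF T Tb])

text \<open>The series is integrated term by term; a constant times
  \<open>\<kappa> s * (1/2) ^ n\<close> dominates its terms. Splitting off the term
  \<open>n = 0\<close> leaves \<open>T\<close>.\<close>

lemma S_eq:
  assumes f: "f \<in> Bb" shows "S t f x = T t f x + op_conv S G t f x"
proof -
  have int: "integrable lborel (\<lambda>s. Sn n (t - s) (G s f) x)" for n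
    by (rule op_conv_integrable[OF Sn_op_family Sn_exp_bounded G Gb \<kappa> f])
  have "\<bar>Sn n (t - s) (G s f) x\<bar> \<le> A / 2 ^ n * exp (l * t) * supnorm f * \<kappa> s" for n s
    by (rule op_conv_integrand_bound[OF Sn_exp_bounded G Gb f])
  then have b: "\<bar>Sn n (t - s) (G s f) x\<bar> \<le> (A * exp (l * t) * supnorm f * \<kappa> s) * (1/2) ^ n" for n s
    by (simp add: power_divide)
  have "op_conv S G t f x = (\<integral>s. (\<Sum>n. Sn n (t - s) (G s f) x) \<partial>lborel)" by (simp add: op_conv_def S_def)
  also have "\<dots> = (\<Sum>n. (\<integral>s. Sn n (t - s) (G s f) x \<partial>lborel))"
  proof (rule integral_suminf[OF int])
    show "AE s in lborel. summable (\<lambda>n. norm (Sn n (t - s) (G s f) x))" using Sn_abs_summable[OF G_Bb[OF f]] by simp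
    show "summable (\<lambda>n. \<integral>s. norm (Sn n (t - s) (G s f) x) \<partial>lborel)"
    proof (rule summable_comparison_test'[OF geometric_summable, where N=0])
      fix n
      have "(\<integral>s. norm (Sn n (t - s) (G s f) x) \<partial>lborel) \<le> (\<integral>s. (A * exp (l * t) * supnorm f * \<kappa> s) * (1/2) ^ n \<partial>lborel)"
        using b int \<kappa> by (intro integral_mono) auto
      then show "norm (\<integral>s. norm (Sn n (t - s) (G s f) x) \<partial>lborel) \<le> (\<integral>s. A * exp (l * t) * supnorm f * \<kappa> s \<partial>lborel) * (1/2) ^ n"
        by simp
    qed
  qed
  also have "\<dots> = (\<Sum>n. Sn (Suc n) t f x)" by (simp add: op_conv_def)
  finally show ?thesis using suminf_split_head[OF Sn_summable[OF f, of t x]] by (simp add: S_def)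
qed

end

section \<open>Laplace transforms and the full generator\<close>

lemma AE_lborel_neqI: "(\<And>s. s \<noteq> c \<Longrightarrow> P s) \<Longrightarrow> AE s in lborel. P (s :: real)"
  using AE_lborel_singleton[of c] by (rule AE_mp) (rule AE_I2, blast)

text \<open>The factor \<open>m\<close> normalises the kernel to mass 1 on the half line, and every
  tail is again an exponential, as \<open>triangle_Fubini\<close> requires.\<close>

lemma has_bochner_integral_exp_tail:
  fixes m q :: real assumes m: "0 < m"
  shows "has_bochner_integral lborel (\<lambda>s. m * exp (- m * s) * indicator {q..} s) (exp (- m * q))"
proof (rule has_bochner_integral_nn_integral)
  have "(\<integral>\<^sup>+s. ennreal (m * exp (- m * s)) * indicator {q..} s \<partial>lborel) = ennreal (0 - (- exp (- m * q)))"
  proof (rule nn_integral_FTC_atLeast[where F="\<lambda>s. - exp (- m * s)"])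
    show "((\<lambda>s. - exp (- m * s)) has_real_derivative m * exp (- m * s)) (at s)" for s
      by (auto intro!: derivative_eq_intros)
    have "filterlim (\<lambda>s. - m * s) at_bot at_top"
      using m by (simp add: filterlim_uminus_at_bot filterlim_tendsto_pos_mult_at_top[OF tendsto_const _ filterlim_ident])
    then have "((\<lambda>s. exp (- m * s)) \<longlongrightarrow> 0) at_top" by (rule filterlim_compose[OF exp_at_bot])
    from tendsto_minus[OF this] show "((\<lambda>s. - exp (- m * s)) \<longlongrightarrow> 0) at_top" by simp
  qed (use m in auto)
  then show "(\<integral>\<^sup>+s. ennreal (m * exp (- m * s) * indicator {q..} s) \<partial>lborel) = ennreal (exp (- m * q))"
    by (simp add: ennreal_mult' ennreal_indicator[symmetric] m less_imp_le)
qed (use m in \<open>auto simp: indicator_def\<close>)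

text \<open>Fubini on the triangle \<open>q \<le> s\<close>, where \<open>W\<close> is the tail of
  the weight \<open>w\<close>. It takes the place of integration by parts when a running integral of
  \<open>a\<close> is averaged in time; its three uses differ only in the exponential
  weight.\<close>

lemma triangle_Fubini:
  fixes w a W :: "real \<Rightarrow> real"
  assumes w[measurable]: "w \<in> borel_measurable lborel" and a[measurable]: "a \<in> borel_measurable lborel"
    and pos: "\<And>s. 0 \<le> w s"
    and W: "\<And>q. has_bochner_integral lborel (\<lambda>s. w s * indicator {q..} s) (W q)"
    and aW: "integrable lborel (\<lambda>q. a q * W q)"
  shows "(\<integral>s. w s * (\<integral>q. indicator {..s} q * a q \<partial>lborel) \<partial>lborel) = (\<integral>q. a q * W q \<partial>lborel)"
proof -
  let ?u = "\<lambda>q s. w s * indicator {q..} s * a q"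
  have Wpos: "0 \<le> W q" for q
  proof -
    have "0 \<le> (\<integral>s. w s * indicator {q..} s \<partial>lborel)" using pos by (intro integral_nonneg_AE) auto
    then show ?thesis using has_bochner_integral_integral_eq[OF W] by simp
  qed
  have m: "case_prod ?u \<in> borel_measurable (lborel \<Otimes>\<^sub>M lborel)"
  proof -
    have "(\<lambda>(q,s). w s * (if q \<le> s then 1 else 0) * a q) \<in> borel_measurable (lborel \<Otimes>\<^sub>M lborel)"
      by measurable
    then show ?thesis by (simp add: indicator_def)
  qed
  have "integrable (lborel \<Otimes>\<^sub>M lborel) (case_prod ?u)"
  proof (rule lborel_pair.Fubini_integrable[OF m])
    have "(\<integral>s. norm (?u q s) \<partial>lborel) = \<bar>a q\<bar> * W q" for q
      using W[of q] pos by (simp add: has_bochner_integral_iff abs_mult)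
    then show "integrable lborel (\<lambda>x. \<integral>y. norm (case (x, y) of (q, s) \<Rightarrow> ?u q s) \<partial>lborel)"
      using integrable_norm[OF aW] Wpos by (simp only: prod.case) (simp add: abs_mult)
    show "AE x in lborel. integrable lborel (\<lambda>y. case (x, y) of (q, s) \<Rightarrow> ?u q s)"
      using W by (simp add: has_bochner_integral_iff)
  qed
  then have "(\<integral>s. (\<integral>q. ?u q s \<partial>lborel) \<partial>lborel) = (\<integral>q. (\<integral>s. ?u q s \<partial>lborel) \<partial>lborel)"
    by (rule lborel_pair.Fubini_integral)
  moreover have "(\<integral>q. ?u q s \<partial>lborel) = w s * (\<integral>q. indicator {..s} q * a q \<partial>lborel)" for s
  proof -
    have "(\<lambda>q. ?u q s) = (\<lambda>q. w s * (indicator {..s} q * a q))" by (auto simp: indicator_def)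
    then show ?thesis by simp
  qed
  moreover have "(\<integral>s. ?u q s \<partial>lborel) = a q * W q" for q
    using W[of q] by (simp add: has_bochner_integral_iff)
  ultimately show ?thesis by (simp only:)
qed

section \<open>Laplace transforms of operator families\<close>

definition laplace :: "(real \<Rightarrow> ('a::euclidean_space \<Rightarrow> real) \<Rightarrow> 'a \<Rightarrow> real) \<Rightarrow> real \<Rightarrow> ('a \<Rightarrow> real) \<Rightarrow> 'a \<Rightarrow> real" where
  "laplace V m f x = (\<integral>t. exp (- m * t) * V t f x \<partial>lborel)"

text \<open>One majorant for all \<open>f\<close> and \<open>x\<close>, so that constant profiles
  (with \<open>m\<close> above the rate) and integrable profiles (with \<open>m\<close> equal to the
  rate allowed) are treated alike.\<close>

definition laplace_dom :: "(real \<Rightarrow> ('a::euclidean_space \<Rightarrow> real) \<Rightarrow> 'a \<Rightarrow> real) \<Rightarrow> real \<Rightarrow> (real \<Rightarrow> real) \<Rightarrow> bool" where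
  "laplace_dom V m d \<longleftrightarrow> integrable lborel d \<and> (\<forall>t. \<forall>f\<in>Bb. \<forall>x. \<bar>exp (- m * t) * V t f x\<bar> \<le> d t * supnorm f)"

lemma laplace_domD: "laplace_dom V m d \<Longrightarrow> f \<in> Bb \<Longrightarrow> \<bar>exp (- m * t) * V t f x\<bar> \<le> d t * supnorm f"
  unfolding laplace_dom_def by blast

text \<open>Multiplying and dividing by \<open>m - l\<close> puts the majorant into the normalised
  form of \<open>has_bochner_integral_exp_tail\<close>.\<close>

lemma laplace_dom_const:
  assumes V: "op_family V" and b: "exp_bounded V (\<lambda>_. A) l" and m: "l < m"
  shows "laplace_dom V m (\<lambda>t. A / (m - l) * ((m - l) * exp (- (m - l) * t) * indicator {0..} t))"
  unfolding laplace_dom_def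
proof (intro conjI allI ballI)
  show "integrable lborel (\<lambda>t. A / (m - l) * ((m - l) * exp (- (m - l) * t) * indicator {0..} t))"
    using has_bochner_integral_exp_tail[of "m - l" 0] m by (intro integrable_mult_right) (simp add: has_bochner_integral_iff)
  fix t x and f :: "'a \<Rightarrow> real" assume f: "f \<in> Bb"
  show "\<bar>exp (- m * t) * V t f x\<bar> \<le> A / (m - l) * ((m - l) * exp (- (m - l) * t) * indicator {0..} t) * supnorm f"
  proof (cases "t \<le> 0")
    case True
    then show ?thesis using op_family_nonpos[OF V True f] exp_bounded_nonneg[OF b] m supnorm_nonneg[OF f]
      by (auto intro!: mult_nonneg_nonneg divide_nonneg_nonneg simp: indicator_def)
  next
    case False
    have "\<bar>exp (- m * t) * V t f x\<bar> = exp (- m * t) * \<bar>V t f x\<bar>" by (simp add: abs_mult)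
    also have "\<dots> \<le> exp (- m * t) * (A * exp (l * t) * supnorm f)" by (intro mult_left_mono exp_boundedD[OF b f]) auto
    also have "\<dots> = A * (exp (- m * t) * exp (l * t)) * supnorm f" by (simp add: mult_ac)
    also have "exp (- m * t) * exp (l * t) = exp (- (m - l) * t)" by (simp add: exp_add[symmetric] algebra_simps)
    finally show ?thesis using m False by simp
  qed
qed

lemma laplace_dom_exp_bounded:
  assumes V: "op_family V" and b: "exp_bounded V v l" and v: "integrable lborel v" and m: "l \<le> m"
  shows "laplace_dom V m v"
  unfolding laplace_dom_def
proof (intro conjI allI ballI)
  fix t x and f :: "'a \<Rightarrow> real" assume f: "f \<in> Bb"
  have "exp_bounded V v m" by (rule exp_bounded_mono[OF V b m order_refl])
  from exp_boundedD[OF this f, of t x] have "exp (- m * t) * \<bar>V t f x\<bar> \<le> exp (- m * t) * (v t * exp (m * t) * supnorm f)"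
    by (intro mult_left_mono) auto
  also have "\<dots> = v t * (exp (- m * t) * exp (m * t)) * supnorm f" by (simp add: mult_ac)
  also have "exp (- m * t) * exp (m * t) = 1" by (simp add: exp_add[symmetric])
  finally show "\<bar>exp (- m * t) * V t f x\<bar> \<le> v t * supnorm f" by (simp add: abs_mult)
qed (rule v)

context
  fixes V :: "real \<Rightarrow> ('a::euclidean_space \<Rightarrow> real) \<Rightarrow> 'a \<Rightarrow> real" and m :: real and d :: "real \<Rightarrow> real"
  assumes V: "op_family V" and d: "laplace_dom V m d"
begin

lemma laplace_dom_integrable: "integrable lborel d" using d unfolding laplace_dom_def by blast

lemma laplace_dom_nonneg: "0 \<le> d t"
proof -
  have "supnorm (\<lambda>x::'a. 1::real) = 1" unfolding supnorm_def by simp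
  then show ?thesis
    using order_trans[OF abs_ge_zero laplace_domD[OF d Bb_const[of 1], of t undefined]] by simp
qed

lemma laplace_measurable2:
  assumes f: "f \<in> Bb" shows "(\<lambda>(t,x). exp (- m * t) * V t f x) \<in> borel_measurable (borel \<Otimes>\<^sub>M borel)"
  using op_family_measurable[OF V f] by (simp add: split_beta')

lemma laplace_measurable1:
  assumes f: "f \<in> Bb" shows "(\<lambda>t. exp (- m * t) * V t f x) \<in> borel_measurable lborel"
  using measurable_Pair1[OF laplace_measurable2[OF f], of x] by (simp add: split_beta')

lemma laplace_integrable:
  assumes f: "f \<in> Bb" shows "integrable lborel (\<lambda>t. exp (- m * t) * V t f x)"
proof (rule Bochner_Integration.integrable_bound)
  show "integrable lborel (\<lambda>t. d t * supnorm f)" using laplace_dom_integrable by simp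
  show "AE t in lborel. norm (exp (- m * t) * V t f x) \<le> norm (d t * supnorm f)"
    using order_trans[OF laplace_domD[OF d f] abs_ge_self] by auto
qed (rule laplace_measurable1[OF f])

lemma laplace_bound:
  assumes f: "f \<in> Bb" shows "\<bar>laplace V m f x\<bar> \<le> (\<integral>t. d t \<partial>lborel) * supnorm f"
proof -
  have "\<bar>laplace V m f x\<bar> \<le> (\<integral>t. \<bar>exp (- m * t) * V t f x\<bar> \<partial>lborel)" unfolding laplace_def by (rule integral_abs_bound)
  also have "\<dots> \<le> (\<integral>t. d t * supnorm f \<partial>lborel)"
    by (intro integral_mono laplace_domD[OF d f]) (use laplace_dom_integrable laplace_integrable[OF f] in auto)
  finally show ?thesis by simp
qed

lemma laplace_Bb:
  assumes f: "f \<in> Bb" shows "laplace V m f \<in> Bb"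
proof (rule BbI[OF _ laplace_bound[OF f]])
  have "(\<lambda>(x,t). exp (- m * t) * V t f x) \<in> borel_measurable (borel \<Otimes>\<^sub>M lborel)"
    unfolding measurable_cong_sets[OF sets_pair_measure_cong[OF refl sets_lborel] refl]
    using measurable_compose[OF measurable_pair_swap' laplace_measurable2[OF f]] by (simp add: split_beta')
  from sigma_finite_measure.borel_measurable_lebesgue_integral[OF sigma_finite_lborel this]
  show "laplace V m f \<in> borel_measurable borel" unfolding laplace_def[abs_def] .
qed

lemma laplace_sfun: "sfun (\<lambda>f. laplace V m f x)"
proof (rule sfunI)
  fix f g :: "'a \<Rightarrow> real" assume f: "f \<in> Bb" and g: "g \<in> Bb"
  then show "laplace V m (\<lambda>x. f x + g x) x = laplace V m f x + laplace V m g x"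
    using laplace_integrable[OF f] laplace_integrable[OF g]
    by (simp add: laplace_def sfun_add[OF op_family_sfun[OF V] f g] distrib_left)
next
  fix f :: "'a \<Rightarrow> real" and c assume f: "f \<in> Bb"
  have "(\<lambda>t. exp (- m * t) * V t (\<lambda>x. c * f x) x) = (\<lambda>t. c * (exp (- m * t) * V t f x))"
    by (simp add: sfun_cmult[OF op_family_sfun[OF V] f] mult_ac)
  then show "laplace V m (\<lambda>x. c * f x) x = c * laplace V m f x" by (simp add: laplace_def)
next
  fix F :: "nat \<Rightarrow> 'a \<Rightarrow> real" and f B
  assume F: "\<And>n. F n \<in> Bb" "\<And>n x. \<bar>F n x\<bar> \<le> B" "\<And>x. (\<lambda>n. F n x) \<longlonglongrightarrow> f x" "f \<in> Bb"
  show "(\<lambda>n. laplace V m (F n) x) \<longlonglongrightarrow> laplace V m f x"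
    unfolding laplace_def
  proof (rule integral_dominated_convergence[where w="\<lambda>t. d t * B"])
    show "AE t in lborel. norm (exp (- m * t) * V t (F n) x) \<le> d t * B" for n
    proof (rule AE_I2)
      fix t
      have "d t * supnorm (F n) \<le> d t * B"
        by (intro mult_left_mono supnorm_le F laplace_dom_nonneg)
      then show "norm (exp (- m * t) * V t (F n) x) \<le> d t * B" using laplace_domD[OF d F(1), of t n x] by simp
    qed
    show "AE t in lborel. (\<lambda>n. exp (- m * t) * V t (F n) x) \<longlonglongrightarrow> exp (- m * t) * V t f x"
      by (rule AE_I2) (intro tendsto_mult tendsto_const sfun_lim[OF op_family_sfun[OF V] F(1-3)])
  qed (use laplace_measurable1 F laplace_dom_integrable in auto)
qed (rule laplace_bound)

end

text \<open>Fubini in the two time variables and the shift of \<open>t\<close> by \<open>s\<close>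
  leave the integral of \<open>exp (- m * s) * laplace V m (G s f) x\<close> over \<open>s\<close>.
  Pulling the functional \<open>laplace V m\<close> out of this integral produces the
  composition.\<close>

lemma laplace_op_conv:
  assumes V: "op_family V" and dV: "laplace_dom V m dV" and G: "op_family G" and dG: "laplace_dom G m dG"
    and Vb: "exp_bounded V (\<lambda>_. A) l" and Gb: "exp_bounded G \<kappa> l" and \<kappa>: "integrable lborel \<kappa>"
    and f: "f \<in> Bb"
  shows "laplace (op_conv V G) m f x = laplace V m (laplace G m f) x"
    "integrable lborel (\<lambda>t. exp (- m * t) * op_conv V G t f x)"
proof -
  let ?u = "\<lambda>s t. exp (- m * t) * V (t - s) (G s f) x"
  have GB: "G s f \<in> Bb" for s by (rule op_family_Bb[OF G Gb f])
  have m: "case_prod ?u \<in> borel_measurable (lborel \<Otimes>\<^sub>M lborel)"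
  proof -
    have "(\<lambda>p. ((snd p, x), fst p)) \<in> measurable (borel \<Otimes>\<^sub>M borel) ((borel \<Otimes>\<^sub>M borel) \<Otimes>\<^sub>M borel :: ((real \<times> 'a) \<times> real) measure)" by simp
    from measurable_compose[OF this op_conv_integrand_measurable[OF V Vb G Gb \<kappa> f]]
    have "(\<lambda>p. V (snd p - fst p) (G (fst p) f) x) \<in> borel_measurable (borel \<Otimes>\<^sub>M borel)" by simp
    then have "(\<lambda>p. exp (- m * snd p) * V (snd p - fst p) (G (fst p) f) x) \<in> borel_measurable (borel \<Otimes>\<^sub>M borel)"
      by simp
    then show ?thesis
      unfolding measurable_cong_sets[OF sets_pair_measure_cong[OF sets_lborel sets_lborel] refl] by (simp add: split_beta')
  qed
  have shift: "(\<lambda>t. ?u s (s + 1 * t)) = (\<lambda>t. exp (- m * s) * (exp (- m * t) * V t (G s f) x))" for s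
    by (auto simp: algebra_simps exp_add[symmetric])
  have i1: "integrable lborel (?u s)" for s
    using lborel_integrable_real_affine_iff[of 1 "?u s" s] laplace_integrable[OF V dV GB[of s], of x]
    unfolding shift by simp
  have int_s: "(\<integral>t. ?u s t \<partial>lborel) = exp (- m * s) * laplace V m (G s f) x" for s
    using lborel_integral_real_affine[of 1 "?u s" s] unfolding shift by (simp add: laplace_def)
  have "integrable (lborel \<Otimes>\<^sub>M lborel) (case_prod ?u)"
  proof (rule lborel_pair.Fubini_integrable[OF m])
    show "integrable lborel (\<lambda>s. \<integral>t. norm (case (s, t) of (s, t) \<Rightarrow> ?u s t) \<partial>lborel)"
    proof (rule Bochner_Integration.integrable_bound)
      let ?c = "(\<integral>t. dV t \<partial>lborel) * supnorm f"
      show "integrable lborel (\<lambda>s. ?c * dG s)" using laplace_dom_integrable[OF G dG] by simp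
      have "(\<lambda>s. \<integral>t. norm ((case_prod ?u) (s, t)) \<partial>lborel) \<in> borel_measurable lborel"
        by (rule lborel.borel_measurable_lebesgue_integral) (use m in \<open>simp add: split_beta'\<close>)
      then show "(\<lambda>s. \<integral>t. norm (case (s, t) of (s, t) \<Rightarrow> ?u s t) \<partial>lborel) \<in> borel_measurable lborel" by simp
      show "AE s in lborel. norm (\<integral>t. norm (case (s, t) of (s, t) \<Rightarrow> ?u s t) \<partial>lborel) \<le> norm (?c * dG s)"
      proof (rule AE_I2)
        fix s
        have n1: "supnorm (\<lambda>y. exp (- m * s) * G s f y) \<le> dG s * supnorm f"
          by (rule supnorm_le) (rule laplace_domD[OF dG f])
        have "(\<integral>t. norm (?u s t) \<partial>lborel) = (\<integral>t. norm (?u s (s + 1 * t)) \<partial>lborel)"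
          using lborel_integral_real_affine[of 1 "\<lambda>t. norm (?u s t)" s] by simp
        also have "\<dots> \<le> (\<integral>t. dV t * (dG s * supnorm f) \<partial>lborel)"
        proof (rule integral_mono)
          show "integrable lborel (\<lambda>t. dV t * (dG s * supnorm f))" using laplace_dom_integrable[OF V dV] by simp
          show "integrable lborel (\<lambda>t. norm (?u s (s + 1 * t)))"
            using laplace_integrable[OF V dV GB[of s], of x] unfolding shift[THEN fun_cong] by simp
          fix t
          \<comment> \<open>The factor \<open>exp (- m * s)\<close> is moved inside
            \<open>V t\<close>, so that the majorant of \<open>V\<close> is applied to the damped
            function, and that of \<open>G\<close> to its norm.\<close>
          have "?u s (s + 1 * t) = exp (- m * t) * V t (\<lambda>y. exp (- m * s) * G s f y) x"
            using fun_cong[OF shift[of s], of t] sfun_cmult[OF op_family_sfun[OF V, of t x] GB[of s], of "exp (- m * s)"] by (simp add: mult_ac)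
          then have "norm (?u s (s + 1 * t)) \<le> dV t * supnorm (\<lambda>y. exp (- m * s) * G s f y)"
            using laplace_domD[OF dV Bb_cmult[OF GB[of s], of "exp (- m * s)"], of t x] by simp
          also have "\<dots> \<le> dV t * (dG s * supnorm f)" by (rule mult_left_mono[OF n1 laplace_dom_nonneg[OF V dV]])
          finally show "norm (?u s (s + 1 * t)) \<le> dV t * (dG s * supnorm f)" .
        qed
        also have "\<dots> = ?c * dG s" by (simp add: mult_ac)
        finally show "norm (\<integral>t. norm (case (s, t) of (s, t) \<Rightarrow> ?u s t) \<partial>lborel) \<le> norm (?c * dG s)"
          by (auto simp: abs_of_nonneg intro: order_trans[OF _ abs_ge_self])
      qed
    qed
    show "AE s in lborel. integrable lborel (\<lambda>t. case (s, t) of (s, t) \<Rightarrow> ?u s t)" using i1 by simp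
  qed
  note ui = this
  have "laplace (op_conv V G) m f x = (\<integral>t. (\<integral>s. ?u s t \<partial>lborel) \<partial>lborel)" by (simp add: laplace_def op_conv_def)
  also have "\<dots> = (\<integral>s. (\<integral>t. ?u s t \<partial>lborel) \<partial>lborel)" by (rule lborel_pair.Fubini_integral[OF ui])
  also have "\<dots> = (\<integral>s. laplace V m (\<lambda>y. exp (- m * s) * G s f y) x \<partial>lborel)"
    unfolding int_s by (simp add: sfun_cmult[OF laplace_sfun[OF V dV] GB])
  also have "\<dots> = laplace V m (\<lambda>y. \<integral>s. exp (- m * s) * G s f y \<partial>lborel) x"
  proof (rule sfun_Fubini(3)[OF laplace_sfun[OF V dV], symmetric])
    show "integrable lborel (\<lambda>s. dG s * supnorm f)" using laplace_dom_integrable[OF G dG] by simp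
  qed (use laplace_measurable2[OF G dG f] laplace_domD[OF dG f] in auto)
  finally show "laplace (op_conv V G) m f x = laplace V m (laplace G m f) x" by (simp add: laplace_def[abs_def])
  have "integrable lborel (\<lambda>t. \<integral>s. ?u s t \<partial>lborel)" by (rule lborel_pair.integrable_snd[OF ui])
  then show "integrable lborel (\<lambda>t. exp (- m * t) * op_conv V G t f x)" by (simp add: op_conv_def)
qed

section \<open>Full generator and resolvent\<close>

definition gen_rel :: "(real \<Rightarrow> ('a::euclidean_space \<Rightarrow> real) \<Rightarrow> 'a \<Rightarrow> real) \<Rightarrow> ('a \<Rightarrow> real) \<Rightarrow> ('a \<Rightarrow> real) \<Rightarrow> bool" where
  "gen_rel V f g \<longleftrightarrow> (\<forall>t>0. \<forall>x. V t f x - f x = (\<integral>s. indicator {..t} s * V s g x \<partial>lborel))"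

text \<open>One direction averages the defining identity with the weight
  \<open>m * exp (- m * s)\<close>. For the other, put \<open>h = m f - g\<close>: the semigroup law
  turns the Laplace representation of \<open>f\<close> into a formula for \<open>V s f\<close>,
  which is then integrated against the derivative of \<open>exp (m * s)\<close>.\<close>

lemma gen_rel_resolvent:
  assumes V: "op_family V" and Vb: "exp_bounded V (\<lambda>_. A) l" and l: "l < m" and m: "0 < m"
    and sg: "\<And>t s f. 0 < t \<Longrightarrow> 0 < s \<Longrightarrow> f \<in> Bb \<Longrightarrow> V (t + s) f = V t (V s f)"
    and f: "f \<in> Bb" and g: "g \<in> Bb"
  shows "gen_rel V f g \<longleftrightarrow> (\<forall>x. f x = laplace V m (\<lambda>y. m * f y - g y) x)"
proof
  note d = laplace_dom_const[OF V Vb l]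
  assume gr: "gen_rel V f g"
  show "\<forall>x. f x = laplace V m (\<lambda>y. m * f y - g y) x"
  proof
    fix x
    let ?e = "\<lambda>s. m * exp (- m * s) * indicator {0..} s"
    have e: "integrable lborel ?e" "(\<integral>s. ?e s \<partial>lborel) = 1"
      using has_bochner_integral_exp_tail[OF m, of 0] by (auto simp: has_bochner_integral_iff)
    have "(\<integral>s. m * exp (- m * s) * (\<integral>q. indicator {..s} q * V q g x \<partial>lborel) \<partial>lborel)
        = (\<integral>q. V q g x * exp (- m * q) \<partial>lborel)"
    proof (rule triangle_Fubini)
      show "(\<lambda>q. V q g x) \<in> borel_measurable lborel"
        using measurable_Pair1[OF op_family_measurable[OF V g], of x] by (simp add: split_beta')
      show "integrable lborel (\<lambda>q. V q g x * exp (- m * q))"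
        using laplace_integrable[OF V d g, of x] by (simp add: mult.commute)
    qed (use m has_bochner_integral_exp_tail[OF m] in auto)
    also have "\<dots> = laplace V m g x" by (simp add: laplace_def mult.commute)
    finally have "laplace V m g x = (\<integral>s. m * exp (- m * s) * (\<integral>q. indicator {..s} q * V q g x \<partial>lborel) \<partial>lborel)" by simp
    also have "\<dots> = (\<integral>s. m * (exp (- m * s) * V s f x) - ?e s * f x \<partial>lborel)"
    proof (rule integral_cong_AE)
      show "(\<lambda>s. m * (exp (- m * s) * V s f x) - ?e s * f x) \<in> borel_measurable lborel"
        using laplace_measurable1[OF V d f] by simp
      have "(\<lambda>p. indicator {..fst p} (snd p) * V (snd p) g x) \<in> borel_measurable (lborel \<Otimes>\<^sub>M lborel)"
      proof -
        have [measurable]: "(\<lambda>q. V q g x) \<in> borel_measurable borel"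
          using measurable_Pair1[OF op_family_measurable[OF V g], of x] by (simp add: split_beta')
        have "(\<lambda>p. (if snd p \<le> fst p then 1 else 0) * V (snd p) g x) \<in> borel_measurable (lborel \<Otimes>\<^sub>M lborel)" by measurable
        then show ?thesis by (simp add: indicator_def)
      qed
      then have "(\<lambda>s. \<integral>q. indicator {..s} q * V q g x \<partial>lborel) \<in> borel_measurable lborel"
        by (intro lborel.borel_measurable_lebesgue_integral) (simp add: split_beta')
      then show "(\<lambda>s. m * exp (- m * s) * (\<integral>q. indicator {..s} q * V q g x \<partial>lborel)) \<in> borel_measurable lborel" by simp
      \<comment> \<open>At \<open>s = 0\<close> the extended family gives 0 instead of
        \<open>f x\<close>, so the identity is claimed off this null set only.\<close>
      have "m * exp (- m * s) * (\<integral>q. indicator {..s} q * V q g x \<partial>lborel) = m * (exp (- m * s) * V s f x) - ?e s * f x"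
        if "s \<noteq> 0" for s
      proof (cases "0 < s")
        case True then show ?thesis using gr unfolding gen_rel_def by (simp add: algebra_simps flip: gr[unfolded gen_rel_def, rule_format])
      next
        case False
        then have "indicator {..s} q * V q g x = 0" for q using op_family_nonpos[OF V _ g, of q] by (auto simp: indicator_def)
        then have "(\<integral>q. indicator {..s} q * V q g x \<partial>lborel) = 0" by (simp only: integral_zero)
        then show ?thesis using False that op_family_nonpos[OF V _ f, of s] by simp
      qed
      then show "AE s in lborel. m * exp (- m * s) * (\<integral>q. indicator {..s} q * V q g x \<partial>lborel) = m * (exp (- m * s) * V s f x) - ?e s * f x"
        by (rule AE_lborel_neqI)
    qed
    also have "\<dots> = m * laplace V m f x - f x"
      using laplace_integrable[OF V d f, of x] e by (simp add: laplace_def)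
    finally show "f x = laplace V m (\<lambda>y. m * f y - g y) x"
      by (simp add: sfun_diff[OF laplace_sfun[OF V d] Bb_cmult[OF f] g] sfun_cmult[OF laplace_sfun[OF V d] f])
  qed
next
  note d = laplace_dom_const[OF V Vb l]
  assume res: "\<forall>x. f x = laplace V m (\<lambda>y. m * f y - g y) x"
  define h where "h = (\<lambda>y. m * f y - g y)"
  have h: "h \<in> Bb" unfolding h_def by (intro Bb_diff Bb_cmult f g)
  have fh: "f x = laplace V m h x" for x using res unfolding h_def by blast
  show "gen_rel V f g" unfolding gen_rel_def
  proof (intro allI impI)
    fix t :: real and x assume t: "0 < t"
    have hi: "integrable lborel (\<lambda>q. exp (- m * q) * V q h x)" by (rule laplace_integrable[OF V d h])
    have hi': "integrable lborel (\<lambda>q. indicator {..s} q * (exp (- m * q) * V q h x))" for s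
      by (rule Bochner_Integration.integrable_bound[OF hi]) (use hi in \<open>auto simp: indicator_def\<close>)
    \<comment> \<open>\<open>V s\<close> shifts the Laplace integral that represents
      \<open>f\<close>: what remains is \<open>exp (m * s)\<close> times its part over
      \<open>q > s\<close>.\<close>
    have Vsf: "V s f x = exp (m * s) * (f x - (\<integral>q. indicator {..s} q * (exp (- m * q) * V q h x) \<partial>lborel))" if s: "0 < s" for s
    proof -
      have "f = (\<lambda>y. \<integral>q. exp (- m * q) * V q h y \<partial>lborel)" using fh by (auto simp: laplace_def)
      then have "V s f x = V s (\<lambda>y. \<integral>q. exp (- m * q) * V q h y \<partial>lborel) x" by simp
      also have "\<dots> = (\<integral>q. V s (\<lambda>y. exp (- m * q) * V q h y) x \<partial>lborel)"
      proof (rule sfun_Fubini(3)[OF op_family_sfun[OF V]])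
        show "(\<lambda>(q,y). exp (- m * q) * V q h y) \<in> borel_measurable (borel \<Otimes>\<^sub>M borel)" by (rule laplace_measurable2[OF V d h])
        show "\<bar>exp (- m * q) * V q h y\<bar> \<le> (A / (m - l) * ((m - l) * exp (- (m - l) * q) * indicator {0..} q)) * supnorm h" for q y
          by (rule laplace_domD[OF d h])
        show "integrable lborel (\<lambda>q. (A / (m - l) * ((m - l) * exp (- (m - l) * q) * indicator {0..} q)) * supnorm h)"
          using laplace_dom_integrable[OF V d] by simp
      qed
      also have "\<dots> = (\<integral>q. exp (m * s) * (exp (- m * (s + 1 * q)) * V (s + 1 * q) h x * indicator {s<..} (s + 1 * q)) \<partial>lborel)"
      proof (intro Bochner_Integration.integral_cong refl)
        fix q
        have "V s (\<lambda>y. exp (- m * q) * V q h y) x = exp (- m * q) * V s (V q h) x"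
          by (rule sfun_cmult[OF op_family_sfun[OF V] op_family_Bb[OF V Vb h]])
        also have "\<dots> = exp (- m * q) * (V (s + q) h x * indicator {s<..} (s + q))"
        proof (cases "0 < q")
          case True then show ?thesis using sg[OF s True h] by simp
        next
          case False then show ?thesis using op_family_nonpos_ext[OF V _ h, of q] op_family_zero[OF V] by simp
        qed
        finally have *: "V s (\<lambda>y. exp (- m * q) * V q h y) x = exp (- m * q) * (V (s + q) h x * indicator {s<..} (s + q))" .
        have e: "exp (- m * q) = exp (m * s) * exp (- m * (s + q))" by (simp add: exp_add[symmetric] algebra_simps)
        show "V s (\<lambda>y. exp (- m * q) * V q h y) x = exp (m * s) * (exp (- m * (s + 1 * q)) * V (s + 1 * q) h x * indicator {s<..} (s + 1 * q))"
          by (subst *, subst e) simp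
      qed
      also have "\<dots> = exp (m * s) * (\<integral>q. exp (- m * (s + 1 * q)) * V (s + 1 * q) h x * indicator {s<..} (s + 1 * q) \<partial>lborel)" by simp
      also have "(\<integral>q. exp (- m * (s + 1 * q)) * V (s + 1 * q) h x * indicator {s<..} (s + 1 * q) \<partial>lborel)
          = (\<integral>q. exp (- m * q) * V q h x * indicator {s<..} q \<partial>lborel)"
        using lborel_integral_real_affine[of 1 "\<lambda>q. exp (- m * q) * V q h x * indicator {s<..} q" s] by simp
      also have "\<dots> = (\<integral>q. exp (- m * q) * V q h x - indicator {..s} q * (exp (- m * q) * V q h x) \<partial>lborel)"
        by (intro Bochner_Integration.integral_cong) (auto simp: indicator_def)
      also have "\<dots> = f x - (\<integral>q. indicator {..s} q * (exp (- m * q) * V q h x) \<partial>lborel)"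
        using hi hi' fh by (simp add: laplace_def)
      finally show ?thesis .
    qed
    \<comment> \<open>The weight is the derivative of \<open>exp (m * s)\<close> on
      \<open>[0, t]\<close>, so its tail \<open>?W\<close> is explicit; \<open>max 0 q\<close>
      appears because the weight starts at 0.\<close>
    let ?w = "\<lambda>s. m * exp (m * s) * indicator {0..t} s"
    let ?a = "\<lambda>q. exp (- m * q) * V q h x"
    let ?W = "\<lambda>q. (exp (m * t) - exp (m * max 0 q)) * indicator {..t} q"
    have FTC: "has_bochner_integral lborel (\<lambda>s. m * exp (m * s) * indicator {a..t} s) (exp (m * t) - exp (m * a))" if "a \<le> t" for a
      by (rule has_bochner_integral_FTC_Icc_real[OF that]) (auto intro!: derivative_eq_intros continuous_intros)
    have W: "has_bochner_integral lborel (\<lambda>s. ?w s * indicator {q..} s) (?W q)" for q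
    proof (cases "q \<le> t")
      case True
      have "(\<lambda>s. ?w s * indicator {q..} s) = (\<lambda>s. m * exp (m * s) * indicator {max 0 q..t} s)" by (auto simp: indicator_def)
      then show ?thesis using FTC[of "max 0 q"] True t by simp
    next
      case False
      then have "(\<lambda>s. ?w s * indicator {q..} s) = (\<lambda>s. 0)" by (auto simp: indicator_def)
      then show ?thesis using False has_bochner_integral_zero[of lborel] by simp
    qed
    have aW: "?a q * ?W q = exp (m * t) * (indicator {..t} q * ?a q) - indicator {..t} q * V q h x" for q
    proof (cases "0 < q")
      case True
      then show ?thesis by (auto simp: indicator_def algebra_simps exp_add[symmetric] exp_minus)
    qed (use op_family_nonpos[OF V _ h, of q] in auto)
    have Vi: "integrable lborel (\<lambda>q. indicator {..t} q * V q k x)" if k: "k \<in> Bb" for k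
    proof (rule Bochner_Integration.integrable_bound)
      show "integrable lborel (\<lambda>q. exp (m * t) * (exp (- m * q) * V q k x))" using laplace_integrable[OF V d k, of x] by simp
      have [measurable]: "(\<lambda>q. V q k x) \<in> borel_measurable lborel"
        using measurable_Pair1[OF op_family_measurable[OF V k], of x] by (simp add: split_beta')
      show "(\<lambda>q. indicator {..t} q * V q k x) \<in> borel_measurable lborel" by measurable
      show "AE q in lborel. norm (indicator {..t} q * V q k x) \<le> norm (exp (m * t) * (exp (- m * q) * V q k x))"
      proof (rule AE_I2)
        fix q
        have "indicator {..t} q * \<bar>V q k x\<bar> \<le> (exp (m * t) * exp (- m * q)) * \<bar>V q k x\<bar>"
          using m by (intro mult_right_mono) (auto simp: indicator_def exp_add[symmetric] one_le_exp_iff mult_left_mono)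
        then show "norm (indicator {..t} q * V q k x) \<le> norm (exp (m * t) * (exp (- m * q) * V q k x))"
          by (simp add: abs_mult mult.assoc)
      qed
    qed
    have Vg: "V s g x = m * V s f x - V s h x" for s
    proof -
      have "g = (\<lambda>y. m * f y - h y)" by (auto simp: h_def)
      then have "V s g x = V s (\<lambda>y. m * f y - h y) x" by simp
      then show ?thesis by (simp add: sfun_diff[OF op_family_sfun[OF V] Bb_cmult[OF f] h] sfun_cmult[OF op_family_sfun[OF V] f])
    qed
    have "(\<integral>s. ?w s * (\<integral>q. indicator {..s} q * ?a q \<partial>lborel) \<partial>lborel) = (\<integral>q. ?a q * ?W q \<partial>lborel)"
    proof (rule triangle_Fubini[OF _ _ _ W])
      show "?a \<in> borel_measurable lborel" by (rule laplace_measurable1[OF V d h])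
      show "integrable lborel (\<lambda>q. ?a q * ?W q)" unfolding aW using hi' Vi[OF h] by simp
    qed (use m in auto)
    also have "\<dots> = exp (m * t) * (\<integral>q. indicator {..t} q * ?a q \<partial>lborel) - (\<integral>q. indicator {..t} q * V q h x \<partial>lborel)"
      unfolding aW using hi' Vi[OF h] by simp
    finally have tri: "(\<integral>s. ?w s * (\<integral>q. indicator {..s} q * ?a q \<partial>lborel) \<partial>lborel)
      = exp (m * t) * (\<integral>q. indicator {..t} q * ?a q \<partial>lborel) - (\<integral>q. indicator {..t} q * V q h x \<partial>lborel)" .
    have pw: "m * (indicator {..t} s * V s f x) = ?w s * f x - ?w s * (\<integral>q. indicator {..s} q * ?a q \<partial>lborel)" if "s \<noteq> 0" for s
    proof (cases "0 < s")
      case True then show ?thesis by (auto simp: Vsf indicator_def algebra_simps)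
    next
      case False then show ?thesis using that op_family_nonpos[OF V _ f, of s] by simp
    qed
    have wi: "integrable lborel ?w" "(\<integral>s. ?w s \<partial>lborel) = exp (m * t) - 1"
      using FTC[of 0] t by (auto simp: has_bochner_integral_iff)
    let ?y = "\<lambda>s. ?w s * (\<integral>q. indicator {..s} q * ?a q \<partial>lborel)"
    have yi: "integrable lborel ?y"
    proof (subst integrable_cong_AE)
      show "integrable lborel (\<lambda>s. ?w s * f x - m * (indicator {..t} s * V s f x))" using wi Vi[OF f] by simp
      show "AE s in lborel. ?y s = ?w s * f x - m * (indicator {..t} s * V s f x)"
        by (rule AE_lborel_neqI[of 0]) (simp add: pw)
      show "(\<lambda>s. ?w s * f x - m * (indicator {..t} s * V s f x)) \<in> borel_measurable lborel"
        using wi Vi[OF f] by (intro borel_measurable_diff borel_measurable_times borel_measurable_integrable) auto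
      have [measurable]: "?a \<in> borel_measurable borel" using laplace_measurable1[OF V d h, of x] by simp
      have "(\<lambda>p. (if snd p \<le> fst p then 1 else 0) * ?a (snd p)) \<in> borel_measurable (lborel \<Otimes>\<^sub>M lborel)" by measurable
      then have "(\<lambda>(s,q). indicator {..s} q * ?a q) \<in> borel_measurable (lborel \<Otimes>\<^sub>M lborel)" by (simp add: indicator_def of_bool_def split_beta')
      then have "(\<lambda>s. \<integral>q. indicator {..s} q * ?a q \<partial>lborel) \<in> borel_measurable lborel"
        by (rule lborel.borel_measurable_lebesgue_integral)
      then show "?y \<in> borel_measurable lborel" by simp
    qed
    have "(\<integral>s. m * (indicator {..t} s * V s f x) \<partial>lborel) = (\<integral>s. ?w s * f x - ?y s \<partial>lborel)"
    proof (rule integral_cong_AE)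
      show "AE s in lborel. m * (indicator {..t} s * V s f x) = ?w s * f x - ?y s"
        by (rule AE_lborel_neqI[of 0]) (simp add: pw)
    qed (use wi yi Vi[OF f] in \<open>auto intro!: borel_measurable_diff borel_measurable_times dest: borel_measurable_integrable\<close>)
    also have "\<dots> = (exp (m * t) - 1) * f x - (\<integral>s. ?y s \<partial>lborel)"
      using wi yi by simp
    finally have 1: "m * (\<integral>s. indicator {..t} s * V s f x \<partial>lborel) = (exp (m * t) - 1) * f x - (\<integral>s. ?y s \<partial>lborel)"
      by simp
    have "(\<integral>s. indicator {..t} s * V s g x \<partial>lborel) = (\<integral>s. m * (indicator {..t} s * V s f x) - indicator {..t} s * V s h x \<partial>lborel)"
      by (intro Bochner_Integration.integral_cong) (auto simp: Vg algebra_simps)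
    also have "\<dots> = m * (\<integral>s. indicator {..t} s * V s f x \<partial>lborel) - (\<integral>s. indicator {..t} s * V s h x \<partial>lborel)"
      using Vi[OF f] Vi[OF h] by simp
    also have "\<dots> = exp (m * t) * (f x - (\<integral>q. indicator {..t} q * ?a q \<partial>lborel)) - f x"
      unfolding 1 tri by (simp add: algebra_simps)
    also have "\<dots> = V t f x - f x" using Vsf[OF t] by simp
    finally show "V t f x - f x = (\<integral>s. indicator {..t} s * V s g x \<partial>lborel)" by simp
  qed
qed

section \<open>The perturbed semigroup\<close>

text \<open>Dominated convergence and Tannery's theorem are applied to sequences; this makes them
  available for decay at infinity.\<close>

lemma at_infinity_0_iff_seq:
  fixes h :: "'a::real_normed_vector \<Rightarrow> real"
  shows "(h \<longlongrightarrow> 0) at_infinity \<longleftrightarrow> (\<forall>xs. filterlim xs at_infinity sequentially \<longrightarrow> (\<lambda>n. h (xs n)) \<longlonglongrightarrow> 0)"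
proof
  assume "(h \<longlongrightarrow> 0) at_infinity"
  then show "\<forall>xs. filterlim xs at_infinity sequentially \<longrightarrow> (\<lambda>n. h (xs n)) \<longlonglongrightarrow> 0"
    by (auto intro: filterlim_compose)
next
  assume *: "\<forall>xs. filterlim xs at_infinity sequentially \<longrightarrow> (\<lambda>n. h (xs n)) \<longlonglongrightarrow> 0"
  show "(h \<longlongrightarrow> 0) at_infinity"
  proof (rule ccontr)
    assume "\<not> (h \<longlongrightarrow> 0) at_infinity"
    then obtain e where e: "e > 0" "\<not> eventually (\<lambda>x. dist (h x) 0 < e) at_infinity" unfolding tendsto_iff by auto
    then have "\<forall>n::nat. \<exists>x. real n \<le> norm x \<and> \<not> dist (h x) 0 < e" unfolding eventually_at_infinity by auto
    then obtain xs where xs: "\<And>n. real n \<le> norm (xs n) \<and> \<not> dist (h (xs n)) 0 < e" by metis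
    have "filterlim xs at_infinity sequentially"
      unfolding filterlim_at_infinity_conv_norm_at_top
      by (rule filterlim_at_top_mono[OF filterlim_real_sequentially]) (use xs in auto)
    then have "(\<lambda>n. h (xs n)) \<longlonglongrightarrow> 0" using * by blast
    then have "eventually (\<lambda>n. dist (h (xs n)) 0 < e) sequentially" using e(1) by (rule tendstoD)
    then show False using xs by (auto simp: eventually_sequentially)
  qed
qed

section \<open>Short times, continuity and decay of the perturbed family\<close>

context dyson
begin

text \<open>The difference is the convolution of \<open>S\<close> with \<open>G\<close>, whose
  integrand lives on \<open>0 < s < t\<close>. The bound is independent of \<open>x\<close> and
  small for short times.\<close>

lemma S_short_time:
  assumes f: "f \<in> Bb"
  shows "\<bar>S t f x - T t f x\<bar> \<le> 2 * A * exp (l * t) * supnorm f * (\<integral>s. \<kappa> s * indicator {0<..<t} s \<partial>lborel)"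
proof -
  let ?c = "2 * A * exp (l * t) * supnorm f"
  have i: "integrable lborel (\<lambda>s. \<kappa> s * indicator {0<..<t} s)"
    by (rule Bochner_Integration.integrable_bound[OF \<kappa>]) (use \<kappa> in \<open>auto simp: indicator_def\<close>)
  have "\<bar>S t f x - T t f x\<bar> = \<bar>\<integral>s. S (t - s) (G s f) x \<partial>lborel\<bar>" by (simp add: S_eq[OF f] op_conv_def)
  also have "\<dots> \<le> (\<integral>s. \<bar>S (t - s) (G s f) x\<bar> \<partial>lborel)" by (rule integral_abs_bound)
  also have "\<dots> \<le> (\<integral>s. ?c * (\<kappa> s * indicator {0<..<t} s) \<partial>lborel)"
  proof (rule integral_mono)
    show "integrable lborel (\<lambda>s. \<bar>S (t - s) (G s f) x\<bar>)"
      using op_conv_integrable[OF S_op_family S_exp_bounded G Gb \<kappa> f] by simp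
    show "integrable lborel (\<lambda>s. ?c * (\<kappa> s * indicator {0<..<t} s))" using i by simp
    fix s
    consider "s \<le> 0" | "t \<le> s" | "s \<in> {0<..<t}" by force
    then show "\<bar>S (t - s) (G s f) x\<bar> \<le> ?c * (\<kappa> s * indicator {0<..<t} s)"
    proof cases
      case 1 then show ?thesis using op_family_nonpos_ext[OF G 1 f] op_family_zero[OF S_op_family] by simp
    next
      case 2 then show ?thesis using op_family_nonpos[OF S_op_family _ G_Bb[OF f]] by simp
    next
      case 3 then show ?thesis using op_conv_integrand_bound[OF S_exp_bounded G Gb f, of t s x] by (simp add: mult_ac)
    qed
  qed
  finally show ?thesis by simp
qed

lemma kappa_short_time: "((\<lambda>t. \<integral>s. \<kappa> s * indicator {0<..<t} s \<partial>lborel) \<longlongrightarrow> 0) (at_right 0)"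
proof (subst tendsto_at_iff_sequentially, intro allI impI)
  fix X :: "nat \<Rightarrow> real" assume X: "\<forall>i. X i \<in> {0<..} - {0}" "X \<longlonglongrightarrow> 0"
  have "(\<lambda>n. \<integral>s. \<kappa> s * indicator {0<..<X n} s \<partial>lborel) \<longlonglongrightarrow> (\<integral>s. 0 \<partial>(lborel :: real measure))"
  proof (rule integral_dominated_convergence[where w="\<lambda>s. \<bar>\<kappa> s\<bar>"])
    show "AE s in lborel. (\<lambda>n. \<kappa> s * indicator {0<..<X n} s) \<longlonglongrightarrow> 0"
    proof (rule AE_I2)
      fix s
      have "eventually (\<lambda>n. \<kappa> s * indicator {0<..<X n} s = 0) sequentially"
      proof (cases "0 < s")
        case True
        have "eventually (\<lambda>n. X n < s) sequentially" using order_tendstoD(2)[OF X(2) True] .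
        then show ?thesis by eventually_elim simp
      qed simp
      then show "(\<lambda>n. \<kappa> s * indicator {0<..<X n} s) \<longlonglongrightarrow> 0" by (rule tendsto_eventually)
    qed
    show "integrable lborel (\<lambda>s. \<bar>\<kappa> s\<bar>)" using \<kappa> by simp
    show "AE s in lborel. norm (\<kappa> s * indicator {0<..<X n} s) \<le> \<bar>\<kappa> s\<bar>" for n by (auto simp: indicator_def)
  qed (use \<kappa> in auto)
  then show "((\<lambda>t. \<integral>s. \<kappa> s * indicator {0<..<t} s \<partial>lborel) \<circ> X) \<longlonglongrightarrow> 0" by (simp add: comp_def)
qed

text \<open>Convergence is uniform in space for every bounded Borel function, so pointwise
  continuity and norm continuity at time 0 both pass from \<open>T\<close> to
  \<open>S\<close>.\<close>

lemma S_uniform_short_time: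
  assumes f: "f \<in> Bb"
  shows "((\<lambda>t. supnorm (\<lambda>x. S t f x - T t f x)) \<longlongrightarrow> 0) (at_right 0)"
proof (rule tendsto_sandwich[OF always_eventually always_eventually])
  show "\<forall>t. 0 \<le> supnorm (\<lambda>x. S t f x - T t f x)"
    by (intro allI supnorm_nonneg Bb_diff S_Bb T_Bb f)
  show "\<forall>t. supnorm (\<lambda>x. S t f x - T t f x) \<le> 2 * A * exp (l * t) * supnorm f * (\<integral>s. \<kappa> s * indicator {0<..<t} s \<partial>lborel)"
    by (intro allI supnorm_le S_short_time f)
  have "((\<lambda>t. 2 * A * exp (l * t) * supnorm f * (\<integral>s. \<kappa> s * indicator {0<..<t} s \<partial>lborel)) \<longlongrightarrow> 2 * A * exp (l * 0) * supnorm f * 0) (at_right 0)"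
    by (intro tendsto_intros kappa_short_time)
  then show "((\<lambda>t. 2 * A * exp (l * t) * supnorm f * (\<integral>s. \<kappa> s * indicator {0<..<t} s \<partial>lborel)) \<longlongrightarrow> 0) (at_right 0)" by simp
qed simp

text \<open>The factor \<open>\<delta>\<close> covers continuity at \<open>x\<close> (\<open>\<delta> = 1\<close>) and vanishing at infinity (\<open>\<delta> = 0\<close>) at once.\<close>

lemma Sn_seq_limit:
  assumes \<Phi>: "\<Phi> \<subseteq> Bb" and G\<Phi>: "\<And>s f. f \<in> \<Phi> \<Longrightarrow> G s f \<in> \<Phi>"
    and Tlim: "\<And>t f. f \<in> \<Phi> \<Longrightarrow> (\<lambda>n. T t f (xs n)) \<longlonglongrightarrow> \<delta> * T t f x"
    and f: "f \<in> \<Phi>"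
  shows "(\<lambda>n. Sn k t f (xs n)) \<longlonglongrightarrow> \<delta> * Sn k t f x"
  using f
proof (induction k arbitrary: t f)
  case (Suc k)
  have f: "f \<in> Bb" using Suc.prems \<Phi> by auto
  note mm = op_conv_integrand_measurable1[OF Sn_op_family Sn_exp_bounded G Gb \<kappa> f, of k t]
  have "(\<lambda>n. \<integral>s. Sn k (t - s) (G s f) (xs n) \<partial>lborel) \<longlonglongrightarrow> (\<integral>s. \<delta> * Sn k (t - s) (G s f) x \<partial>lborel)"
  proof (rule integral_dominated_convergence[where w="\<lambda>s. A / 2 ^ k * exp (l * t) * supnorm f * \<kappa> s"])
    show "AE s in lborel. norm (Sn k (t - s) (G s f) (xs n)) \<le> A / 2 ^ k * exp (l * t) * supnorm f * \<kappa> s" for n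
      using op_conv_integrand_bound[OF Sn_exp_bounded G Gb f] by simp
    show "AE s in lborel. (\<lambda>n. Sn k (t - s) (G s f) (xs n)) \<longlonglongrightarrow> \<delta> * Sn k (t - s) (G s f) x"
      using Suc.IH[OF G\<Phi>[OF Suc.prems]] by simp
  qed (use mm \<kappa> in auto)
  then show ?case by (simp add: op_conv_def)
qed (use Tlim in simp)

lemma S_seq_limit:
  assumes \<Phi>: "\<Phi> \<subseteq> Bb" and G\<Phi>: "\<And>s f. f \<in> \<Phi> \<Longrightarrow> G s f \<in> \<Phi>"
    and Tlim: "\<And>t f. f \<in> \<Phi> \<Longrightarrow> (\<lambda>n. T t f (xs n)) \<longlonglongrightarrow> \<delta> * T t f x"
    and f: "f \<in> \<Phi>"
  shows "(\<lambda>n. S t f (xs n)) \<longlonglongrightarrow> \<delta> * S t f x"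
proof -
  have fB: "f \<in> Bb" using f \<Phi> by auto
  have "((\<lambda>n. \<Sum>k. Sn k t f (xs n)) \<longlonglongrightarrow> (\<Sum>k. \<delta> * Sn k t f x))"
    by (rule tannerys_theorem[THEN conjunct2, THEN conjunct2, OF _ _ geometric_summable[of "A * exp (l * t) * supnorm f"]])
       (use Sn_bound[OF fB] in \<open>auto intro!: Sn_seq_limit[OF assms] always_eventually\<close>)
  then show ?thesis by (simp add: S_def suminf_mult[OF Sn_summable[OF fB]])
qed

text \<open>\<open>G s f\<close> may be merely Borel, so the class in \<open>S_seq_limit\<close> has
  to be all of \<open>Bb\<close>; the continuity of every \<open>T t f\<close> with \<open>f\<close>
  in \<open>Bb\<close> is what makes this class admissible.\<close>

lemma S_continuous:
  assumes "\<And>t f. f \<in> Bb \<Longrightarrow> continuous_on UNIV (T t f)" and f: "f \<in> Bb"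
  shows "continuous_on UNIV (S t f)"
  unfolding continuous_on_sequentially
proof (intro allI ballI impI)
  fix xs :: "nat \<Rightarrow> 'a" and x assume "(\<forall>n. xs n \<in> UNIV) \<and> xs \<longlonglongrightarrow> x"
  then have xs: "xs \<longlonglongrightarrow> x" by blast
  have "(\<lambda>n. T t f (xs n)) \<longlonglongrightarrow> 1 * T t f x" if "f \<in> Bb" for t f
    using continuous_on_tendsto_compose[OF assms(1)[OF that] xs] by simp
  from S_seq_limit[OF order_refl G_Bb this f] show "(S t f \<circ> xs) \<longlonglongrightarrow> S t f x" by (simp add: comp_def)
qed

lemma S_vanishes:
  assumes Tv: "\<And>t f. f \<in> Bb \<Longrightarrow> (f \<longlongrightarrow> 0) at_infinity \<Longrightarrow> (T t f \<longlongrightarrow> 0) at_infinity"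
    and Gv: "\<And>t f. f \<in> Bb \<Longrightarrow> (f \<longlongrightarrow> 0) at_infinity \<Longrightarrow> (G t f \<longlongrightarrow> 0) at_infinity"
    and f: "f \<in> Bb" "(f \<longlongrightarrow> 0) at_infinity"
  shows "(S t f \<longlongrightarrow> 0) at_infinity"
  unfolding at_infinity_0_iff_seq
proof (intro allI impI)
  fix xs :: "nat \<Rightarrow> 'a" assume xs: "filterlim xs at_infinity sequentially"
  let ?\<Phi> = "{f \<in> Bb. (f \<longlongrightarrow> 0) at_infinity}"
  \<comment> \<open>With the factor 0 the reference point is irrelevant, hence
    \<open>undefined\<close>.\<close>
  have "(\<lambda>n. S t f (xs n)) \<longlonglongrightarrow> 0 * S t f undefined"
  proof (rule S_seq_limit[of ?\<Phi>])
    show "(\<lambda>n. T t f (xs n)) \<longlonglongrightarrow> 0 * T t f undefined" if "f \<in> ?\<Phi>" for t f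
      using filterlim_compose[OF Tv xs] that by simp
  qed (use Gv G_Bb f in auto)
  then show "(\<lambda>n. S t f (xs n)) \<longlonglongrightarrow> 0" by simp
qed

end

section \<open>Semigroup law and generator of the perturbed family\<close>

locale dyson_semigroup = dyson +
  assumes T_sg: "\<And>t s f. 0 < t \<Longrightarrow> 0 < s \<Longrightarrow> f \<in> Bb \<Longrightarrow> T (t + s) f = T t (T s f)"
    and G_sg: "\<And>t s f. 0 < t \<Longrightarrow> 0 < s \<Longrightarrow> f \<in> Bb \<Longrightarrow> G (t + s) f = G t (T s f)"
begin

text \<open>The Volterra integral is cut at \<open>r = s\<close>. Beyond \<open>s\<close> the law
  \<open>G r f = G (r - s) (T s f)\<close> turns it into the Volterra integral for
  \<open>T s f\<close>, which combines with \<open>T t (T s f)\<close> to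
  \<open>S t (T s f)\<close>.\<close>

lemma S_T_split:
  assumes t: "0 < t" and s: "0 < s" and f: "f \<in> Bb"
  shows "S (t + s) f x = S t (T s f) x + (\<integral>r. indicator {..s} r * S (t + s - r) (G r f) x \<partial>lborel)"
    and "integrable lborel (\<lambda>r. indicator {..s} r * S (t + s - r) (G r f) x)"
proof -
  note int = op_conv_integrable[OF S_op_family S_exp_bounded G Gb \<kappa>]
  have i1: "integrable lborel (\<lambda>r. S (t + s - r) (G r f) x)" by (rule int[OF f])
  have i2: "integrable lborel (\<lambda>r. indicator {..s} r * S (t + s - r) (G r f) x)"
    by (rule Bochner_Integration.integrable_bound[OF i1]) (use i1 in \<open>auto simp: indicator_def\<close>)
  have i3: "integrable lborel (\<lambda>r. indicator {s<..} r * S (t + s - r) (G r f) x)"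
    by (rule Bochner_Integration.integrable_bound[OF i1]) (use i1 in \<open>auto simp: indicator_def\<close>)
  have "op_conv S G (t + s) f x = (\<integral>r. indicator {..s} r * S (t + s - r) (G r f) x + indicator {s<..} r * S (t + s - r) (G r f) x \<partial>lborel)"
    unfolding op_conv_def by (intro Bochner_Integration.integral_cong) (auto simp: indicator_def)
  also have "\<dots> = (\<integral>r. indicator {..s} r * S (t + s - r) (G r f) x \<partial>lborel) + (\<integral>r. indicator {s<..} r * S (t + s - r) (G r f) x \<partial>lborel)"
    using i2 i3 by simp
  also have "(\<integral>r. indicator {s<..} r * S (t + s - r) (G r f) x \<partial>lborel)
      = (\<integral>q. indicator {s<..} (s + 1 * q) * S (t + s - (s + 1 * q)) (G (s + 1 * q) f) x \<partial>lborel)"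
    using lborel_integral_real_affine[of 1 "\<lambda>r. indicator {s<..} r * S (t + s - r) (G r f) x" s] by simp
  also have "\<dots> = op_conv S G t (T s f) x"
    unfolding op_conv_def
  proof (intro Bochner_Integration.integral_cong refl)
    fix q
    show "indicator {s<..} (s + 1 * q) * S (t + s - (s + 1 * q)) (G (s + 1 * q) f) x = S (t - q) (G q (T s f)) x"
    proof (cases "0 < q")
      case True
      then have "G (s + q) f = G q (T s f)" using G_sg[OF True s f] by (simp add: add.commute)
      then show ?thesis using True by simp
    next
      case False
      then have "G q (T s f) = (\<lambda>x. 0)" by (intro op_family_nonpos_ext[OF G _ T_Bb[OF f]]) simp
      then show ?thesis using False op_family_zero[OF S_op_family] by simp
    qed
  qed
  finally have split: "op_conv S G (t + s) f x = (\<integral>r. indicator {..s} r * S (t + s - r) (G r f) x \<partial>lborel) + op_conv S G t (T s f) x" .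
  show "S (t + s) f x = S t (T s f) x + (\<integral>r. indicator {..s} r * S (t + s - r) (G r f) x \<partial>lborel)"
    using S_eq[OF f, of "t + s" x] S_eq[OF T_Bb[OF f], of t s x] split T_sg[OF t s f] by simp
  show "integrable lborel (\<lambda>r. indicator {..s} r * S (t + s - r) (G r f) x)" by (rule i2)
qed

text \<open>For fixed \<open>t\<close> the defect \<open>S (t + s) - S t (S s)\<close>, as a family
  in \<open>s\<close>, is exponentially bounded and solves the homogeneous Volterra equation, so it
  vanishes.\<close>

lemma S_sg:
  assumes t: "0 < t" and s: "0 < s" and f: "f \<in> Bb"
  shows "S (t + s) f = S t (S s f)"
proof -
  define D where "D = (\<lambda>s f x. if 0 < s then S (t + s) f x - S t (S s f) x else 0)"
  have Db: "exp_bounded D (\<lambda>_. 2 * A * exp (l * t) + 4 * A * A * exp (l * t)) l"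
    unfolding exp_bounded_def
  proof (intro allI ballI)
    fix s x and f :: "'a \<Rightarrow> real" assume f: "f \<in> Bb"
    have e: "exp (l * (t + s)) = exp (l * t) * exp (l * s)" by (simp add: exp_add[symmetric] algebra_simps)
    have 1: "\<bar>S (t + s) f x\<bar> \<le> 2 * A * exp (l * t) * exp (l * s) * supnorm f"
      using exp_boundedD[OF S_exp_bounded f, of "t + s" x] by (simp add: e mult_ac)
    have "\<bar>S t (S s f) x\<bar> \<le> 2 * A * exp (l * t) * supnorm (S s f)" by (rule exp_boundedD[OF S_exp_bounded S_Bb[OF f]])
    also have "\<dots> \<le> 2 * A * exp (l * t) * (2 * A * exp (l * s) * supnorm f)"
      using A_nonneg by (intro mult_left_mono exp_bounded_supnorm[OF S_exp_bounded f]) auto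
    finally have 2: "\<bar>S t (S s f) x\<bar> \<le> 4 * A * A * exp (l * t) * exp (l * s) * supnorm f" by (simp add: mult_ac)
    have 3: "0 \<le> 2 * A * exp (l * t) * exp (l * s) * supnorm f" "0 \<le> 4 * A * A * exp (l * t) * exp (l * s) * supnorm f"
      using A_nonneg supnorm_nonneg[OF f] by (auto intro!: mult_nonneg_nonneg)
    show "\<bar>D s f x\<bar> \<le> (2 * A * exp (l * t) + 4 * A * A * exp (l * t)) * exp (l * s) * supnorm f"
      unfolding D_def using 1 2 3 by (auto simp: distrib_right)
  qed
  have "D s f x = op_conv D G s f x" if f: "f \<in> Bb" for s f x
  proof (cases "0 < s")
    case False
    have "D (s - r) (G r f) x = 0" for r
    proof (cases "r \<le> 0")
      case True
      have "S (s - r) (\<lambda>x. 0) = (\<lambda>x. 0)" using op_family_zero[OF S_op_family] by auto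
      then show ?thesis using op_family_nonpos_ext[OF G True f] op_family_zero[OF S_op_family] by (simp add: D_def)
    qed (use False in \<open>simp add: D_def\<close>)
    then show ?thesis using False by (simp add: op_conv_def D_def)
  next
    case s: True
    note i2 = S_T_split(2)[OF t s f, of x]
    let ?F = "\<lambda>r y. S (s - r) (G r f) y"
    have Fm: "(\<lambda>(r,y). ?F r y) \<in> borel_measurable (borel \<Otimes>\<^sub>M borel)"
    proof -
      have "(\<lambda>p. ((s, snd p), fst p)) \<in> measurable (borel \<Otimes>\<^sub>M borel) ((borel \<Otimes>\<^sub>M borel) \<Otimes>\<^sub>M borel :: ((real \<times> 'a) \<times> real) measure)" by simp
      from measurable_compose[OF this op_conv_integrand_measurable[OF S_op_family S_exp_bounded G Gb \<kappa> f]]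
      show ?thesis by (simp add: split_beta')
    qed
    have fub: "integrable lborel (\<lambda>r. S t (?F r) x)" "S t (\<lambda>y. \<integral>r. ?F r y \<partial>lborel) x = (\<integral>r. S t (?F r) x \<partial>lborel)"
      "(\<lambda>y. \<integral>r. ?F r y \<partial>lborel) \<in> Bb"
      using sfun_Fubini[OF op_family_sfun[OF S_op_family] Fm _ op_conv_integrand_bound[OF S_exp_bounded G Gb f]] \<kappa> by auto
    have "S s f = (\<lambda>y. T s f y + (\<integral>r. ?F r y \<partial>lborel))" using S_eq[OF f] by (auto simp: op_conv_def)
    then have "S t (S s f) x = S t (T s f) x + (\<integral>r. S t (?F r) x \<partial>lborel)"
      using sfun_add[OF op_family_sfun[OF S_op_family] T_Bb[OF f] fub(3)] fub(2) by simp
    then have "S (t + s) f x - S t (S s f) x = (\<integral>r. indicator {..s} r * S (t + s - r) (G r f) x \<partial>lborel) - (\<integral>r. S t (?F r) x \<partial>lborel)"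
      using S_T_split(1)[OF t s f, of x] by simp
    also have "\<dots> = (\<integral>r. indicator {..s} r * S (t + s - r) (G r f) x - S t (?F r) x \<partial>lborel)"
      using i2 fub by simp
    \<comment> \<open>At \<open>r = s\<close> the integrand need not agree with
      \<open>D 0 = 0\<close>, since the extended \<open>S 0\<close> is zero and not the identity;
      this point is discarded.\<close>
    also have "\<dots> = (\<integral>r. indicator {..<s} r * (indicator {..s} r * S (t + s - r) (G r f) x - S t (?F r) x) \<partial>lborel)"
    proof (rule integral_cong_AE)
      show m: "(\<lambda>r. indicator {..s} r * S (t + s - r) (G r f) x - S t (?F r) x) \<in> borel_measurable lborel"
        using i2 fub(1) by (intro borel_measurable_diff) auto
      then show "(\<lambda>r. indicator {..<s} r * (indicator {..s} r * S (t + s - r) (G r f) x - S t (?F r) x)) \<in> borel_measurable lborel" by simp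
      show "AE r in lborel. indicator {..s} r * S (t + s - r) (G r f) x - S t (?F r) x
         = indicator {..<s} r * (indicator {..s} r * S (t + s - r) (G r f) x - S t (?F r) x)"
      proof (rule AE_lborel_neqI[of s])
        fix r :: real assume "r \<noteq> s"
        moreover have "?F r = (\<lambda>x. 0)" if "r > s" using that by (intro op_family_nonpos_ext[OF S_op_family _ G_Bb[OF f]]) simp
        ultimately show "indicator {..s} r * S (t + s - r) (G r f) x - S t (?F r) x
         = indicator {..<s} r * (indicator {..s} r * S (t + s - r) (G r f) x - S t (?F r) x)"
          using op_family_zero[OF S_op_family] by (cases "r < s") (auto simp: indicator_def)
      qed
    qed
    also have "\<dots> = op_conv D G s f x"
      unfolding op_conv_def
    proof (intro Bochner_Integration.integral_cong refl)
      fix r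
      show "indicator {..<s} r * (indicator {..s} r * S (t + s - r) (G r f) x - S t (?F r) x) = D (s - r) (G r f) x"
        by (auto simp: D_def indicator_def add_diff_eq)
    qed
    finally show ?thesis using s by (simp add: D_def)
  qed
  then have "D s f x = 0" for x using op_conv_fixed_point_zero[OF Db G Gb \<kappa> half _ f] by blast
  then show ?thesis using s by (auto simp: D_def)
qed

text \<open>\<open>laplace G m\<close> has norm at most 1/2, so the Neumann series inverts
  \<open>1 - laplace G m\<close>. Its partial sums converge boundedly and pointwise, which permits
  applying the operator term by term.\<close>

lemma neumann:
  assumes m: "l \<le> m" and p: "p \<in> Bb"
  shows "\<exists>g\<in>Bb. \<forall>x. g x - laplace G m g x = p x"
proof -
  let ?K = "laplace G m"
  note d = laplace_dom_exp_bounded[OF G Gb \<kappa> m]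
  define k where "k n = (?K ^^ n) p" for n
  have kB: "k n \<in> Bb" for n by (induction n) (auto simp: k_def p laplace_Bb[OF G d])
  have kb: "supnorm (k n) \<le> supnorm p * (1/2) ^ n" for n
  proof (induction n)
    case (Suc n)
    have "supnorm (k (Suc n)) \<le> (\<integral>s. \<kappa> s \<partial>lborel) * supnorm (k n)"
      by (rule supnorm_le) (simp add: k_def laplace_bound[OF G d] kB[unfolded k_def])
    also have "\<dots> \<le> 1/2 * (supnorm p * (1/2) ^ n)"
      by (rule mult_mono[OF half Suc]) (auto simp: supnorm_nonneg[OF kB])
    finally show ?case by simp
  qed (simp add: k_def)
  have kx: "\<bar>k n x\<bar> \<le> supnorm p * (1/2) ^ n" for n x using order_trans[OF supnorm_ge[OF kB] kb] .
  have sa: "summable (\<lambda>n. \<bar>k n x\<bar>)" for x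
    by (rule summable_comparison_test'[OF geometric_summable, where N=0]) (use kx in auto)
  have sk: "summable (\<lambda>n. k n x)" for x by (rule summable_rabs_cancel[OF sa])
  define g where "g x = (\<Sum>n. k n x)" for x
  have PB: "(\<lambda>x. \<Sum>i<n. k i x) \<in> Bb \<and> (\<forall>x. ?K (\<lambda>x. \<Sum>i<n. k i x) x = (\<Sum>i<n. k (Suc i) x))" for n
  proof (induction n)
    case 0 then show ?case using sfun_zero[OF laplace_sfun[OF G d]] by (simp add: Bb_const)
  next
    case (Suc n)
    have "?K (k n) x = k (Suc n) x" for x by (simp add: k_def)
    with Suc show ?case by (auto simp: Bb_add kB sfun_add[OF laplace_sfun[OF G d]])
  qed
  have Pb: "\<bar>\<Sum>i<n. k i x\<bar> \<le> supnorm p * 2" for n x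
  proof -
    have "\<bar>\<Sum>i<n. k i x\<bar> \<le> (\<Sum>i<n. \<bar>k i x\<bar>)" by (rule sum_abs)
    also have "\<dots> \<le> (\<Sum>i. \<bar>k i x\<bar>)" by (rule sum_le_suminf[OF sa]) auto
    also have "\<dots> \<le> (\<Sum>i. supnorm p * (1/2) ^ i)" by (rule suminf_le[OF kx sa geometric_summable])
    also have "\<dots> = supnorm p * 2" by (subst suminf_mult) (auto simp: suminf_geometric intro: summable_geometric)
    finally show ?thesis .
  qed
  have Plim: "(\<lambda>n. \<Sum>i<n. k i x) \<longlonglongrightarrow> g x" for x unfolding g_def by (rule summable_LIMSEQ[OF sk])
  note PB1 = PB[THEN conjunct1] and PB2 = PB[THEN conjunct2, rule_format]
  have gB: "g \<in> Bb" by (rule Bb_limit[OF PB1 Pb Plim])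
  have "(\<lambda>n. ?K (\<lambda>x. \<Sum>i<n. k i x) x) \<longlonglongrightarrow> ?K g x" for x
    by (rule sfun_lim[OF laplace_sfun[OF G d] PB1 Pb Plim])
  then have 1: "(\<lambda>n. \<Sum>i<n. k (Suc i) x) \<longlonglongrightarrow> ?K g x" for x unfolding PB2 .
  have "(\<lambda>n. \<Sum>i<n. k (Suc i) x) \<longlonglongrightarrow> (\<Sum>i. k (Suc i) x)" for x
    by (rule summable_LIMSEQ[OF summable_Suc_iff[THEN iffD2, OF sk]])
  then have "?K g x = (\<Sum>i. k (Suc i) x)" for x by (rule LIMSEQ_unique[OF 1])
  then have "g x - ?K g x = p x" for x using suminf_split_head[OF sk, of x] by (simp add: g_def k_def)
  with gB show ?thesis by (intro bexI[of _ g] allI)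
qed

text \<open>If \<open>u\<close> is the resolvent of \<open>T\<close> applied to \<open>g\<close>,
  then \<open>B u = laplace G m g\<close>, and \<open>m u - h = g - laplace G m g\<close> says
  exactly that \<open>h\<close> is \<open>m u - g\<close> plus \<open>B u\<close>. In this way the
  resolvent equations for \<open>S\<close> and for \<open>T\<close> correspond.\<close>

lemma gen_rel_S:
  assumes l: "l < m" and m: "0 < m" and B: "\<And>g x. g \<in> Bb \<Longrightarrow> B (laplace T m g) x = laplace G m g x"
    and u: "u \<in> Bb"
  shows "h \<in> Bb \<and> gen_rel S u h \<longleftrightarrow> (\<exists>f\<in>Bb. gen_rel T u f \<and> h = (\<lambda>x. f x + B u x))"
proof -
  let ?K = "laplace G m"
  note dG = laplace_dom_exp_bounded[OF G Gb \<kappa> less_imp_le[OF l]]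
  note dT = laplace_dom_const[OF T Tb l]
  note dS = laplace_dom_const[OF S_op_family S_exp_bounded l]
  note sfS = laplace_sfun[OF S_op_family dS]
  have res: "laplace S m f x = laplace T m f x + laplace S m (?K f) x" if f: "f \<in> Bb" for f x
  proof -
    have "laplace S m f x = (\<integral>t. exp (- m * t) * T t f x + exp (- m * t) * op_conv S G t f x \<partial>lborel)"
      unfolding laplace_def by (intro Bochner_Integration.integral_cong) (auto simp: S_eq[OF f] algebra_simps)
    also have "\<dots> = laplace T m f x + laplace (op_conv S G) m f x"
      using laplace_integrable[OF T dT f, of x] laplace_op_conv(2)[OF S_op_family dS G dG S_exp_bounded Gb \<kappa> f, of x] by (simp add: laplace_def)
    also have "laplace (op_conv S G) m f x = laplace S m (?K f) x" by (rule laplace_op_conv(1)[OF S_op_family dS G dG S_exp_bounded Gb \<kappa> f])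
    finally show ?thesis .
  qed
  have KB: "?K f \<in> Bb" if "f \<in> Bb" for f by (rule laplace_Bb[OF G dG that])
  have key: "laplace S m (\<lambda>y. g y - ?K g y) x = laplace T m g x" if g: "g \<in> Bb" for g x
    using res[OF g] by (simp add: sfun_diff[OF sfS g KB[OF g]])
  have rT: "gen_rel T u h \<longleftrightarrow> (\<forall>x. u x = laplace T m (\<lambda>y. m * u y - h y) x)" if "h \<in> Bb" for h
    by (rule gen_rel_resolvent[OF T Tb l m _ u that]) (rule T_sg)
  have rS: "gen_rel S u h \<longleftrightarrow> (\<forall>x. u x = laplace S m (\<lambda>y. m * u y - h y) x)" if "h \<in> Bb" for h
    by (rule gen_rel_resolvent[OF S_op_family S_exp_bounded l m _ u that]) (rule S_sg)
  show ?thesis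
  proof
    assume h: "h \<in> Bb \<and> gen_rel S u h"
    then have hB: "h \<in> Bb" by simp
    have us: "u x = laplace S m (\<lambda>y. m * u y - h y) x" for x by (rule rS[OF hB, THEN iffD1, OF conjunct2[OF h], rule_format])
    \<comment> \<open>Solvability in \<open>g\<close> is what rules out elements of the generator of
      \<open>S\<close> beyond the sum.\<close>
    obtain g where g0: "g \<in> Bb" "\<forall>x. g x - ?K g x = m * u x - h x"
      using neumann[OF less_imp_le[OF l] Bb_diff[OF Bb_cmult[OF u, of m] hB]] by (elim bexE)
    note g = g0(1) g0(2)[rule_format]
    have uT: "u = laplace T m g"
    proof
      fix x show "u x = laplace T m g x"
        unfolding key[OF g(1), symmetric] g(2) by (rule us)
    qed
    define f where "f = (\<lambda>x. m * u x - g x)"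
    have fB: "f \<in> Bb" unfolding f_def by (intro Bb_diff Bb_cmult u g)
    have "gen_rel T u f" unfolding rT[OF fB] using uT by (simp add: f_def)
    moreover have "h = (\<lambda>x. f x + B u x)"
    proof
      fix x show "h x = f x + B u x" using B[OF g(1), of x] g(2)[of x] uT by (simp add: f_def)
    qed
    ultimately show "\<exists>f\<in>Bb. gen_rel T u f \<and> h = (\<lambda>x. f x + B u x)" using fB by blast
  next
    assume "\<exists>f\<in>Bb. gen_rel T u f \<and> h = (\<lambda>x. f x + B u x)"
    then obtain f where f: "f \<in> Bb" "gen_rel T u f" and h: "h = (\<lambda>x. f x + B u x)" by blast
    define g where "g = (\<lambda>x. m * u x - f x)"
    have gB: "g \<in> Bb" unfolding g_def by (intro Bb_diff Bb_cmult u f)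
    have uT: "u = laplace T m g" unfolding g_def by (rule ext) (rule rT[OF f(1), THEN iffD1, OF f(2), rule_format])
    have Bu: "B u x = ?K g x" for x using B[OF gB] uT by simp
    have hB: "h \<in> Bb" unfolding h Bu by (intro Bb_add f KB gB)
    have "(\<lambda>y. m * u y - h y) = (\<lambda>y. g y - ?K g y)" by (auto simp: h Bu g_def)
    then have "u x = laplace S m (\<lambda>y. m * u y - h y) x" for x using key[OF gB, of x] fun_cong[OF uT, of x] by (simp only:)
    then have "gen_rel S u h" by (intro rS[OF hB, THEN iffD2] allI)
    with hB show "h \<in> Bb \<and> gen_rel S u h" by blast
  qed
qed

end

section \<open>Bounded perturbations and positivity\<close>

text \<open>The convergence hypothesis lets the argument vary with \<open>n\<close>, because the
  inner factor \<open>Gn n s (F n)\<close> of an iterate does. All families share \<open>A\<close>,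
  \<open>l\<close> and \<open>\<kappa>\<close>, so the majorants of the integrals and of the series
  are uniform in \<open>n\<close>.\<close>

lemma dyson_limit:
  assumes dG: "dyson T G A l \<kappa>" and dGn: "\<And>n. dyson T (Gn n) A l \<kappa>"
    and lim: "\<And>s F f B x. (\<And>n. F n \<in> Bb) \<Longrightarrow> (\<And>n x. \<bar>F n x\<bar> \<le> B) \<Longrightarrow> (\<And>x. (\<lambda>n. F n x) \<longlonglongrightarrow> f x) \<Longrightarrow> f \<in> Bb \<Longrightarrow>
      (\<lambda>n. Gn n s (F n) x) \<longlonglongrightarrow> G s f x"
    and f: "f \<in> Bb"
  shows "(\<lambda>n. dyson.S T (Gn n) t f x) \<longlonglongrightarrow> dyson.S T G t f x"
proof -
  interpret S: dyson T G A l \<kappa> by (rule dG)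
  interpret Sn: dyson T "Gn n" A l \<kappa> for n by (rule dGn)
  have step: "(\<lambda>n. Sn.Sn n k t (F n) x) \<longlonglongrightarrow> S.Sn k t f x"
    if "\<And>n. F n \<in> Bb" "\<And>n x. \<bar>F n x\<bar> \<le> B" "\<And>x. (\<lambda>n. F n x) \<longlonglongrightarrow> f x" for k t F f B x
    using that
  proof (induction k arbitrary: t F f B x)
    case 0
    then show ?case by (simp add: sfun_lim[OF op_family_sfun[OF S.T] 0])
  next
    case (Suc k)
    note F = Suc.prems
    have fB: "f \<in> Bb" using F by (rule Bb_limit)
    have snB: "supnorm (F n) \<le> B" for n by (rule supnorm_le) (rule F)
    have "(\<lambda>n. \<integral>s. Sn.Sn n k (t - s) (Gn n s (F n)) x \<partial>lborel) \<longlonglongrightarrow> (\<integral>s. S.Sn k (t - s) (G s f) x \<partial>lborel)"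
    proof (rule integral_dominated_convergence[where w="\<lambda>s. A / 2 ^ k * exp (l * t) * B * \<kappa> s"])
      show "(\<lambda>s. S.Sn k (t - s) (G s f) x) \<in> borel_measurable lborel"
        by (rule op_conv_integrand_measurable1[OF S.Sn_op_family S.Sn_exp_bounded S.G S.Gb S.\<kappa> fB])
      show "(\<lambda>s. Sn.Sn n k (t - s) (Gn n s (F n)) x) \<in> borel_measurable lborel" for n
        by (rule op_conv_integrand_measurable1[OF Sn.Sn_op_family Sn.Sn_exp_bounded Sn.G Sn.Gb S.\<kappa> F(1)])
      show "integrable lborel (\<lambda>s. A / 2 ^ k * exp (l * t) * B * \<kappa> s)" using S.\<kappa> by simp
      show "AE s in lborel. norm (Sn.Sn n k (t - s) (Gn n s (F n)) x) \<le> A / 2 ^ k * exp (l * t) * B * \<kappa> s" for n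
      proof (rule AE_I2)
        fix s
        have "A / 2 ^ k * exp (l * t) * supnorm (F n) * \<kappa> s \<le> A / 2 ^ k * exp (l * t) * B * \<kappa> s"
          using S.A_nonneg by (intro mult_right_mono mult_left_mono snB) (auto simp: exp_bounded_nonneg[OF S.Gb])
        then show "norm (Sn.Sn n k (t - s) (Gn n s (F n)) x) \<le> A / 2 ^ k * exp (l * t) * B * \<kappa> s"
          using op_conv_integrand_bound[OF Sn.Sn_exp_bounded[of n k] Sn.G[of n] Sn.Gb[of n] F(1)[of n], of t s x] by simp
      qed
      show "AE s in lborel. (\<lambda>n. Sn.Sn n k (t - s) (Gn n s (F n)) x) \<longlonglongrightarrow> S.Sn k (t - s) (G s f) x"
      proof (rule AE_I2)
        fix s
        show "(\<lambda>n. Sn.Sn n k (t - s) (Gn n s (F n)) x) \<longlonglongrightarrow> S.Sn k (t - s) (G s f) x"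
        proof (rule Suc.IH[where B="\<kappa> s * exp (l * s) * B"])
          show "Gn n s (F n) \<in> Bb" for n by (rule Sn.G_Bb[OF F(1)])
          show "(\<lambda>n. Gn n s (F n) y) \<longlonglongrightarrow> G s f y" for y by (rule lim[OF F fB])
          show "\<bar>Gn n s (F n) y\<bar> \<le> \<kappa> s * exp (l * s) * B" for n y
            by (rule order_trans[OF exp_boundedD[OF Sn.Gb F(1)] mult_left_mono[OF snB]]) (simp add: exp_bounded_nonneg[OF S.Gb])
        qed
      qed
    qed
    then show ?case by (simp add: op_conv_def)
  qed
  have "((\<lambda>n. \<Sum>k. Sn.Sn n k t f x) \<longlonglongrightarrow> (\<Sum>k. S.Sn k t f x))"
  proof (rule tannerys_theorem[THEN conjunct2, THEN conjunct2, OF _ _ geometric_summable[of "A * exp (l * t) * supnorm f"]])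
    show "(\<lambda>n. Sn.Sn n k t f x) \<longlonglongrightarrow> S.Sn k t f x" for k
      by (rule step[where B="supnorm f"]) (use f supnorm_ge[OF f] in auto)
  qed (use Sn.Sn_bound[OF f] in \<open>auto intro!: always_eventually\<close>)
  then show ?thesis by (simp add: S.S_def Sn.S_def)
qed

text \<open>The number \<open>c\<close> has two roles: it bounds the positive operator
  \<open>P\<close>, and it is the damping rate, so that \<open>P - c\<close> maps the constant 1 to
  a nonpositive function.\<close>

locale bounded_perturbation =
  fixes T :: "real \<Rightarrow> ('a::euclidean_space \<Rightarrow> real) \<Rightarrow> 'a \<Rightarrow> real" and P :: "('a \<Rightarrow> real) \<Rightarrow> 'a \<Rightarrow> real" and A l c :: real
  assumes T: "op_family T" and Tb: "exp_bounded T (\<lambda>_. A) l"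
    and T_sg: "\<And>t s f. 0 < t \<Longrightarrow> 0 < s \<Longrightarrow> f \<in> Bb \<Longrightarrow> T (t + s) f = T t (T s f)"
    and c: "0 < c" and P: "\<And>x. sfun (\<lambda>f. P f x)" and Pm: "\<And>f. f \<in> Bb \<Longrightarrow> P f \<in> borel_measurable borel"
    and Pb: "\<And>f x. f \<in> Bb \<Longrightarrow> \<bar>P f x\<bar> \<le> c * supnorm f"
    and T_pos: "\<And>t f x. f \<in> Bb \<Longrightarrow> (\<And>y. 0 \<le> f y) \<Longrightarrow> 0 \<le> T t f x"
    and P_pos: "\<And>f x. f \<in> Bb \<Longrightarrow> (\<And>y. 0 \<le> f y) \<Longrightarrow> 0 \<le> P f x"
begin

definition H where "H s f x = P (T s f) x"
text \<open>Chosen such that \<open>\<kappa>'\<close> has integral \<open>c * A / (l' - l)\<close>,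
  at most 1/2; the summand 1 keeps \<open>l' > l\<close> when \<open>A = 0\<close>.\<close>

definition "l' = l + 2 * c * A + 1"
text \<open>\<open>H\<close> grows at rate \<open>l\<close>; the surplus rate \<open>l' - l\<close>
  is turned into an integrable exponential profile.\<close>

definition "\<kappa>' = (\<lambda>s. c * A / (l' - l) * ((l' - l) * exp (- (l' - l) * s) * indicator {0..} s))"

lemma A_nonneg: "0 \<le> A" using exp_bounded_nonneg[OF Tb] .

lemma l'_gt: "l < l'" using A_nonneg c by (simp add: l'_def add_nonneg_pos)

lemma H_op_family: "op_family H"
  unfolding op_family_def
proof (intro conjI allI ballI impI)
  note TB = op_family_Bb[OF T Tb]
  fix t x
  show "sfun (\<lambda>f. H t f x)"
  proof (rule sfunI[where C="c * (A * exp (l * t))"])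
    fix f g :: "'a \<Rightarrow> real" assume f: "f \<in> Bb" and g: "g \<in> Bb"
    have "T t (\<lambda>x. f x + g x) = (\<lambda>y. T t f y + T t g y)" using sfun_add[OF op_family_sfun[OF T] f g] by auto
    then show "H t (\<lambda>x. f x + g x) x = H t f x + H t g x" by (simp add: H_def sfun_add[OF P TB[OF f] TB[OF g]])
  next
    fix f :: "'a \<Rightarrow> real" and a assume f: "f \<in> Bb"
    have "T t (\<lambda>x. a * f x) = (\<lambda>y. a * T t f y)" using sfun_cmult[OF op_family_sfun[OF T] f] by auto
    then show "H t (\<lambda>x. a * f x) x = a * H t f x" by (simp add: H_def sfun_cmult[OF P TB[OF f]])
  next
    fix f :: "'a \<Rightarrow> real" assume f: "f \<in> Bb"
    have "c * supnorm (T t f) \<le> c * (A * exp (l * t) * supnorm f)" using c by (intro mult_left_mono exp_bounded_supnorm[OF Tb f]) simp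
    then show "\<bar>H t f x\<bar> \<le> c * (A * exp (l * t)) * supnorm f" using Pb[OF TB[OF f], of t x] by (simp add: H_def mult_ac)
  next
    fix F :: "nat \<Rightarrow> 'a \<Rightarrow> real" and f B
    assume F: "\<And>n. F n \<in> Bb" "\<And>n x. \<bar>F n x\<bar> \<le> B" "\<And>x. (\<lambda>n. F n x) \<longlonglongrightarrow> f x" "f \<in> Bb"
    have snB: "supnorm (F n) \<le> B" for n by (rule supnorm_le) (rule F)
    show "(\<lambda>n. H t (F n) x) \<longlonglongrightarrow> H t f x"
      unfolding H_def
    proof (rule sfun_lim[OF P TB[OF F(1)], where B="A * exp (l * t) * B"])
      show "\<bar>T t (F n) y\<bar> \<le> A * exp (l * t) * B" for n y
        using A_nonneg by (intro order_trans[OF exp_boundedD[OF Tb F(1)] mult_left_mono[OF snB]]) simp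
      show "(\<lambda>n. T t (F n) y) \<longlonglongrightarrow> T t f y" for y by (rule sfun_lim[OF op_family_sfun[OF T] F(1-3)])
    qed
  qed
next
  fix f :: "'a \<Rightarrow> real" assume f: "f \<in> Bb"
  let ?N = "borel \<Otimes>\<^sub>M borel :: (real \<times> 'a) measure"
  have "(\<lambda>p. P (T (fst p) f) (snd p)) \<in> borel_measurable ?N"
  proof (rule sfun_param_measurable[where L="\<lambda>p f. P f (snd p)" and F="\<lambda>p. T (fst p) f"])
    show "space ?N = UNIV" by (simp add: space_pair_measure)
    show "(\<lambda>p. P f (snd p)) \<in> borel_measurable ?N" if "f \<in> Bb" for f
      using measurable_compose[OF measurable_snd Pm[OF that]] .
    have "(\<lambda>q. (fst (fst q), snd q)) \<in> measurable (?N \<Otimes>\<^sub>M (borel :: 'a measure)) (borel \<Otimes>\<^sub>M borel)" by simp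
    from measurable_compose[OF this op_family_measurable[OF T f]]
    show "(\<lambda>(p, y). T (fst p) f y) \<in> borel_measurable (?N \<Otimes>\<^sub>M borel)" by (simp add: split_beta')
  qed (use P op_family_Bb[OF T Tb f] in auto)
  then show "(\<lambda>(t, x). H t f x) \<in> borel_measurable ?N" by (simp add: H_def split_beta')
next
  fix t :: real and f :: "'a \<Rightarrow> real" and x assume "t \<le> 0" "f \<in> Bb"
  then show "H t f x = 0" using op_family_nonpos_ext[OF T] sfun_zero[OF P] by (simp add: H_def)
qed

lemma H_exp_bounded: "exp_bounded H \<kappa>' l'"
  unfolding exp_bounded_def
proof (intro allI ballI)
  fix t x and f :: "'a \<Rightarrow> real" assume f: "f \<in> Bb"
  show "\<bar>H t f x\<bar> \<le> \<kappa>' t * exp (l' * t) * supnorm f"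
  proof (cases "t \<le> 0")
    case True
    then show ?thesis using op_family_nonpos[OF H_op_family True f] l'_gt c A_nonneg supnorm_nonneg[OF f]
      by (auto simp: \<kappa>'_def indicator_def intro!: mult_nonneg_nonneg divide_nonneg_nonneg)
  next
    case False
    have "\<bar>H t f x\<bar> \<le> c * supnorm (T t f)" unfolding H_def by (rule Pb[OF op_family_Bb[OF T Tb f]])
    also have "\<dots> \<le> c * (A * exp (l * t) * supnorm f)" using c by (intro mult_left_mono exp_bounded_supnorm[OF Tb f]) simp
    also have "exp (l * t) = exp (- (l' - l) * t) * exp (l' * t)" by (simp add: exp_add[symmetric] algebra_simps)
    finally show ?thesis using False l'_gt by (simp add: \<kappa>'_def mult_ac)
  qed
qed

sublocale Z: dyson_semigroup T H A l' \<kappa>'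
proof
  show "op_family T" by (rule T)
  show "exp_bounded T (\<lambda>_. A) l'" by (rule exp_bounded_mono[OF T Tb less_imp_le[OF l'_gt] order_refl])
  show "op_family H" by (rule H_op_family)
  show "exp_bounded H \<kappa>' l'" by (rule H_exp_bounded)
  have e: "integrable lborel (\<lambda>s. (l' - l) * exp (- (l' - l) * s) * indicator {0..} s)"
    "(\<integral>s. (l' - l) * exp (- (l' - l) * s) * indicator {0..} s \<partial>lborel) = 1"
    using has_bochner_integral_exp_tail[of "l' - l" 0] l'_gt by (simp_all add: has_bochner_integral_iff)
  show "integrable lborel \<kappa>'" unfolding \<kappa>'_def using e(1) by (rule integrable_mult_right)
  have "(\<integral>s. \<kappa>' s \<partial>lborel) = c * A / (l' - l)" unfolding \<kappa>'_def integral_mult_right_zero e(2) by simp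
  also have "\<dots> \<le> 1/2"
  proof -
    have "0 \<le> c * A" using c A_nonneg by simp
    then show ?thesis by (simp add: l'_def divide_simps)
  qed
  finally show "(\<integral>s. \<kappa>' s \<partial>lborel) \<le> 1/2" .
  show "T (t + s) f = T t (T s f)" if "0 < t" "0 < s" "f \<in> Bb" for t s f by (rule T_sg[OF that])
  show "H (t + s) f = H t (T s f)" if "0 < t" "0 < s" "f \<in> Bb" for t s f
    by (rule ext) (simp only: H_def T_sg[OF that])
qed

lemma Zn_pos: "f \<in> Bb \<Longrightarrow> (\<And>y. 0 \<le> f y) \<Longrightarrow> 0 \<le> Z.Sn n t f x"
proof (induction n arbitrary: t f x)
  case (Suc n)
  have "0 \<le> H s f y" for s y
    unfolding H_def by (intro P_pos T_pos op_family_Bb[OF T Tb] Suc.prems)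
  then have "0 \<le> Z.Sn n (t - s) (H s f) x" for s by (intro Suc.IH Z.G_Bb Suc.prems)
  then show ?case by (simp add: op_conv_def)
qed (simp add: T_pos)

lemma Z_pos: "f \<in> Bb \<Longrightarrow> (\<And>y. 0 \<le> f y) \<Longrightarrow> 0 \<le> Z.S t f x"
  unfolding Z.S_def by (intro suminf_nonneg Z.Sn_summable Zn_pos)

text \<open>Positivity makes the iterates comparable: \<open>H s 1\<close> is at most
  \<open>c\<close>, so each convolution costs a factor \<open>c\<close> and one integration in time,
  as in the exponential series.\<close>

lemma Zn_one_bound:
  assumes T1: "\<And>t x. T t (\<lambda>y. 1) x \<le> 1"
  shows "Z.Sn n t (\<lambda>y. 1) x \<le> (if 0 < t then (c * t) ^ n / fact n else 0)"
proof (induction n arbitrary: t x)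
  case 0
  then show ?case using T1 op_family_nonpos[OF T _ Bb_const[of 1], of t x] by simp
next
  case (Suc n)
  let ?one = "\<lambda>y::'a. 1::real"
  show ?case
  proof (cases "0 < t")
    case False
    then show ?thesis using op_family_nonpos[OF Z.Sn_op_family _ Bb_const[of 1], of t "Suc n" x] by simp
  next
    case True
    \<comment> \<open>The derivative of minus the next term of the exponential series at
      \<open>t - s\<close>; its integral is that term at \<open>t\<close>.\<close>
    let ?w = "\<lambda>s. c * ((c * (t - s)) ^ n / fact n) * indicator {0..t} s"
    have hb: "has_bochner_integral lborel ?w (- ((c * (t - t)) ^ Suc n / fact (Suc n)) - (- ((c * (t - 0)) ^ Suc n / fact (Suc n))))"
    proof (rule has_bochner_integral_FTC_Icc_real[where F="\<lambda>s. - ((c * (t - s)) ^ Suc n / fact (Suc n))"])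
      show "0 \<le> t" using True by simp
      show "((\<lambda>s. - ((c * (t - s)) ^ Suc n / fact (Suc n))) has_real_derivative c * ((c * (t - s)) ^ n / fact n)) (at s)" for s
      proof -
        have "((\<lambda>s. - ((c * (t - s)) ^ Suc n / fact (Suc n))) has_real_derivative - (real (Suc n) * (c * (t - s)) ^ n * (c * (0 - 1)) / fact (Suc n))) (at s)"
          by (rule derivative_eq_intros refl | simp)+
        moreover have "- (real (Suc n) * (c * (t - s)) ^ n * (c * (0 - 1)) / fact (Suc n)) = c * ((c * (t - s)) ^ n / fact n)"
          by (simp add: divide_simps)
        ultimately show ?thesis by (simp only:)
      qed
    qed (auto intro!: continuous_intros)
    have "(\<integral>s. Z.Sn n (t - s) (H s ?one) x \<partial>lborel) \<le> (\<integral>s. ?w s \<partial>lborel)"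
    proof (rule integral_mono)
      show "integrable lborel (\<lambda>s. Z.Sn n (t - s) (H s ?one) x)"
        by (rule op_conv_integrable[OF Z.Sn_op_family Z.Sn_exp_bounded Z.G Z.Gb Z.\<kappa> Bb_const])
      show "integrable lborel ?w" using hb by (simp add: has_bochner_integral_iff)
      fix s
      have HB: "H s ?one \<in> Bb" by (rule Z.G_Bb[OF Bb_const])
      consider "s \<le> 0" | "t \<le> s" | "0 < s" "s < t" by force
      then show "Z.Sn n (t - s) (H s ?one) x \<le> ?w s"
      proof cases
        case 1
        then show ?thesis using op_family_nonpos_ext[OF H_op_family 1 Bb_const] op_family_zero[OF Z.Sn_op_family] c by (auto simp: indicator_def)
      next
        case 2
        then show ?thesis using op_family_nonpos[OF Z.Sn_op_family _ HB] c by (auto simp: indicator_def)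
      next
        case 3
        have "supnorm (T s ?one) \<le> 1"
          using T1 T_pos[OF Bb_const[of 1]] by (intro supnorm_le) (auto simp: abs_le_iff intro: order_trans[of _ 0])
        then have "c * supnorm (T s ?one) \<le> c" using c by simp
        then have "H s ?one y \<le> c" for y
          using Pb[OF op_family_Bb[OF T Tb Bb_const[of 1]], of s y] by (simp add: H_def)
        \<comment> \<open>Monotonicity of \<open>Z.Sn n (t - s)\<close>, obtained by applying the
          positive operator to the nonnegative function \<open>c - H s 1\<close>.\<close>
        then have "0 \<le> Z.Sn n (t - s) (\<lambda>y. c * 1 - H s ?one y) x"
          by (intro Zn_pos Bb_diff Bb_cmult Bb_const HB) simp
        also have "\<dots> = c * Z.Sn n (t - s) ?one x - Z.Sn n (t - s) (H s ?one) x"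
          by (subst sfun_diff[OF op_family_sfun[OF Z.Sn_op_family] Bb_cmult[OF Bb_const] HB])
             (simp only: sfun_cmult[OF op_family_sfun[OF Z.Sn_op_family] Bb_const])
        finally have "Z.Sn n (t - s) (H s ?one) x \<le> c * Z.Sn n (t - s) ?one x" by simp
        also have "\<dots> \<le> c * ((c * (t - s)) ^ n / fact n)" using Suc.IH[of "t - s" x] 3 c by (intro mult_left_mono) auto
        finally show ?thesis using 3 by simp
      qed
    qed
    also have "\<dots> = (c * t) ^ Suc n / fact (Suc n)" using has_bochner_integral_integral_eq[OF hb] by simp
    finally show ?thesis using True by (simp add: op_conv_def)
  qed
qed

text \<open>The iterates at 1 sum to at most \<open>exp (c * t)\<close>, which the damping cancels
  exactly; this is where the constant \<open>c\<close> has to be the same for the norm of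
  \<open>P\<close> and for the damping.\<close>

lemma Z_one_bound:
  assumes T1: "\<And>t x. T t (\<lambda>y. 1) x \<le> 1"
  shows "exp (- c * t) * Z.S t (\<lambda>y. 1) x \<le> 1"
proof (cases "0 < t")
  case True
  have s: "(\<lambda>n. (c * t) ^ n / fact n) sums exp (c * t)"
    using exp_converges[of "c * t"] by (simp add: field_simps)
  have "Z.S t (\<lambda>y. 1) x \<le> (\<Sum>n. (c * t) ^ n / fact n)"
    unfolding Z.S_def using Zn_one_bound[OF T1, of _ t x] True
    by (intro suminf_le Z.Sn_summable Bb_const sums_summable[OF s]) auto
  also have "\<dots> = exp (c * t)" using s by (simp add: sums_iff)
  finally have "exp (- c * t) * Z.S t (\<lambda>y. 1) x \<le> exp (- c * t) * exp (c * t)" by (intro mult_left_mono) auto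
  then show ?thesis by (simp add: exp_add[symmetric])
next
  case False
  then show ?thesis using op_family_nonpos[OF Z.S_op_family _ Bb_const[of 1], of t x] by simp
qed

text \<open>Damping by \<open>exp (- c * t)\<close> adds \<open>- c\<close> to the perturbation;
  this is the integrated form. The splitting of \<open>Z.S t f\<close> at each time \<open>s\<close>
  is averaged with the weight \<open>c * exp (- c * (t - s))\<close> on \<open>[0, t]\<close>, and
  the double integral is exchanged over the triangle.\<close>

lemma expZ_equation:
  assumes f: "f \<in> Bb"
  defines "W \<equiv> \<lambda>t f x. exp (- c * t) * Z.S t f x"
  shows "W t f x = T t f x + op_conv W (\<lambda>s f x. H s f x - c * T s f x) t f x"
proof (cases "0 < t")
  case False
  have "W (t - s) (\<lambda>x. H s f x - c * T s f x) x = 0" for s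
  proof (cases "s \<le> 0")
    case True
    then show ?thesis using op_family_nonpos[OF H_op_family True f] op_family_nonpos[OF T True f] op_family_zero[OF Z.S_op_family] by (simp add: W_def)
  next
    case s: False
    have "(\<lambda>x. H s f x - c * T s f x) \<in> Bb" by (intro Bb_diff Bb_cmult Z.G_Bb Z.T_Bb f)
    then show ?thesis using op_family_nonpos[OF Z.S_op_family] False s by (simp add: W_def)
  qed
  then show ?thesis using False op_family_nonpos[OF T _ f] op_family_nonpos[OF Z.S_op_family _ f] by (simp add: W_def op_conv_def)
next
  case t: True
  let ?a = "\<lambda>r. Z.S (t - r) (H r f) x"
  \<comment> \<open>The weight has mass \<open>1 - exp (- c * t)\<close> and tail \<open>?Q\<close>.
    The 1 in \<open>?Q\<close> reproduces the undamped Volterra integral, the exponential the damped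
    one.\<close>
  let ?w = "\<lambda>s. c * exp (- c * (t - s)) * indicator {0..t} s"
  let ?Q = "\<lambda>q. (1 - exp (- c * (t - max 0 q))) * indicator {..t} q"
  have ai: "integrable lborel ?a" by (rule op_conv_integrable[OF Z.S_op_family Z.S_exp_bounded Z.G Z.Gb Z.\<kappa> f])
  have aint: "(\<integral>r. ?a r \<partial>lborel) = Z.S t f x - T t f x" using Z.S_eq[OF f, of t x] by (simp add: op_conv_def)
  have FTC: "has_bochner_integral lborel (\<lambda>s. c * exp (- c * (t - s)) * indicator {q..t} s) (1 - exp (- c * (t - q)))" if "q \<le> t" for q
  proof -
    have "has_bochner_integral lborel (\<lambda>s. c * exp (- c * (t - s)) * indicator {q..t} s) (exp (- c * (t - t)) - exp (- c * (t - q)))"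
      by (rule has_bochner_integral_FTC_Icc_real[OF that]) (auto intro!: derivative_eq_intros continuous_intros)
    then show ?thesis by simp
  qed
  have Q: "has_bochner_integral lborel (\<lambda>s. ?w s * indicator {q..} s) (?Q q)" for q
  proof (cases "q \<le> t")
    case True
    have "(\<lambda>s. ?w s * indicator {q..} s) = (\<lambda>s. c * exp (- c * (t - s)) * indicator {max 0 q..t} s)" by (auto simp: indicator_def)
    then show ?thesis using FTC[of "max 0 q"] True t by simp
  next
    case False
    then have "(\<lambda>s. ?w s * indicator {q..} s) = (\<lambda>s. 0)" by (auto simp: indicator_def)
    then show ?thesis using False has_bochner_integral_zero[of lborel] by simp
  qed
  have ea: "integrable lborel (\<lambda>r. exp (- c * (t - r)) * ?a r)"
  proof (rule Bochner_Integration.integrable_bound[OF ai])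
    show "(\<lambda>r. exp (- c * (t - r)) * ?a r) \<in> borel_measurable lborel" using ai by simp
    have "exp (- c * (t - r)) * \<bar>?a r\<bar> \<le> \<bar>?a r\<bar>" for r
    proof (cases "r < t")
      case True
      then show ?thesis using c by (intro mult_left_le_one_le) auto
    next
      case False
      then show ?thesis using op_family_nonpos[OF Z.S_op_family _ Z.G_Bb[OF f]] by simp
    qed
    then show "AE r in lborel. norm (exp (- c * (t - r)) * ?a r) \<le> norm (?a r)" by (simp add: abs_mult)
  qed
  have aQ: "?a q * ?Q q = ?a q - exp (- c * (t - q)) * ?a q" for q
  proof (cases "0 < q \<and> q \<le> t")
    case True then show ?thesis by (simp add: algebra_simps)
  next
    case False
    then have "?a q = 0"
      using op_family_nonpos[OF Z.S_op_family _ Z.G_Bb[OF f], of "t - q" q x] op_family_nonpos_ext[OF H_op_family _ f, of q] op_family_zero[OF Z.S_op_family]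
      by (cases "q \<le> 0") auto
    then show ?thesis by simp
  qed
  have tri: "(\<integral>s. ?w s * (\<integral>q. indicator {..s} q * ?a q \<partial>lborel) \<partial>lborel) = (\<integral>q. ?a q * ?Q q \<partial>lborel)"
  proof (rule triangle_Fubini[OF _ _ _ Q])
    show "?a \<in> borel_measurable lborel" using ai by simp
    show "integrable lborel (\<lambda>q. ?a q * ?Q q)" unfolding aQ using ai ea by simp
  qed (use c in auto)
  have wi: "integrable lborel ?w" "(\<integral>s. ?w s \<partial>lborel) = 1 - exp (- c * t)"
    using FTC[of 0] t by (auto simp: has_bochner_integral_iff)
  let ?y = "\<lambda>s. ?w s * (\<integral>q. indicator {..s} q * ?a q \<partial>lborel)"
  \<comment> \<open>At \<open>s = 0\<close> the extended \<open>T s\<close>, and at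
    \<open>s = t\<close> the extended \<open>Z.S (t - s)\<close>, is zero where the identity would
    be needed, so these two points are excluded.\<close>
  have pw: "c * W (t - s) (T s f) x = ?w s * Z.S t f x - ?y s" if "s \<noteq> 0" "s \<noteq> t" for s
  proof -
    have "s < 0 \<or> t < s \<or> 0 < s \<and> s < t" using that by linarith
    then show ?thesis
    proof (elim disjE conjE)
      assume "s < 0" then show ?thesis using op_family_nonpos_ext[OF T _ f, of s] op_family_zero[OF Z.S_op_family] by (simp add: W_def)
    next
      assume "t < s" then show ?thesis using op_family_nonpos[OF Z.S_op_family _ Z.T_Bb[OF f]] by (simp add: W_def)
    next
      assume "0 < s" "s < t" then show ?thesis using Z.S_T_split(1)[of "t - s" s f x] f by (simp add: W_def algebra_simps)
    qed
  qed
  let ?TT = "\<lambda>s. W (t - s) (T s f) x"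
  \<comment> \<open>The convolution of \<open>Z.S\<close> with \<open>T\<close> itself occurs, so
    \<open>T\<close> is given an integrable profile at the larger rate \<open>l'\<close>.\<close>
  have Tk: "exp_bounded T (\<lambda>s. A / (l' - l) * ((l' - l) * exp (- (l' - l) * s) * indicator {0..} s)) l'"
    unfolding exp_bounded_def
  proof (intro allI ballI)
    fix s y and f :: "'a \<Rightarrow> real" assume f: "f \<in> Bb"
    have "\<bar>exp (- l' * s) * T s f y\<bar> \<le> A / (l' - l) * ((l' - l) * exp (- (l' - l) * s) * indicator {0..} s) * supnorm f"
      by (rule laplace_domD[OF laplace_dom_const[OF T Tb l'_gt] f])
    then have 1: "exp (l' * s) * (exp (- l' * s) * \<bar>T s f y\<bar>) \<le> exp (l' * s) * (A / (l' - l) * ((l' - l) * exp (- (l' - l) * s) * indicator {0..} s) * supnorm f)"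
      by (intro mult_left_mono) (auto simp: abs_mult)
    have 2: "exp (l' * s) * (exp (- l' * s) * \<bar>T s f y\<bar>) = \<bar>T s f y\<bar>"
      by (simp add: exp_add[symmetric] mult.assoc[symmetric])
    show "\<bar>T s f y\<bar> \<le> A / (l' - l) * ((l' - l) * exp (- (l' - l) * s) * indicator {0..} s) * exp (l' * s) * supnorm f"
      using 1 unfolding 2 by (simp only: mult_ac)
  qed
  have ZTi: "integrable lborel (\<lambda>s. Z.S (t - s) (T s f) x)"
    by (rule op_conv_integrable[OF Z.S_op_family Z.S_exp_bounded T Tk laplace_dom_integrable[OF T laplace_dom_const[OF T Tb l'_gt]] f])
  have TTi: "integrable lborel ?TT"
  proof (rule Bochner_Integration.integrable_bound[OF ZTi])
    show "?TT \<in> borel_measurable lborel" using ZTi by (simp add: W_def)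
    have "exp (- c * (t - r)) * \<bar>Z.S (t - r) (T r f) x\<bar> \<le> \<bar>Z.S (t - r) (T r f) x\<bar>" for r
    proof (cases "r < t")
      case True
      then show ?thesis using c by (intro mult_left_le_one_le) auto
    next
      case False
      then show ?thesis using op_family_nonpos[OF Z.S_op_family _ Z.T_Bb[OF f]] by simp
    qed
    then show "AE r in lborel. norm (?TT r) \<le> norm (Z.S (t - r) (T r f) x)" by (simp add: abs_mult W_def)
  qed
  have AE2: "AE s in lborel. Q s" if "\<And>s. s \<noteq> 0 \<Longrightarrow> s \<noteq> t \<Longrightarrow> Q s" for Q :: "real \<Rightarrow> bool"
  proof -
    have "AE s in lborel. s \<noteq> 0 \<longrightarrow> Q s" by (rule AE_lborel_neqI[of t]) (use that in blast)
    then show ?thesis by (rule AE_mp) (rule AE_lborel_neqI[of 0], blast)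
  qed
  have ym: "?y \<in> borel_measurable lborel"
  proof -
    have [measurable]: "?a \<in> borel_measurable borel" using ai by simp
    have "(\<lambda>p. (if snd p \<le> fst p then 1 else 0) * ?a (snd p)) \<in> borel_measurable (lborel \<Otimes>\<^sub>M lborel)" by measurable
    then have "(\<lambda>(s,q). indicator {..s} q * ?a q) \<in> borel_measurable (lborel \<Otimes>\<^sub>M lborel)" by (simp add: indicator_def of_bool_def split_beta')
    then have "(\<lambda>s. \<integral>q. indicator {..s} q * ?a q \<partial>lborel) \<in> borel_measurable lborel"
      by (rule lborel.borel_measurable_lebesgue_integral)
    then show ?thesis by simp
  qed
  have TTm: "(\<lambda>s. c * ?TT s) \<in> borel_measurable lborel" using TTi by simp
  have yi: "integrable lborel ?y"
  proof (subst integrable_cong_AE[OF ym])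
    show "integrable lborel (\<lambda>s. ?w s * Z.S t f x - c * ?TT s)" using wi TTi by simp
    then show "(\<lambda>s. ?w s * Z.S t f x - c * ?TT s) \<in> borel_measurable lborel" by (rule borel_measurable_integrable)
    show "AE s in lborel. ?y s = ?w s * Z.S t f x - c * ?TT s"
      by (rule AE2) (drule (1) pw, linarith)
  qed
  have "(\<integral>s. c * ?TT s \<partial>lborel) = (\<integral>s. ?w s * Z.S t f x - ?y s \<partial>lborel)"
  proof (rule integral_cong_AE[OF TTm])
    show "(\<lambda>s. ?w s * Z.S t f x - ?y s) \<in> borel_measurable lborel" using ym by simp
    show "AE s in lborel. c * ?TT s = ?w s * Z.S t f x - ?y s" by (rule AE2) (rule pw)
  qed
  also have "\<dots> = (1 - exp (- c * t)) * Z.S t f x - (\<integral>s. ?y s \<partial>lborel)" using wi yi by simp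
  also have "(\<integral>s. ?y s \<partial>lborel) = (Z.S t f x - T t f x) - (\<integral>r. exp (- c * (t - r)) * ?a r \<partial>lborel)"
    unfolding tri aQ using ai ea aint by simp
  finally have cT: "c * (\<integral>s. ?TT s \<partial>lborel) = T t f x - W t f x + (\<integral>r. exp (- c * (t - r)) * ?a r \<partial>lborel)"
    by (simp add: W_def algebra_simps)
  have "op_conv W (\<lambda>s f x. H s f x - c * T s f x) t f x = (\<integral>s. exp (- c * (t - s)) * ?a s - c * ?TT s \<partial>lborel)"
    unfolding op_conv_def W_def
    by (intro Bochner_Integration.integral_cong refl)
       (simp add: sfun_diff[OF op_family_sfun[OF Z.S_op_family] Z.G_Bb[OF f] Bb_cmult[OF Z.T_Bb[OF f]]]
         sfun_cmult[OF op_family_sfun[OF Z.S_op_family] Z.T_Bb[OF f]] algebra_simps)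
  also have "\<dots> = (\<integral>s. exp (- c * (t - s)) * ?a s \<partial>lborel) - c * (\<integral>s. ?TT s \<partial>lborel)" using ea TTi by simp
  finally show ?thesis using cT by simp
qed

text \<open>Both sides solve the same Volterra equation, so their difference is a fixed point of the
  convolution. Their growth rates differ, hence the common rate \<open>L\<close>.\<close>

lemma S_eq_expZ:
  assumes d: "dyson T (\<lambda>s f x. H s f x - c * T s f x) A0 l0 \<kappa>0" and f: "f \<in> Bb"
  shows "dyson.S T (\<lambda>s f x. H s f x - c * T s f x) t f x = exp (- c * t) * Z.S t f x"
proof -
  interpret D: dyson T "\<lambda>s f x. H s f x - c * T s f x" A0 l0 \<kappa>0 by (rule d)
  let ?G = "\<lambda>s f x. H s f x - c * T s f x"
  define W where "W = (\<lambda>t f x. exp (- c * t) * Z.S t f x)"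
  define L where "L = max l0 l'"
  have Wb: "exp_bounded W (\<lambda>_. 2 * A) L"
    unfolding exp_bounded_def
  proof (intro allI ballI)
    fix t x and f :: "'a \<Rightarrow> real" assume f: "f \<in> Bb"
    have b: "exp_bounded Z.S (\<lambda>_. 2 * A) L" by (rule exp_bounded_mono[OF Z.S_op_family Z.S_exp_bounded]) (auto simp: L_def)
    have "\<bar>W t f x\<bar> \<le> \<bar>Z.S t f x\<bar>"
    proof (cases "0 < t")
      case True then show ?thesis using c by (auto simp: W_def abs_mult intro!: mult_left_le_one_le)
    next
      case False then show ?thesis using op_family_nonpos[OF Z.S_op_family _ f] by (simp add: W_def)
    qed
    then show "\<bar>W t f x\<bar> \<le> 2 * A * exp (L * t) * supnorm f" using exp_boundedD[OF b f, of t x] by simp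
  qed
  have Sb: "exp_bounded D.S (\<lambda>_. 2 * A0) L" by (rule exp_bounded_mono[OF D.S_op_family D.S_exp_bounded]) (auto simp: L_def)
  have Gb: "exp_bounded ?G \<kappa>0 L" by (rule exp_bounded_mono[OF D.G D.Gb]) (auto simp: L_def)
  define E where "E = (\<lambda>t f x. D.S t f x - W t f x)"
  have Eb: "exp_bounded E (\<lambda>_. 2 * A0 + 2 * A) L"
    unfolding exp_bounded_def
  proof (intro allI ballI)
    fix t x and f :: "'a \<Rightarrow> real" assume f: "f \<in> Bb"
    show "\<bar>E t f x\<bar> \<le> (2 * A0 + 2 * A) * exp (L * t) * supnorm f"
      using exp_boundedD[OF Sb f, of t x] exp_boundedD[OF Wb f, of t x] by (simp add: E_def distrib_right)
  qed
  have Wop: "op_family W"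
    unfolding op_family_def
  proof (intro conjI allI ballI impI)
    fix t x
    show "sfun (\<lambda>f. W t f x)"
    proof (rule sfunI[where C="2 * A * exp (L * t)"])
      show "(\<lambda>n. W t (F n) x) \<longlonglongrightarrow> W t f x"
        if "\<And>n. F n \<in> Bb" "\<And>n x. \<bar>F n x\<bar> \<le> B" "\<And>x. (\<lambda>n. F n x) \<longlonglongrightarrow> f x" for F f B
        unfolding W_def by (intro tendsto_mult tendsto_const sfun_lim[OF op_family_sfun[OF Z.S_op_family] that])
      show "\<bar>W t f x\<bar> \<le> 2 * A * exp (L * t) * supnorm f" if "f \<in> Bb" for f by (rule exp_boundedD[OF Wb that])
    qed (simp_all add: W_def sfun_add[OF op_family_sfun[OF Z.S_op_family]] sfun_cmult[OF op_family_sfun[OF Z.S_op_family]] algebra_simps)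
  next
    fix f :: "'a \<Rightarrow> real" assume f: "f \<in> Bb"
    show "(\<lambda>(t, x). W t f x) \<in> borel_measurable (borel \<Otimes>\<^sub>M borel)"
      using op_family_measurable[OF Z.S_op_family f] by (simp add: W_def split_beta')
  next
    fix t :: real and f :: "'a \<Rightarrow> real" and x assume "t \<le> 0" "f \<in> Bb"
    then show "W t f x = 0" by (simp add: W_def op_family_nonpos[OF Z.S_op_family])
  qed
  have "E t f x = op_conv E ?G t f x" if f: "f \<in> Bb" for t f x
  proof -
    have "op_conv E ?G t f x = op_conv D.S ?G t f x - op_conv W ?G t f x"
      unfolding op_conv_def E_def
      by (rule Bochner_Integration.integral_diff)
         (rule op_conv_integrable[OF D.S_op_family Sb D.G Gb D.\<kappa> f] op_conv_integrable[OF Wop Wb D.G Gb D.\<kappa> f])+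
    then show ?thesis using D.S_eq[OF f, of t x] expZ_equation[OF f, of t x] by (simp add: E_def W_def)
  qed
  then have "E t f x = 0" using op_conv_fixed_point_zero[OF Eb D.G Gb D.\<kappa> D.half _ f] by blast
  then show ?thesis by (simp add: E_def W_def)
qed

end

section \<open>Regularity of functions in the Hoelder spaces\<close>

text \<open>One symbol for both regimes: for \<open>\<rho> \<le> 1\<close> the gradient terms of
  \<open>Bhat\<close> are absent, and a gradient set to 0 makes the same formulas valid.\<close>

definition vg :: "real \<Rightarrow> ('a::euclidean_space \<Rightarrow> real) \<Rightarrow> 'a \<Rightarrow> 'a" where
  "vg \<rho> h x = (if \<rho> \<le> 1 then 0 else grad h x)"

text \<open>The only consequence of membership in the Hoelder space that the argument uses: a first order Taylor
  expansion with remainder of order \<open>min \<rho> 2\<close>, where the gradient is dropped if \<open>\<rho> \<le> 1\<close>.\<close>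

definition reg :: "real \<Rightarrow> real \<Rightarrow> ('a::euclidean_space \<Rightarrow> real) \<Rightarrow> bool" where
  "reg \<rho> N h \<longleftrightarrow> h \<in> Bb \<and> (\<forall>x. \<bar>h x\<bar> \<le> N) \<and> (\<forall>x. norm (vg \<rho> h x) \<le> N) \<and>
     (\<forall>x y. \<bar>h (x + y) - h x - y \<bullet> vg \<rho> h x\<bar> \<le> N * norm y powr min \<rho> 2)"

lemma regD:
  assumes "reg \<rho> N h"
  shows "h \<in> Bb" "\<bar>h x\<bar> \<le> N" "norm (vg \<rho> h x) \<le> N"
    "\<bar>h (x + y) - h x - y \<bullet> vg \<rho> h x\<bar> \<le> N * norm y powr min \<rho> 2" "0 \<le> N"
  using assms order_trans[OF abs_ge_zero, of "h undefined" N] unfolding reg_def by blast+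

lemma pd_eqI:
  fixes h :: "'a::euclidean_space \<Rightarrow> real"
  assumes g: "1 < \<gamma>" and e: "norm e = 1"
    and t: "\<And>y. \<bar>h (x + y) - h x - y \<bullet> v\<bar> \<le> N * norm y powr \<gamma>"
  shows "pd h e x = e \<bullet> v"
  unfolding pd_def
proof (rule DERIV_imp_deriv, unfold DERIV_def)
  have b: "norm ((h (x + (0 + r) *\<^sub>R e) - h (x + 0 *\<^sub>R e)) / r - e \<bullet> v) \<le> N * \<bar>r\<bar> powr (\<gamma> - 1)" if r: "r \<noteq> 0" for r
  proof -
    have "(h (x + (0 + r) *\<^sub>R e) - h (x + 0 *\<^sub>R e)) / r - e \<bullet> v = (h (x + r *\<^sub>R e) - h x - (r *\<^sub>R e) \<bullet> v) / r"
      using r by (simp add: field_simps)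
    then have "norm ((h (x + (0 + r) *\<^sub>R e) - h (x + 0 *\<^sub>R e)) / r - e \<bullet> v) = \<bar>h (x + r *\<^sub>R e) - h x - (r *\<^sub>R e) \<bullet> v\<bar> / \<bar>r\<bar>"
      by simp
    also have "\<dots> \<le> (N * norm (r *\<^sub>R e) powr \<gamma>) / \<bar>r\<bar>" by (intro divide_right_mono t) simp
    also have "\<dots> = N * \<bar>r\<bar> powr (\<gamma> - 1)" using r e by (simp add: powr_diff)
    finally show ?thesis .
  qed
  have "((\<lambda>r::real. \<bar>r\<bar> powr (\<gamma> - 1)) \<longlongrightarrow> 0) (at 0)"
    by (rule tendsto_zero_powrI[where b="\<gamma> - 1"]) (use g in \<open>auto intro!: tendsto_eq_intros\<close>)
  then have "((\<lambda>r. N * \<bar>r\<bar> powr (\<gamma> - 1)) \<longlongrightarrow> 0) (at 0)" using tendsto_mult_right_zero by blast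
  then have "((\<lambda>r. (h (x + (0 + r) *\<^sub>R e) - h (x + 0 *\<^sub>R e)) / r - e \<bullet> v) \<longlongrightarrow> 0) (at 0)"
    by (rule Lim_null_comparison[rotated]) (use b in \<open>auto simp: eventually_at_filter\<close>)
  then show "((\<lambda>r. (h (x + (0 + r) *\<^sub>R e) - h (x + 0 *\<^sub>R e)) / r) \<longlongrightarrow> e \<bullet> v) (at 0)"
    by (rule LIM_zero_cancel)
qed

lemma grad_eqI:
  fixes h :: "'a::euclidean_space \<Rightarrow> real"
  assumes g: "1 < \<gamma>" and t: "\<And>y. \<bar>h (x + y) - h x - y \<bullet> v\<bar> \<le> N * norm y powr \<gamma>"
  shows "grad h x = v"
  unfolding grad_def using pd_eqI[OF g _ t] euclidean_representation[of v]
  by (simp add: inner_commute cong: sum.cong)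

text \<open>A Taylor bound of order above 1 determines the gradient. Gradients of sums, limits and
  time integrals are thus found by adding, passing to the limit or integrating in the Taylor bound,
  without differentiating under an integral.\<close>

lemma vg_eqI:
  fixes h :: "'a::euclidean_space \<Rightarrow> real"
  assumes t: "\<And>y. \<bar>h (x + y) - h x - y \<bullet> v\<bar> \<le> N * norm y powr min \<rho> 2" and v: "\<rho> \<le> 1 \<Longrightarrow> v = 0"
  shows "vg \<rho> h x = v"
proof (cases "\<rho> \<le> 1")
  case False
  then show ?thesis using grad_eqI[of "min \<rho> 2" h x v N] t by (simp add: vg_def)
qed (simp add: vg_def v)

text \<open>Difference quotients approximate the gradient at a rate that depends only on
  \<open>N\<close>. So the values of a function control its gradient, which is used for limits, for
  joint measurability and for decay at infinity.\<close>

lemma reg_inner_bound: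
  assumes r: "reg \<rho> N h" and \<rho>: "1 < \<rho>" and s: "0 < s" and e: "norm e = 1"
  shows "\<bar>(h (x + s *\<^sub>R e) - h x) / s - e \<bullet> vg \<rho> h x\<bar> \<le> N * s powr (min \<rho> 2 - 1)"
proof -
  have "(h (x + s *\<^sub>R e) - h x) / s - e \<bullet> vg \<rho> h x = (h (x + s *\<^sub>R e) - h x - (s *\<^sub>R e) \<bullet> vg \<rho> h x) / s"
    using s by (simp add: field_simps)
  then have "\<bar>(h (x + s *\<^sub>R e) - h x) / s - e \<bullet> vg \<rho> h x\<bar> = \<bar>h (x + s *\<^sub>R e) - h x - (s *\<^sub>R e) \<bullet> vg \<rho> h x\<bar> / s"
    using s by simp
  also have "\<dots> \<le> (N * norm (s *\<^sub>R e) powr min \<rho> 2) / s" by (intro divide_right_mono regD(4)[OF r]) (use s in simp)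
  also have "\<dots> = N * s powr (min \<rho> 2 - 1)" using s e by (simp add: powr_diff)
  finally show ?thesis .
qed

lemma small_powr:
  fixes a N e :: real assumes a: "0 < a" and e: "0 < e" and N: "0 \<le> N"
  shows "\<exists>s>0. N * s powr a < e"
proof -
  have "((\<lambda>s::real. s powr a) \<longlongrightarrow> 0) (at_right 0)"
    by (rule tendsto_zero_powrI[where b=a])
       (use a in \<open>auto intro!: tendsto_eq_intros eventually_at_right_less[THEN eventually_mono]\<close>)
  then have "((\<lambda>s. N * s powr a) \<longlongrightarrow> 0) (at_right 0)" using tendsto_mult_right_zero by blast
  then have "eventually (\<lambda>s. N * s powr a < e) (at_right 0)" using e by (rule order_tendstoD)
  then have "eventually (\<lambda>s. 0 < s \<and> N * s powr a < e) (at_right 0)"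
    using eventually_at_right_less[of "0::real"] by (rule eventually_elim2) simp
  from eventually_happens[OF this] show ?thesis by simp
qed

text \<open>Gradients converge although only the functions are assumed to: they are close, uniformly
  in \<open>n\<close>, to difference quotients with a small fixed step, and these converge. Hence
  the class is closed under pointwise limits.\<close>

lemma reg_limit:
  fixes H :: "nat \<Rightarrow> 'a::euclidean_space \<Rightarrow> real"
  assumes r: "\<And>n. reg \<rho> N (H n)" and lim: "\<And>x. (\<lambda>n. H n x) \<longlonglongrightarrow> h x"
  shows "reg \<rho> N h" and "(\<lambda>n. vg \<rho> (H n) x) \<longlonglongrightarrow> vg \<rho> h x"
proof -
  have hB: "h \<in> Bb" by (rule Bb_limit[OF regD(1)[OF r] regD(2)[OF r] lim])
  have hb: "\<bar>h x\<bar> \<le> N" for x by (rule LIMSEQ_le_const2[OF tendsto_rabs[OF lim]]) (use regD(2)[OF r] in auto)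
  have N: "0 \<le> N" by (rule regD(5)[OF r])
  have ex: "\<exists>v. (\<lambda>n. vg \<rho> (H n) x) \<longlonglongrightarrow> v" for x
  proof (cases "\<rho> \<le> 1")
    case True then show ?thesis by (auto simp: vg_def)
  next
    case False
    have "Cauchy (\<lambda>n. e \<bullet> vg \<rho> (H n) x)" if e: "e \<in> Basis" for e
    proof (rule metric_CauchyI)
      fix \<epsilon> :: real assume \<epsilon>: "0 < \<epsilon>"
      \<comment> \<open>Three errors of size \<open>\<epsilon>/4\<close> add up: one for each of the
        two gradients, and one between the two difference quotients.\<close>
      obtain s where s: "0 < s" "N * s powr (min \<rho> 2 - 1) < \<epsilon>/4"
        using small_powr[of "min \<rho> 2 - 1" "\<epsilon>/4" N] False \<epsilon> N by auto
      have "(\<lambda>n. (H n (x + s *\<^sub>R e) - H n x) / s) \<longlonglongrightarrow> (h (x + s *\<^sub>R e) - h x) / s"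
        using s by (intro tendsto_intros lim) auto
      then have "Cauchy (\<lambda>n. (H n (x + s *\<^sub>R e) - H n x) / s)" by (rule LIMSEQ_imp_Cauchy)
      from metric_CauchyD[OF this, of "\<epsilon>/4"] \<epsilon>
      obtain M where M: "\<forall>m\<ge>M. \<forall>n\<ge>M. dist ((H m (x + s *\<^sub>R e) - H m x) / s) ((H n (x + s *\<^sub>R e) - H n x) / s) < \<epsilon>/4"
        by auto
      have "dist (e \<bullet> vg \<rho> (H m) x) (e \<bullet> vg \<rho> (H n) x) < \<epsilon>" if "m \<ge> M" "n \<ge> M" for m n
      proof -
        have b: "\<bar>(H j (x + s *\<^sub>R e) - H j x) / s - e \<bullet> vg \<rho> (H j) x\<bar> < \<epsilon>/4" for j
          using reg_inner_bound[OF r _ s(1), of e j x] s(2) False e by (simp add: order_le_less_trans)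
        show ?thesis using b[of m] b[of n] M[rule_format, OF that] unfolding dist_real_def by linarith
      qed
      then show "\<exists>M. \<forall>m\<ge>M. \<forall>n\<ge>M. dist (e \<bullet> vg \<rho> (H m) x) (e \<bullet> vg \<rho> (H n) x) < \<epsilon>" by blast
    qed
    then have "\<exists>L. (\<lambda>n. e \<bullet> vg \<rho> (H n) x) \<longlonglongrightarrow> L" if "e \<in> Basis" for e
      using that Cauchy_convergent_iff convergent_def by blast
    then obtain L where L: "\<And>e. e \<in> Basis \<Longrightarrow> (\<lambda>n. e \<bullet> vg \<rho> (H n) x) \<longlonglongrightarrow> L e" by metis
    have "(\<lambda>n. \<Sum>e\<in>Basis. (e \<bullet> vg \<rho> (H n) x) *\<^sub>R e) \<longlonglongrightarrow> (\<Sum>e\<in>Basis. L e *\<^sub>R e)"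
      by (intro tendsto_sum tendsto_scaleR tendsto_const L)
    moreover have "(\<Sum>e\<in>Basis. (e \<bullet> u) *\<^sub>R e) = u" for u :: 'a
      using euclidean_representation[of u] by (simp add: inner_commute)
    ultimately show ?thesis by auto
  qed
  obtain v where v: "\<And>x. (\<lambda>n. vg \<rho> (H n) x) \<longlonglongrightarrow> v x" using ex by metis
  have tay: "\<bar>h (x + y) - h x - y \<bullet> v x\<bar> \<le> N * norm y powr min \<rho> 2" for x y
  proof (rule LIMSEQ_le_const2)
    show "(\<lambda>n. \<bar>H n (x + y) - H n x - y \<bullet> vg \<rho> (H n) x\<bar>) \<longlonglongrightarrow> \<bar>h (x + y) - h x - y \<bullet> v x\<bar>"
      by (intro tendsto_intros lim v)
  qed (use regD(4)[OF r] in auto)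
  have vgv: "vg \<rho> h x = v x" for x
  proof (rule vg_eqI[OF tay])
    assume "\<rho> \<le> 1"
    then have "(\<lambda>n. vg \<rho> (H n) x) = (\<lambda>n. 0)" by (simp add: vg_def)
    then show "v x = 0" using v[of x] LIMSEQ_unique tendsto_const by metis
  qed
  show "(\<lambda>n. vg \<rho> (H n) x) \<longlonglongrightarrow> vg \<rho> h x" using v vgv by simp
  have "norm (v x) \<le> N" for x by (rule LIMSEQ_le_const2[OF tendsto_norm[OF v]]) (use regD(3)[OF r] in auto)
  then show "reg \<rho> N h" unfolding reg_def using hB hb tay by (simp add: vgv)
qed

lemma reg_mono: "reg \<rho> N h \<Longrightarrow> N \<le> N' \<Longrightarrow> reg \<rho> N' h"
  unfolding reg_def by (meson order_trans mult_right_mono powr_ge_zero)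

section \<open>From Hoelder norms to first order Taylor expansions\<close>

lemma differentiable_has_derivative_grad:
  fixes g :: "'a::euclidean_space \<Rightarrow> real"
  assumes "g differentiable at z"
  shows "(g has_derivative (\<lambda>y. y \<bullet> grad g z)) (at z)"
proof -
  obtain g' where g': "(g has_derivative g') (at z)" using assms unfolding differentiable_def by blast
  have lin: "linear g'" using has_derivative_linear[OF g'] .
  have pd: "pd g e z = g' e" for e
  proof -
    have "((\<lambda>r. g (z + r *\<^sub>R e)) has_derivative (\<lambda>r. g' (r *\<^sub>R e))) (at 0)"
      by (rule has_derivative_compose[where g=g and f="\<lambda>r. z + r *\<^sub>R e"]) (auto intro!: derivative_eq_intros simp: g')
    then have "((\<lambda>r. g (z + r *\<^sub>R e)) has_real_derivative g' e) (at 0)"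
      unfolding has_field_derivative_def using linear_cmul[OF lin, of _ e] by (simp add: mult_commute_abs)
    then show ?thesis unfolding pd_def by (rule DERIV_imp_deriv)
  qed
  have "g' y = y \<bullet> grad g z" for y
  proof -
    have "g' y = g' (\<Sum>e\<in>Basis. (y \<bullet> e) *\<^sub>R e)" by (simp add: euclidean_representation)
    also have "\<dots> = (\<Sum>e\<in>Basis. (y \<bullet> e) * g' e)" by (simp add: linear_sum[OF lin] linear_cmul[OF lin])
    also have "\<dots> = y \<bullet> grad g z" by (simp add: grad_def inner_sum_right pd mult.commute)
    finally show ?thesis .
  qed
  then have "g' = (\<lambda>y. y \<bullet> grad g z)" by auto
  with g' show ?thesis by simp
qed

lemma grad_mvt:
  fixes g :: "'a::euclidean_space \<Rightarrow> real"
  assumes d: "\<And>z. g differentiable at z"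
  shows "\<exists>\<theta>. 0 < \<theta> \<and> \<theta> < 1 \<and> g (x + y) - g x = y \<bullet> grad g (x + \<theta> *\<^sub>R y)"
proof -
  have der: "((\<lambda>r. g (x + r *\<^sub>R y)) has_real_derivative (y \<bullet> grad g (x + r *\<^sub>R y))) (at r)" for r
  proof -
    have "((\<lambda>r. g (x + r *\<^sub>R y)) has_derivative (\<lambda>s. (s *\<^sub>R y) \<bullet> grad g (x + r *\<^sub>R y))) (at r)"
      by (rule has_derivative_compose[where g=g and f="\<lambda>r. x + r *\<^sub>R y"])
         (auto intro!: derivative_eq_intros differentiable_has_derivative_grad d)
    then show ?thesis unfolding has_field_derivative_def by (simp add: mult_commute_abs)
  qed
  have "\<exists>z>0. z < 1 \<and> g (x + 1 *\<^sub>R y) - g (x + 0 *\<^sub>R y) = (1 - 0) * (y \<bullet> grad g (x + z *\<^sub>R y))"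
    by (rule MVT2) (auto intro: der)
  then show ?thesis by auto
qed

lemma abs_inner_le_sum:
  fixes y u :: "'a::euclidean_space"
  assumes "\<And>e. e \<in> Basis \<Longrightarrow> \<bar>u \<bullet> e\<bar> \<le> K"
  shows "\<bar>y \<bullet> u\<bar> \<le> real DIM('a) * K * norm y"
proof -
  have "y \<bullet> u = (\<Sum>e\<in>Basis. (y \<bullet> e) * (u \<bullet> e))" by (rule euclidean_inner)
  also have "\<bar>\<dots>\<bar> \<le> (\<Sum>e\<in>Basis. \<bar>(y \<bullet> e) * (u \<bullet> e)\<bar>)" by (rule sum_abs)
  also have "\<dots> \<le> (\<Sum>e\<in>(Basis::'a set). norm y * K)"
    by (intro sum_mono) (auto simp: abs_mult intro!: mult_mono assms Basis_le_norm)
  finally show ?thesis by (simp add: mult_ac)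
qed

lemma grad_inner: "e \<in> Basis \<Longrightarrow> grad h x \<bullet> e = pd h e x"
  by (simp add: grad_def inner_sum_left inner_Basis if_distrib cong: if_cong)

context
  fixes \<rho> :: real and h :: "'a::euclidean_space \<Rightarrow> real"
  assumes h: "h \<in> Cb_rho \<rho>"
begin

lemma Cb_rho_Dlist_Bb: "set es \<subseteq> Basis \<Longrightarrow> length es \<le> hord \<rho> \<Longrightarrow> Dlist es h \<in> Bb"
  using h unfolding Cb_rho_def Bb_def by (auto intro: borel_measurable_continuous_onI)

text \<open>A supremum of reals is informative only over a nonempty set with an upper bound. The
  bound is the Hoelder condition, and a basis vector together with 0 gives a pair of distinct
  points.\<close>

lemma Cb_rho_quotient:
  assumes es: "set es \<subseteq> Basis" "length es = hord \<rho>"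
  defines "Q \<equiv> \<lambda>p. \<bar>Dlist es h (fst p) - Dlist es h (snd p)\<bar> / dist (fst p) (snd p) powr (\<rho> - real (hord \<rho>))"
  shows "bdd_above (Q ` {(x,y). x \<noteq> y})" "0 \<le> (SUP p\<in>{(x,y). x \<noteq> y}. Q p)"
proof -
  obtain C where C: "\<forall>x y. \<bar>Dlist es h x - Dlist es h y\<bar> \<le> C * dist x y powr (\<rho> - real (hord \<rho>))"
    using h es unfolding Cb_rho_def by blast
  show b: "bdd_above (Q ` {(x,y). x \<noteq> y})"
  proof (rule bdd_aboveI2)
    fix p :: "'a \<times> 'a" assume "p \<in> {(x,y). x \<noteq> y}"
    then have "dist (fst p) (snd p) powr (\<rho> - real (hord \<rho>)) > 0" by auto
    then show "Q p \<le> C" using C unfolding Q_def by (simp add: divide_le_eq)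
  qed
  obtain e :: 'a where e: "e \<in> Basis" using nonempty_Basis by blast
  then have "(0, e) \<in> {(x,y). x \<noteq> y}" by auto
  from cSUP_upper[OF this b] have "Q (0, e) \<le> (SUP p\<in>{(x,y). x \<noteq> y}. Q p)" .
  moreover have "0 \<le> Q (0, e)" unfolding Q_def by simp
  ultimately show "0 \<le> (SUP p\<in>{(x,y). x \<noteq> y}. Q p)" by simp
qed

lemma Cb_rho_norm_bounds:
  shows "set es \<subseteq> Basis \<Longrightarrow> length es \<le> hord \<rho> \<Longrightarrow> \<bar>Dlist es h x\<bar> \<le> Cb_rho_norm \<rho> h"
    and "set es \<subseteq> Basis \<Longrightarrow> length es = hord \<rho> \<Longrightarrow>
      \<bar>Dlist es h x - Dlist es h y\<bar> \<le> Cb_rho_norm \<rho> h * dist x y powr (\<rho> - real (hord \<rho>))"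
    and "0 \<le> Cb_rho_norm \<rho> h"
proof -
  let ?Q = "\<lambda>es p. \<bar>Dlist es h (fst p) - Dlist es h (snd p)\<bar> / dist (fst p) (snd p) powr (\<rho> - real (hord \<rho>))"
  let ?I = "{es. set es \<subseteq> (Basis :: 'a set) \<and> length es \<le> hord \<rho>}" and ?J = "{es. set es \<subseteq> (Basis :: 'a set) \<and> length es = hord \<rho>}"
  let ?X = "\<Sum>es\<in>?I. supnorm (Dlist es h)" and ?Y = "\<Sum>es\<in>?J. (SUP p\<in>{(x,y). x \<noteq> y}. ?Q es p)"
  have eq: "Cb_rho_norm \<rho> h = ?X + ?Y" unfolding Cb_rho_norm_def ..
  have fI: "finite ?I" and fJ: "finite ?J" by (auto intro: finite_lists_length_le finite_lists_length_eq)
  have X: "0 \<le> ?X" by (intro sum_nonneg) (auto intro: supnorm_nonneg Cb_rho_Dlist_Bb)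
  have Y: "0 \<le> ?Y" by (intro sum_nonneg) (auto intro: Cb_rho_quotient)
  show "0 \<le> Cb_rho_norm \<rho> h" using eq X Y by simp
  show "\<bar>Dlist es h x\<bar> \<le> Cb_rho_norm \<rho> h" if es: "set es \<subseteq> Basis" "length es \<le> hord \<rho>"
  proof -
    have "\<bar>Dlist es h x\<bar> \<le> supnorm (Dlist es h)" by (rule supnorm_ge[OF Cb_rho_Dlist_Bb[OF es]])
    also have "\<dots> \<le> ?X" by (rule member_le_sum) (use fI es in \<open>auto intro: supnorm_nonneg Cb_rho_Dlist_Bb\<close>)
    finally show ?thesis using eq Y by simp
  qed
  show "\<bar>Dlist es h x - Dlist es h y\<bar> \<le> Cb_rho_norm \<rho> h * dist x y powr (\<rho> - real (hord \<rho>))"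
    if es: "set es \<subseteq> Basis" "length es = hord \<rho>"
  proof (cases "x = y")
    case False
    have "?Q es (x, y) \<le> (SUP p\<in>{(x,y). x \<noteq> y}. ?Q es p)"
      by (rule cSUP_upper[OF _ Cb_rho_quotient(1)[OF es]]) (use False in simp)
    also have "\<dots> \<le> ?Y" by (rule member_le_sum) (use fJ es in \<open>auto intro: Cb_rho_quotient\<close>)
    finally have "?Q es (x, y) \<le> Cb_rho_norm \<rho> h" using eq X by simp
    moreover have "0 < dist x y powr (\<rho> - real (hord \<rho>))" using False by simp
    ultimately show ?thesis by (simp add: divide_le_eq)
  qed simp
qed

text \<open>For \<open>1 < \<rho> \<le> 2\<close> the gradient is Hoelder of exponent
  \<open>\<rho> - 1\<close>; for \<open>\<rho> > 2\<close> bounded second derivatives make it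
  Lipschitz, whence \<open>min \<rho> 2\<close>. The mean value theorem yields the remainder. One
  factor of the squared dimension comes from summing the coordinates of the gradient increment, the
  other from summing second derivatives.\<close>

lemma Cb_rho_reg:
  assumes \<rho>: "0 < \<rho>"
  shows "reg \<rho> (real DIM('a) ^ 2 * Cb_rho_norm \<rho> h) h"
proof -
  let ?N = "Cb_rho_norm \<rho> h" and ?d = "real DIM('a)"
  note b = Cb_rho_norm_bounds
  have d1: "1 \<le> ?d" by (simp add: Suc_leI)
  have d2: "1 \<le> ?d ^ 2" using d1 by simp
  have dd: "?d \<le> ?d ^ 2" using d1 by (simp add: power2_eq_square)
  have NN: "?N \<le> ?d ^ 2 * ?N" using mult_right_mono[OF d2 b(3)] by simp
  have hB: "h \<in> Bb" using Cb_rho_Dlist_Bb[of "[]"] by simp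
  have hb: "\<bar>h x\<bar> \<le> ?d ^ 2 * ?N" for x using b(1)[of "[]" x] NN by simp
  show ?thesis
  proof (cases "\<rho> \<le> 1")
    case True
    have "\<lceil>\<rho>\<rceil> = 1" using True \<rho> by (simp add: ceiling_eq_iff)
    then have ho: "hord \<rho> = 0" by (simp add: hord_def)
    have "\<bar>h (x + y) - h x\<bar> \<le> ?d ^ 2 * ?N * norm y powr min \<rho> 2" for x y
    proof -
      have "\<bar>h (x + y) - h x\<bar> \<le> ?N * norm y powr \<rho>" using b(2)[of "[]" "x + y" x] by (simp add: ho dist_norm)
      also have "\<dots> \<le> ?d ^ 2 * ?N * norm y powr \<rho>" by (rule mult_right_mono[OF NN]) simp
      finally show ?thesis using True by simp
    qed
    moreover have "0 \<le> ?d ^ 2 * ?N" using b(3) by simp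
    ultimately show ?thesis unfolding reg_def using True hB hb by (simp add: vg_def)
  next
    case False
    have ho1: "1 \<le> hord \<rho>" using False by (simp add: hord_def le_nat_iff)
    have hdiff: "h differentiable at x" for x
      using h ho1 unfolding Cb_rho_def by (auto dest: spec[of _ "[]"])
    have pdb: "\<bar>pd h e x\<bar> \<le> ?N" if "e \<in> Basis" for e x using b(1)[of "[e]" x] ho1 that by simp
    let ?\<alpha> = "min \<rho> 2 - 1"
    have hold: "\<bar>pd h e x - pd h e z\<bar> \<le> ?d * ?N * norm (x - z) powr ?\<alpha>" if e: "e \<in> Basis" for e x z
    proof (cases "\<rho> \<le> 2")
      case True
      have "\<lceil>\<rho>\<rceil> = 2" using True False by (simp add: ceiling_eq_iff)
      then have ho: "hord \<rho> = 1" by (simp add: hord_def)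
      have "\<bar>pd h e x - pd h e z\<bar> \<le> ?N * norm (x - z) powr (\<rho> - 1)" using b(2)[of "[e]" x z] e ho by (simp add: dist_norm)
      also have "\<dots> \<le> ?d * ?N * norm (x - z) powr (\<rho> - 1)"
        using mult_right_mono[OF d1 b(3)] by (intro mult_right_mono) auto
      finally show ?thesis using True by simp
    next
      case r2: False
      have ho2: "2 \<le> hord \<rho>" using r2 by (simp add: hord_def le_nat_iff)
      have pdiff: "pd h e differentiable at x" for x
      proof -
        have "set [e] \<subseteq> Basis \<and> length [e] < hord \<rho> \<longrightarrow> (\<forall>x. Dlist [e] h differentiable at x)"
          using h unfolding Cb_rho_def by blast
        then show ?thesis using e ho2 by simp
      qed
      obtain \<theta> where th: "pd h e (z + (x - z)) - pd h e z = (x - z) \<bullet> grad (pd h e) (z + \<theta> *\<^sub>R (x - z))"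
        using grad_mvt[OF pdiff, of z "x - z"] by blast
      have "\<bar>(x - z) \<bullet> grad (pd h e) (z + \<theta> *\<^sub>R (x - z))\<bar> \<le> ?d * ?N * norm (x - z)"
      proof (rule abs_inner_le_sum)
        fix e' :: 'a assume e': "e' \<in> Basis"
        show "\<bar>grad (pd h e) (z + \<theta> *\<^sub>R (x - z)) \<bullet> e'\<bar> \<le> ?N"
          using b(1)[of "[e', e]" "z + \<theta> *\<^sub>R (x - z)"] e e' ho2 by (simp add: grad_inner)
      qed
      then show ?thesis using th r2 by simp
    qed
    have vgh: "vg \<rho> h x = grad h x" for x using False by (simp add: vg_def)
    have "norm (grad h x) \<le> ?d ^ 2 * ?N" for x
    proof -
      have "norm (grad h x) \<le> (\<Sum>e\<in>Basis. \<bar>grad h x \<bullet> e\<bar>)" by (rule norm_le_l1)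
      also have "\<dots> \<le> (\<Sum>e\<in>(Basis::'a set). ?N)" by (intro sum_mono) (simp add: grad_inner pdb)
      also have "\<dots> = ?d * ?N" by simp
      also have "\<dots> \<le> ?d ^ 2 * ?N" by (rule mult_right_mono[OF dd b(3)])
      finally show ?thesis .
    qed
    moreover have "\<bar>h (x + y) - h x - y \<bullet> grad h x\<bar> \<le> ?d ^ 2 * ?N * norm y powr min \<rho> 2" for x y
    proof (cases "y = 0")
      case y: False
      obtain \<theta> where th: "0 < \<theta>" "\<theta> < 1" "h (x + y) - h x = y \<bullet> grad h (x + \<theta> *\<^sub>R y)"
        using grad_mvt[OF hdiff, of x y] by blast
      have "h (x + y) - h x - y \<bullet> grad h x = y \<bullet> (grad h (x + \<theta> *\<^sub>R y) - grad h x)"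
        using th(3) by (simp add: inner_diff_right)
      also have "\<bar>\<dots>\<bar> \<le> ?d * (?d * ?N * norm y powr ?\<alpha>) * norm y"
      proof (rule abs_inner_le_sum)
        fix e :: 'a assume e: "e \<in> Basis"
        have "\<bar>(grad h (x + \<theta> *\<^sub>R y) - grad h x) \<bullet> e\<bar> \<le> ?d * ?N * norm (x + \<theta> *\<^sub>R y - x) powr ?\<alpha>"
          using hold[OF e, of "x + \<theta> *\<^sub>R y" x] by (simp add: inner_diff_left grad_inner[OF e])
        also have "\<dots> \<le> ?d * ?N * norm y powr ?\<alpha>"
          using th(1,2) False b(3) by (intro mult_left_mono powr_mono2) (auto intro!: mult_left_le_one_le)
        finally show "\<bar>(grad h (x + \<theta> *\<^sub>R y) - grad h x) \<bullet> e\<bar> \<le> ?d * ?N * norm y powr ?\<alpha>" .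
      qed
      also have "\<dots> = ?d ^ 2 * ?N * (norm y powr ?\<alpha> * norm y)" by (simp add: power2_eq_square)
      also have "norm y powr ?\<alpha> * norm y = norm y powr min \<rho> 2" using y by (simp add: powr_diff)
      finally show ?thesis .
    qed simp
    ultimately show ?thesis unfolding reg_def vgh using hB hb by blast
  qed
qed

end

section \<open>The perturbing operator\<close>

lemma vg_add:
  assumes "reg \<rho> N h" "reg \<rho> N' h'"
  shows "vg \<rho> (\<lambda>x. h x + h' x) x = vg \<rho> h x + vg \<rho> h' x"
proof (rule vg_eqI)
  fix y
  have "h (x + y) + h' (x + y) - (h x + h' x) - y \<bullet> (vg \<rho> h x + vg \<rho> h' x)
      = (h (x + y) - h x - y \<bullet> vg \<rho> h x) + (h' (x + y) - h' x - y \<bullet> vg \<rho> h' x)" by (simp add: inner_add_right)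
  also have "\<bar>\<dots>\<bar> \<le> N * norm y powr min \<rho> 2 + N' * norm y powr min \<rho> 2"
    by (rule order_trans[OF abs_triangle_ineq add_mono[OF regD(4)[OF assms(1)] regD(4)[OF assms(2)]]])
  finally show "\<bar>h (x + y) + h' (x + y) - (h x + h' x) - y \<bullet> (vg \<rho> h x + vg \<rho> h' x)\<bar> \<le> (N + N') * norm y powr min \<rho> 2"
    by (simp add: distrib_right)
qed (simp add: vg_def)

lemma reg_scale:
  assumes "reg \<rho> N h"
  shows "vg \<rho> (\<lambda>x. c * h x) x = c *\<^sub>R vg \<rho> h x" and "reg \<rho> (\<bar>c\<bar> * N) (\<lambda>x. c * h x)"
proof -
  have tay: "\<bar>c * h (x + y) - c * h x - y \<bullet> (c *\<^sub>R vg \<rho> h x)\<bar> \<le> (\<bar>c\<bar> * N) * norm y powr min \<rho> 2" for x y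
  proof -
    have "c * h (x + y) - c * h x - y \<bullet> (c *\<^sub>R vg \<rho> h x) = c * (h (x + y) - h x - y \<bullet> vg \<rho> h x)" by (simp add: algebra_simps)
    also have "\<bar>\<dots>\<bar> \<le> \<bar>c\<bar> * (N * norm y powr min \<rho> 2)" unfolding abs_mult by (intro mult_left_mono regD(4)[OF assms]) simp
    finally show ?thesis by (simp add: mult.assoc)
  qed
  have v: "vg \<rho> (\<lambda>x. c * h x) x = c *\<^sub>R vg \<rho> h x" for x by (rule vg_eqI[OF tay]) (simp add: vg_def)
  show "vg \<rho> (\<lambda>x. c * h x) x = c *\<^sub>R vg \<rho> h x" by (rule v)
  show "reg \<rho> (\<bar>c\<bar> * N) (\<lambda>x. c * h x)"
    unfolding reg_def v using tay
    by (auto simp: abs_mult Bb_cmult regD[OF assms] intro!: mult_left_mono)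
qed

lemma reg_zero: "0 \<le> N \<Longrightarrow> reg \<rho> N (\<lambda>x. 0)"
proof -
  assume N: "0 \<le> N"
  have "vg \<rho> (\<lambda>x. 0) x = 0" for x :: 'a by (rule vg_eqI[where N=0]) auto
  then show ?thesis unfolding reg_def using N by (auto simp: Bb_const)
qed

text \<open>The bounds on \<open>b\<close> and on the integrals of \<open>\<mu>\<close> enter as
  explicit numbers, because the smallness condition on the semigroup is stated in terms of
  them.\<close>

locale levy =
  fixes \<rho> \<beta> :: real and chi :: "'a::euclidean_space \<Rightarrow> real" and b :: "'a \<Rightarrow> 'a" and \<mu> :: "'a \<Rightarrow> 'a measure"
    and bB mB :: real
  assumes rho_pos: "\<rho> > 0"
    and chi_meas[measurable]: "chi \<in> borel_measurable borel"
    and chi_bounds: "\<forall>y. indicator (ball 0 1) y \<le> chi y \<and> chi y \<le> indicator (ball 0 2) y"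
    and b_meas[measurable]: "b \<in> borel_measurable borel"
    and b_bdd: "\<And>x. norm (b x) \<le> bB"
    and mu_sets: "\<And>x. sets (\<mu> x) = sets borel"
    and mu_meas: "\<forall>f::'a \<Rightarrow> real. continuous_on UNIV f \<and> compact (closure {y. f y \<noteq> 0})
                       \<and> 0 \<notin> closure {y. f y \<noteq> 0}
                   \<longrightarrow> (\<lambda>x. \<integral>y. f y \<partial>\<mu> x) \<in> borel_measurable borel"
    and beta: "0 < \<beta>" "\<beta> < 2" "\<beta> < \<rho>"
    and mB: "0 \<le> mB" and mu_int: "\<And>x. (\<integral>\<^sup>+ y. ennreal (min (norm y powr \<beta>) 1) \<partial>\<mu> x) \<le> ennreal mB"
begin

definition w :: "'a \<Rightarrow> real" where "w y = min (norm y powr \<beta>) 1"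

text \<open>\<open>\<mu> x\<close> may be infinite near 0. Weighted by \<open>w\<close> it becomes a
  measure of mass at most \<open>mB\<close>, accessible to the theory of \<open>sfun\<close>, and
  \<open>w 0 = 0\<close> leaves no mass at the origin. The singularity reappears in the quotient
  \<open>q\<close>.\<close>

definition k :: "'a \<Rightarrow> 'a measure" where "k x = density (\<mu> x) (\<lambda>y. ennreal (w y))"

lemma w_nonneg: "0 \<le> w y" and w_le_1: "w y \<le> 1" and w_0: "w 0 = 0" and w_pos: "y \<noteq> 0 \<Longrightarrow> 0 < w y"
  by (auto simp: w_def)

lemma w_cont: "continuous_on UNIV w"
  unfolding w_def using beta by (intro continuous_intros continuous_on_powr') auto

lemma w_meas[measurable]: "w \<in> borel_measurable borel"
  using w_cont by (rule borel_measurable_continuous_onI)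

lemma mu_measurable: "f \<in> borel_measurable borel \<Longrightarrow> f \<in> borel_measurable (\<mu> x)"
  by (simp add: measurable_cong_sets[OF mu_sets refl])

lemma k_sets: "sets (k x) = sets borel" by (simp add: k_def mu_sets)

lemma k_space: "space (k x) = UNIV" using sets_eq_imp_space_eq[OF k_sets] by simp

lemma k_mass: "emeasure (k x) UNIV \<le> ennreal mB"
proof -
  have "emeasure (k x) UNIV = (\<integral>\<^sup>+ y. ennreal (w y) * indicator UNIV y \<partial>\<mu> x)"
    unfolding k_def by (rule emeasure_density) (use mu_sets mu_measurable[of w] in auto)
  also have "\<dots> \<le> ennreal mB" using mu_int[of x] by (simp add: w_def)
  finally show ?thesis .
qed

lemma k_finite: "finite_measure (k x)"
proof (rule finite_measureI)
  show "emeasure (k x) (space (k x)) \<noteq> \<infinity>" using k_mass[of x] k_space[of x]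
    by (metis ennreal_neq_top infinity_ennreal_def neq_top_trans)
qed

lemma k_measure_le: "measure (k x) A \<le> mB"
proof -
  interpret finite_measure "k x" by (rule k_finite)
  have "ennreal (measure (k x) UNIV) \<le> ennreal mB" using k_mass[of x] by (simp add: emeasure_eq_measure)
  then have "measure (k x) UNIV \<le> mB" using mB by simp
  then show ?thesis using bounded_measure[of A] k_space[of x] by simp
qed

lemma integral_k:
  assumes "f \<in> borel_measurable borel" shows "(\<integral>y. f y \<partial>k x) = (\<integral>y. w y * f y \<partial>\<mu> x)"
  unfolding k_def using mu_measurable[OF assms] mu_measurable[OF w_meas] w_nonneg
  by (subst integral_density) auto

lemma k_zero: "measure (k x) {0} = 0"
proof -
  have "measure (k x) {0} = (\<integral>y. indicator {0} y \<partial>k x)" using k_sets k_space by simp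
  also have "\<dots> = (\<integral>y. w y * indicator {0} y \<partial>\<mu> x)" by (rule integral_k) simp
  also have "(\<lambda>y. w y * indicator {0} y) = (\<lambda>y. 0)" by (auto simp: fun_eq_iff indicator_eq_0_iff w_0)
  finally show ?thesis by simp
qed

text \<open>Measurability of \<open>\<mu>\<close> is given for continuous functions with compact
  support off the origin. The functions \<open>w y * F n y\<close> are of this kind, and
  \<open>F n\<close> tends boundedly to the indicator of \<open>U\<close>.\<close>

lemma k_open_measurable:
  assumes U: "open U" "0 \<notin> U"
  shows "(\<lambda>x. measure (k x) U) \<in> borel_measurable borel"
proof -
  \<comment> \<open>For positive \<open>n\<close> the first factor vanishes within distance
    \<open>1/n\<close> of the complement of \<open>U\<close>, which contains 0, and the second
    outside the ball of radius \<open>n\<close>; so the support is compact and avoids 0.\<close>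
  define F :: "nat \<Rightarrow> 'a \<Rightarrow> real" where
    "F n y = max 0 (min 1 (real n * infdist y (-U) - 1)) * max 0 (min 1 (real n - norm y))" for n y
  have ne: "-U \<noteq> {}" "0 \<in> -U" using U by auto
  have Fc: "continuous_on UNIV (F n)" for n unfolding F_def by (intro continuous_intros)
  have Fm: "F n \<in> borel_measurable borel" for n using Fc by (rule borel_measurable_continuous_onI)
  have Fb: "\<bar>F n y\<bar> \<le> 1" for n y
  proof -
    have "\<bar>F n y\<bar> \<le> 1 * 1" unfolding F_def abs_mult by (intro mult_mono) auto
    then show ?thesis by simp
  qed
  have lim: "(\<lambda>n. F n y) \<longlonglongrightarrow> indicator U y" for y
  proof (cases "y \<in> U")
    case True
    have pos: "0 < infdist y (-U)"
      using U True ne by (metis ComplD closed_Compl in_closed_iff_infdist_zero infdist_nonneg less_le)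
    obtain n0 :: nat where n0: "2 / infdist y (-U) + norm y + 1 \<le> real n0" using real_arch_simple by blast
    have "F n y = 1" if "n \<ge> n0" for n
    proof -
      have n: "2 / infdist y (-U) + norm y + 1 \<le> real n" using n0 that by (meson of_nat_mono order_trans)
      have p2: "0 \<le> 2 / infdist y (-U)" using pos by simp
      have "2 / infdist y (-U) \<le> real n" using n norm_ge_zero[of y] by linarith
      then have "2 \<le> real n * infdist y (-U)" using pos by (simp add: divide_le_eq)
      moreover have "1 \<le> real n - norm y" using n p2 by linarith
      ultimately show ?thesis by (simp add: F_def)
    qed
    then have "eventually (\<lambda>n. F n y = indicator U y) sequentially" using True by (auto simp: eventually_sequentially)
    then show ?thesis by (rule tendsto_eventually)
  next
    case False
    then have "infdist y (-U) = 0" by (intro infdist_zero) simp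
    then show ?thesis using False by (simp add: F_def)
  qed
  have meas: "(\<lambda>x. \<integral>y. F n y \<partial>k x) \<in> borel_measurable borel" for n
  proof -
    let ?g = "\<lambda>y. w y * F n y"
    have sub: "{y. ?g y \<noteq> 0} \<subseteq> {y. 1 \<le> real n * infdist y (-U)} \<inter> cball 0 (real n)"
      by (auto simp: F_def max_def min_def split: if_splits)
    have cl: "closed ({y. 1 \<le> real n * infdist y (-U)} \<inter> cball 0 (real n))"
      by (intro closed_Int closed_Collect_le continuous_intros closed_cball)
    have cs: "closure {y. ?g y \<noteq> 0} \<subseteq> {y. 1 \<le> real n * infdist y (-U)} \<inter> cball 0 (real n)"
      by (rule closure_minimal[OF sub cl])
    have "compact (closure {y. ?g y \<noteq> 0})"
      using sub by (intro compact_closure[THEN iffD2] bounded_subset[OF bounded_cball[of 0 "real n"]]) auto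
    moreover have "0 \<notin> closure {y. ?g y \<noteq> 0}" using cs ne(2) by auto
    moreover have "continuous_on UNIV ?g" by (intro continuous_on_mult w_cont Fc)
    ultimately have "(\<lambda>x. \<integral>y. ?g y \<partial>\<mu> x) \<in> borel_measurable borel" using mu_meas[rule_format, of ?g] by blast
    then show ?thesis by (simp add: integral_k[OF Fm])
  qed
  have "(\<lambda>n. \<integral>y. F n y \<partial>k x) \<longlonglongrightarrow> measure (k x) U" for x
  proof -
    have "(\<lambda>n. \<integral>y. F n y \<partial>k x) \<longlonglongrightarrow> (\<integral>y. indicator U y \<partial>k x)"
      by (rule sfun_lim[OF sfun_integral[OF k_finite k_sets] _ Fb lim]) (rule BbI[OF Fm Fb])
    then show ?thesis using k_space U k_sets by simp
  qed
  then show ?thesis by (rule borel_measurable_LIMSEQ_real) (rule meas)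
qed

text \<open>Open sets form an intersection stable generator of the Borel sets, and the origin, a
  null set of every \<open>k x\<close>, can be removed from them.\<close>

lemma k_set_measurable:
  assumes "A \<in> sets borel" shows "(\<lambda>x. measure (k x) A) \<in> borel_measurable borel"
proof -
  have op: "(\<lambda>x. measure (k x) U) \<in> borel_measurable borel" if U: "open U" for U
  proof -
    have "measure (k x) U = measure (k x) (U - {0})" for x
    proof -
      interpret finite_measure "k x" by (rule k_finite)
      have "measure (k x) (U - {0}) = measure (k x) U"
        by (rule measure_Diff_null_set) (use U k_sets k_zero in \<open>auto simp: null_sets_def emeasure_eq_measure\<close>)
      then show ?thesis by simp
    qed
    then show ?thesis using k_open_measurable[of "U - {0}"] U by (simp add: open_Diff)
  qed
  have "Int_stable {S::'a set. open S}" by (auto simp: Int_stable_def)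
  moreover have "{S::'a set. open S} \<subseteq> Pow UNIV" by simp
  moreover have "A \<in> sigma_sets UNIV {S. open S}" using assms by (simp add: borel_def)
  ultimately show ?thesis
  proof (induction A rule: sigma_sets_induct_disjoint)
    case (compl A)
    have A: "A \<in> sets borel" using compl by (simp add: borel_def)
    have "measure (k x) (UNIV - A) = measure (k x) UNIV - measure (k x) A" for x
      using finite_measure.finite_measure_compl[OF k_finite, of A x] A k_sets k_space by simp
    then show ?case using compl op[of UNIV] by simp
  next
    case (union A)
    have A: "\<And>i. A i \<in> sets borel" using union by (auto simp: borel_def)
    have "measure (k x) (\<Union>i. A i) = (\<Sum>i. measure (k x) (A i))" for x
    proof -
      have "range A \<subseteq> sets (k x)" using A k_sets by auto
      from finite_measure.finite_measure_UNION[OF k_finite this union(1)] show ?thesis by (rule sums_unique)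
    qed
    then show ?case using union by (simp add: borel_measurable_suminf)
  qed (auto intro: op)
qed

lemma k_integral_measurable:
  assumes f: "f \<in> Bb" shows "(\<lambda>x. \<integral>y. f y \<partial>k x) \<in> borel_measurable borel"
proof -
  note sf = sfun_integral[OF k_finite k_sets]
  have "f \<in> Bb \<and> (\<lambda>x. \<integral>y. f y \<partial>k x) \<in> borel_measurable borel"
  proof (rule real_measurable_induct[where P="\<lambda>f. f \<in> Bb \<and> (\<lambda>x. \<integral>y. f y \<partial>k x) \<in> borel_measurable borel" and N=borel])
    show "f \<in> borel_measurable borel" using f by (rule Bb_measurable)
    show "indicator A \<in> Bb \<and> (\<lambda>x. \<integral>y. (indicator A y :: real) \<partial>k x) \<in> borel_measurable borel" if "A \<in> sets borel" for A
    proof -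
      have "(\<integral>y. (indicator A y :: real) \<partial>k x) = measure (k x) A" for x using k_sets[of x] k_space[of x] that by simp
      then show ?thesis using k_set_measurable[OF that] Bb_indicator[OF that] by (simp only: simp_thms)
    qed
    fix F assume F: "\<And>n. F n \<in> Bb \<and> (\<lambda>x. \<integral>y. F n y \<partial>k x) \<in> borel_measurable borel"
      "\<And>x. (\<lambda>n. F n x) \<longlonglongrightarrow> f x" "\<And>n x. \<bar>F n x\<bar> \<le> 2 * \<bar>f x\<bar>"
    have b: "\<bar>F n x\<bar> \<le> 2 * supnorm f" for n x using F(3)[of n x] supnorm_ge[OF f, of x] by linarith
    have "(\<lambda>n. \<integral>y. F n y \<partial>k x) \<longlonglongrightarrow> (\<integral>y. f y \<partial>k x)" for x
      by (rule sfun_lim[OF sf _ b F(2)]) (use F(1) in blast)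
    then have "(\<lambda>x. \<integral>y. f y \<partial>k x) \<in> borel_measurable borel"
      by (rule borel_measurable_LIMSEQ_real) (use F(1) in blast)
    then show "f \<in> Bb \<and> (\<lambda>x. \<integral>y. f y \<partial>k x) \<in> borel_measurable borel" using f by blast
  qed (auto simp: sfun_add[OF sf] sfun_cmult[OF sf] Bb_add Bb_cmult)
  then show ?thesis by blast
qed

lemma k_integral_bound:
  assumes f: "f \<in> borel_measurable borel" and b: "\<And>y. \<bar>f y\<bar> \<le> B" and B: "0 \<le> B"
  shows "\<bar>\<integral>y. f y \<partial>k x\<bar> \<le> B * mB"
proof -
  interpret finite_measure "k x" by (rule k_finite)
  have fB: "f \<in> Bb" by (rule BbI[OF f b])
  have "\<bar>\<integral>y. f y \<partial>k x\<bar> \<le> (\<integral>y. B \<partial>k x)"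
    using integrable_Bb[OF k_finite k_sets fB] b by (intro order_trans[OF integral_abs_bound] integral_mono) auto
  also have "\<dots> \<le> B * mB" using mult_left_mono[OF k_measure_le B] by (simp add: mult.commute)
  finally show ?thesis .
qed

text \<open>The jump integrand of \<open>Bhat\<close> divided by \<open>w\<close>, to be integrated
  against \<open>k x\<close>. For regular \<open>h\<close> it is of order
  \<open>min \<rho> 2 - \<beta> > 0\<close> near 0, hence bounded; at 0 the division by zero returns
  0, which is also its limit.\<close>

definition q :: "('a \<Rightarrow> real) \<Rightarrow> 'a \<Rightarrow> 'a \<Rightarrow> real" where
  "q h x y = (h (x + y) - h x - (y \<bullet> vg \<rho> h x) * chi y) / w y"

definition b' :: "'a \<Rightarrow> 'a" where "b' x = (if \<rho> \<le> 1 then 0 else b x)"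

lemma bB_nonneg: "0 \<le> bB" using b_bdd[of undefined] norm_ge_zero order_trans by blast

lemma b'_bound: "norm (b' x) \<le> bB" using b_bdd bB_nonneg by (simp add: b'_def)

lemma q_measurable:
  assumes [measurable]: "h \<in> borel_measurable borel" shows "q h x \<in> borel_measurable borel"
  unfolding q_def by measurable

text \<open>At \<open>y = 0\<close> the numerator of \<open>q\<close> vanishes as well, so
  multiplication by \<open>w\<close> recovers the integrand everywhere. The conventions for
  \<open>b'\<close> and \<open>vg\<close> merge the two cases of \<open>Bhat\<close>.\<close>

lemma Bhat_eq:
  assumes h: "h \<in> borel_measurable borel"
  shows "Bhat \<rho> b \<mu> chi h x = b' x \<bullet> vg \<rho> h x + (\<integral>y. q h x y \<partial>k x)"
proof -
  have "w y * q h x y = h (x + y) - h x - (y \<bullet> vg \<rho> h x) * chi y" for y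
    using w_pos[of y] by (cases "y = 0") (auto simp: q_def w_0)
  then have "(\<integral>y. q h x y \<partial>k x) = (\<integral>y. h (x + y) - h x - (y \<bullet> vg \<rho> h x) * chi y \<partial>\<mu> x)"
    by (simp add: integral_k[OF q_measurable[OF h]])
  then show ?thesis by (simp add: Bhat_def b'_def vg_def)
qed

lemma chi_facts: "norm y < 1 \<Longrightarrow> chi y = 1" "2 \<le> norm y \<Longrightarrow> chi y = 0" "0 \<le> chi y" "chi y \<le> 1"
proof -
  have c: "indicator (ball 0 1) y \<le> chi y" "chi y \<le> indicator (ball 0 2) y" using chi_bounds by auto
  have "0 \<le> (indicator (ball 0 1) y :: real)" "indicator (ball 0 2) y \<le> (1::real)" by (auto simp: indicator_def)
  with c show "0 \<le> chi y" "chi y \<le> 1" by linarith+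
  show "chi y = 1" if "norm y < 1" using c that by (auto simp: indicator_def)
  show "chi y = 0" if "2 \<le> norm y" using c that by (auto simp: indicator_def)
qed

lemma chi_norm: "norm y * chi y \<le> 2"
proof (cases "2 \<le> norm y")
  case False
  then have "norm y * chi y \<le> 2 * 1" using chi_facts(3,4)[of y] by (intro mult_mono) auto
  then show ?thesis by simp
qed (simp add: chi_facts)

lemma q_small:
  assumes r: "reg \<rho> N h" and y: "norm y < 1"
  shows "\<bar>q h x y\<bar> \<le> N * norm y powr (min \<rho> 2 - \<beta>)"
proof (cases "y = 0")
  case False
  have wy: "w y = norm y powr \<beta>" using y beta by (simp add: w_def powr_le1)
  have "\<bar>q h x y\<bar> = \<bar>h (x + y) - h x - y \<bullet> vg \<rho> h x\<bar> / norm y powr \<beta>"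
    using chi_facts(1)[OF y] by (simp add: q_def wy)
  also have "\<dots> \<le> (N * norm y powr min \<rho> 2) / norm y powr \<beta>" by (intro divide_right_mono regD(4)[OF r]) simp
  also have "\<dots> = N * norm y powr (min \<rho> 2 - \<beta>)" by (simp add: powr_diff)
  finally show ?thesis .
qed (simp add: q_def)

lemma q_large:
  assumes y: "1 \<le> norm y"
  shows "\<bar>q h x y\<bar> \<le> \<bar>h (x + y)\<bar> + \<bar>h x\<bar> + 2 * norm (vg \<rho> h x)"
proof -
  have wy: "w y = 1" using y beta by (simp add: w_def ge_one_powr_ge_zero)
  have "\<bar>(y \<bullet> vg \<rho> h x) * chi y\<bar> \<le> (norm y * norm (vg \<rho> h x)) * chi y"
    unfolding abs_mult using chi_facts(3)[of y] by (simp add: Cauchy_Schwarz_ineq2 mult_right_mono)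
  also have "\<dots> = (norm y * chi y) * norm (vg \<rho> h x)" by simp
  also have "\<dots> \<le> 2 * norm (vg \<rho> h x)" by (intro mult_right_mono chi_norm) simp
  finally show ?thesis by (simp add: q_def wy)
qed

text \<open>Inside the unit ball the remainder has order above \<open>\<beta>\<close>. Outside,
  \<open>w\<close> is 1 and the three terms contribute \<open>N\<close>, \<open>N\<close> and
  \<open>2 * N\<close>, the last because \<open>norm y * chi y\<close> is at most 2.\<close>

lemma q_bound:
  assumes r: "reg \<rho> N h" shows "\<bar>q h x y\<bar> \<le> 4 * N"
proof (cases "norm y < 1")
  case True
  have "\<bar>q h x y\<bar> \<le> N * norm y powr (min \<rho> 2 - \<beta>)" by (rule q_small[OF r True])
  also have "\<dots> \<le> N * 1" using True beta regD(5)[OF r] by (intro mult_left_mono powr_le1) auto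
  finally show ?thesis using regD(5)[OF r] by simp
next
  case False
  then show ?thesis using q_large[of y h x] regD(2)[OF r, of x] regD(2)[OF r, of "x + y"] regD(3)[OF r, of x] by simp
qed

lemma q_Bb: "reg \<rho> N h \<Longrightarrow> q h x \<in> Bb"
  by (rule BbI[OF q_measurable q_bound]) (auto dest: regD intro: Bb_measurable)

lemma reg_Bhat_eq: "reg \<rho> N h \<Longrightarrow> Bhat \<rho> b \<mu> chi h x = b' x \<bullet> vg \<rho> h x + (\<integral>y. q h x y \<partial>k x)"
  by (rule Bhat_eq[OF Bb_measurable[OF regD(1)]])

lemma drift_bound: "reg \<rho> N h \<Longrightarrow> \<bar>b' x \<bullet> vg \<rho> h x\<bar> \<le> bB * N"
  by (rule order_trans[OF Cauchy_Schwarz_ineq2 mult_mono[OF b'_bound regD(3) bB_nonneg norm_ge_zero]])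

lemma Bhat_bound:
  assumes r: "reg \<rho> N h" shows "\<bar>Bhat \<rho> b \<mu> chi h x\<bar> \<le> (bB + 4 * mB) * N"
proof -
  have "\<bar>\<integral>y. q h x y \<partial>k x\<bar> \<le> (4 * N) * mB"
    by (rule k_integral_bound[OF Bb_measurable[OF q_Bb[OF r]] q_bound[OF r]]) (use regD(5)[OF r] in simp)
  then show ?thesis unfolding reg_Bhat_eq[OF r] using drift_bound[OF r, of x] by (simp add: algebra_simps)
qed

lemma q_limit:
  assumes r: "\<And>n. reg \<rho> N (H n)" and lim: "\<And>x. (\<lambda>n. H n x) \<longlonglongrightarrow> h x"
  shows "(\<lambda>n. q (H n) x y) \<longlonglongrightarrow> q h x y"
proof (cases "w y = 0")
  case False
  then show ?thesis unfolding q_def by (intro tendsto_intros lim reg_limit(2)[OF r lim])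
qed (simp add: q_def)

text \<open>At fixed \<open>N\<close> the unbounded operator is continuous along pointwise
  convergence: gradients converge by \<open>reg_limit\<close>, and the integrands \<open>q\<close>
  stay below \<open>4 * N\<close> against a finite measure.\<close>

lemma Bhat_limit:
  assumes r: "\<And>n. reg \<rho> N (H n)" and lim: "\<And>x. (\<lambda>n. H n x) \<longlonglongrightarrow> h x"
  shows "(\<lambda>n. Bhat \<rho> b \<mu> chi (H n) x) \<longlonglongrightarrow> Bhat \<rho> b \<mu> chi h x"
  unfolding reg_Bhat_eq[OF r] reg_Bhat_eq[OF reg_limit(1)[OF r lim]]
  by (intro tendsto_add tendsto_inner tendsto_const reg_limit(2)[OF r lim]
      sfun_lim[OF sfun_integral[OF k_finite k_sets] q_Bb[OF r] q_bound[OF r] q_limit[OF r lim]])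

lemma Bhat_add:
  assumes r: "reg \<rho> N h" "reg \<rho> N' h'"
  shows "Bhat \<rho> b \<mu> chi (\<lambda>x. h x + h' x) x = Bhat \<rho> b \<mu> chi h x + Bhat \<rho> b \<mu> chi h' x"
proof -
  have "q (\<lambda>x. h x + h' x) x = (\<lambda>y. q h x y + q h' x y)"
    by (auto simp: q_def vg_add[OF r] inner_add_right algebra_simps add_divide_distrib diff_divide_distrib)
  then have "(\<integral>y. q (\<lambda>x. h x + h' x) x y \<partial>k x) = (\<integral>y. q h x y \<partial>k x) + (\<integral>y. q h' x y \<partial>k x)"
    using sfun_add[OF sfun_integral[OF k_finite k_sets] q_Bb[OF r(1)] q_Bb[OF r(2)]] by simp
  moreover have "(\<lambda>x. h x + h' x) \<in> borel_measurable borel" by (intro Bb_measurable Bb_add regD(1)[OF r(1)] regD(1)[OF r(2)])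
  ultimately show ?thesis
    by (simp add: Bhat_eq reg_Bhat_eq[OF r(1)] reg_Bhat_eq[OF r(2)] vg_add[OF r] inner_add_right)
qed

lemma Bhat_cmult:
  assumes r: "reg \<rho> N h" shows "Bhat \<rho> b \<mu> chi (\<lambda>x. c * h x) x = c * Bhat \<rho> b \<mu> chi h x"
proof -
  have "q (\<lambda>x. c * h x) x = (\<lambda>y. c * q h x y)"
    by (auto simp: q_def reg_scale(1)[OF r] algebra_simps add_divide_distrib diff_divide_distrib)
  moreover have "(\<lambda>x. c * h x) \<in> borel_measurable borel" by (intro Bb_measurable Bb_cmult regD(1)[OF r])
  ultimately show ?thesis by (simp add: Bhat_eq reg_Bhat_eq[OF r] reg_scale(1)[OF r] algebra_simps)
qed

lemma Bhat_zero: "Bhat \<rho> b \<mu> chi (\<lambda>x. 0) x = 0"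
  using Bhat_cmult[OF reg_zero[of 0], of 0 x] by simp

end

section \<open>The perturbation along a regularising semigroup\<close>

lemma integrable_dominated:
  fixes u :: "'b \<Rightarrow> 'c::{banach, second_countable_topology}"
  assumes "integrable M n" "u \<in> borel_measurable M" "\<And>t. norm (u t) \<le> c * n t"
  shows "integrable M u"
  by (rule Bochner_Integration.integrable_bound[OF integrable_mult_right[OF assms(1), of c] assms(2)])
     (use order_trans[OF assms(3) abs_ge_self] in auto)

text \<open>The summand 1 in \<open>bB + 4 * mB + 1\<close> leaves room for the drift error of the
  bounded approximations, so that they satisfy the same smallness condition as
  \<open>Bhat\<close>.\<close>

locale levy_semigroup = levy +
  fixes T :: "real \<Rightarrow> ('a \<Rightarrow> real) \<Rightarrow> 'a \<Rightarrow> real" and A l :: real and \<kappa> :: "real \<Rightarrow> real"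
  assumes T: "op_family T" and Tb: "exp_bounded T (\<lambda>_. A) l"
    and T_sg: "\<And>t s f. 0 < t \<Longrightarrow> 0 < s \<Longrightarrow> f \<in> Bb \<Longrightarrow> T (t + s) f = T t (T s f)"
    and Treg: "\<And>t f. f \<in> Bb \<Longrightarrow> reg \<rho> (\<kappa> t * exp (l * t) * supnorm f) (T t f)"
    and kappa_int: "integrable lborel \<kappa>" and half: "(bB + 4 * mB + 1) * (\<integral>s. \<kappa> s \<partial>lborel) \<le> 1/2"
begin

definition G :: "real \<Rightarrow> ('a \<Rightarrow> real) \<Rightarrow> 'a \<Rightarrow> real" where
  "G t f x = Bhat \<rho> b \<mu> chi (T t f) x"

lemma TB: "f \<in> Bb \<Longrightarrow> T t f \<in> Bb" by (rule op_family_Bb[OF T Tb])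

lemma \<kappa>_nonneg: "0 \<le> \<kappa> t"
proof -
  have "supnorm (\<lambda>x::'a. 1::real) = 1" unfolding supnorm_def by simp
  then have "0 \<le> \<kappa> t * exp (l * t)" using regD(5)[OF Treg[OF Bb_const[of 1]], of t] by simp
  then show ?thesis by (simp add: zero_le_mult_iff)
qed

lemma T_shift_measurable:
  assumes f: "f \<in> Bb" shows "(\<lambda>(t,x). T t f (x + v)) \<in> borel_measurable (borel \<Otimes>\<^sub>M borel)"
proof -
  have "(\<lambda>p. (fst p, snd p + v)) \<in> measurable (borel \<Otimes>\<^sub>M borel) (borel \<Otimes>\<^sub>M borel :: (real \<times> 'a) measure)" by simp
  from measurable_compose[OF this op_family_measurable[OF T f]] show ?thesis by (simp add: split_beta')
qed

text \<open>Each coordinate of the gradient is a limit of difference quotients with steps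
  \<open>1 / (n + 1)\<close>, and these are jointly measurable in time and space.\<close>

lemma vgT_measurable:
  assumes f: "f \<in> Bb" shows "(\<lambda>(t,x). vg \<rho> (T t f) x) \<in> borel_measurable (borel \<Otimes>\<^sub>M borel)"
proof (cases "\<rho> \<le> 1")
  case True
  then have "(\<lambda>(t,x). vg \<rho> (T t f) x) = (\<lambda>_. 0)" by (auto simp: vg_def)
  then show ?thesis by simp
next
  case False
  show ?thesis
  proof (subst borel_measurable_euclidean_space, rule ballI)
    fix e :: 'a assume e: "e \<in> Basis"
    let ?s = "\<lambda>n::nat. inverse (real (Suc n))"
    let ?u = "\<lambda>n p. (T (fst p) f (snd p + ?s n *\<^sub>R e) - T (fst p) f (snd p)) / ?s n"
    have "(\<lambda>p. e \<bullet> vg \<rho> (T (fst p) f) (snd p)) \<in> borel_measurable (borel \<Otimes>\<^sub>M borel)"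
    proof (rule borel_measurable_LIMSEQ_real[where u="?u"])
      show "?u n \<in> borel_measurable (borel \<Otimes>\<^sub>M borel)" for n
        using T_shift_measurable[OF f, of "?s n *\<^sub>R e"] T_shift_measurable[OF f, of 0] by (simp add: split_beta')
      fix p :: "real \<times> 'a"
      let ?N = "\<kappa> (fst p) * exp (l * fst p) * supnorm f"
      have "((\<lambda>n. ?s n powr (min \<rho> 2 - 1)) \<longlonglongrightarrow> 0)"
        by (rule tendsto_zero_powrI[where b="min \<rho> 2 - 1"]) (use False LIMSEQ_inverse_real_of_nat in auto)
      then have "(\<lambda>n. ?N * ?s n powr (min \<rho> 2 - 1)) \<longlonglongrightarrow> 0" by (rule tendsto_mult_right_zero)
      then have "(\<lambda>n. ?u n p - e \<bullet> vg \<rho> (T (fst p) f) (snd p)) \<longlonglongrightarrow> 0"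
      proof (rule Lim_null_comparison[rotated])
        show "eventually (\<lambda>n. norm (?u n p - e \<bullet> vg \<rho> (T (fst p) f) (snd p)) \<le> ?N * ?s n powr (min \<rho> 2 - 1)) sequentially"
          using reg_inner_bound[OF Treg[OF f], of _ e "fst p" "snd p"] False e by (intro always_eventually) auto
      qed
      then show "(\<lambda>n. ?u n p) \<longlonglongrightarrow> e \<bullet> vg \<rho> (T (fst p) f) (snd p)" by (rule LIM_zero_cancel)
    qed
    then show "(\<lambda>p. (case p of (t, x) \<Rightarrow> vg \<rho> (T t f) x) \<bullet> e) \<in> borel_measurable (borel \<Otimes>\<^sub>M borel)"
      by (simp add: split_beta' inner_commute)
  qed
qed

lemma qT_measurable:
  assumes f: "f \<in> Bb"
  shows "(\<lambda>(p,y). q (T (fst p) f) (snd p) y) \<in> borel_measurable ((borel \<Otimes>\<^sub>M borel) \<Otimes>\<^sub>M borel)"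
proof -
  let ?M = "(borel \<Otimes>\<^sub>M borel) \<Otimes>\<^sub>M borel :: ((real \<times> 'a) \<times> 'a) measure"
  have 1: "(\<lambda>z. (fst (fst z), snd (fst z) + snd z)) \<in> measurable ?M (borel \<Otimes>\<^sub>M borel)" by simp
  have 2: "fst \<in> measurable ?M (borel \<Otimes>\<^sub>M borel)" by simp
  note m1 = measurable_compose[OF 1 op_family_measurable[OF T f]]
  note m2 = measurable_compose[OF 2 op_family_measurable[OF T f]]
  note m3 = measurable_compose[OF 2 vgT_measurable[OF f]]
  have m4: "(\<lambda>z. chi (snd z)) \<in> borel_measurable ?M" "(\<lambda>z. w (snd z)) \<in> borel_measurable ?M" by measurable
  have "(\<lambda>z. (T (fst (fst z)) f (snd (fst z) + snd z) - T (fst (fst z)) f (snd (fst z)) -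
       (snd z \<bullet> vg \<rho> (T (fst (fst z)) f) (snd (fst z))) * chi (snd z)) / w (snd z)) \<in> borel_measurable ?M"
    using m1 m2 m3 m4
    by (intro borel_measurable_divide borel_measurable_diff borel_measurable_times borel_measurable_inner)
       (simp_all add: split_beta')
  then show ?thesis by (simp add: q_def split_beta')
qed

lemma G_measurable:
  assumes f: "f \<in> Bb" shows "(\<lambda>(t,x). G t f x) \<in> borel_measurable (borel \<Otimes>\<^sub>M borel)"
proof -
  let ?N = "borel \<Otimes>\<^sub>M borel :: (real \<times> 'a) measure"
  have "(\<lambda>p. \<integral>y. q (T (fst p) f) (snd p) y \<partial>k (snd p)) \<in> borel_measurable ?N"
  proof (rule sfun_param_measurable[where L="\<lambda>p f. \<integral>y. f y \<partial>k (snd p)" and F="\<lambda>p. q (T (fst p) f) (snd p)"])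
    show "space ?N = UNIV" by (simp add: space_pair_measure)
    show "sfun (\<lambda>f. \<integral>y. f y \<partial>k (snd p))" for p :: "real \<times> 'a" by (rule sfun_integral[OF k_finite k_sets])
    show "(\<lambda>p. \<integral>y. f y \<partial>k (snd p)) \<in> borel_measurable ?N" if "f \<in> Bb" for f
      by (rule measurable_compose[OF measurable_snd k_integral_measurable[OF that]])
    show "(\<lambda>(p,y). q (T (fst p) f) (snd p) y) \<in> borel_measurable (?N \<Otimes>\<^sub>M borel)" by (rule qT_measurable[OF f])
    show "q (T (fst p) f) (snd p) \<in> Bb" for p by (rule q_Bb[OF Treg[OF f]])
  qed
  moreover have "b' \<in> borel_measurable borel"
  proof (cases "\<rho> \<le> 1")
    case True
    then have "b' = (\<lambda>x. 0)" by (auto simp: b'_def)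
    then show ?thesis by simp
  next
    case False
    then have "b' = b" by (auto simp: b'_def)
    then show ?thesis using b_meas by simp
  qed
  then have "(\<lambda>p. b' (snd p) \<bullet> vg \<rho> (T (fst p) f) (snd p)) \<in> borel_measurable ?N"
    using vgT_measurable[OF f] by (intro borel_measurable_inner measurable_compose[OF measurable_snd]) (simp_all add: split_beta')
  ultimately have "(\<lambda>p. b' (snd p) \<bullet> vg \<rho> (T (fst p) f) (snd p) + (\<integral>y. q (T (fst p) f) (snd p) y \<partial>k (snd p))) \<in> borel_measurable ?N"
    by (intro borel_measurable_add)
  then show ?thesis unfolding G_def by (simp add: reg_Bhat_eq[OF Treg[OF f]] split_beta')
qed

lemma T_limit:
  assumes F: "\<And>n. F n \<in> Bb" "\<And>n x. \<bar>F n x\<bar> \<le> B" "\<And>x. (\<lambda>n. F n x) \<longlonglongrightarrow> f x"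
  shows "reg \<rho> (\<kappa> t * exp (l * t) * B) (T t (F n))" "(\<lambda>n. T t (F n) x) \<longlonglongrightarrow> T t f x"
proof -
  have "supnorm (F n) \<le> B" by (rule supnorm_le) (rule F)
  then show "reg \<rho> (\<kappa> t * exp (l * t) * B) (T t (F n))"
    using \<kappa>_nonneg[of t] by (intro reg_mono[OF Treg[OF F(1)]] mult_left_mono) auto
  show "(\<lambda>n. T t (F n) x) \<longlonglongrightarrow> T t f x" by (rule sfun_lim[OF op_family_sfun[OF T] F])
qed

lemma G_bound:
  assumes f: "f \<in> Bb" shows "\<bar>G t f x\<bar> \<le> (bB + 4 * mB) * (\<kappa> t * exp (l * t) * supnorm f)"
  unfolding G_def by (rule Bhat_bound[OF Treg[OF f]])

lemma G_exp_bounded: "exp_bounded G (\<lambda>t. (bB + 4 * mB + 1) * \<kappa> t) l"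
  unfolding exp_bounded_def
proof (intro allI ballI)
  fix t x and f :: "'a \<Rightarrow> real" assume f: "f \<in> Bb"
  have "0 \<le> \<kappa> t * exp (l * t) * supnorm f" using \<kappa>_nonneg[of t] supnorm_nonneg[OF f] by simp
  then have "(bB + 4 * mB) * (\<kappa> t * exp (l * t) * supnorm f) \<le> (bB + 4 * mB + 1) * (\<kappa> t * exp (l * t) * supnorm f)"
    by (intro mult_right_mono) auto
  then show "\<bar>G t f x\<bar> \<le> (bB + 4 * mB + 1) * \<kappa> t * exp (l * t) * supnorm f" using G_bound[OF f, of t x] by (simp add: mult.assoc)
qed

lemma G_op_family: "op_family G"
  unfolding op_family_def
proof (intro conjI allI ballI impI)
  fix t x
  show "sfun (\<lambda>f. G t f x)"
  proof (rule sfunI[where C="(bB + 4 * mB + 1) * \<kappa> t * exp (l * t)"])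
    fix f g :: "'a \<Rightarrow> real" assume f: "f \<in> Bb" and g: "g \<in> Bb"
    have "T t (\<lambda>x. f x + g x) = (\<lambda>x. T t f x + T t g x)" using sfun_add[OF op_family_sfun[OF T] f g] by auto
    then show "G t (\<lambda>x. f x + g x) x = G t f x + G t g x" by (simp add: G_def Bhat_add[OF Treg[OF f] Treg[OF g]])
  next
    fix f :: "'a \<Rightarrow> real" and c assume f: "f \<in> Bb"
    have "T t (\<lambda>x. c * f x) = (\<lambda>x. c * T t f x)" using sfun_cmult[OF op_family_sfun[OF T] f] by auto
    then show "G t (\<lambda>x. c * f x) x = c * G t f x" by (simp add: G_def Bhat_cmult[OF Treg[OF f]])
  next
    fix f :: "'a \<Rightarrow> real" assume f: "f \<in> Bb"
    then show "\<bar>G t f x\<bar> \<le> (bB + 4 * mB + 1) * \<kappa> t * exp (l * t) * supnorm f" by (rule exp_boundedD[OF G_exp_bounded])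
  next
    fix F :: "nat \<Rightarrow> 'a \<Rightarrow> real" and f B
    assume F: "\<And>n. F n \<in> Bb" "\<And>n x. \<bar>F n x\<bar> \<le> B" "\<And>x. (\<lambda>n. F n x) \<longlonglongrightarrow> f x" "f \<in> Bb"
    show "(\<lambda>n. G t (F n) x) \<longlonglongrightarrow> G t f x"
      unfolding G_def by (rule Bhat_limit[OF T_limit(1)[OF F(1-3)] T_limit(2)[OF F(1-3)]])
  qed
next
  fix t :: real and f :: "'a \<Rightarrow> real" and x assume "t \<le> 0" "f \<in> Bb"
  then show "G t f x = 0" using op_family_nonpos_ext[OF T] by (simp add: G_def Bhat_zero)
qed (rule G_measurable)

sublocale dyson_semigroup T G A l "\<lambda>t. (bB + 4 * mB + 1) * \<kappa> t"
proof
  show "integrable lborel (\<lambda>t. (bB + 4 * mB + 1) * \<kappa> t)" using kappa_int by (rule integrable_mult_right)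
  show "(\<integral>t. (bB + 4 * mB + 1) * \<kappa> t \<partial>lborel) \<le> 1/2" using half by simp
  show "G (t + s) f = G t (T s f)" if "0 < t" "0 < s" "f \<in> Bb" for t s f
    by (rule ext) (simp only: G_def T_sg[OF that])
qed (rule T Tb G_op_family G_exp_bounded T_sg; assumption)+

text \<open>The closedness of the perturbation in the form needed. Taylor bounds of
  \<open>T t g\<close> integrate in time, so the gradient of the Laplace integral is the integral of
  the gradients; Fubini exchanges the jump part with the time integral.\<close>

lemma Bhat_laplace:
  assumes m: "l < m" and g: "g \<in> Bb"
  shows "Bhat \<rho> b \<mu> chi (laplace T m g) x = laplace G m g x"
proof -
  define h where "h t y = exp (- m * t) * T t g y" for t y
  let ?n = "\<lambda>t. \<kappa> t * supnorm g"
  have ni: "integrable lborel ?n" using kappa_int by simp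
  \<comment> \<open>Since \<open>m > l\<close>, the factor \<open>exp (- m * t)\<close> absorbs the
    growth \<open>exp (l * t)\<close>, and the remaining Taylor constant
    \<open>\<kappa> t * supnorm g\<close> is integrable in \<open>t\<close>.\<close>
  have hr: "reg \<rho> (?n t) (h t)" for t
  proof (cases "t \<le> 0")
    case True
    then have "h t = (\<lambda>x. 0)" using op_family_nonpos[OF T True g] by (auto simp: h_def)
    then show ?thesis using reg_zero[of "?n t" \<rho>] \<kappa>_nonneg supnorm_nonneg[OF g] by simp
  next
    case False
    have "reg \<rho> (\<bar>exp (- m * t)\<bar> * (\<kappa> t * exp (l * t) * supnorm g)) (h t)"
      unfolding h_def by (rule reg_scale(2)[OF Treg[OF g]])
    moreover have "\<bar>exp (- m * t)\<bar> * (\<kappa> t * exp (l * t) * supnorm g) \<le> ?n t"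
    proof -
      have "\<bar>exp (- m * t)\<bar> * (\<kappa> t * exp (l * t) * supnorm g) = exp (- (m - l) * t) * ?n t"
        by (simp add: mult_ac exp_add[symmetric] algebra_simps)
      also have "\<dots> \<le> 1 * ?n t"
      proof (rule mult_right_mono)
        have "(l - m) * t \<le> 0" using False m by (intro mult_nonpos_nonneg) auto
        then show "exp (- (m - l) * t) \<le> 1" by simp
      qed (use \<kappa>_nonneg supnorm_nonneg[OF g] in simp)
      finally show ?thesis by simp
    qed
    ultimately show ?thesis by (rule reg_mono)
  qed
  have vgh: "vg \<rho> (h t) z = exp (- m * t) *\<^sub>R vg \<rho> (T t g) z" for t z unfolding h_def by (rule reg_scale(1)[OF Treg[OF g]])
  have hm: "(\<lambda>t. h t z) \<in> borel_measurable lborel" for z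
    using measurable_Pair1[OF op_family_measurable[OF T g], of z] unfolding h_def by (simp add: split_beta')
  have hi: "integrable lborel (\<lambda>t. h t z)" for z
    by (rule integrable_dominated[where c=1, OF ni hm]) (use regD(2)[OF hr] in simp)
  have vm: "(\<lambda>t. vg \<rho> (h t) z) \<in> borel_measurable lborel" for z
    using measurable_Pair1[OF vgT_measurable[OF g], of z] unfolding vgh by (simp add: split_beta')
  have vi: "integrable lborel (\<lambda>t. vg \<rho> (h t) z)" for z
    by (rule integrable_dominated[where c=1, OF ni vm]) (use regD(3)[OF hr] in simp)
  have H: "laplace T m g = (\<lambda>z. \<integral>t. h t z \<partial>lborel)" by (auto simp: laplace_def h_def)
  define v where "v = (\<integral>t. vg \<rho> (h t) x \<partial>lborel)"
  have vgH: "vg \<rho> (laplace T m g) x = v"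
  proof (rule vg_eqI)
    fix y
    have "laplace T m g (x + y) - laplace T m g x - y \<bullet> v = (\<integral>t. h t (x + y) - h t x - y \<bullet> vg \<rho> (h t) x \<partial>lborel)"
      unfolding H v_def using hi vi by simp
    also have "\<bar>\<dots>\<bar> \<le> (\<integral>t. \<bar>h t (x + y) - h t x - y \<bullet> vg \<rho> (h t) x\<bar> \<partial>lborel)" by (rule integral_abs_bound)
    also have "\<dots> \<le> (\<integral>t. ?n t * norm y powr min \<rho> 2 \<partial>lborel)"
      using hi vi ni by (intro integral_mono regD(4)[OF hr]) auto
    finally show "\<bar>laplace T m g (x + y) - laplace T m g x - y \<bullet> v\<bar> \<le> (\<integral>t. ?n t \<partial>lborel) * norm y powr min \<rho> 2" by simp
  next
    assume "\<rho> \<le> 1" then show "v = 0" by (simp add: v_def vg_def)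
  qed
  have qm: "(\<lambda>(t,y). q (h t) x y) \<in> borel_measurable (borel \<Otimes>\<^sub>M borel)"
  proof -
    have "(\<lambda>z. ((fst z, x), snd z)) \<in> measurable (borel \<Otimes>\<^sub>M borel) ((borel \<Otimes>\<^sub>M borel) \<Otimes>\<^sub>M borel :: ((real \<times> 'a) \<times> 'a) measure)" by simp
    from measurable_compose[OF this qT_measurable[OF g]]
    have "(\<lambda>z. exp (- m * fst z) * q (T (fst z) g) x (snd z)) \<in> borel_measurable (borel \<Otimes>\<^sub>M borel)" by simp
    moreover have "q (h t) x y = exp (- m * t) * q (T t g) x y" for t y
      unfolding q_def vgh unfolding h_def by (simp add: algebra_simps)
    ultimately show ?thesis by (simp add: split_beta')
  qed
  have qi: "integrable lborel (\<lambda>t. q (h t) x y)" for y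
    by (rule integrable_dominated[where c=4, OF ni]) (use measurable_Pair1[OF qm, of y] q_bound[OF hr] in \<open>auto simp: split_beta'\<close>)
  have qH: "q (laplace T m g) x y = (\<integral>t. q (h t) x y \<partial>lborel)" for y
    unfolding q_def vgH unfolding H v_def using hi vi by simp
  note fub = sfun_Fubini[OF sfun_integral[OF k_finite k_sets, of x] qm integrable_mult_right[OF ni, of 4] q_bound[OF hr]]
  have "Bhat \<rho> b \<mu> chi (laplace T m g) x = b' x \<bullet> v + (\<integral>y. (\<integral>t. q (h t) x y \<partial>lborel) \<partial>k x)"
    using Bhat_eq[OF Bb_measurable[OF laplace_Bb[OF T laplace_dom_const[OF T Tb m] g]], of x] by (simp add: vgH qH)
  also have "\<dots> = (\<integral>t. b' x \<bullet> vg \<rho> (h t) x \<partial>lborel) + (\<integral>t. (\<integral>y. q (h t) x y \<partial>k x) \<partial>lborel)"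
    using fub(3) vi[of x] by (simp add: v_def)
  also have "\<dots> = (\<integral>t. b' x \<bullet> vg \<rho> (h t) x + (\<integral>y. q (h t) x y \<partial>k x) \<partial>lborel)"
    using fub(2) vi[of x] by simp
  also have "\<dots> = (\<integral>t. Bhat \<rho> b \<mu> chi (h t) x \<partial>lborel)" by (simp add: reg_Bhat_eq[OF hr])
  also have "\<dots> = laplace G m g x" unfolding laplace_def G_def h_def by (simp add: Bhat_cmult[OF Treg[OF g]])
  finally show ?thesis .
qed

text \<open>The gradient vanishes at infinity because difference quotients of \<open>h\<close> do
  and approximate it uniformly. In the jump integral, short jumps are controlled by regularity and
  long ones by the tail condition; for jumps of medium size \<open>x + y\<close> is still far out,
  so all terms of the numerator are small.\<close>

lemma Bhat_vanishes:
  assumes r: "reg \<rho> N h" and h: "(h \<longlongrightarrow> 0) at_infinity"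
    and tail: "\<And>e. 0 < e \<Longrightarrow> \<exists>R\<ge>1. \<forall>x. measure (k x) {y. R < norm y} \<le> e"
  shows "(Bhat \<rho> b \<mu> chi h \<longlongrightarrow> 0) at_infinity"
proof -
  have N: "0 \<le> N" by (rule regD(5)[OF r])
  have vgv: "(vg \<rho> h \<longlongrightarrow> 0) at_infinity"
  proof (cases "\<rho> \<le> 1")
    case True
    then have "vg \<rho> h = (\<lambda>x. 0)" by (auto simp: vg_def)
    then show ?thesis by simp
  next
    case False
    have "((\<lambda>x. e \<bullet> vg \<rho> h x) \<longlongrightarrow> 0) at_infinity" if e: "e \<in> Basis" for e
    proof (rule tendstoI)
      fix \<epsilon> :: real assume \<epsilon>: "0 < \<epsilon>"
      obtain s where s: "0 < s" "N * s powr (min \<rho> 2 - 1) < \<epsilon>/2"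
        using small_powr[of "min \<rho> 2 - 1" "\<epsilon>/2" N] False \<epsilon> N by auto
      have "filterlim (\<lambda>x. x + s *\<^sub>R e) at_infinity at_infinity"
        by (rule tendsto_add_filterlim_at_infinity'[OF filterlim_ident tendsto_const])
      then have "((\<lambda>x. (h (x + s *\<^sub>R e) - h x) / s) \<longlongrightarrow> (0 - 0) / s) at_infinity"
        using s by (intro tendsto_intros h filterlim_compose[OF h]) auto
      then have "eventually (\<lambda>x. dist ((h (x + s *\<^sub>R e) - h x) / s) 0 < \<epsilon>/2) at_infinity"
        using \<epsilon> by (intro tendstoD) auto
      then show "eventually (\<lambda>x. dist (e \<bullet> vg \<rho> h x) 0 < \<epsilon>) at_infinity"
      proof eventually_elim
        case (elim x)
        have "\<bar>(h (x + s *\<^sub>R e) - h x) / s - e \<bullet> vg \<rho> h x\<bar> < \<epsilon>/2"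
          using reg_inner_bound[OF r _ s(1), of e x] False e s(2) by simp
        with elim show ?case unfolding dist_real_def by linarith
      qed
    qed
    then have "((\<lambda>x. \<Sum>e\<in>Basis. (e \<bullet> vg \<rho> h x) *\<^sub>R e) \<longlongrightarrow> (\<Sum>e\<in>(Basis::'a set). 0 *\<^sub>R e)) at_infinity"
      by (intro tendsto_sum tendsto_scaleR tendsto_const)
    moreover have "(\<Sum>e\<in>Basis. (e \<bullet> u) *\<^sub>R e) = u" for u :: 'a
      using euclidean_representation[of u] by (simp add: inner_commute)
    ultimately show ?thesis by simp
  qed
  have drift: "((\<lambda>x. b' x \<bullet> vg \<rho> h x) \<longlongrightarrow> 0) at_infinity"
  proof (rule Lim_null_comparison)
    show "eventually (\<lambda>x. norm (b' x \<bullet> vg \<rho> h x) \<le> bB * norm (vg \<rho> h x)) at_infinity"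
      using order_trans[OF Cauchy_Schwarz_ineq2 mult_right_mono[OF b'_bound norm_ge_zero]] by (intro always_eventually) auto
    show "((\<lambda>x. bB * norm (vg \<rho> h x)) \<longlongrightarrow> 0) at_infinity"
      using tendsto_mult_right_zero[OF tendsto_norm_zero[OF vgv]] by simp
  qed
  have jump: "((\<lambda>x. \<integral>y. q h x y \<partial>k x) \<longlongrightarrow> 0) at_infinity"
  proof (rule tendstoI)
    fix \<epsilon> :: real assume \<epsilon>: "0 < \<epsilon>"
    \<comment> \<open>Less than half of \<open>\<epsilon>\<close> is left after multiplication by
      the mass bound \<open>mB\<close>; the summand 1 avoids division by zero.\<close>
    define \<eta> where "\<eta> = \<epsilon> / (2 * (mB + 1))"
    have \<eta>: "0 < \<eta>" using \<epsilon> mB by (simp add: \<eta>_def)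
    obtain R where R: "1 \<le> R" "\<And>x. measure (k x) {y. R < norm y} \<le> \<epsilon> / (4 * (4 * N + 1))"
      using tail[of "\<epsilon> / (4 * (4 * N + 1))"] \<epsilon> N by auto
    obtain d0 where d0: "0 < d0" "N * d0 powr (min \<rho> 2 - \<beta>) < \<eta>"
      using small_powr[of "min \<rho> 2 - \<beta>" \<eta> N] beta \<eta> N by auto
    define d where "d = min d0 1"
    have d: "0 < d" "d \<le> 1" "N * d powr (min \<rho> 2 - \<beta>) < \<eta>"
    proof -
      have "d powr (min \<rho> 2 - \<beta>) \<le> d0 powr (min \<rho> 2 - \<beta>)" using d0 beta by (intro powr_mono2) (auto simp: d_def)
      then have "N * d powr (min \<rho> 2 - \<beta>) \<le> N * d0 powr (min \<rho> 2 - \<beta>)" using N by (rule mult_left_mono)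
      with d0 show "0 < d" "d \<le> 1" "N * d powr (min \<rho> 2 - \<beta>) < \<eta>" by (auto simp: d_def)
    qed
    \<comment> \<open>The numerator of \<open>q\<close> will be at most \<open>4 * z\<close>, and
      division by \<open>w y\<close>, which is at least \<open>d powr \<beta>\<close>, gives
      \<open>\<eta>\<close>.\<close>
    define z where "z = \<eta> * d powr \<beta> / 4"
    have z: "0 < z" using \<eta> d by (simp add: z_def)
    obtain R1 where R1: "\<And>x. R1 \<le> norm x \<Longrightarrow> \<bar>h x\<bar> < z"
      using tendstoD[OF h z] by (auto simp: eventually_at_infinity)
    obtain R2 where R2: "\<And>x. R2 \<le> norm x \<Longrightarrow> norm (vg \<rho> h x) < z"
      using tendstoD[OF vgv z] by (auto simp: eventually_at_infinity)
    have "dist (\<integral>y. q h x y \<partial>k x) 0 < \<epsilon>" if x: "max (\<bar>R1\<bar> + R) R2 \<le> norm x" for x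
    proof -
      have x1: "R1 + R \<le> norm x" "R1 \<le> norm x" "R2 \<le> norm x" using x R(1) by auto
      have qb: "\<bar>q h x y\<bar> \<le> \<eta> + 4 * N * indicator {y. R < norm y} y" for y
      proof (cases "R < norm y")
        case True then show ?thesis using q_bound[OF r, of x y] \<eta> by simp
      next
        case yR: False
        show ?thesis
        proof (cases "norm y < d")
          case True
          have "\<bar>q h x y\<bar> \<le> N * norm y powr (min \<rho> 2 - \<beta>)" using q_small[OF r, of y x] True d by simp
          also have "\<dots> \<le> N * d powr (min \<rho> 2 - \<beta>)" using True beta N by (intro mult_left_mono powr_mono2) auto
          finally show ?thesis using d(3) yR by simp
        next
          case False
          have "R1 \<le> norm (x + y)" using norm_diff_ineq[of x y] x1(1) yR by linarith
          from R1[OF this] R1[OF x1(2)] R2[OF x1(3)]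
          have sm: "\<bar>h (x + y)\<bar> < z" "\<bar>h x\<bar> < z" "norm (vg \<rho> h x) < z" by auto
          have wd: "d powr \<beta> \<le> w y"
            using False d beta by (auto simp: w_def intro!: powr_mono2 powr_le1)
          have num: "\<bar>h (x + y) - h x - (y \<bullet> vg \<rho> h x) * chi y\<bar> \<le> \<bar>h (x + y)\<bar> + \<bar>h x\<bar> + 2 * norm (vg \<rho> h x)"
          proof -
            have "\<bar>(y \<bullet> vg \<rho> h x) * chi y\<bar> \<le> (norm y * norm (vg \<rho> h x)) * chi y"
              unfolding abs_mult using chi_facts(3)[of y] by (simp add: Cauchy_Schwarz_ineq2 mult_right_mono)
            also have "\<dots> = (norm y * chi y) * norm (vg \<rho> h x)" by simp
            also have "\<dots> \<le> 2 * norm (vg \<rho> h x)" by (intro mult_right_mono chi_norm) simp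
            finally show ?thesis by linarith
          qed
          have "\<bar>q h x y\<bar> = \<bar>h (x + y) - h x - (y \<bullet> vg \<rho> h x) * chi y\<bar> / w y" using w_nonneg[of y] by (simp add: q_def)
          also have "\<dots> \<le> (4 * z) / d powr \<beta>"
            using num sm wd d z by (intro frac_le) auto
          also have "\<dots> = \<eta>" using d by (simp add: z_def)
          finally show ?thesis using yR by simp
        qed
      qed
      interpret finite_measure "k x" by (rule k_finite)
      have st: "{y. R < norm y} \<in> sets (k x)" unfolding k_sets by measurable
      have "\<bar>\<integral>y. q h x y \<partial>k x\<bar> \<le> (\<integral>y. \<bar>q h x y\<bar> \<partial>k x)" by (rule integral_abs_bound)
      also have "\<dots> \<le> (\<integral>y. \<eta> + 4 * N * indicator {y. R < norm y} y \<partial>k x)"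
      proof (rule integral_mono)
        show "integrable (k x) (\<lambda>y. \<bar>q h x y\<bar>)" using integrable_Bb[OF k_finite k_sets q_Bb[OF r]] by simp
        show "integrable (k x) (\<lambda>y. \<eta> + 4 * N * indicator {y. R < norm y} y)"
          by (rule integrable_Bb[OF k_finite k_sets Bb_add[OF Bb_const Bb_cmult[OF Bb_indicator]]]) (use st k_sets in simp)
      qed (rule qb)
      also have "\<dots> = \<eta> * measure (k x) UNIV + 4 * N * measure (k x) {y. R < norm y}"
      proof -
        have i: "integrable (k x) (indicator {y. R < norm y} :: 'a \<Rightarrow> real)"
          by (rule integrable_Bb[OF k_finite k_sets Bb_indicator]) (use st k_sets in simp)
        have "(\<integral>y. \<eta> + 4 * N * indicator {y. R < norm y} y \<partial>k x) = (\<integral>y. \<eta> \<partial>k x) + (\<integral>y. 4 * N * indicator {y. R < norm y} y \<partial>k x)"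
          by (rule Bochner_Integration.integral_add) (use i in auto)
        also have "\<dots> = (\<integral>y. \<eta> \<partial>k x) + 4 * N * (\<integral>y. indicator {y. R < norm y} y \<partial>k x)" by (simp only: integral_mult_right_zero)
        also have "(\<integral>y. (indicator {y. R < norm y} y :: real) \<partial>k x) = measure (k x) {y. R < norm y}" using st k_space[of x] by simp
        finally show ?thesis using k_space[of x] by simp
      qed
      also have "\<dots> \<le> \<eta> * mB + 4 * N * (\<epsilon> / (4 * (4 * N + 1)))"
        using \<eta> N by (intro add_mono mult_left_mono k_measure_le R) auto
      also have "\<dots> < \<epsilon>"
      proof -
        have "\<eta> * mB < \<epsilon> / 2" using \<epsilon> mB by (simp add: \<eta>_def field_simps)
        moreover have "4 * N * (\<epsilon> / (4 * (4 * N + 1))) \<le> \<epsilon> / 4" using \<epsilon> N by (simp add: field_simps)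
        ultimately show ?thesis using \<epsilon> by linarith
      qed
      finally show ?thesis by simp
    qed
    then show "eventually (\<lambda>x. dist (\<integral>y. q h x y \<partial>k x) 0 < \<epsilon>) at_infinity"
      unfolding eventually_at_infinity by blast
  qed
  have "Bhat \<rho> b \<mu> chi h = (\<lambda>x. b' x \<bullet> vg \<rho> h x + (\<integral>y. q h x y \<partial>k x))" using reg_Bhat_eq[OF r] by auto
  then show ?thesis using tendsto_add[OF drift jump] by simp
qed

end

section \<open>Approximation by bounded perturbations\<close>

lemma sfun_eval: "sfun (\<lambda>f. f x)"
  by (rule sfunI[where C=1]) (auto intro: supnorm_ge)

lemma sfun_scale: assumes L: "sfun L" shows "sfun (\<lambda>f. a * L f)"
proof -
  obtain C where C: "\<forall>f\<in>Bb. \<bar>L f\<bar> \<le> C * supnorm f" using sfun_bound[OF L] by blast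
  show ?thesis
  proof (rule sfunI[where C="\<bar>a\<bar> * C"])
    show "\<bar>a * L f\<bar> \<le> \<bar>a\<bar> * C * supnorm f" if "f \<in> Bb" for f
      using C that by (simp add: abs_mult mult.assoc mult_left_mono)
    show "(\<lambda>n. a * L (F n)) \<longlonglongrightarrow> a * L f"
      if "\<And>n. F n \<in> Bb" "\<And>n x. \<bar>F n x\<bar> \<le> B" "\<And>x. (\<lambda>n. F n x) \<longlonglongrightarrow> f x" for F f B
      by (intro tendsto_mult tendsto_const sfun_lim[OF L that])
  qed (simp_all add: sfun_add[OF L] sfun_cmult[OF L] algebra_simps)
qed

lemma Bb_mult: "f \<in> Bb \<Longrightarrow> g \<in> Bb \<Longrightarrow> (\<lambda>x. f x * g x) \<in> Bb"
proof (rule BbI[where B="supnorm f * supnorm g"])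
  assume f: "f \<in> Bb" and g: "g \<in> Bb"
  show "(\<lambda>x. f x * g x) \<in> borel_measurable borel" by (intro borel_measurable_times Bb_measurable f g)
  show "\<bar>f x * g x\<bar> \<le> supnorm f * supnorm g" for x
    unfolding abs_mult by (intro mult_mono supnorm_ge f g supnorm_nonneg) auto
qed

lemma Bb_shift: "f \<in> Bb \<Longrightarrow> (\<lambda>y. f (x + y)) \<in> Bb"
proof (rule BbI[where B="supnorm f"])
  assume f: "f \<in> Bb"
  have [measurable]: "f \<in> borel_measurable borel" by (rule Bb_measurable[OF f])
  show "(\<lambda>y. f (x + y)) \<in> borel_measurable borel" by measurable
qed (rule supnorm_ge)

lemma sfun_weighted_shift:
  fixes g :: "'a::euclidean_space \<Rightarrow> real"
  assumes L: "sfun L" and g: "g \<in> Bb" shows "sfun (\<lambda>f. L (\<lambda>y. g y * f (x + y)))"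
proof -
  have M: "(\<lambda>y. g y * f (x + y)) \<in> Bb" if "f \<in> Bb" for f by (intro Bb_mult Bb_shift g that)
  obtain C where C: "0 \<le> C" "\<forall>f\<in>Bb. \<bar>L f\<bar> \<le> C * supnorm f" using sfun_bound[OF L] by blast
  have gb: "\<bar>g y * f (x + y)\<bar> \<le> supnorm g * B" if "\<And>y. \<bar>f y\<bar> \<le> B" for f y B
    unfolding abs_mult by (intro mult_mono supnorm_ge g that supnorm_nonneg) auto
  show ?thesis
  proof (rule sfunI[where C="C * supnorm g"])
    fix f h :: "'a \<Rightarrow> real" assume f: "f \<in> Bb" and h: "h \<in> Bb"
    show "L (\<lambda>y. g y * (f (x + y) + h (x + y))) = L (\<lambda>y. g y * f (x + y)) + L (\<lambda>y. g y * h (x + y))"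
      using sfun_add[OF L M[OF f] M[OF h]] by (simp add: distrib_left)
  next
    fix f :: "'a \<Rightarrow> real" and c assume f: "f \<in> Bb"
    show "L (\<lambda>y. g y * (c * f (x + y))) = c * L (\<lambda>y. g y * f (x + y))"
      using sfun_cmult[OF L M[OF f], of c] by (simp add: mult.left_commute)
  next
    fix f :: "'a \<Rightarrow> real" assume f: "f \<in> Bb"
    have "supnorm (\<lambda>y. g y * f (x + y)) \<le> supnorm g * supnorm f"
      by (rule supnorm_le) (rule gb[OF supnorm_ge[OF f]])
    then have "C * supnorm (\<lambda>y. g y * f (x + y)) \<le> C * (supnorm g * supnorm f)" by (rule mult_left_mono[OF _ C(1)])
    then show "\<bar>L (\<lambda>y. g y * f (x + y))\<bar> \<le> C * supnorm g * supnorm f"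
      using C(2)[rule_format, OF M[OF f]] by (simp add: mult.assoc)
  next
    fix F :: "nat \<Rightarrow> 'a \<Rightarrow> real" and f B
    assume F: "\<And>n. F n \<in> Bb" "\<And>n x. \<bar>F n x\<bar> \<le> B" "\<And>x. (\<lambda>n. F n x) \<longlonglongrightarrow> f x"
    show "(\<lambda>n. L (\<lambda>y. g y * F n (x + y))) \<longlonglongrightarrow> L (\<lambda>y. g y * f (x + y))"
    proof (rule sfun_lim[OF L])
      show "(\<lambda>y. g y * F n (x + y)) \<in> Bb" for n by (rule M[OF F(1)])
      show "\<bar>g y * F n (x + y)\<bar> \<le> supnorm g * B" for n y by (rule gb[OF F(2)])
      show "(\<lambda>n. g y * F n (x + y)) \<longlonglongrightarrow> g y * f (x + y)" for y by (intro tendsto_mult tendsto_const F(3))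
    qed
  qed
qed

lemma op_family_diff_scale:
  assumes V: "op_family V" and W: "op_family W" shows "op_family (\<lambda>t f x. V t f x - c * W t f x)"
  unfolding op_family_def
proof (intro conjI allI ballI impI)
  fix t x show "sfun (\<lambda>f. V t f x - c * W t f x)" by (intro sfun_minus sfun_scale op_family_sfun V W)
next
  fix f :: "'a \<Rightarrow> real" assume "f \<in> Bb"
  then show "(\<lambda>(t,x). V t f x - c * W t f x) \<in> borel_measurable (borel \<Otimes>\<^sub>M borel)"
    using op_family_measurable[OF V] op_family_measurable[OF W] by (simp add: split_beta')
qed (simp add: op_family_nonpos[OF V] op_family_nonpos[OF W])

context levy
begin

text \<open>Bounded approximations of the perturbation: jumps of size at most \<open>en n\<close> are discarded, and the
  remaining drift \<open>bn n\<close> is replaced by jumps \<open>dl n *\<^sub>R bn n\<close> at rate \<open>1 / dl n\<close>; adding the constant \<open>cn n\<close>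
  turns the result into a positive operator \<open>Pn n\<close>.\<close>

definition en :: "nat \<Rightarrow> real" where "en n = 1 / (real n + 2)"
text \<open>The density with respect to \<open>k x\<close> that restores \<open>\<mu> x\<close> on
  the jumps longer than \<open>en n\<close>.\<close>

definition gn :: "nat \<Rightarrow> 'a \<Rightarrow> real" where "gn n y = indicator {y. en n < norm y} y / w y"
definition mass :: "nat \<Rightarrow> 'a \<Rightarrow> real" where "mass n x = (\<integral>y. gn n y \<partial>k x)"
definition cmp :: "nat \<Rightarrow> 'a \<Rightarrow> 'a \<Rightarrow> real" where "cmp n e x = (\<integral>y. gn n y * (chi y * (y \<bullet> e)) \<partial>k x)"
definition bn :: "nat \<Rightarrow> 'a \<Rightarrow> 'a" where
  "bn n x = (if \<rho> \<le> 1 then 0 else b x - (\<Sum>e\<in>Basis. cmp n e x *\<^sub>R e))"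
definition bnB :: "nat \<Rightarrow> real" where "bnB n = bB + real DIM('a) * (2 / en n ^ 2 * mB)"
text \<open>The step is so short that
  \<open>dl n powr (min \<rho> 2 - 1) * bnB n powr min \<rho> 2\<close> is at most
  \<open>en n\<close> when \<open>\<rho> > 1\<close>; this is the error of a difference quotient in
  place of the derivative. For \<open>\<rho> \<le> 1\<close> the drift \<open>bn\<close> is 0 and
  any positive step will do.\<close>

definition dl :: "nat \<Rightarrow> real" where
  "dl n = (en n / (bnB n powr min \<rho> 2 + 1)) powr (1 / (min \<rho> 2 - 1))"
text \<open>\<open>mB / en n ^ 2\<close> bounds the jump rates \<open>mass n x\<close> for all
  \<open>x\<close>. The coefficient of \<open>f x\<close> in \<open>Pn\<close> is therefore
  nonnegative, and it levels the total rate to the same value at every point.\<close>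

definition cn :: "nat \<Rightarrow> real" where "cn n = 1 / dl n + mB / en n ^ 2"
definition Pn :: "nat \<Rightarrow> ('a \<Rightarrow> real) \<Rightarrow> 'a \<Rightarrow> real" where
  "Pn n f x = (\<integral>y. gn n y * f (x + y) \<partial>k x) + (1 / dl n) * f (x + dl n *\<^sub>R bn n x) + (cn n - 1 / dl n - mass n x) * f x"

lemma en: "0 < en n" "en n < 1" "en \<longlonglongrightarrow> 0"
proof -
  show "0 < en n" "en n < 1" by (auto simp: en_def)
  have "(\<lambda>n. 1 / (real n + 2)) \<longlonglongrightarrow> 0" by real_asymp
  then show "en \<longlonglongrightarrow> 0" by (simp add: en_def[abs_def])
qed

lemma dl_pos: "0 < dl n"
proof -
  have "0 < en n / (bnB n powr min \<rho> 2 + 1)" by (intro divide_pos_pos en add_nonneg_pos) auto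
  then show ?thesis unfolding dl_def by (simp only: powr_gt_zero)
qed

text \<open>As \<open>en n < 1\<close> and \<open>\<beta> < 2\<close>, the square lies below the
  power with exponent \<open>\<beta>\<close>. This bounds the density \<open>gn n\<close>.\<close>

lemma w_lower: "en n < norm y \<Longrightarrow> en n ^ 2 \<le> w y"
proof -
  assume y: "en n < norm y"
  have "en n ^ 2 = en n powr 2" using en(1)[of n] by (simp add: powr_numeral)
  also have "\<dots> \<le> en n powr \<beta>" using en(1,2)[of n] beta by (intro powr_mono') auto
  also have "\<dots> \<le> norm y powr \<beta>" using en(1)[of n] y beta by (intro powr_mono2) auto
  finally have "en n ^ 2 \<le> norm y powr \<beta>" .
  moreover have "en n ^ 2 \<le> 1" using en(1,2)[of n] by (simp add: power_le_one)
  ultimately show ?thesis by (simp add: w_def)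
qed

lemma gn_bounds: "0 \<le> gn n y" "gn n y \<le> 1 / en n ^ 2"
proof -
  show "0 \<le> gn n y" using w_nonneg[of y] by (simp add: gn_def)
  show "gn n y \<le> 1 / en n ^ 2"
  proof (cases "en n < norm y")
    case True
    then show ?thesis using w_lower[OF True] en(1)[of n] by (simp add: gn_def frac_le)
  qed (simp add: gn_def)
qed

lemma gn_Bb: "gn n \<in> Bb"
proof (rule BbI[where B="1 / en n ^ 2"])
  show "gn n \<in> borel_measurable borel" unfolding gn_def by measurable
  show "\<bar>gn n y\<bar> \<le> 1 / en n ^ 2" for y using gn_bounds[of n y] by simp
qed

lemma mass_bounds: "0 \<le> mass n x" "mass n x \<le> mB / en n ^ 2"
proof -
  show "0 \<le> mass n x" unfolding mass_def using gn_bounds by simp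
  have "\<bar>mass n x\<bar> \<le> 1 / en n ^ 2 * mB"
    unfolding mass_def using gn_bounds[of n] by (intro k_integral_bound Bb_measurable gn_Bb) auto
  then show "mass n x \<le> mB / en n ^ 2" by simp
qed

lemma cmp_integrand:
  assumes e: "e \<in> Basis"
  shows "(\<lambda>y. gn n y * (chi y * (y \<bullet> e))) \<in> Bb" "\<bar>gn n y * (chi y * (y \<bullet> e))\<bar> \<le> 2 / en n ^ 2"
proof -
  show b: "\<bar>gn n y * (chi y * (y \<bullet> e))\<bar> \<le> 2 / en n ^ 2" for y
  proof -
    have "chi y * \<bar>y \<bullet> e\<bar> \<le> chi y * norm y" using e chi_facts(3)[of y] by (intro mult_left_mono Basis_le_norm) auto
    also have "\<dots> \<le> 2" using chi_norm[of y] by (simp add: mult.commute)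
    finally have "gn n y * (chi y * \<bar>y \<bullet> e\<bar>) \<le> (1 / en n ^ 2) * 2"
      using gn_bounds[of n y] chi_facts(3)[of y] by (intro mult_mono) auto
    then show ?thesis using gn_bounds[of n y] chi_facts(3)[of y] by (simp add: abs_mult)
  qed
  have [measurable]: "gn n \<in> borel_measurable borel" by (rule Bb_measurable[OF gn_Bb])
  show "(\<lambda>y. gn n y * (chi y * (y \<bullet> e))) \<in> Bb" by (rule BbI[OF _ b]) measurable
qed

lemma bn_measurable[measurable]: "bn n \<in> borel_measurable borel"
proof -
  have "(\<lambda>x. cmp n e x) \<in> borel_measurable borel" if "e \<in> Basis" for e
    unfolding cmp_def by (rule k_integral_measurable[OF cmp_integrand(1)[OF that]])
  then have "(\<lambda>x. b x - (\<Sum>e\<in>Basis. cmp n e x *\<^sub>R e)) \<in> borel_measurable borel"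
    by (intro borel_measurable_diff b_meas borel_measurable_sum borel_measurable_scaleR) auto
  moreover have "bn n = (if \<rho> \<le> 1 then (\<lambda>x. 0) else (\<lambda>x. b x - (\<Sum>e\<in>Basis. cmp n e x *\<^sub>R e)))" by (auto simp: bn_def)
  ultimately show ?thesis by simp
qed

lemma bn_bound: "norm (bn n x) \<le> bnB n"
proof (cases "\<rho> \<le> 1")
  case True
  then show ?thesis using bB_nonneg mB by (simp add: bn_def bnB_def)
next
  case False
  have c: "\<bar>cmp n e x\<bar> \<le> 2 / en n ^ 2 * mB" if "e \<in> Basis" for e
    unfolding cmp_def by (rule k_integral_bound[OF Bb_measurable[OF cmp_integrand(1)[OF that]] cmp_integrand(2)[OF that]]) simp
  have "norm (\<Sum>e\<in>Basis. cmp n e x *\<^sub>R e) \<le> (\<Sum>e\<in>(Basis::'a set). 2 / en n ^ 2 * mB)"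
    by (rule order_trans[OF norm_sum sum_mono]) (use c in simp)
  then have "norm (\<Sum>e\<in>Basis. cmp n e x *\<^sub>R e) \<le> real DIM('a) * (2 / en n ^ 2 * mB)" by simp
  then show ?thesis using False b_bdd[of x] norm_triangle_ineq4[of "b x" "\<Sum>e\<in>Basis. cmp n e x *\<^sub>R e"]
    by (simp add: bn_def bnB_def)
qed

lemma cn_pos: "0 < cn n" unfolding cn_def using dl_pos[of n] mB by (intro add_pos_nonneg) auto

lemma Pn_coeff: "0 \<le> cn n - 1 / dl n - mass n x" unfolding cn_def using mass_bounds[of n x] by simp

lemma Pn_sfun: "sfun (\<lambda>f. Pn n f x)"
  unfolding Pn_def
  by (intro sfun_plus sfun_scale sfun_eval sfun_weighted_shift[OF sfun_integral[OF k_finite k_sets] gn_Bb])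

lemma Pn_measurable:
  assumes f: "f \<in> Bb" shows "Pn n f \<in> borel_measurable borel"
proof -
  have [measurable]: "f \<in> borel_measurable borel" "gn n \<in> borel_measurable borel" by (intro Bb_measurable f gn_Bb)+
  have [measurable]: "mass n \<in> borel_measurable borel" unfolding mass_def[abs_def] by (rule k_integral_measurable[OF gn_Bb])
  have [measurable]: "(\<lambda>x. \<integral>y. gn n y * f (x + y) \<partial>k x) \<in> borel_measurable borel"
  proof (rule sfun_param_measurable[where L="\<lambda>x f. \<integral>y. f y \<partial>k x" and F="\<lambda>x y. gn n y * f (x + y)"])
    show "sfun (\<lambda>f. \<integral>y. f y \<partial>k x)" for x by (rule sfun_integral[OF k_finite k_sets])
    show "(\<lambda>(x,y). gn n y * f (x + y)) \<in> borel_measurable (borel \<Otimes>\<^sub>M borel)" by measurable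
    show "(\<lambda>y. gn n y * f (x + y)) \<in> Bb" for x by (intro Bb_mult gn_Bb Bb_shift f)
  qed (auto intro: k_integral_measurable)
  show ?thesis unfolding Pn_def[abs_def] by measurable
qed

lemma Pn_pos:
  assumes f: "f \<in> Bb" "\<And>y. 0 \<le> f y" shows "0 \<le> Pn n f x"
  unfolding Pn_def using f gn_bounds[of n] dl_pos[of n] Pn_coeff[of n x]
  by (intro add_nonneg_nonneg mult_nonneg_nonneg integral_nonneg_AE) auto

lemma Pn_one: "Pn n (\<lambda>y. 1) x = cn n"
  unfolding Pn_def mass_def by simp

text \<open>The norm of a positive operator is read off from its value at 1, here
  \<open>cn n\<close>, by applying it to \<open>supnorm f\<close> plus and minus
  \<open>f\<close>.\<close>

lemma Pn_bound:
  assumes f: "f \<in> Bb" shows "\<bar>Pn n f x\<bar> \<le> cn n * supnorm f"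
proof -
  note sf = Pn_sfun[of n x]
  have c: "Pn n (\<lambda>y. supnorm f * 1) x = supnorm f * cn n" by (simp only: sfun_cmult[OF sf Bb_const] Pn_one)
  have "0 \<le> Pn n (\<lambda>y. supnorm f * 1 - f y) x"
    by (intro Pn_pos Bb_diff Bb_cmult Bb_const f) (use supnorm_ge[OF f] in \<open>auto simp: abs_le_iff\<close>)
  moreover have "Pn n (\<lambda>y. supnorm f * 1 - f y) x = supnorm f * cn n - Pn n f x"
    by (simp only: sfun_diff[OF sf Bb_cmult[OF Bb_const] f] c)
  moreover have "0 \<le> Pn n (\<lambda>y. supnorm f * 1 + f y) x"
  proof (intro Pn_pos Bb_add Bb_cmult Bb_const f)
    fix y show "0 \<le> supnorm f * 1 + f y" using supnorm_ge[OF f, of y] by simp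
  qed
  moreover have "Pn n (\<lambda>y. supnorm f * 1 + f y) x = supnorm f * cn n + Pn n f x"
    by (simp only: sfun_add[OF sf Bb_cmult[OF Bb_const] f] c)
  ultimately show ?thesis by (simp add: abs_le_iff mult.commute)
qed

section \<open>Comparison of the bounded approximations with the perturbation\<close>

definition err :: "nat \<Rightarrow> ('a \<Rightarrow> real) \<Rightarrow> 'a \<Rightarrow> real" where
  "err n h x = (h (x + dl n *\<^sub>R bn n x) - h x - (dl n *\<^sub>R bn n x) \<bullet> vg \<rho> h x) / dl n"

text \<open>\<open>err\<close> is the Taylor remainder at the increment
  \<open>dl n *\<^sub>R bn n x\<close>, divided by \<open>dl n\<close>; the step was chosen for
  exactly this estimate.\<close>

lemma err_bound:
  assumes r: "reg \<rho> N h" shows "\<bar>err n h x\<bar> \<le> N * en n"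
proof (cases "\<rho> \<le> 1")
  case True
  then show ?thesis using regD(5)[OF r] en(1)[of n] by (simp add: err_def bn_def)
next
  case False
  let ?\<gamma> = "min \<rho> 2"
  have N: "0 \<le> N" by (rule regD(5)[OF r])
  have d: "0 < dl n" by (rule dl_pos)
  have dg: "dl n powr (?\<gamma> - 1) = en n / (bnB n powr ?\<gamma> + 1)"
  proof -
    have "?\<gamma> - 1 \<noteq> 0" using False by simp
    then have "1 / (?\<gamma> - 1) * (?\<gamma> - 1) = 1" by simp
    then have "dl n powr (?\<gamma> - 1) = (en n / (bnB n powr ?\<gamma> + 1)) powr 1" unfolding dl_def powr_powr by (simp only:)
    then show ?thesis using en(1)[of n] by simp
  qed
  have "\<bar>err n h x\<bar> = \<bar>h (x + dl n *\<^sub>R bn n x) - h x - (dl n *\<^sub>R bn n x) \<bullet> vg \<rho> h x\<bar> / dl n" using d by (simp add: err_def)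
  also have "\<dots> \<le> (N * norm (dl n *\<^sub>R bn n x) powr ?\<gamma>) / dl n" by (intro divide_right_mono regD(4)[OF r]) (use d in simp)
  also have "\<dots> = N * (dl n powr (?\<gamma> - 1) * norm (bn n x) powr ?\<gamma>)" using d by (simp add: powr_mult powr_diff)
  also have "\<dots> \<le> N * (dl n powr (?\<gamma> - 1) * bnB n powr ?\<gamma>)"
    using N bn_bound[of n x] rho_pos by (intro mult_left_mono powr_mono2) auto
  also have "dl n powr (?\<gamma> - 1) * bnB n powr ?\<gamma> \<le> en n"
  proof -
    have "0 < bnB n powr ?\<gamma> + 1" by (intro add_nonneg_pos) auto
    then show ?thesis unfolding dg using en(1)[of n] by (simp add: field_simps)
  qed
  finally show ?thesis using N by (simp add: mult_left_mono)
qed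

text \<open>The compensator of the retained jumps, removed from the drift in \<open>bn\<close>, is
  absorbed by the truncated integral of \<open>q\<close>. After this cancellation only the drift
  error and the truncation distinguish the approximation from \<open>Bhat\<close>.\<close>

lemma Pn_reg:
  assumes r: "reg \<rho> N h"
  shows "Pn n h x - cn n * h x = err n h x + b' x \<bullet> vg \<rho> h x + (\<integral>y. indicator {y. en n < norm y} y * q h x y \<partial>k x)"
proof -
  let ?v = "vg \<rho> h x"
  note sfk = sfun_integral[OF k_finite k_sets, of x]
  have hB: "h \<in> Bb" by (rule regD(1)[OF r])
  have B1: "(\<lambda>y. gn n y * h (x + y)) \<in> Bb" by (intro Bb_mult gn_Bb Bb_shift hB)
  have B2: "(\<lambda>y. h x * gn n y) \<in> Bb" by (intro Bb_cmult gn_Bb)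
  have B3: "(\<lambda>y. gn n y * (chi y * (y \<bullet> e))) \<in> Bb" if "e \<in> Basis" for e by (rule cmp_integrand(1)[OF that])
  \<comment> \<open>\<open>cmp\<close> consists of scalar integrals, so the inner product with the
    gradient is assembled by induction over the basis vectors.\<close>
  have inner: "(\<lambda>y. gn n y * (chi y * (y \<bullet> ?v))) \<in> Bb
      \<and> (\<integral>y. gn n y * (chi y * (y \<bullet> ?v)) \<partial>k x) = (\<Sum>e\<in>Basis. cmp n e x *\<^sub>R e) \<bullet> ?v"
  proof -
    have "(\<lambda>y. \<Sum>e\<in>E. (?v \<bullet> e) * (gn n y * (chi y * (y \<bullet> e)))) \<in> Bb
        \<and> (\<integral>y. (\<Sum>e\<in>E. (?v \<bullet> e) * (gn n y * (chi y * (y \<bullet> e)))) \<partial>k x) = (\<Sum>e\<in>E. (?v \<bullet> e) * cmp n e x)"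
      if "finite E" "E \<subseteq> Basis" for E
      using that
    proof (induction E rule: finite_induct)
      case empty then show ?case by (simp add: Bb_const)
    next
      case (insert e E)
      then have e: "e \<in> Basis" and IH: "(\<lambda>y. \<Sum>e\<in>E. (?v \<bullet> e) * (gn n y * (chi y * (y \<bullet> e)))) \<in> Bb"
        "(\<integral>y. (\<Sum>e\<in>E. (?v \<bullet> e) * (gn n y * (chi y * (y \<bullet> e)))) \<partial>k x) = (\<Sum>e\<in>E. (?v \<bullet> e) * cmp n e x)" by auto
      note Bc = Bb_cmult[OF B3[OF e], of "?v \<bullet> e"]
      show ?case
        using insert(1,2) Bb_add[OF Bc IH(1)] sfun_add[OF sfk Bc IH(1)] sfun_cmult[OF sfk B3[OF e], of "?v \<bullet> e"] IH(2)
        by (simp add: cmp_def)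
    qed
    from this[of Basis]
    have 1: "(\<lambda>y. \<Sum>e\<in>Basis. (?v \<bullet> e) * (gn n y * (chi y * (y \<bullet> e)))) \<in> Bb"
      "(\<integral>y. (\<Sum>e\<in>Basis. (?v \<bullet> e) * (gn n y * (chi y * (y \<bullet> e)))) \<partial>k x) = (\<Sum>e\<in>Basis. (?v \<bullet> e) * cmp n e x)" by auto
    have 2: "(\<lambda>y. \<Sum>e\<in>Basis. (?v \<bullet> e) * (gn n y * (chi y * (y \<bullet> e)))) = (\<lambda>y. gn n y * (chi y * (y \<bullet> ?v)))"
    proof
      fix y
      have "gn n y * (chi y * (y \<bullet> ?v)) = gn n y * (chi y * (\<Sum>e\<in>Basis. (y \<bullet> e) * (?v \<bullet> e)))"
        using euclidean_inner[of y ?v] by simp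
      then show "(\<Sum>e\<in>Basis. (?v \<bullet> e) * (gn n y * (chi y * (y \<bullet> e)))) = gn n y * (chi y * (y \<bullet> ?v))"
        by (simp add: sum_distrib_left mult_ac)
    qed
    have 3: "(\<Sum>e\<in>Basis. cmp n e x *\<^sub>R e) \<bullet> ?v = (\<Sum>e\<in>Basis. (?v \<bullet> e) * cmp n e x)"
      by (simp add: inner_sum_left inner_commute[of ?v] mult.commute)
    show ?thesis using 1 unfolding 2 3 by blast
  qed
  have "(\<lambda>y. indicator {y. en n < norm y} y * q h x y) = (\<lambda>y. (gn n y * h (x + y) - h x * gn n y) - gn n y * (chi y * (y \<bullet> ?v)))"
    by (auto simp: gn_def q_def diff_divide_distrib add_divide_distrib algebra_simps)
  then have I: "(\<integral>y. indicator {y. en n < norm y} y * q h x y \<partial>k x)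
     = ((\<integral>y. gn n y * h (x + y) \<partial>k x) - h x * mass n x) - (\<Sum>e\<in>Basis. cmp n e x *\<^sub>R e) \<bullet> ?v"
    using sfun_diff[OF sfk Bb_diff[OF B1 B2] inner[THEN conjunct1]] sfun_diff[OF sfk B1 B2] sfun_cmult[OF sfk gn_Bb, of "h x" n]
      inner[THEN conjunct2] by (simp add: mass_def)
  have bv: "bn n x \<bullet> ?v = b' x \<bullet> ?v - (\<Sum>e\<in>Basis. cmp n e x *\<^sub>R e) \<bullet> ?v"
    by (simp add: bn_def b'_def vg_def inner_diff_left)
  have "err n h x = (1 / dl n) * h (x + dl n *\<^sub>R bn n x) - (1 / dl n) * h x - bn n x \<bullet> ?v"
    using dl_pos[of n] by (simp add: err_def diff_divide_distrib)
  then show ?thesis unfolding I by (simp add: Pn_def bv algebra_simps)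
qed

text \<open>The constant is independent of \<open>n\<close>, unlike the bounds for
  \<open>Pn n\<close> and \<open>cn n\<close> taken separately. The summand 1 stands for the drift
  error, as \<open>en n < 1\<close>.\<close>

lemma Pn_reg_bound:
  assumes r: "reg \<rho> N h" shows "\<bar>Pn n h x - cn n * h x\<bar> \<le> (bB + 4 * mB + 1) * N"
proof -
  have N: "0 \<le> N" by (rule regD(5)[OF r])
  have "\<bar>\<integral>y. indicator {y. en n < norm y} y * q h x y \<partial>k x\<bar> \<le> (4 * N) * mB"
  proof (rule k_integral_bound)
    have [measurable]: "q h x \<in> borel_measurable borel" by (rule Bb_measurable[OF q_Bb[OF r]])
    show "(\<lambda>y. indicator {y. en n < norm y} y * q h x y) \<in> borel_measurable borel" by measurable
    show "\<bar>indicator {y. en n < norm y} y * q h x y\<bar> \<le> 4 * N" for y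
      using q_bound[OF r, of x y] N by (auto simp: indicator_def)
  qed (use N in simp)
  moreover have "\<bar>err n h x\<bar> \<le> N"
    using err_bound[OF r, of n x] mult_left_mono[OF less_imp_le[OF en(2)[of n]] N] by simp
  ultimately show ?thesis
    unfolding Pn_reg[OF r] using drift_bound[OF r, of x] by (simp add: algebra_simps)
qed

text \<open>The argument varies with \<open>n\<close>, as \<open>dyson_limit\<close> demands. For
  \<open>y \<noteq> 0\<close> the truncation is eventually inactive, and at \<open>y = 0\<close> the
  integrand is 0.\<close>

lemma Pn_limit:
  assumes r: "\<And>n. reg \<rho> N (H n)" and lim: "\<And>x. (\<lambda>n. H n x) \<longlonglongrightarrow> h x"
  shows "(\<lambda>n. Pn n (H n) x - cn n * H n x) \<longlonglongrightarrow> Bhat \<rho> b \<mu> chi h x"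
proof -
  have N: "0 \<le> N" by (rule regD(5)[OF r])
  note rh = reg_limit(1)[OF r lim]
  have "(\<lambda>n. N * en n) \<longlonglongrightarrow> 0" using tendsto_mult_right_zero[OF en(3)] .
  then have e: "(\<lambda>n. err n (H n) x) \<longlonglongrightarrow> 0"
    by (rule Lim_null_comparison[rotated]) (use err_bound[OF r] in auto)
  have i: "(\<lambda>n. \<integral>y. indicator {y. en n < norm y} y * q (H n) x y \<partial>k x) \<longlonglongrightarrow> (\<integral>y. q h x y \<partial>k x)"
  proof (rule sfun_lim[OF sfun_integral[OF k_finite k_sets], where B="4 * N"])
    show b: "\<bar>indicator {y. en n < norm y} y * q (H n) x y\<bar> \<le> 4 * N" for n y
      using q_bound[OF r[of n], of x y] N by (auto simp: indicator_def)
    have [measurable]: "q (H n) x \<in> borel_measurable borel" for n by (rule Bb_measurable[OF q_Bb[OF r]])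
    show "(\<lambda>y. indicator {y. en n < norm y} y * q (H n) x y) \<in> Bb" for n
      by (rule BbI[OF _ b]) measurable
    fix y
    show "(\<lambda>n. indicator {y. en n < norm y} y * q (H n) x y) \<longlonglongrightarrow> q h x y"
    proof (cases "y = 0")
      case True
      then show ?thesis by (simp add: q_def)
    next
      case False
      have "eventually (\<lambda>n. en n < norm y) sequentially" using False by (intro order_tendstoD(2)[OF en(3)]) simp
      then have "eventually (\<lambda>n. q (H n) x y = indicator {y. en n < norm y} y * q (H n) x y) sequentially"
        by eventually_elim simp
      then show ?thesis by (rule Lim_transform_eventually[OF q_limit[OF r lim]])
    qed
  qed
  have "(\<lambda>n. err n (H n) x + b' x \<bullet> vg \<rho> (H n) x + (\<integral>y. indicator {y. en n < norm y} y * q (H n) x y \<partial>k x))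
      \<longlonglongrightarrow> 0 + b' x \<bullet> vg \<rho> h x + (\<integral>y. q h x y \<partial>k x)"
    by (intro tendsto_add e i tendsto_inner tendsto_const reg_limit(2)[OF r lim])
  then show ?thesis unfolding Pn_reg[OF r] reg_Bhat_eq[OF rh] by simp
qed

end

context levy_semigroup
begin

text \<open>The perturbations \<open>Pn n - cn n\<close> share the profile of \<open>Bhat\<close>,
  so \<open>dyson_limit\<close> applies, and \<open>S_eq_expZ\<close> rewrites the approximating
  semigroups as damped Dyson series of the positive operators \<open>Pn n\<close>. Sign and bound at
  1 can then be read off before the limit.\<close>

lemma
  assumes T_pos: "\<And>t f x. f \<in> Bb \<Longrightarrow> (\<And>y. 0 \<le> f y) \<Longrightarrow> 0 \<le> T t f x"
  shows bounded_perturbation_Pn: "bounded_perturbation T (Pn n) A l (cn n)"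
    and S_limit: "f \<in> Bb \<Longrightarrow> (\<lambda>n. exp (- cn n * t) * dyson.S T (bounded_perturbation.H T (Pn n)) t f x) \<longlonglongrightarrow> S t f x"
proof -
  show bp: "bounded_perturbation T (Pn n) A l (cn n)" for n
    by unfold_locales (use T Tb T_sg cn_pos Pn_sfun Pn_measurable Pn_bound T_pos Pn_pos in auto)
  interpret BP: bounded_perturbation T "Pn n" A l "cn n" for n by (rule bp)
  let ?Gn = "\<lambda>n s f x. BP.H n s f x - cn n * T s f x"
  have Gn: "?Gn n s f x = Pn n (T s f) x - cn n * T s f x" for n s f x by (simp add: BP.H_def)
  have dn: "dyson T (?Gn n) A l (\<lambda>t. (bB + 4 * mB + 1) * \<kappa> t)" for n
  proof
    show "op_family (?Gn n)" by (rule op_family_diff_scale[OF BP.H_op_family T])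
    show "exp_bounded (?Gn n) (\<lambda>t. (bB + 4 * mB + 1) * \<kappa> t) l"
      unfolding exp_bounded_def Gn using Pn_reg_bound[OF Treg] by (simp add: mult.assoc)
    show "(\<integral>t. (bB + 4 * mB + 1) * \<kappa> t \<partial>lborel) \<le> 1/2" using half by simp
  qed (rule T Tb \<kappa>)+
  assume f: "f \<in> Bb"
  have "(\<lambda>n. dyson.S T (?Gn n) t f x) \<longlonglongrightarrow> S t f x"
  proof (rule dyson_limit[OF dyson_axioms dn _ f])
    fix s B x and F :: "nat \<Rightarrow> 'a \<Rightarrow> real" and f
    assume F: "\<And>n. F n \<in> Bb" "\<And>n x. \<bar>F n x\<bar> \<le> B" "\<And>x. (\<lambda>n. F n x) \<longlonglongrightarrow> f x"
    show "(\<lambda>n. ?Gn n s (F n) x) \<longlonglongrightarrow> G s f x"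
      unfolding Gn G_def by (rule Pn_limit[OF T_limit(1)[OF F] T_limit(2)[OF F]])
  qed
  moreover have "dyson.S T (?Gn n) t f x = exp (- cn n * t) * dyson.S T (BP.H n) t f x" for n
    by (rule BP.S_eq_expZ[OF dn f])
  ultimately show "(\<lambda>n. exp (- cn n * t) * dyson.S T (BP.H n) t f x) \<longlonglongrightarrow> S t f x" by simp
qed

lemma S_pos:
  assumes T_pos: "\<And>t f x. f \<in> Bb \<Longrightarrow> (\<And>y. 0 \<le> f y) \<Longrightarrow> 0 \<le> T t f x"
    and f: "f \<in> Bb" "\<And>y. 0 \<le> f y"
  shows "0 \<le> S t f x"
proof (rule LIMSEQ_le_const[OF S_limit[OF T_pos f(1)]])
  show "\<exists>N. \<forall>n\<ge>N. 0 \<le> exp (- cn n * t) * dyson.S T (bounded_perturbation.H T (Pn n)) t f x"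
    using bounded_perturbation.Z_pos[OF bounded_perturbation_Pn[OF T_pos] f] by simp
qed auto

lemma S_one_le:
  assumes T_pos: "\<And>t f x. f \<in> Bb \<Longrightarrow> (\<And>y. 0 \<le> f y) \<Longrightarrow> 0 \<le> T t f x"
    and T1: "\<And>t x. T t (\<lambda>y. 1) x \<le> 1"
  shows "S t (\<lambda>y. 1) x \<le> 1"
proof (rule LIMSEQ_le_const2[OF S_limit[OF T_pos Bb_const]])
  show "\<exists>N. \<forall>n\<ge>N. exp (- cn n * t) * dyson.S T (bounded_perturbation.H T (Pn n)) t (\<lambda>y. 1) x \<le> 1"
    using bounded_perturbation.Z_one_bound[OF bounded_perturbation_Pn[OF T_pos] T1] by blast
qed auto

end

section \<open>The theorem\<close>

lemma Cb_subset_Bb: "f \<in> Cb \<Longrightarrow> f \<in> Bb"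
  unfolding Cb_def Bb_def by (auto intro: borel_measurable_continuous_onI)

lemma Cinf_subset_Cb:
  fixes f :: "'a::euclidean_space \<Rightarrow> real"
  assumes "f \<in> Cinf" shows "f \<in> Cb"
proof -
  have c: "continuous_on UNIV f" and l: "(f \<longlongrightarrow> 0) at_infinity" using assms by (auto simp: Cinf_def)
  obtain R where R: "\<And>x. R \<le> norm x \<Longrightarrow> dist (f x) 0 < 1"
    using tendstoD[OF l, of 1] by (auto simp: eventually_at_infinity)
  have "compact (f ` cball 0 R)" by (intro compact_continuous_image continuous_on_subset[OF c]) auto
  then have "bounded (f ` cball 0 R)" by (rule compact_imp_bounded)
  then obtain C where C: "\<forall>x\<in>cball 0 R. norm (f x) \<le> C" unfolding bounded_iff by auto
  have "norm (f x) \<le> max 1 C" for x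
  proof (cases "R \<le> norm x")
    case True then show ?thesis using R[OF True] by simp
  next
    case False then show ?thesis using C[rule_format, of x] by simp
  qed
  then show ?thesis unfolding Cb_def bounded_iff using c by auto
qed

text \<open>Outside a ball \<open>f\<close> is small, and inside it is dominated by a multiple of a
  continuous cutoff. Positivity transfers this domination to \<open>K f\<close>, so decay on
  \<open>Cinf\<close> extends to Borel functions.\<close>

lemma positive_op_vanishing:
  fixes K :: "('a::euclidean_space \<Rightarrow> real) \<Rightarrow> 'a \<Rightarrow> real"
  assumes K: "\<And>x. sfun (\<lambda>f. K f x)" and pos: "positive_op K" and Kinf: "\<And>f. f \<in> Cinf \<Longrightarrow> K f \<in> Cinf"
    and C: "\<And>f x. f \<in> Bb \<Longrightarrow> \<bar>K f x\<bar> \<le> C * supnorm f"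
    and f: "f \<in> Bb" "(f \<longlongrightarrow> 0) at_infinity"
  shows "(K f \<longlongrightarrow> 0) at_infinity"
proof (rule tendstoI)
  fix e :: real assume e: "0 < e"
  have one: "supnorm (\<lambda>x::'a. 1::real) = 1" unfolding supnorm_def by simp
  have C0: "0 \<le> C" using order_trans[OF abs_ge_zero C[OF Bb_const[of 1]]] one by simp
  define d where "d = e / (2 * (C + 1))"
  have d: "0 < d" using e C0 by (simp add: d_def)
  obtain R where R: "\<And>x. R \<le> norm x \<Longrightarrow> dist (f x) 0 < d" using tendstoD[OF f(2) d] by (auto simp: eventually_at_infinity)
  define \<psi> :: "'a \<Rightarrow> real" where "\<psi> y = max 0 (min 1 (R + 1 - norm y))" for y
  have pc: "continuous_on UNIV \<psi>" unfolding \<psi>_def by (intro continuous_intros)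
  have "eventually (\<lambda>y. \<psi> y = 0) at_infinity" unfolding eventually_at_infinity by (intro exI[of _ "R + 1"]) (auto simp: \<psi>_def)
  then have "(\<psi> \<longlongrightarrow> 0) at_infinity" by (rule tendsto_eventually)
  then have pC: "\<psi> \<in> Cinf" using pc by (simp add: Cinf_def)
  have pB: "\<psi> \<in> Bb" by (rule Cb_subset_Bb[OF Cinf_subset_Cb[OF pC]])
  define N where "N = supnorm f"
  have N: "0 \<le> N" unfolding N_def by (rule supnorm_nonneg[OF f(1)])
  have dom: "\<bar>f y\<bar> \<le> d * 1 + N * \<psi> y" for y
  proof (cases "R \<le> norm y")
    case True
    have "0 \<le> N * \<psi> y" using N by (simp add: \<psi>_def)
    then show ?thesis using R[OF True] by simp
  next
    case False
    then have "\<psi> y = 1" by (simp add: \<psi>_def)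
    then show ?thesis using supnorm_ge[OF f(1), of y] d by (simp add: N_def)
  qed
  have dB: "(\<lambda>y. d * 1 + N * \<psi> y) \<in> Bb" by (intro Bb_add Bb_cmult Bb_const pB)
  have Kd: "K (\<lambda>y. d * 1 + N * \<psi> y) x = d * K (\<lambda>y. 1) x + N * K \<psi> x" for x
    by (simp only: sfun_add[OF K Bb_cmult[OF Bb_const] Bb_cmult[OF pB]] sfun_cmult[OF K Bb_const] sfun_cmult[OF K pB])
  have bnd: "\<bar>K f x\<bar> \<le> d * C + N * K \<psi> x" for x
  proof -
    have posD: "0 \<le> K g x" if "g \<in> Bb" "\<And>y. 0 \<le> g y" for g using pos that unfolding positive_op_def by simp
    have "0 \<le> K (\<lambda>y. (d * 1 + N * \<psi> y) - f y) x"
    proof (rule posD[OF Bb_diff[OF dB f(1)]])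
      fix y show "0 \<le> (d * 1 + N * \<psi> y) - f y" using dom[of y] by (simp add: abs_le_iff)
    qed
    moreover have "0 \<le> K (\<lambda>y. (d * 1 + N * \<psi> y) + f y) x"
    proof (rule posD[OF Bb_add[OF dB f(1)]])
      fix y show "0 \<le> (d * 1 + N * \<psi> y) + f y" using dom[of y] by (simp add: abs_le_iff)
    qed
    ultimately have "\<bar>K f x\<bar> \<le> d * K (\<lambda>y. 1) x + N * K \<psi> x"
      unfolding sfun_diff[OF K dB f(1)] sfun_add[OF K dB f(1)] Kd by (simp add: abs_le_iff)
    also have "d * K (\<lambda>y. 1) x \<le> d * C" using C[OF Bb_const[of 1], of x] one d by (intro mult_left_mono) auto
    finally show ?thesis by simp
  qed
  have "((\<lambda>x. N * K \<psi> x) \<longlongrightarrow> N * 0) at_infinity"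
    using Kinf[OF pC] by (intro tendsto_intros) (simp add: Cinf_def)
  then have ev: "eventually (\<lambda>x. N * K \<psi> x < e / 2) at_infinity" using e by (intro order_tendstoD(2)) auto
  have dC: "d * C < e / 2" using e C0 by (simp add: d_def field_simps)
  from ev show "eventually (\<lambda>x. dist (K f x) 0 < e) at_infinity"
  proof eventually_elim
    case (elim x)
    then show ?case using bnd[of x] dC by simp
  qed
qed

lemma causal_extension_measurable:
  fixes u :: "real \<Rightarrow> 'a::euclidean_space \<Rightarrow> real"
  assumes "(\<lambda>(t,x). u t x) \<in> borel_measurable (restrict_space borel ({0<..} \<times> UNIV))"
  shows "(\<lambda>(t,x). if 0 < t then u t x else 0) \<in> borel_measurable (borel \<Otimes>\<^sub>M borel)"
proof -
  have "open ({0<..} \<times> UNIV :: (real \<times> 'a) set)" by (intro open_Times) auto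
  then have "(\<lambda>p. indicator ({0<..} \<times> UNIV) p *\<^sub>R (\<lambda>(t,x). u t x) p) \<in> borel_measurable (borel :: (real \<times> 'a) measure)"
    using assms by (subst borel_measurable_restrict_space_iff[symmetric]) auto
  moreover have "(\<lambda>p. indicator ({0<..} \<times> UNIV) p *\<^sub>R (\<lambda>(t,x). u t x) p) = (\<lambda>(t,x). if 0 < t then u t x else 0)"
    by (auto simp: fun_eq_iff indicator_def)
  ultimately show ?thesis by (simp add: borel_prod)
qed

text \<open>Kernel semigroups are specified for positive times only, so the value of the integrand
  at \<open>s = 0\<close> is arbitrary; it affects a null set.\<close>

lemma set_integral_Icc_causal:
  fixes u :: "real \<Rightarrow> real"
  assumes m: "(\<lambda>s. if 0 < s then u s else 0) \<in> borel_measurable borel" and t: "0 < t"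
  shows "(LINT s:{0..t}|lborel. u s) = (\<integral>s. indicator {..t} s * (if 0 < s then u s else 0) \<partial>lborel)"
  unfolding set_lebesgue_integral_def
proof (rule integral_cong_AE)
  let ?u = "\<lambda>s. if 0 < s then u s else 0"
  \<comment> \<open>The extra term on \<open>{0}\<close> restores the value \<open>u 0\<close> and
    shows that the original integrand is measurable whatever this value is.\<close>
  have "(\<lambda>s. indicator {..t} s * ?u s + indicator {0} s * u 0) \<in> borel_measurable lborel" using m by simp
  moreover have "(\<lambda>s. indicator {..t} s * ?u s + indicator {0} s * u 0) = (\<lambda>s. indicator {0..t} s *\<^sub>R u s)"
    using t by (auto simp: fun_eq_iff indicator_def)
  ultimately show "(\<lambda>s. indicator {0..t} s *\<^sub>R u s) \<in> borel_measurable lborel" by simp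
  show "(\<lambda>s. indicator {..t} s * ?u s) \<in> borel_measurable lborel" using m by simp
  show "AE s in lborel. indicator {0..t} s *\<^sub>R u s = indicator {..t} s * ?u s"
    by (rule AE_lborel_neqI[of 0]) (auto simp: indicator_def)
qed

lemma full_generator_iff:
  fixes V :: "real \<Rightarrow> ('a::euclidean_space \<Rightarrow> real) \<Rightarrow> 'a \<Rightarrow> real"
  assumes V': "op_family V'" and eq: "\<And>t f x. 0 < t \<Longrightarrow> V t f x = V' t f x"
  shows "(f, g) \<in> full_generator V \<longleftrightarrow> f \<in> Bb \<and> g \<in> Bb \<and> gen_rel V' f g"
proof -
  have "(LINT s:{0..t}|lborel. V s g x) = (\<integral>s. indicator {..t} s * V' s g x \<partial>lborel)" if g: "g \<in> Bb" and t: "0 < t" for t x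
  proof -
    have e: "(\<lambda>s. if 0 < s then V s g x else 0) = (\<lambda>s. V' s g x)"
      using op_family_nonpos[OF V' _ g] by (auto simp: fun_eq_iff eq)
    have m: "(\<lambda>s. V' s g x) \<in> borel_measurable borel"
      using measurable_Pair1[OF op_family_measurable[OF V' g], of x] by (simp add: split_beta')
    show ?thesis using set_integral_Icc_causal[of "\<lambda>s. V s g x" t] t m unfolding e[THEN fun_cong] by simp
  qed
  then show ?thesis unfolding full_generator_def gen_rel_def by (auto simp: eq)
qed

text \<open>The weights tend to 0 at every positive time and \<open>u\<close> itself provides the
  majorant. This is how a growth rate is found for which the perturbation is small.\<close>

lemma exists_exponential_weight:
  fixes u :: "real \<Rightarrow> real"
  assumes u: "integrable lborel u" and z: "\<And>t. t \<le> 0 \<Longrightarrow> u t = 0" and e: "0 < e"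
  shows "\<exists>j::nat. integrable lborel (\<lambda>t. u t * exp (- real j * t)) \<and> (\<integral>t. u t * exp (- real j * t) \<partial>lborel) < e"
proof -
  have b: "norm (u t * exp (- real j * t)) \<le> \<bar>u t\<bar>" for j t
    using z[of t] by (cases "t \<le> 0") (auto simp: abs_mult intro!: mult_right_le_one_le)
  have "(\<lambda>j. \<integral>t. u t * exp (- real j * t) \<partial>lborel) \<longlonglongrightarrow> (\<integral>t. 0 \<partial>(lborel :: real measure))"
  proof (rule integral_dominated_convergence[where w="\<lambda>t. \<bar>u t\<bar>"])
    show "AE t in lborel. (\<lambda>j. u t * exp (- real j * t)) \<longlonglongrightarrow> 0"
    proof (rule AE_I2)
      fix t
      show "(\<lambda>j. u t * exp (- real j * t)) \<longlonglongrightarrow> 0"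
      proof (cases "t \<le> 0")
        case False
        have "(\<lambda>j. exp (- t) ^ j) \<longlonglongrightarrow> 0" using False by (intro LIMSEQ_power_zero) simp
        moreover have "exp (- t) ^ j = exp (- real j * t)" for j by (simp add: exp_of_nat_mult[symmetric])
        ultimately show ?thesis using tendsto_mult_right_zero[of "\<lambda>j. exp (- real j * t)"] by simp
      qed (simp add: z)
    qed
  qed (use u b in auto)
  then have "eventually (\<lambda>j. (\<integral>t. u t * exp (- real j * t) \<partial>lborel) < e) sequentially"
    using e by (intro order_tendstoD(2)) auto
  then obtain j where "(\<integral>t. u t * exp (- real j * t) \<partial>lborel) < e" by (auto simp: eventually_sequentially)
  moreover have "integrable lborel (\<lambda>t. u t * exp (- real j * t))"
    by (rule Bochner_Integration.integrable_bound[OF u]) (use u b in auto)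
  ultimately show ?thesis by blast
qed

theorem theorem6p4:
  fixes T :: "real \<Rightarrow> ('a::euclidean_space \<Rightarrow> real) \<Rightarrow> 'a \<Rightarrow> real"
    and M \<omega> \<rho> \<beta> :: real
    and \<phi> :: "real \<Rightarrow> real"
    and chi :: "'a \<Rightarrow> real"
    and b :: "'a \<Rightarrow> 'a"
    and \<mu> :: "'a \<Rightarrow> 'a measure"
  assumes T_sg: "kernel_semigroup T M \<omega>"
    and T_Cb: "Cb_semigroup T"
    and T_sF: "\<forall>t>0. strong_Feller (T t)"
    and rho_pos: "\<rho> > 0"
    and T_reg: "\<forall>t>0. \<forall>f\<in>Bb. T t f \<in> Cb_rho \<rho>"
    and phi_L1: "set_integrable lborel {0<..<1} \<phi>"
    and T_est: "\<forall>t\<in>{0<..<1}. \<forall>f\<in>Bb. Cb_rho_norm \<rho> (T t f) \<le> \<phi> t * supnorm f"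
    and chi_meas: "chi \<in> borel_measurable borel"
    and chi_bounds: "\<forall>y. indicator (ball 0 1) y \<le> chi y \<and> chi y \<le> indicator (ball 0 2) y"
    and b_meas: "b \<in> borel_measurable borel"
    and b_bdd: "bounded (range b)"
    and mu_sets: "\<forall>x. sets (\<mu> x) = sets borel"
    and mu_zero: "\<forall>x. emeasure (\<mu> x) {0} = 0"
    and mu_meas: "\<forall>f::'a \<Rightarrow> real. continuous_on UNIV f \<and> compact (closure {y. f y \<noteq> 0})
                       \<and> 0 \<notin> closure {y. f y \<noteq> 0}
                   \<longrightarrow> (\<lambda>x. \<integral>y. f y \<partial>\<mu> x) \<in> borel_measurable borel"
    and beta: "0 < \<beta>" "\<beta> < 2" "\<beta> < \<rho>"
    and mu_int: "\<exists>C::real. \<forall>x. (\<integral>\<^sup>+ y. ennreal (min (norm y powr \<beta>) 1) \<partial>\<mu> x) \<le> ennreal C"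
    and drift: "\<rho> \<le> 1 \<longrightarrow> (\<forall>x. b x - (\<integral>y. chi y *\<^sub>R y \<partial>\<mu> x) = 0)"
  shows "\<exists>S. Cb_semigroup S \<and> (\<forall>t>0. strong_Feller (S t)) \<and>
             full_generator S = gen_sum (full_generator T) (Bhat \<rho> b \<mu> chi) \<and>
             ((\<forall>t>0. sub_Markovian (T t)) \<longrightarrow> (\<forall>t>0. sub_Markovian (S t))) \<and>
             (((\<lambda>R. SUP x. emeasure (\<mu> x) {y. R < norm y}) \<longlongrightarrow> 0) at_top \<and>
              (\<forall>t>0. positive_op (T t)) \<and> Cinf_semigroup T \<and>
              is_core Cc_inf (Cinf_generator T)
              \<longrightarrow> Cinf_semigroup S)"
proof -
  \<comment> \<open>The values of \<open>T\<close> at nonpositive times are unspecified; the theory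
    above needs them to be 0.\<close>
  define T' where "T' t f x = (if 0 < t then T t f x else 0)" for t f x
  have T'_eq: "0 < t \<Longrightarrow> T' t f = T t f" for t f by (auto simp: T'_def)
  have TCb: "T t f \<in> Cb" if "0 < t" "f \<in> Bb" for t f using T_sF that unfolding strong_Feller_def by blast
  have TBb: "T t f \<in> Bb" if "0 < t" "f \<in> Bb" for t f by (rule Cb_subset_Bb[OF TCb[OF that]])
  have Tsn: "supnorm (T t f) \<le> M * exp (\<omega> * t) * supnorm f" if "0 < t" "f \<in> Bb" for t f
    using T_sg that unfolding kernel_semigroup_def by blast
  have one: "supnorm (\<lambda>x::'a. 1::real) = 1" unfolding supnorm_def by simp
  have M0: "0 \<le> M"
  proof -
    have "0 \<le> M * exp (\<omega> * 1)" using order_trans[OF supnorm_nonneg[OF TBb] Tsn, of 1 "\<lambda>x. 1"] Bb_const[of 1] one by simp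
    then show ?thesis by (simp add: zero_le_mult_iff)
  qed
  have T'op: "op_family T'"
    unfolding op_family_def
  proof (intro conjI allI ballI impI)
    fix t x
    show "sfun (\<lambda>f. T' t f x)"
    proof (cases "0 < t")
      case True
      then have "kernel_op (T t)" using T_sg unfolding kernel_semigroup_def by blast
      then show ?thesis using kernel_op_sfun by (simp add: T'_eq[OF True])
    qed (simp add: T'_def sfun_zero_functional)
  next
    fix f :: "'a \<Rightarrow> real" assume "f \<in> Bb"
    then have "(\<lambda>(t,x). T t f x) \<in> borel_measurable (restrict_space borel ({0<..} \<times> UNIV))"
      using T_sg unfolding kernel_semigroup_def by blast
    from causal_extension_measurable[OF this]
    show "(\<lambda>(t,x). T' t f x) \<in> borel_measurable (borel \<Otimes>\<^sub>M borel)" by (simp add: T'_def)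
  qed (simp add: T'_def)
  have T'b0: "exp_bounded T' (\<lambda>_. M) \<omega>"
    unfolding exp_bounded_def
  proof (intro allI ballI)
    fix t x and f :: "'a \<Rightarrow> real" assume f: "f \<in> Bb"
    show "\<bar>T' t f x\<bar> \<le> M * exp (\<omega> * t) * supnorm f"
    proof (cases "0 < t")
      case True then show ?thesis using order_trans[OF supnorm_ge[OF TBb[OF True f]] Tsn[OF True f]] by (simp add: T'_eq)
    next
      case False then show ?thesis using M0 supnorm_nonneg[OF f] by (simp add: T'_def)
    qed
  qed
  have T'sg: "T' (t + s) f = T' t (T' s f)" if "0 < t" "0 < s" "f \<in> Bb" for t s f
    using T_sg that unfolding kernel_semigroup_def by (simp add: T'_eq)
  let ?D = "real DIM('a) ^ 2"
  have D: "0 \<le> ?D" by simp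
  have phi0: "0 \<le> \<phi> t" if t: "t \<in> {0<..<1}" for t
  proof -
    have "0 \<le> Cb_rho_norm \<rho> (T t (\<lambda>x. 1))" using T_reg t Bb_const by (intro Cb_rho_norm_bounds(3)) auto
    also have "\<dots> \<le> \<phi> t" using T_est t Bb_const[of 1] one by fastforce
    finally show ?thesis .
  qed
  have reg0: "reg \<rho> (?D * \<phi> t * supnorm f) (T t f)" if t: "t \<in> {0<..<1}" and f: "f \<in> Bb" for t f
  proof (rule reg_mono)
    show "reg \<rho> (?D * Cb_rho_norm \<rho> (T t f)) (T t f)" using T_reg t f by (intro Cb_rho_reg rho_pos) auto
    have "Cb_rho_norm \<rho> (T t f) \<le> \<phi> t * supnorm f" using T_est t f by blast
    then show "?D * Cb_rho_norm \<rho> (T t f) \<le> ?D * \<phi> t * supnorm f" unfolding mult.assoc by (rule mult_left_mono[OF _ D])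
  qed
  let ?h = "1/2 :: real"
  \<comment> \<open>The smoothing estimate covers \<open>t < 1\<close> only. For later times the
    final half unit does the smoothing, \<open>T t f = T (1/2) (T (t - 1/2) f)\<close>, and the
    earlier part contributes its exponential bound.\<close>
  define \<kappa>0 where "\<kappa>0 t = (if t \<le> 0 then 0 else if t < 1 then ?D * \<phi> t else ?D * \<phi> ?h * M * exp (\<omega> * (t - ?h)))" for t
  have \<kappa>00: "0 \<le> \<kappa>0 t" for t unfolding \<kappa>0_def using phi0 M0 by auto
  have reg1: "reg \<rho> (\<kappa>0 t * supnorm f) (T' t f)" if f: "f \<in> Bb" for t f
  proof -
    consider "t \<le> 0" | "0 < t" "t < 1" | "1 \<le> t" by linarith
    then show ?thesis
    proof cases
      case 1
      then have "T' t f = (\<lambda>x. 0)" by (auto simp: T'_def)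
      then show ?thesis using reg_zero[of "\<kappa>0 t * supnorm f" \<rho>] \<kappa>00 supnorm_nonneg[OF f] by simp
    next
      case 2 then show ?thesis using reg0[of t f] f by (simp add: \<kappa>0_def T'_eq)
    next
      case 3
      have p: "0 < t - ?h" using 3 by simp
      have Tt: "T t f = T ?h (T (t - ?h) f)" using T'sg[of ?h "t - ?h" f] p f 3 by (simp add: T'_eq)
      have r: "reg \<rho> (?D * \<phi> ?h * supnorm (T (t - ?h) f)) (T ?h (T (t - ?h) f))"
        by (rule reg0[OF _ TBb[OF p f]]) simp
      have "reg \<rho> (?D * \<phi> ?h * (M * exp (\<omega> * (t - ?h)) * supnorm f)) (T ?h (T (t - ?h) f))"
      proof (rule reg_mono[OF r])
        show "?D * \<phi> ?h * supnorm (T (t - ?h) f) \<le> ?D * \<phi> ?h * (M * exp (\<omega> * (t - ?h)) * supnorm f)"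
          by (intro mult_left_mono Tsn[OF p f] mult_nonneg_nonneg phi0 D) simp
      qed
      then have "reg \<rho> (?D * \<phi> ?h * (M * exp (\<omega> * (t - ?h)) * supnorm f)) (T t f)" unfolding Tt .
      then show ?thesis using 3 by (simp add: \<kappa>0_def T'_eq mult.assoc)
    qed
  qed
  \<comment> \<open>It exceeds \<open>\<omega>\<close>, which makes the part over
    \<open>t \<ge> 1\<close> integrable, and it is positive, so that the weight is at most 1 on the
    unit interval.\<close>
  define l0 where "l0 = \<bar>\<omega>\<bar> + 1"
  define \<kappa>1 where "\<kappa>1 t = \<kappa>0 t * exp (- l0 * t)" for t
  have \<kappa>1i: "integrable lborel \<kappa>1"
  proof -
    let ?u = "\<lambda>t. indicator {0<..<1} t *\<^sub>R \<phi> t"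
    have ui: "integrable lborel ?u" using phi_L1 unfolding set_integrable_def .
    have 1: "integrable lborel (\<lambda>t. exp (- l0 * t) * ?u t)"
    proof (rule Bochner_Integration.integrable_bound[OF ui])
      have [measurable]: "?u \<in> borel_measurable borel" using ui by simp
      show "(\<lambda>t. exp (- l0 * t) * ?u t) \<in> borel_measurable lborel" by measurable
      show "AE t in lborel. norm (exp (- l0 * t) * ?u t) \<le> norm (?u t)"
      proof (rule AE_I2)
        fix t show "norm (exp (- l0 * t) * ?u t) \<le> norm (?u t)"
          by (cases "0 < t") (auto simp: abs_mult l0_def intro!: mult_left_le_one_le mult_nonpos_nonneg)
      qed
    qed
    have g: "0 < l0 - \<omega>" by (simp add: l0_def)
    have 2: "integrable lborel (\<lambda>t. (l0 - \<omega>) * exp (- (l0 - \<omega>) * t) * indicator {1..} t)"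
      using has_bochner_integral_exp_tail[OF g, of 1] by (simp add: has_bochner_integral_iff)
    let ?c = "?D * \<phi> ?h * M * exp (- \<omega> * ?h) / (l0 - \<omega>)"
    have "\<kappa>1 = (\<lambda>t. ?D * (exp (- l0 * t) * ?u t) + ?c * ((l0 - \<omega>) * exp (- (l0 - \<omega>) * t) * indicator {1..} t))"
    proof
      fix t :: real
      consider "t \<le> 0" | "0 < t" "t < 1" | "1 \<le> t" by linarith
      then show "\<kappa>1 t = ?D * (exp (- l0 * t) * ?u t) + ?c * ((l0 - \<omega>) * exp (- (l0 - \<omega>) * t) * indicator {1..} t)"
      proof cases
        case 3
        have "exp (\<omega> * (t - ?h)) * exp (- l0 * t) = exp (- \<omega> * ?h) * exp (- (l0 - \<omega>) * t)"
          by (simp add: exp_add[symmetric] algebra_simps)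
        then show ?thesis using 3 g by (simp add: \<kappa>1_def \<kappa>0_def mult.assoc)
      qed (auto simp: \<kappa>1_def \<kappa>0_def)
    qed
    then show ?thesis using Bochner_Integration.integrable_add[OF integrable_mult_right[OF 1, of ?D] integrable_mult_right[OF 2, of ?c]] by simp
  qed
  obtain bB where bB: "\<And>x. norm (b x) \<le> bB" using b_bdd unfolding bounded_iff by auto
  obtain mC where mC: "\<And>x. (\<integral>\<^sup>+ y. ennreal (min (norm y powr \<beta>) 1) \<partial>\<mu> x) \<le> ennreal mC" using mu_int by blast
  define mB where "mB = max mC 0"
  have K: "0 < bB + 4 * mB + 1" using order_trans[OF norm_ge_zero bB[of undefined]] by (simp add: mB_def)
  \<comment> \<open>The rate is raised once more, now to make the integral small against the bound
    of the perturbation.\<close>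
  have "\<exists>j::nat. integrable lborel (\<lambda>t. \<kappa>1 t * exp (- real j * t)) \<and> (\<integral>t. \<kappa>1 t * exp (- real j * t) \<partial>lborel) < 1 / (2 * (bB + 4 * mB + 1))"
    by (rule exists_exponential_weight[OF \<kappa>1i]) (use K in \<open>auto simp: \<kappa>1_def \<kappa>0_def\<close>)
  then obtain j :: nat where j: "integrable lborel (\<lambda>t. \<kappa>1 t * exp (- real j * t))"
    "(\<integral>t. \<kappa>1 t * exp (- real j * t) \<partial>lborel) < 1 / (2 * (bB + 4 * mB + 1))" by (elim exE conjE)
  define l where "l = l0 + real j"
  have l\<omega>: "\<omega> \<le> l" by (simp add: l_def l0_def)
  define \<kappa> where "\<kappa> t = \<kappa>1 t * exp (- real j * t)" for t
  have \<kappa>l: "\<kappa> t * exp (l * t) = \<kappa>0 t" for t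
  proof -
    have "\<kappa> t * exp (l * t) = \<kappa>0 t * (exp (- l0 * t) * exp (- real j * t) * exp (l * t))" by (simp add: \<kappa>_def \<kappa>1_def)
    also have "exp (- l0 * t) * exp (- real j * t) * exp (l * t) = 1" by (simp add: exp_add[symmetric] l_def algebra_simps)
    finally show ?thesis by simp
  qed
  interpret L: levy_semigroup \<rho> \<beta> chi b \<mu> bB mB T' M l \<kappa>
  proof
    show "(\<integral>\<^sup>+ y. ennreal (min (norm y powr \<beta>) 1) \<partial>\<mu> x) \<le> ennreal mB" for x
      using mC[of x] by (rule order_trans) (simp add: mB_def ennreal_leI)
    show "exp_bounded T' (\<lambda>_. M) l" by (rule exp_bounded_mono[OF T'op T'b0 l\<omega> order_refl])
    show "reg \<rho> (\<kappa> t * exp (l * t) * supnorm f) (T' t f)" if "f \<in> Bb" for t f unfolding \<kappa>l by (rule reg1[OF that])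
    show "integrable lborel \<kappa>" using j(1) by (simp add: \<kappa>_def[abs_def])
    have "(bB + 4 * mB + 1) * (\<integral>s. \<kappa> s \<partial>lborel) \<le> (bB + 4 * mB + 1) * (1 / (2 * (bB + 4 * mB + 1)))"
      using j(2) K by (intro mult_left_mono) (auto simp: \<kappa>_def)
    also have "\<dots> = 1/2" using K by simp
    finally show "(bB + 4 * mB + 1) * (\<integral>s. \<kappa> s \<partial>lborel) \<le> 1/2" .
    show "T' (t + s) f = T' t (T' s f)" if "0 < t" "0 < s" "f \<in> Bb" for t s f by (rule T'sg[OF that])
  qed (use rho_pos chi_meas chi_bounds b_meas bB mu_sets mu_meas beta T'op in \<open>auto simp: mB_def\<close>)
  let ?S = "L.S"
  have Sks: "kernel_semigroup ?S (2 * M) l"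
    unfolding kernel_semigroup_def
  proof (intro conjI allI impI ballI)
    fix t :: real assume "0 < t"
    show "kernel_op (?S t)"
    proof (rule kernel_opI)
      show "sfun (\<lambda>f. ?S t f x)" for x by (rule op_family_sfun[OF L.S_op_family])
      show "?S t f \<in> borel_measurable borel" if "f \<in> Bb" for f by (rule Bb_measurable[OF L.S_Bb[OF that]])
      show "\<bar>?S t f x\<bar> \<le> (2 * M * exp (l * t)) * supnorm f" if "f \<in> Bb" for f x by (rule exp_boundedD[OF L.S_exp_bounded that])
    qed
  next
    fix f :: "'a \<Rightarrow> real" assume f: "f \<in> Bb"
    have "(\<lambda>(t,x). ?S t f x) \<in> borel_measurable (borel :: (real \<times> 'a) measure)"
      using op_family_measurable[OF L.S_op_family f] by (simp add: borel_prod)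
    then show "(\<lambda>(t,x). ?S t f x) \<in> borel_measurable (restrict_space borel ({0<..} \<times> UNIV))"
      by (rule measurable_restrict_space1)
  qed (use L.S_sg exp_bounded_supnorm[OF L.S_exp_bounded] in auto)
  have T'cont: "continuous_on UNIV (T' t f)" if "f \<in> Bb" for t f
  proof (cases "0 < t")
    case True then show ?thesis using TCb[OF True that] by (simp add: T'_eq Cb_def)
  next
    case False
    then have "T' t f = (\<lambda>x. 0)" by (auto simp: T'_def)
    then show ?thesis by simp
  qed
  have SCb: "?S t f \<in> Cb" if f: "f \<in> Bb" for t f
    using L.S_continuous[OF T'cont f] L.S_Bb[OF f] by (simp add: Cb_def Bb_def)
  have T'T: "eventually (\<lambda>t. T' t f = T t f) (at_right 0)" for f
    using eventually_at_right_less[of "0::real"] by (rule eventually_mono) (rule T'_eq)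
  have Csg: "Cb_semigroup ?S"
    unfolding Cb_semigroup_def
  proof (intro conjI allI impI ballI)
    show "\<exists>M \<omega>. kernel_semigroup ?S M \<omega>" using Sks by blast
    show "?S t f \<in> Cb" if "f \<in> Cb" for t f by (rule SCb[OF Cb_subset_Bb[OF that]])
    fix f :: "'a \<Rightarrow> real" assume fC: "f \<in> Cb"
    have f: "f \<in> Bb" by (rule Cb_subset_Bb[OF fC])
    show "((\<lambda>t. ?S t f x) \<longlongrightarrow> f x) (at_right 0)" for x
    proof -
      have 1: "((\<lambda>t. ?S t f x - T' t f x) \<longlongrightarrow> 0) (at_right 0)"
        by (rule Lim_null_comparison[OF _ L.S_uniform_short_time[OF f]])
           (use supnorm_ge[OF Bb_diff[OF L.S_Bb[OF f] L.T_Bb[OF f]]] in auto)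
      have "((\<lambda>t. T t f x) \<longlongrightarrow> f x) (at_right 0)" using T_Cb fC unfolding Cb_semigroup_def by blast
      then have 2: "((\<lambda>t. T' t f x) \<longlongrightarrow> f x) (at_right 0)"
        by (rule Lim_transform_eventually) (use T'T[of f] in \<open>auto elim: eventually_mono\<close>)
      from tendsto_add[OF 1 2] show ?thesis by simp
    qed
    show "\<exists>C. \<forall>t\<in>{0<..1}. supnorm (?S t f) \<le> C"
    proof (rule exI[of _ "2 * M * exp \<bar>l\<bar> * supnorm f"], rule ballI)
      fix t :: real assume t: "t \<in> {0<..1}"
      have "l * t \<le> \<bar>l\<bar> * t" using t by (intro mult_right_mono) auto
      also have "\<dots> \<le> \<bar>l\<bar> * 1" using t by (intro mult_left_mono) auto
      finally have "2 * M * exp (l * t) * supnorm f \<le> 2 * M * exp \<bar>l\<bar> * supnorm f"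
        using M0 supnorm_nonneg[OF f] by (intro mult_right_mono mult_left_mono) auto
      then show "supnorm (?S t f) \<le> 2 * M * exp \<bar>l\<bar> * supnorm f" using exp_bounded_supnorm[OF L.S_exp_bounded f, of t] by simp
    qed
  qed
  have SF: "\<forall>t>0. strong_Feller (?S t)" unfolding strong_Feller_def using SCb by blast
  have gen: "full_generator ?S = gen_sum (full_generator T) (Bhat \<rho> b \<mu> chi)"
  proof -
    \<comment> \<open>A positive number above the growth rate; the resolvent characterisation at one
      such point already determines the full generator.\<close>
    define m where "m = max l 0 + 1"
    have m: "l < m" "0 < m" by (auto simp: m_def)
    have gS: "(u, h) \<in> full_generator ?S \<longleftrightarrow> u \<in> Bb \<and> h \<in> Bb \<and> gen_rel ?S u h" for u h
      by (rule full_generator_iff[OF L.S_op_family]) simp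
    have gT: "(u, h) \<in> full_generator T \<longleftrightarrow> u \<in> Bb \<and> h \<in> Bb \<and> gen_rel T' u h" for u h
      by (rule full_generator_iff[OF T'op]) (simp add: T'_def)
    have key: "h \<in> Bb \<and> gen_rel ?S u h \<longleftrightarrow> (\<exists>f\<in>Bb. gen_rel T' u f \<and> h = (\<lambda>x. f x + Bhat \<rho> b \<mu> chi u x))" if "u \<in> Bb" for u h
      by (rule L.gen_rel_S[OF m L.Bhat_laplace[OF m(1)] that])
    have "(u, h) \<in> full_generator ?S \<longleftrightarrow> (u, h) \<in> gen_sum (full_generator T) (Bhat \<rho> b \<mu> chi)" for u h
    proof -
      have "(u, h) \<in> gen_sum (full_generator T) (Bhat \<rho> b \<mu> chi) \<longleftrightarrow>
          (\<exists>f. (u, f) \<in> full_generator T \<and> h = (\<lambda>x. f x + Bhat \<rho> b \<mu> chi u x))" unfolding gen_sum_def by auto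
      then show ?thesis unfolding gS gT using key[of u h] by auto
    qed
    then show ?thesis by auto
  qed
  have T'pos: "0 \<le> T' t f x" if "\<forall>t>0. positive_op (T t)" "f \<in> Bb" "\<And>y. 0 \<le> f y" for t f x
    using that unfolding positive_op_def T'_def by auto
  have sub: "\<forall>t>0. sub_Markovian (?S t)" if sM: "\<forall>t>0. sub_Markovian (T t)"
  proof (intro allI impI)
    fix t :: real assume t: "0 < t"
    have pos: "\<forall>t>0. positive_op (T t)" using sM unfolding sub_Markovian_def by blast
    note Tp = T'pos[OF pos]
    have T1: "T' t (\<lambda>y. 1) x \<le> 1" for t x
    proof (cases "0 < t")
      case True
      have "\<bar>T t (\<lambda>y. 1) x\<bar> \<le> supnorm (T t (\<lambda>y. 1))" by (rule supnorm_ge[OF TBb[OF True Bb_const]])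
      also have "\<dots> \<le> supnorm (\<lambda>y::'a. 1::real)" using sM True Bb_const[of 1] unfolding sub_Markovian_def by blast
      finally show ?thesis using True one by (simp add: T'_eq)
    qed (simp add: T'_def)
    have Sp: "0 \<le> ?S t f x" if "f \<in> Bb" "\<And>y. 0 \<le> f y" for f x by (rule L.S_pos[OF Tp that])
    have S1: "?S t (\<lambda>y. 1) x \<le> 1" for x by (rule L.S_one_le[OF Tp T1])
    have "supnorm (?S t f) \<le> supnorm f" if f: "f \<in> Bb" for f
    proof (rule supnorm_le)
      fix x
      note sf = op_family_sfun[OF L.S_op_family, of t x]
      have n: "0 \<le> supnorm f" by (rule supnorm_nonneg[OF f])
      have c: "?S t (\<lambda>y. supnorm f * 1) x \<le> supnorm f"
        unfolding sfun_cmult[OF sf Bb_const] using mult_left_mono[OF S1[of x] n] by simp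
      have cB: "(\<lambda>y. supnorm f * 1) \<in> Bb" by (rule Bb_cmult[OF Bb_const])
      have "0 \<le> ?S t (\<lambda>y. supnorm f * 1 - f y) x" "0 \<le> ?S t (\<lambda>y. supnorm f * 1 + f y) x"
      proof (intro Sp Bb_diff cB f)
        fix y show "0 \<le> supnorm f * 1 - f y" using supnorm_ge[OF f, of y] by simp
      next
        show "0 \<le> ?S t (\<lambda>y. supnorm f * 1 + f y) x"
        proof (intro Sp Bb_add cB f)
          fix y show "0 \<le> supnorm f * 1 + f y" using supnorm_ge[OF f, of y] by simp
        qed
      qed
      then show "\<bar>?S t f x\<bar> \<le> supnorm f"
        unfolding sfun_diff[OF sf cB f] sfun_add[OF sf cB f] using c by simp
    qed
    then show "sub_Markovian (?S t)" unfolding sub_Markovian_def positive_op_def using Sp by blast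
  qed
  have inf: "Cinf_semigroup ?S"
    if tail: "((\<lambda>R. SUP x. emeasure (\<mu> x) {y. R < norm y}) \<longlongrightarrow> 0) at_top"
      and pos: "\<forall>t>0. positive_op (T t)" and TC: "Cinf_semigroup T"
  proof -
    \<comment> \<open>Since \<open>w\<close> is at most 1, the tails of the weighted measures are
      bounded by those of \<open>\<mu> x\<close>.\<close>
    have ktail: "\<exists>R\<ge>1. \<forall>x. measure (L.k x) {y. R < norm y} \<le> e" if e: "0 < e" for e
    proof -
      have "eventually (\<lambda>R. (SUP x. emeasure (\<mu> x) {y. R < norm y}) < ennreal e) at_top"
        using tail e by (intro order_tendstoD(2)) auto
      then have "eventually (\<lambda>R. 1 \<le> R \<and> (SUP x. emeasure (\<mu> x) {y. R < norm y}) < ennreal e) at_top"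
        using eventually_ge_at_top[of "1::real"] by eventually_elim simp
      then obtain R where R: "1 \<le> R" "(SUP x. emeasure (\<mu> x) {y. R < norm y}) < ennreal e"
        using eventually_happens[of _ "at_top :: real filter"] by auto
      have "measure (L.k x) {y. R < norm y} \<le> e" for x
      proof -
        interpret finite_measure "L.k x" by (rule L.k_finite)
        have st: "{y. R < norm y} \<in> sets (\<mu> x)" using mu_sets by auto
        have "emeasure (L.k x) {y. R < norm y} = (\<integral>\<^sup>+ y. ennreal (L.w y) * indicator {y. R < norm y} y \<partial>\<mu> x)"
          unfolding L.k_def by (rule emeasure_density[OF _ st]) (use L.mu_measurable[OF L.w_meas] in simp)
        also have "\<dots> \<le> (\<integral>\<^sup>+ y. indicator {y. R < norm y} y \<partial>\<mu> x)"
          using L.w_le_1 by (intro nn_integral_mono) (auto simp: indicator_def ennreal_le_1)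
        also have "\<dots> = emeasure (\<mu> x) {y. R < norm y}" using st by simp
        also have "\<dots> \<le> (SUP x. emeasure (\<mu> x) {y. R < norm y})" by (rule SUP_upper) simp
        also have "\<dots> \<le> ennreal e" using R(2) by simp
        finally show ?thesis using e by (simp add: emeasure_eq_measure)
      qed
      with R(1) show ?thesis by blast
    qed
    have Tv: "(T' t f \<longlongrightarrow> 0) at_infinity" if f: "f \<in> Bb" "(f \<longlongrightarrow> 0) at_infinity" for t f
    proof (cases "0 < t")
      case True
      have "(T t f \<longlongrightarrow> 0) at_infinity"
      proof (rule positive_op_vanishing[OF _ _ _ _ f])
        show "sfun (\<lambda>f. T t f x)" for x using op_family_sfun[OF T'op, of t x] by (simp add: T'_eq[OF True])
        show "positive_op (T t)" using pos True by blast
        show "T t f \<in> Cinf" if "f \<in> Cinf" for f using TC True that unfolding Cinf_semigroup_def by blast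
        show "\<bar>T t f x\<bar> \<le> M * exp (\<omega> * t) * supnorm f" if "f \<in> Bb" for f x
          using exp_boundedD[OF T'b0 that, of t x] by (simp add: T'_eq[OF True])
      qed
      then show ?thesis by (simp add: T'_eq[OF True])
    next
      case False
      then have "T' t f = (\<lambda>x. 0)" by (auto simp: T'_def)
      then show ?thesis by simp
    qed
    have Gv: "(L.G t f \<longlongrightarrow> 0) at_infinity" if f: "f \<in> Bb" "(f \<longlongrightarrow> 0) at_infinity" for t f
      unfolding L.G_def by (rule L.Bhat_vanishes[OF L.Treg[OF f(1)] Tv[OF f] ktail])
    show ?thesis
      unfolding Cinf_semigroup_def
    proof (intro conjI allI impI ballI)
      show "\<exists>M \<omega>. kernel_semigroup ?S M \<omega>" using Sks by blast
    next
      fix t :: real and f :: "'a \<Rightarrow> real" assume fC: "f \<in> Cinf"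
      have f: "f \<in> Bb" by (rule Cb_subset_Bb[OF Cinf_subset_Cb[OF fC]])
      have "(?S t f \<longlongrightarrow> 0) at_infinity" using fC by (intro L.S_vanishes[OF Tv Gv f]) (auto simp: Cinf_def)
      then show "?S t f \<in> Cinf" using L.S_continuous[OF T'cont f] by (simp add: Cinf_def)
    next
      fix f :: "'a \<Rightarrow> real" assume fC: "f \<in> Cinf"
      have f: "f \<in> Bb" by (rule Cb_subset_Bb[OF Cinf_subset_Cb[OF fC]])
      have 1: "((\<lambda>t. supnorm (\<lambda>x. T t f x - f x)) \<longlongrightarrow> 0) (at_right 0)"
        using TC fC unfolding Cinf_semigroup_def by blast
      have 2: "((\<lambda>t. supnorm (\<lambda>x. ?S t f x - T' t f x) + supnorm (\<lambda>x. T t f x - f x)) \<longlongrightarrow> 0) (at_right 0)"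
        using tendsto_add[OF L.S_uniform_short_time[OF f] 1] by simp
      show "((\<lambda>t. supnorm (\<lambda>x. ?S t f x - f x)) \<longlongrightarrow> 0) (at_right 0)"
      proof (rule tendsto_sandwich[OF _ _ tendsto_const 2])
        show "eventually (\<lambda>t. 0 \<le> supnorm (\<lambda>x. ?S t f x - f x)) (at_right 0)"
          by (intro always_eventually allI supnorm_nonneg Bb_diff L.S_Bb f)
        show "eventually (\<lambda>t. supnorm (\<lambda>x. ?S t f x - f x) \<le> supnorm (\<lambda>x. ?S t f x - T' t f x) + supnorm (\<lambda>x. T t f x - f x)) (at_right 0)"
          using eventually_at_right_less[of "0::real"]
        proof eventually_elim
          case (elim t)
          show ?case
          proof (rule supnorm_le)
            fix x
            have "\<bar>?S t f x - T' t f x\<bar> \<le> supnorm (\<lambda>x. ?S t f x - T' t f x)"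
              by (rule supnorm_ge[OF Bb_diff[OF L.S_Bb[OF f] L.T_Bb[OF f]]])
            moreover have "\<bar>T t f x - f x\<bar> \<le> supnorm (\<lambda>x. T t f x - f x)"
              by (rule supnorm_ge[OF Bb_diff[OF TBb[OF elim f] f]])
            ultimately show "\<bar>?S t f x - f x\<bar> \<le> supnorm (\<lambda>x. ?S t f x - T' t f x) + supnorm (\<lambda>x. T t f x - f x)"
              using T'_eq[OF elim, of f] by simp
          qed
        qed
      qed
    qed
  qed
  show ?thesis
    using Csg SF gen sub inf by blast
qed

end
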